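(* There exist absolute constants $\epsilon^*>0$ and $C^*>0$ such that, for every planar convex domain $\Omega$ normalised as in the context, with length scale $L$ and first Dirichlet eigenfunction $u$, for all unit directions $\nu=(\nu_1,\nu_2)\in\mathbb{R}^2$ and all $(x,y)\in\Omega_{1-\epsilon^*}$, $$\frac{1}{C^*}L^{-2}\max\{1,|\nu_2|L\}^2 \leq -\partial_{\nu}^2u(x,y) \leq C^*L^{-2}\max\{1,|\nu_2|L\}^2,$$ where $\partial_\nu^2 u$ denotes the second derivative of $u$ in the direction $\nu$.
   Context: Domain: $\Omega\subset\mathbb{R}^2$ is a bounded convex domain, normalised (by a rotation, dilation and translation) so that its projection onto the $y$-axis is the smallest among its projections onto all directions, and $$\Omega=\{(x,y)\in\mathbb{R}^2: x\in[a,b],\ f_1(x)\leq y\leq f_2(x)\},$$ where $f_1$ is convex and $f_2$ is concave on $[a,b]$, $\min_{[a,b]}f_1=0$ and $\max_{[a,b]}f_2=1$. No further regularity of $\partial\Omega$ is assumed. Length scale: let $h(x)=f_2(x)-f_1(x)$ (a concave function on $[a,b]$). $L$ is the largest value such that $h(x)\geq 1-L^{-2}$ for all $x\in I$, for some interval $I\subset[a,b]$ of length at least $L$. Eigenfunction: $\lambda$ is the first Dirichlet eigenvalue of $\Omega$ and $u$ the corresponding eigenfunction, $\Delta u=-\lambda u$ in $\Omega$, $u=0$ on $\partial\Omega$, normalised to be positive inside $\Omega$ with maximum value $1$. Superlevel sets: $\Omega_c=\{(x,y)\in\Omega: u(x,y)\geq c\}$. An absolute constant is one that does not depend on $\Omega$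 or $L$. *)

theory Defs
  imports "HOL-Analysis.Analysis"
begin

text \<open>The length (one-dimensional Lebesgue measure) of the orthogonal projection of \<open>S\<close> onto
  the line spanned by the unit vector \<open>e\<close>.\<close>

definition projection_length :: "(real \<times> real) set \<Rightarrow> real \<times> real \<Rightarrow> real" where
  "projection_length S e = measure lborel ((\<lambda>p. p \<bullet> e) ` S)"

text \<open>No continuity of \<open>f1\<close>, \<open>f2\<close> at the end points is required, so \<open>S\<close> need not be closed; the
  eigenvalue problem below only involves its interior, closure and frontier.  The interior of \<open>S\<close>
  is nonempty: a flat \<open>S\<close> would have a projection shorter than the one onto the \<open>y\<close>-axis.\<close>

definition normalised_convex_domain ::
  "real \<Rightarrow> real \<Rightarrow> (real \<Rightarrow> real) \<Rightarrow> (real \<Rightarrow> real) \<Rightarrow> (real \<times> real) set \<Rightarrow> bool" where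
  "normalised_convex_domain a b f1 f2 S \<longleftrightarrow>
     bounded S \<and> convex S \<and>
     a < b \<and> convex_on {a..b} f1 \<and> concave_on {a..b} f2 \<and> (\<forall>x\<in>{a..b}. f1 x \<le> f2 x) \<and>
     S = {(x, y). x \<in> {a..b} \<and> f1 x \<le> y \<and> y \<le> f2 x} \<and>
     (\<forall>x\<in>{a..b}. 0 \<le> f1 x) \<and> (\<exists>x\<in>{a..b}. f1 x = 0) \<and>
     (\<forall>x\<in>{a..b}. f2 x \<le> 1) \<and> (\<exists>x\<in>{a..b}. f2 x = 1) \<and>
     (\<forall>e. norm e = 1 \<longrightarrow> projection_length S (0, 1) \<le> projection_length S e)"

definition length_scale_candidates :: "real \<Rightarrow> real \<Rightarrow> (real \<Rightarrow> real) \<Rightarrow> real set" where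
  "length_scale_candidates a b h =
     {L. L > 0 \<and> (\<exists>I. is_interval I \<and> I \<subseteq> {a..b} \<and> L \<le> measure lborel I \<and>
                      (\<forall>x\<in>I. h x \<ge> 1 - 1 / L\<^sup>2))}"

definition is_length_scale :: "real \<Rightarrow> real \<Rightarrow> (real \<Rightarrow> real) \<Rightarrow> real \<Rightarrow> bool" where
  "is_length_scale a b h L \<longleftrightarrow>
     L \<in> length_scale_candidates a b h \<and> (\<forall>M\<in>length_scale_candidates a b h. M \<le> L)"

definition C2_on :: "'a::euclidean_space set \<Rightarrow> ('a \<Rightarrow> real) \<Rightarrow> bool" where
  "C2_on U u \<longleftrightarrow>
     (\<exists>(D :: 'a \<Rightarrow> 'a \<Rightarrow>\<^sub>L real) (H :: 'a \<Rightarrow> 'a \<Rightarrow>\<^sub>L 'a \<Rightarrow>\<^sub>L real).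
        (\<forall>p\<in>U. (u has_derivative blinfun_apply (D p)) (at p)) \<and>
        (\<forall>p\<in>U. (D has_derivative blinfun_apply (H p)) (at p)) \<and>
        continuous_on U H)"

definition second_directional_deriv :: "'a::euclidean_space \<Rightarrow> ('a \<Rightarrow> real) \<Rightarrow> 'a \<Rightarrow> real" where
  "second_directional_deriv v u p = deriv (deriv (\<lambda>t. u (p + t *\<^sub>R v))) 0"

definition laplacian :: "('a::euclidean_space \<Rightarrow> real) \<Rightarrow> 'a \<Rightarrow> real" where
  "laplacian u p = (\<Sum>e\<in>Basis. second_directional_deriv e u p)"

text \<open>Eigenfunctions in the classical sense; on a bounded convex domain these are exactly the
  (continuous representatives of the) weak eigenfunctions.  The equation is imposed on the interior
  of \<open>S\<close>, where \<open>C2_on\<close> makes the iterated \<open>deriv\<close> the genuine second derivative.\<close>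

definition dirichlet_eigenfunction ::
  "'a::euclidean_space set \<Rightarrow> real \<Rightarrow> ('a \<Rightarrow> real) \<Rightarrow> bool" where
  "dirichlet_eigenfunction S \<mu> u \<longleftrightarrow>
     continuous_on (closure S) u \<and> C2_on (interior S) u \<and>
     (\<forall>p\<in>interior S. laplacian u p = - \<mu> * u p) \<and>
     (\<forall>p\<in>frontier S. u p = 0) \<and>
     (\<exists>p\<in>interior S. u p \<noteq> 0)"

definition is_first_dirichlet_eigenvalue :: "'a::euclidean_space set \<Rightarrow> real \<Rightarrow> bool" where
  "is_first_dirichlet_eigenvalue S \<mu> \<longleftrightarrow>
     (\<exists>u. dirichlet_eigenfunction S \<mu> u) \<and>
     (\<forall>\<kappa>. (\<exists>u. dirichlet_eigenfunction S \<kappa> u) \<longrightarrow> \<mu> \<le> \<kappa>)"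

definition normalised_first_eigenfunction ::
  "'a::euclidean_space set \<Rightarrow> real \<Rightarrow> ('a \<Rightarrow> real) \<Rightarrow> bool" where
  "normalised_first_eigenfunction S \<mu> u \<longleftrightarrow>
     is_first_dirichlet_eigenvalue S \<mu> \<and> dirichlet_eigenfunction S \<mu> u \<and>
     (\<forall>p\<in>interior S. u p > 0) \<and>
     (\<forall>p\<in>S. u p \<le> 1) \<and> (\<exists>p\<in>S. u p = 1)"

definition superlevel :: "'a set \<Rightarrow> ('a \<Rightarrow> real) \<Rightarrow> real \<Rightarrow> 'a set" where
  "superlevel S u c = {p \<in> S. u p \<ge> c}"

end

theory Submission
 imports Defs
begin

text \<open>Apart from gradient estimates by circle means, only maximum principles are used.  A two-point argument shows that \<open>v = ln u\<close> is concave.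
 Barriers on the normalised domain confine \<open>{u \<ge> \<eta>}\<close> to \<open>O(L)\<close> in \<open>x\<close>, and since \<open>- u\<^sub>x\<^sub>x + m u\<close> is,
 for some \<open>m = O(L\<^sup>-\<^sup>2)\<close>, a nonnegative solution on the sections where \<open>\<bar>u\<^sub>x\<bar> \<le> O(1/L) u\<close>, pairing it with a sine
 gives \<open>u\<^sub>x\<^sub>x = O(L\<^sup>-\<^sup>2)\<close> and then the remaining upper bounds.  For the lower bound, \<open>W = - D\<^sup>2 v \<ge> 0\<close>
 satisfies \<open>(\<Delta> + 2 \<nabla>v \<bullet> \<nabla>) (\<xi> \<bullet> W \<xi>) = 2 \<bar>W \<xi>\<bar>\<^sup>2\<close>; comparing its lowest eigenvalue with explicit
 exponentials propagates a lower bound from the maximum of \<open>v\<close> plus a small quadratic to \<open>{u \<ge> 1/2}\<close>.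
 Finally \<open>- u\<^sub>\<nu>\<^sub>\<nu> = u (W\<^sub>\<nu>\<^sub>\<nu> - v\<^sub>\<nu>\<^sup>2)\<close>, and \<open>v\<^sub>\<nu>\<close> is small near the maximum by Taylor expansion.\<close>

text \<open>What shapes the proof is that every constant must survive
  \<open>L \<rightarrow> \<infinity>\<close>: the natural scale is 1 in \<open>y\<close> and
  \<open>L\<close> in \<open>x\<close>, while interior estimates only see scale 1. The factors
  \<open>1 / L\<close> therefore come from concavity of \<open>ln u\<close> over lengths comparable
  to \<open>L\<close>, which needs lower bounds for \<open>u\<close> at such distances. For
  \<open>u_xx\<close> concavity controls one sign only; the other is excluded because the eigenvalue
  exceeds \<open>pi^2\<close> by at most \<open>O(1 / L^2)\<close>, which leaves almost no room in
  the pairing with the sine. For the lower bound, the Hessian of \<open>ln u\<close> is known to be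
  definite at one point and merely semidefinite near the boundary. The barriers hence contain a
  multiple of \<open>ln u\<close> in the exponent, which makes them vanish at the boundary, and the
  horizontal barrier decays at a rate proportional to \<open>1 / L\<close>, so that only an absolute
  factor is lost over the superlevel set. No compactness over domains is used; constants are
  explicit, and numbers such as 1350, 1800 and 2690 trace back to the eigenvalue bound and to the
  linear barrier built on it.\<close>

type_synonym point = "real \<times> real"

abbreviation "ex \<equiv> (1::real, 0::real)"
abbreviation "ey \<equiv> (0::real, 1::real)"

section \<open>Directional derivatives and classical solutions of the eigenvalue equation\<close>

definition dd :: "point \<Rightarrow> (point \<Rightarrow> real) \<Rightarrow> point \<Rightarrow> real" where
 "dd \<nu> P p = deriv (\<lambda>t. P (p + t *\<^sub>R \<nu>)) 0"

definition grad :: "(point \<Rightarrow> real) \<Rightarrow> point \<Rightarrow> point" where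
 "grad P p = (dd ex P p, dd ey P p)"

lemma has_derivative_line:
 assumes "(P has_derivative D) (at (p + t *\<^sub>R \<nu>))"
 shows "((\<lambda>t. P (p + t *\<^sub>R \<nu>)) has_real_derivative D \<nu>) (at t)"
proof -
 have b: "bounded_linear D" using assms has_derivative_bounded_linear by blast
 have "((\<lambda>t. P (p + t *\<^sub>R \<nu>)) has_derivative (\<lambda>s. D (s *\<^sub>R \<nu>))) (at t)"
  by (rule has_derivative_compose[where f="\<lambda>t. p + t *\<^sub>R \<nu>", OF _ assms])
    (auto intro!: derivative_eq_intros)
 moreover have "(\<lambda>s. D (s *\<^sub>R \<nu>)) = (*) (D \<nu>)"
  using b by (auto simp: linear_simps mult.commute)
 ultimately show ?thesis by (simp add: has_field_derivative_def)
qed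

lemma dd_eqI: "((\<lambda>t. P (p + t *\<^sub>R \<nu>)) has_real_derivative d) (at 0) \<Longrightarrow> dd \<nu> P p = d"
 by (simp add: dd_def DERIV_imp_deriv)

lemma dd_has_derivative: "(P has_derivative D) (at p) \<Longrightarrow> dd \<nu> P p = D \<nu>"
 by (rule dd_eqI) (use has_derivative_line[of P D p 0 \<nu>] in simp)

lemma grad_has_derivative:
 assumes "P differentiable at p"
 shows "(P has_derivative (\<lambda>h. grad P p \<bullet> h)) (at p)"
proof -
 obtain D where D: "(P has_derivative D) (at p)" using assms by (auto simp: differentiable_def)
 have b: "bounded_linear D" using D has_derivative_bounded_linear by blast
 have "D h = grad P p \<bullet> h" for h
 proof -
  obtain x y where [simp]: "h = (x, y)" by (cases h)
  have "h = x *\<^sub>R ex + y *\<^sub>R ey" by simp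
  then have "D h = D (x *\<^sub>R ex) + D (y *\<^sub>R ey)"
   using linear_add[OF bounded_linear.linear[OF b], of "x *\<^sub>R ex" "y *\<^sub>R ey"] by simp
  also have "\<dots> = x * D ex + y * D ey"
   by (simp only: linear_scale[OF bounded_linear.linear[OF b]] real_scaleR_def)
  finally have "D h = x * D ex + y * D ey" .
  then show ?thesis by (simp add: grad_def dd_has_derivative[OF D])
 qed
 then have "D = (\<lambda>h. grad P p \<bullet> h)" by auto
 with D show ?thesis by simp
qed

lemma dd_eq_grad: "P differentiable at p \<Longrightarrow> dd \<nu> P p = grad P p \<bullet> \<nu>"
 using dd_has_derivative[OF grad_has_derivative] .

lemma has_real_derivative_dd:
 assumes "P differentiable at (p + t *\<^sub>R \<nu>)"
 shows "((\<lambda>t. P (p + t *\<^sub>R \<nu>)) has_real_derivative dd \<nu> P (p + t *\<^sub>R \<nu>)) (at t)"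
 using has_derivative_line[OF grad_has_derivative[OF assms]] dd_eq_grad[OF assms] by simp

lemma dd_cong:
 assumes "open V" "p \<in> V" "\<And>q. q \<in> V \<Longrightarrow> P q = Q q"
 shows "dd \<nu> P p = dd \<nu> Q p"
proof -
 have "((\<lambda>t. p + t *\<^sub>R \<nu>) \<longlongrightarrow> p + 0 *\<^sub>R \<nu>) (nhds 0)"
  by (intro tendsto_intros) (simp add: filterlim_ident)
 then have "\<forall>\<^sub>F t in nhds 0. p + t *\<^sub>R \<nu> \<in> V"
  using assms topological_tendstoD[of _ "p + 0 *\<^sub>R \<nu>" "nhds 0" V] by simp
 then have "\<forall>\<^sub>F t in nhds 0. P (p + t *\<^sub>R \<nu>) = Q (p + t *\<^sub>R \<nu>)"
  by eventually_elim (use assms in auto)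
 then show ?thesis unfolding dd_def by (intro deriv_cong_ev) auto
qed

lemma differentiable_cong_open:
 assumes "open V" "p \<in> V" "\<And>q. q \<in> V \<Longrightarrow> P q = Q q" "P differentiable at p"
 shows "Q differentiable at p"
 using assms has_derivative_transform_within_open[of P _ p UNIV V Q]
 unfolding differentiable_def by blast

text \<open>Joint differentiability of \<open>P\<close> and of its first partials is demanded
  besides continuity of the iterated \<open>dd\<close>, because \<open>dd\<close> is a total
  function built from \<open>deriv\<close> and carries no differentiability by itself. Symmetry of
  the second partials is not built in; for solutions it comes from
  \<open>dd_commute\<close>.\<close>

definition C2f :: "point set \<Rightarrow> (point \<Rightarrow> real) \<Rightarrow> bool" where
 "C2f V P \<longleftrightarrow> open V \<and> (\<forall>p\<in>V. P differentiable at p \<and> dd ex P differentiable at p \<and> dd ey P differentiable at p)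
   \<and> (\<forall>i\<in>{ex,ey}. \<forall>j\<in>{ex,ey}. continuous_on V (dd i (dd j P)))"

definition sol :: "real \<Rightarrow> point set \<Rightarrow> (point \<Rightarrow> real) \<Rightarrow> bool" where
 "sol \<mu> V P \<longleftrightarrow> C2f V P \<and> (\<forall>p\<in>V. dd ex (dd ex P) p + dd ey (dd ey P) p = - \<mu> * P p)"

lemma C2f_cong:
 assumes "C2f V P" "\<And>p. p \<in> V \<Longrightarrow> P p = Q p"
 shows "C2f V Q"
proof -
 have V: "open V" using assms by (simp add: C2f_def)
 have d: "dd i P p = dd i Q p" if "p \<in> V" for i p
  by (rule dd_cong[OF V that assms(2)])
 have d2: "dd j (dd i P) p = dd j (dd i Q) p" if "p \<in> V" for i j p
  by (rule dd_cong[OF V that d])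
 have "continuous_on V (dd i (dd j Q)) \<longleftrightarrow> continuous_on V (dd i (dd j P))" for i j
  by (rule continuous_on_cong[OF refl]) (rule d2[symmetric])
 moreover have "Q differentiable at p" if "p \<in> V" for p
  by (rule differentiable_cong_open[OF V that assms(2)]) (use assms(1) that in \<open>simp_all add: C2f_def\<close>)
 moreover have "dd i Q differentiable at p" if "p \<in> V" "i \<in> {ex,ey}" for p i
  by (rule differentiable_cong_open[OF V that(1) d]) (use assms(1) that in \<open>auto simp: C2f_def\<close>)
 ultimately show ?thesis using assms(1) V unfolding C2f_def by blast
qed

lemma sol_cong:
 assumes "sol \<mu> V P" "\<And>p. p \<in> V \<Longrightarrow> P p = Q p"
 shows "sol \<mu> V Q"
proof -
 have V: "open V" using assms by (simp add: sol_def C2f_def)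
 have d: "dd i P p = dd i Q p" if "p \<in> V" for i p
  by (rule dd_cong[OF V that assms(2)])
 have d2: "dd j (dd i P) p = dd j (dd i Q) p" if "p \<in> V" for i j p
  by (rule dd_cong[OF V that d])
 have "C2f V Q" using C2f_cong[of V P Q] assms by (simp add: sol_def)
 then show ?thesis using assms by (simp add: sol_def d2)
qed

lemma C2f_D:
 assumes "C2f V P" "p \<in> V"
 shows "P differentiable at p" "i \<in> {ex,ey} \<Longrightarrow> dd i P differentiable at p"
  "i \<in> {ex,ey} \<Longrightarrow> j \<in> {ex,ey} \<Longrightarrow> continuous_on V (dd i (dd j P))" "open V"
 using assms by (auto simp: C2f_def)

lemma C2f_continuous:
 assumes "C2f V P"
 shows "continuous_on V P" "i \<in> {ex,ey} \<Longrightarrow> continuous_on V (dd i P)"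
 using assms unfolding C2f_def
 by (auto intro!: differentiable_imp_continuous_on simp: differentiable_on_eq_differentiable_at)

lemma dd_lin:
 assumes "P differentiable at p" "Q differentiable at p"
 shows "dd \<nu> (\<lambda>z. a * P z + b * Q z) p = a * dd \<nu> P p + b * dd \<nu> Q p"
  "(\<lambda>z. a * P z + b * Q z) differentiable at p"
proof -
 have *: "((\<lambda>z. a * P z + b * Q z) has_derivative (\<lambda>h. a * (grad P p \<bullet> h) + b * (grad Q p \<bullet> h))) (at p)"
  by (intro has_derivative_add has_derivative_mult_right grad_has_derivative assms)
 show "dd \<nu> (\<lambda>z. a * P z + b * Q z) p = a * dd \<nu> P p + b * dd \<nu> Q p"
  using dd_has_derivative[OF *] assms by (simp add: dd_eq_grad)
 show "(\<lambda>z. a * P z + b * Q z) differentiable at p"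
  using * by (auto simp: differentiable_def)
qed

lemma C2f_lin:
 assumes "C2f V P" "C2f V Q"
 shows "C2f V (\<lambda>z. a * P z + b * Q z)"
  "p \<in> V \<Longrightarrow> i \<in> {ex,ey} \<Longrightarrow> dd j (dd i (\<lambda>z. a * P z + b * Q z)) p = a * dd j (dd i P) p + b * dd j (dd i Q) p"
proof -
 have V: "open V" using assms by (simp add: C2f_def)
 have d: "dd i (\<lambda>z. a * P z + b * Q z) p = a * dd i P p + b * dd i Q p" if "p \<in> V" for i p
  by (rule dd_lin(1)) (rule C2f_D(1)[OF assms(1) that] C2f_D(1)[OF assms(2) that])+
 have d2: "dd j (dd i (\<lambda>z. a * P z + b * Q z)) p = a * dd j (dd i P) p + b * dd j (dd i Q) p"
  if "p \<in> V" "i \<in> {ex,ey}" for i j p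
 proof -
  have "dd j (dd i (\<lambda>z. a * P z + b * Q z)) p = dd j (\<lambda>z. a * dd i P z + b * dd i Q z) p"
   by (rule dd_cong[OF V that(1) d])
  also have "\<dots> = a * dd j (dd i P) p + b * dd j (dd i Q) p"
   by (rule dd_lin(1)) (rule C2f_D(2)[OF assms(1) that] C2f_D(2)[OF assms(2) that])+
  finally show ?thesis .
 qed
 then show "p \<in> V \<Longrightarrow> i \<in> {ex,ey} \<Longrightarrow> dd j (dd i (\<lambda>z. a * P z + b * Q z)) p = a * dd j (dd i P) p + b * dd j (dd i Q) p" .
 have "dd i (\<lambda>z. a * P z + b * Q z) differentiable at p" if "p \<in> V" "i \<in> {ex,ey}" for p i
 proof (rule differentiable_cong_open[OF V that(1) d[symmetric]])
  show "(\<lambda>z. a * dd i P z + b * dd i Q z) differentiable at p"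
   by (rule dd_lin(2)) (rule C2f_D(2)[OF assms(1) that] C2f_D(2)[OF assms(2) that])+
 qed
 moreover have "continuous_on V (dd i (dd j (\<lambda>z. a * P z + b * Q z)))" if "i \<in> {ex,ey}" "j \<in> {ex,ey}" for i j
 proof -
  have "continuous_on V (\<lambda>z. a * dd i (dd j P) z + b * dd i (dd j Q) z)"
   using assms that by (intro continuous_intros) (auto simp: C2f_def)
  then show ?thesis using that(2) by (subst continuous_on_cong[OF refl d2])
 qed
 moreover have "(\<lambda>z. a * P z + b * Q z) differentiable at p" if "p \<in> V" for p
  by (rule dd_lin(2)) (rule C2f_D(1)[OF assms(1) that] C2f_D(1)[OF assms(2) that])+
 ultimately show "C2f V (\<lambda>z. a * P z + b * Q z)"
  using V unfolding C2f_def by blast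
qed

lemma sol_lin:
 assumes "sol \<mu> V P" "sol \<mu> V Q"
 shows "sol \<mu> V (\<lambda>z. a * P z + b * Q z)"
proof -
 have C: "C2f V P" "C2f V Q" using assms by (auto simp: sol_def)
 have "dd ex (dd ex (\<lambda>z. a * P z + b * Q z)) p + dd ey (dd ey (\<lambda>z. a * P z + b * Q z)) p = - \<mu> * (a * P p + b * Q p)"
  if "p \<in> V" for p
 proof -
  have e: "dd ey (dd ey P) p = - \<mu> * P p - dd ex (dd ex P) p" "dd ey (dd ey Q) p = - \<mu> * Q p - dd ex (dd ex Q) p"
   using assms that by (simp_all add: sol_def algebra_simps)
  show ?thesis by (simp add: C2f_lin(2)[OF C that] e algebra_simps)
 qed
 then show ?thesis using C2f_lin(1)[OF C] by (simp add: sol_def)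
qed

lemma C2f_subset: "C2f V P \<Longrightarrow> V' \<subseteq> V \<Longrightarrow> open V' \<Longrightarrow> C2f V' P"
 unfolding C2f_def by (blast intro: continuous_on_subset)

lemma sol_subset: "sol \<mu> V P \<Longrightarrow> V' \<subseteq> V \<Longrightarrow> open V' \<Longrightarrow> sol \<mu> V' P"
 unfolding sol_def using C2f_subset by blast

text \<open>Plane waves as model solutions. The cosine has value 1 at \<open>q\<close> and serves to
  subtract off the value of a solution; the sine, scaled to slope 1, is the reference for first
  derivatives.\<close>

lemma sol_trig:
 assumes "norm \<nu> = 1" "0 < \<mu>"
 shows "sol \<mu> UNIV (\<lambda>z. cos (sqrt \<mu> * (\<nu> \<bullet> (z - q))))"
  "sol \<mu> UNIV (\<lambda>z. sin (sqrt \<mu> * (\<nu> \<bullet> (z - q))) / sqrt \<mu>)"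
  "dd \<nu> (\<lambda>z. sin (sqrt \<mu> * (\<nu> \<bullet> (z - q))) / sqrt \<mu>) q = 1"
proof -
 define k where "k = sqrt \<mu>"
 have k: "k > 0" "k * k = \<mu>" using assms by (auto simp: k_def)
 obtain n m where nu: "\<nu> = (n, m)" by (cases \<nu>)
 have nm: "n * n + m * m = 1" using assms(1) nu by (simp add: norm_Pair power2_eq_square)
 have gen: "sol \<mu> UNIV (\<lambda>z. c * cos (k * (\<nu> \<bullet> (z - q))) + s * sin (k * (\<nu> \<bullet> (z - q)))) \<and>
   dd \<xi> (\<lambda>z. c * cos (k * (\<nu> \<bullet> (z - q))) + s * sin (k * (\<nu> \<bullet> (z - q))))
    = (\<lambda>z. k * (\<nu> \<bullet> \<xi>) * (s * cos (k * (\<nu> \<bullet> (z - q))) - c * sin (k * (\<nu> \<bullet> (z - q)))))" for c s \<xi>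
 proof -
  let ?f = "\<lambda>c s z. c * cos (k * (\<nu> \<bullet> (z - q))) + s * sin (k * (\<nu> \<bullet> (z - q)))"
  have 1: "(?f c s has_derivative (\<lambda>h. k * (\<nu> \<bullet> h) * (s * cos (k * (\<nu> \<bullet> (z - q))) - c * sin (k * (\<nu> \<bullet> (z - q)))))) (at z)" for c s z
   by (auto intro!: derivative_eq_intros simp: algebra_simps inner_diff_right)
  have 2: "dd \<xi> (?f c s) = ?f (k * (\<nu> \<bullet> \<xi>) * s) (- (k * (\<nu> \<bullet> \<xi>) * c))" for c s \<xi>
   by (rule ext, subst dd_has_derivative[OF 1]) (simp add: algebra_simps)
  have 3: "?f c s differentiable at z" for c s z using 1[of c s z] by (rule differentiableI)
  have "C2f UNIV (?f c s)"
   unfolding C2f_def 2 by (intro conjI ballI 3 open_UNIV continuous_intros)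
  moreover have "dd ex (dd ex (?f c s)) p + dd ey (dd ey (?f c s)) p = - \<mu> * ?f c s p" for p
  proof -
   have "dd ex (dd ex (?f c s)) p + dd ey (dd ey (?f c s)) p = - (k*k) * (n*n+m*m) * ?f c s p"
    unfolding 2 by (simp add: nu algebra_simps)
   then show ?thesis using k nm by simp
  qed
  ultimately show ?thesis unfolding sol_def 2 by (auto simp: algebra_simps)
 qed
 show "sol \<mu> UNIV (\<lambda>z. cos (sqrt \<mu> * (\<nu> \<bullet> (z - q))))"
  using gen[of 1 0] by (simp add: k_def)
 show "sol \<mu> UNIV (\<lambda>z. sin (sqrt \<mu> * (\<nu> \<bullet> (z - q))) / sqrt \<mu>)"
  using gen[of 0 "1/k"] by (simp add: k_def)
 have "dd \<nu> (\<lambda>z. 0 * cos (k * (\<nu> \<bullet> (z - q))) + 1/k * sin (k * (\<nu> \<bullet> (z - q)))) q = 1"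
  using gen[of 0 "1/k" \<nu>] k nm by (simp add: nu)
 then show "dd \<nu> (\<lambda>z. sin (sqrt \<mu> * (\<nu> \<bullet> (z - q))) / sqrt \<mu>) q = 1" by (simp add: k_def)
qed

section \<open>Circle means of solutions\<close>

lemma DERIV_integral_param:
 fixes f f' :: "real \<Rightarrow> real \<Rightarrow> real"
 assumes "\<And>r \<theta>. \<bar>r\<bar> < R \<Longrightarrow> \<theta> \<in> {a..b} \<Longrightarrow> ((\<lambda>r. f r \<theta>) has_real_derivative f' r \<theta>) (at r)"
  and "\<And>r. \<bar>r\<bar> < R \<Longrightarrow> continuous_on {a..b} (f r)"
  and "continuous_on ({-R<..<R} \<times> {a..b}) (\<lambda>(r,\<theta>). f' r \<theta>)"
  and "\<bar>r0\<bar> < R"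
 shows "((\<lambda>r. integral {a..b} (f r)) has_real_derivative integral {a..b} (f' r0)) (at r0)"
proof -
 have r0: "r0 \<in> {-R<..<R}" using assms(4) by auto
 have "((\<lambda>r. integral (cbox a b) (f r)) has_real_derivative integral (cbox a b) (f' r0)) (at r0 within {-R<..<R})"
 proof (rule leibniz_rule_field_derivative)
  fix x t assume "x \<in> {-R<..<R}" "t \<in> cbox a b"
  then show "((\<lambda>x. f x t) has_real_derivative f' x t) (at x within {-R<..<R})"
   using assms(1)[of x t] by (auto intro: has_field_derivative_at_within)
 next
  fix x assume "x \<in> {-R<..<R}"
  then have "continuous_on {a..b} (f x)" using assms(2) by auto
  then show "f x integrable_on cbox a b" by (simp add: integrable_continuous_real)
 qed (use assms r0 in auto)
 then show ?thesis using at_within_open[OF r0] by auto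
qed

lemma has_derivative_integral_param:
 fixes a b :: real
 assumes V: "open V" "\<And>q. q \<in> V \<Longrightarrow> P differentiable at q"
  and c: "continuous_on V (dd ex P)" "continuous_on V (dd ey P)"
  and gw: "continuous_on {a..b} \<gamma>" "continuous_on {a..b} w"
  and U: "\<And>p \<theta>. p \<in> ball p0 r \<Longrightarrow> \<theta> \<in> {a..b} \<Longrightarrow> p + \<gamma> \<theta> \<in> V" and r: "r > 0"
 shows "((\<lambda>p. integral {a..b} (\<lambda>\<theta>::real. w \<theta> * P (p + \<gamma> \<theta>))) has_derivative
   (\<lambda>h. integral {a..b} (\<lambda>\<theta>. w \<theta> * (grad P (p0 + \<gamma> \<theta>) \<bullet> h)))) (at p0)"
proof -
 let ?U = "ball p0 r"
 have p0: "p0 \<in> ?U" using r by simp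
 have cP: "continuous_on V P"
  using V by (auto intro!: differentiable_imp_continuous_on simp: differentiable_on_eq_differentiable_at)
 have cg: "continuous_on V (grad P)" unfolding grad_def by (intro continuous_intros c)
 let ?D = "\<lambda>p \<theta>. blinfun_inner_right (w \<theta> *\<^sub>R grad P (p + \<gamma> \<theta>))"
 have cD: "continuous_on (?U \<times> cbox a b) (\<lambda>(p, \<theta>). ?D p \<theta>)"
  unfolding split_beta
 proof (intro continuous_intros)
  show "continuous_on (?U \<times> cbox a b) (\<lambda>x. w (snd x))"
   by (rule continuous_on_compose2[OF gw(2) continuous_on_snd[OF continuous_on_id]]) (auto simp: box_real)
  show "continuous_on (?U \<times> cbox a b) (\<lambda>x. grad P (fst x + \<gamma> (snd x)))"
   by (rule continuous_on_compose2[OF cg])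
     (use U in \<open>auto intro!: continuous_intros continuous_on_compose2[OF gw(1)] simp: box_real\<close>)
 qed
 have "((\<lambda>p. integral (cbox a b) (\<lambda>\<theta>. w \<theta> * P (p + \<gamma> \<theta>))) has_derivative
   integral (cbox a b) (?D p0)) (at p0 within ?U)"
 proof (rule leibniz_rule[OF _ _ cD p0])
  fix p \<theta> assume *: "p \<in> ?U" "\<theta> \<in> cbox a b"
  then have "p + \<gamma> \<theta> \<in> V" using U by (simp add: box_real)
  then have P: "(P has_derivative (\<lambda>h. grad P (p + \<gamma> \<theta>) \<bullet> h)) (at (p + \<gamma> \<theta>))"
   by (intro grad_has_derivative V)
  have "((\<lambda>p. p + \<gamma> \<theta>) has_derivative (\<lambda>h. h)) (at p)"
   by (rule has_derivative_add_const[OF has_derivative_ident])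
  note D = has_derivative_compose[of "\<lambda>p. p + \<gamma> \<theta>" "\<lambda>h. h" p UNIV P "\<lambda>h. grad P (p + \<gamma> \<theta>) \<bullet> h", OF this P]
  note has_derivative_at_withinI[OF has_derivative_mult_right[OF D, of "w \<theta>"], of ?U]
  moreover have "(\<lambda>h. w \<theta> * (grad P (p + \<gamma> \<theta>) \<bullet> h)) = blinfun_apply (?D p \<theta>)"
   by (simp add: blinfun_inner_right.rep_eq fun_eq_iff)
  ultimately show "((\<lambda>p. w \<theta> * P (p + \<gamma> \<theta>)) has_derivative blinfun_apply (?D p \<theta>)) (at p within ?U)"
   by simp
 next
  fix p assume p: "p \<in> ?U"
  have "continuous_on {a..b} (\<lambda>\<theta>. w \<theta> * P (p + \<gamma> \<theta>))"
   by (intro continuous_intros gw continuous_on_compose2[OF cP] image_subsetI U[OF p])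
  then show "(\<lambda>\<theta>. w \<theta> * P (p + \<gamma> \<theta>)) integrable_on cbox a b"
   by (simp add: integrable_continuous_real)
 qed auto
 moreover have "blinfun_apply (integral (cbox a b) (?D p0)) = (\<lambda>h. integral {a..b} (\<lambda>\<theta>. w \<theta> * (grad P (p0 + \<gamma> \<theta>) \<bullet> h)))"
 proof
  fix h
  have "continuous_on (cbox a b) (?D p0)"
   by (rule continuous_on_compose2[OF cD, of _ "\<lambda>\<theta>. (p0, \<theta>)", simplified]) (use r in \<open>auto intro!: continuous_intros\<close>)
  then have "?D p0 integrable_on cbox a b" by (rule integrable_continuous)
  from blinfun_apply_integral[OF this, of h]
  show "blinfun_apply (integral (cbox a b) (?D p0)) h = integral {a..b} (\<lambda>\<theta>. w \<theta> * (grad P (p0 + \<gamma> \<theta>) \<bullet> h))"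
   by (simp add: blinfun_inner_right.rep_eq)
 qed
 ultimately show ?thesis using at_within_open[OF p0] by auto
qed

definition circ :: "real \<Rightarrow> point" where "circ \<theta> = (cos \<theta>, sin \<theta>)"

lemma norm_circ [simp]: "norm (circ \<theta>) = 1"
 by (simp add: circ_def norm_Pair)

lemma circ_inner_le: "\<bar>\<nu> \<bullet> circ \<theta>\<bar> \<le> norm \<nu>"
 using Cauchy_Schwarz_ineq2[of \<nu> "circ \<theta>"] by simp

lemma continuous_circ [continuous_intros]:
 fixes f :: "'a::t2_space \<Rightarrow> real"
 shows "continuous_on A f \<Longrightarrow> continuous_on A (\<lambda>x. circ (f x))"
 unfolding circ_def by (intro continuous_on_Pair continuous_on_cos continuous_on_sin)

lemma in_ball_circ: "\<bar>r\<bar> < R \<Longrightarrow> p + r *\<^sub>R circ \<theta> \<in> ball p R"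
 by (simp add: dist_norm)

lemma DERIV_radial:
 assumes "P differentiable at (p + r *\<^sub>R circ \<theta>)"
 shows "((\<lambda>r. P (p + r *\<^sub>R circ \<theta>)) has_real_derivative grad P (p + r *\<^sub>R circ \<theta>) \<bullet> circ \<theta>) (at r)"
 using has_real_derivative_dd[OF assms] dd_eq_grad[OF assms] by simp

lemma DERIV_angular:
 assumes "P differentiable at (p + r *\<^sub>R circ \<theta>)"
 shows "((\<lambda>\<theta>. P (p + r *\<^sub>R circ \<theta>)) has_real_derivative r * (grad P (p + r *\<^sub>R circ \<theta>) \<bullet> (- sin \<theta>, cos \<theta>))) (at \<theta>)"
proof -
 have "((\<lambda>\<theta>. p + r *\<^sub>R circ \<theta>) has_derivative (\<lambda>h. h *\<^sub>R r *\<^sub>R (- sin \<theta>, cos \<theta>))) (at \<theta>)"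
  unfolding circ_def by (auto intro!: derivative_eq_intros has_derivative_Pair simp: algebra_simps)
 from has_derivative_compose[OF this grad_has_derivative[OF assms]]
 have "((\<lambda>\<theta>. P (p + r *\<^sub>R circ \<theta>)) has_derivative (\<lambda>h. grad P (p + r *\<^sub>R circ \<theta>) \<bullet> (h *\<^sub>R r *\<^sub>R (- sin \<theta>, cos \<theta>)))) (at \<theta>)" .
 moreover have "(\<lambda>h. grad P (p + r *\<^sub>R circ \<theta>) \<bullet> (h *\<^sub>R r *\<^sub>R (- sin \<theta>, cos \<theta>)))
   = (*) (r * (grad P (p + r *\<^sub>R circ \<theta>) \<bullet> (- sin \<theta>, cos \<theta>)))"
  by (simp only: inner_scaleR_right) (simp add: fun_eq_iff)
 ultimately show ?thesis by (simp only: has_field_derivative_def)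
qed

definition cmean :: "(point \<Rightarrow> real) \<Rightarrow> point \<Rightarrow> real \<Rightarrow> real" where
 "cmean P p r = integral {0..2*pi} (\<lambda>\<theta>. P (p + r *\<^sub>R circ \<theta>))"

text \<open>The outward flux of the gradient through the circle. For a solution it turns the circle
  mean into a solution of the Bessel equation, split into the first-order relations
  \<open>cmean' = cflux / r\<close> and \<open>cflux' = - \<mu> * r * cmean\<close>.\<close>

definition cflux :: "(point \<Rightarrow> real) \<Rightarrow> point \<Rightarrow> real \<Rightarrow> real" where
 "cflux P p r = integral {0..2*pi} (\<lambda>\<theta>. r * (grad P (p + r *\<^sub>R circ \<theta>) \<bullet> circ \<theta>))"

lemma continuous_circle:
 assumes "continuous_on V f" "ball p R \<subseteq> V"
 shows "continuous_on ({-R<..<R} \<times> {0..2*pi}) (\<lambda>x. f (p + fst x *\<^sub>R circ (snd x)))"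
proof (rule continuous_on_compose2[OF assms(1)])
 show "continuous_on ({-R<..<R} \<times> {0..2*pi}) (\<lambda>x. p + fst x *\<^sub>R circ (snd x))"
  by (intro continuous_intros)
 show "(\<lambda>x. p + fst x *\<^sub>R circ (snd x)) ` ({-R<..<R} \<times> {0..2*pi}) \<subseteq> V"
 proof (rule image_subsetI)
  fix x assume "x \<in> {-R<..<R} \<times> {0..2*pi}"
  then have "\<bar>fst x\<bar> < R" by auto
  then show "p + fst x *\<^sub>R circ (snd x) \<in> V" using in_ball_circ assms(2) by blast
 qed
qed

lemma continuous_circle1:
 assumes "continuous_on V f" "ball p R \<subseteq> V" "\<bar>r\<bar> < R"
 shows "continuous_on {0..2*pi} (\<lambda>\<theta>. f (p + r *\<^sub>R circ \<theta>))"
 by (rule continuous_on_compose2[OF assms(1)])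
   (use in_ball_circ[of _ R p] assms in \<open>auto intro!: continuous_intros\<close>)

lemma integral_periodic_derivative:
 fixes f f' :: "real \<Rightarrow> real"
 assumes "\<And>\<theta>. (f has_real_derivative f' \<theta>) (at \<theta>)" "f (2*pi) = f 0"
 shows "(f' has_integral 0) {0..2*pi}"
 using fundamental_theorem_of_calculus[of 0 "2*pi" f f'] assms
 by (auto simp: has_real_derivative_iff_has_vector_derivative[symmetric] intro: has_field_derivative_at_within)

lemma cmean_DERIV:
 assumes P: "sol \<mu> V P" and B: "ball p R \<subseteq> V" and r: "\<bar>r\<bar> < R" "r \<noteq> 0"
 shows "(cmean P p has_real_derivative cflux P p r / r) (at r)"
proof -
 have C: "C2f V P" using P by (simp add: sol_def)
 have V: "p + r *\<^sub>R circ \<theta> \<in> V" if "\<bar>r\<bar> < R" for r \<theta> using in_ball_circ[OF that] B by blast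
 have "((\<lambda>r. integral {0..2*pi} (\<lambda>\<theta>. P (p + r *\<^sub>R circ \<theta>))) has_real_derivative
  integral {0..2*pi} (\<lambda>\<theta>. grad P (p + r *\<^sub>R circ \<theta>) \<bullet> circ \<theta>)) (at r)"
 proof (rule DERIV_integral_param[OF _ _ _ r(1)])
  fix r \<theta> assume "\<bar>r\<bar> < R"
  then show "((\<lambda>r. P (p + r *\<^sub>R circ \<theta>)) has_real_derivative grad P (p + r *\<^sub>R circ \<theta>) \<bullet> circ \<theta>) (at r)"
   using DERIV_radial C2f_D(1)[OF C V] by blast
 next
  fix r assume r: "\<bar>r\<bar> < R"
  show "continuous_on {0..2*pi} (\<lambda>\<theta>. P (p + r *\<^sub>R circ \<theta>))"
   using continuous_circle1[OF C2f_continuous(1)[OF C] B r] .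
 next
  have "continuous_on V (grad P)" unfolding grad_def using C2f_continuous[OF C] by (intro continuous_intros) auto
  from continuous_circle[OF this B]
  show "continuous_on ({-R<..<R} \<times> {0..2*pi}) (\<lambda>(r, \<theta>). grad P (p + r *\<^sub>R circ \<theta>) \<bullet> circ \<theta>)"
   unfolding split_beta by (intro continuous_intros)
 qed
 moreover have "cflux P p r / r = integral {0..2*pi} (\<lambda>\<theta>. grad P (p + r *\<^sub>R circ \<theta>) \<bullet> circ \<theta>)"
  unfolding cflux_def using r by simp
 ultimately show ?thesis unfolding cmean_def by simp
qed

lemma cflux_DERIV:
 assumes P: "sol \<mu> V P" and B: "ball p R \<subseteq> V" and r: "\<bar>r\<bar> < R"
 shows "(cflux P p has_real_derivative - \<mu> * r * cmean P p r) (at r)"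
proof -
 have C: "C2f V P" using P by (simp add: sol_def)
 have V: "p + r *\<^sub>R circ \<theta> \<in> V" if "\<bar>r\<bar> < R" for r \<theta> using in_ball_circ[OF that] B by blast
 let ?z = "\<lambda>r \<theta>. p + r *\<^sub>R circ \<theta>"
 let ?G = "\<lambda>z. (grad (dd ex P) z, grad (dd ey P) z)"
 let ?k = "\<lambda>r \<theta>. grad P (?z r \<theta>) \<bullet> circ \<theta> + r * ((grad (dd ex P) (?z r \<theta>) \<bullet> circ \<theta>) * cos \<theta> + (grad (dd ey P) (?z r \<theta>) \<bullet> circ \<theta>) * sin \<theta>)"
 have cg: "continuous_on V (grad P)" "continuous_on V (grad (dd ex P))" "continuous_on V (grad (dd ey P))"
  unfolding grad_def using C2f_continuous[OF C] C by (auto intro!: continuous_intros simp: C2f_def)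
 have D: "(cflux P p has_real_derivative integral {0..2*pi} (?k r)) (at r)"
  unfolding cflux_def
 proof (rule DERIV_integral_param[OF _ _ _ r])
  fix r \<theta> assume r: "\<bar>r\<bar> < R"
  have "((\<lambda>r. r * (dd ex P (?z r \<theta>) * cos \<theta> + dd ey P (?z r \<theta>) * sin \<theta>)) has_real_derivative ?k r \<theta>) (at r)"
   using DERIV_radial[OF C2f_D(2)[OF C V[OF r, of \<theta>]], of ex] DERIV_radial[OF C2f_D(2)[OF C V[OF r, of \<theta>]], of ey]
   by (auto intro!: derivative_eq_intros simp: grad_def circ_def algebra_simps)
  then show "((\<lambda>r. r * (grad P (?z r \<theta>) \<bullet> circ \<theta>)) has_real_derivative ?k r \<theta>) (at r)"
   by (simp add: grad_def circ_def)
 next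
  fix r assume r: "\<bar>r\<bar> < R"
  show "continuous_on {0..2*pi} (\<lambda>\<theta>. r * (grad P (?z r \<theta>) \<bullet> circ \<theta>))"
   using continuous_circle1[OF cg(1) B r] by (intro continuous_intros)
 next
  show "continuous_on ({-R<..<R} \<times> {0..2*pi}) (\<lambda>(r, \<theta>). ?k r \<theta>)"
   using continuous_circle[OF cg(1) B] continuous_circle[OF cg(2) B] continuous_circle[OF cg(3) B]
   unfolding split_beta by (intro continuous_intros)
 qed
 \<comment> \<open>The tangential derivative. In polar form, \<open>r\<close> times the Laplacian is
   \<open>?k\<close> plus the angular derivative of \<open>?\<tau>\<close>, and the latter
   integrates to 0 over a period.\<close>
 let ?\<tau> = "\<lambda>\<theta>. - sin \<theta> * dd ex P (?z r \<theta>) + cos \<theta> * dd ey P (?z r \<theta>)"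
 have k: "?k r \<theta> = - \<mu> * r * P (?z r \<theta>) - \<tau>'"
  if "\<tau>' = - cos \<theta> * dd ex P (?z r \<theta>) - sin \<theta> * (r * (grad (dd ex P) (?z r \<theta>) \<bullet> (- sin \<theta>, cos \<theta>)))
    - sin \<theta> * dd ey P (?z r \<theta>) + cos \<theta> * (r * (grad (dd ey P) (?z r \<theta>) \<bullet> (- sin \<theta>, cos \<theta>)))" for \<theta> \<tau>'
 proof -
  have e: "dd ey (dd ey P) (?z r \<theta>) = - \<mu> * P (?z r \<theta>) - dd ex (dd ex P) (?z r \<theta>)"
   using P V[OF r] unfolding sol_def by (smt (verit))
  have sc: "sin \<theta> * sin \<theta> = 1 - cos \<theta> * cos \<theta>" using sin_squared_eq[of \<theta>] by (simp add: power2_eq_square)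
  have sc2: "sin \<theta> * (sin \<theta> * x) = x - cos \<theta> * (cos \<theta> * x)" for x
   using sc by (metis left_diff_distrib mult.assoc mult_1)
  show ?thesis unfolding that grad_def by (simp add: circ_def e[unfolded circ_def scaleR_Pair real_scaleR_def] algebra_simps sc2)
 qed
 have "((\<lambda>\<theta>. - \<mu> * r * P (?z r \<theta>) - ?k r \<theta>) has_integral 0) {0..2*pi}"
 proof (rule integral_periodic_derivative[of ?\<tau>])
  fix \<theta>
  show "(?\<tau> has_real_derivative - \<mu> * r * P (?z r \<theta>) - ?k r \<theta>) (at \<theta>)"
   unfolding k[OF refl]
   using DERIV_angular[OF C2f_D(2)[OF C V[OF r, of \<theta>]], of ex] DERIV_angular[OF C2f_D(2)[OF C V[OF r, of \<theta>]], of ey]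
   by (auto intro!: derivative_eq_intros simp: algebra_simps)
 qed (simp add: circ_def)
 moreover have "(\<lambda>\<theta>. P (?z r \<theta>)) integrable_on {0..2*pi}"
  using continuous_circle1[OF C2f_continuous(1)[OF C] B r] integrable_continuous_real by blast
 then have "((\<lambda>\<theta>. - \<mu> * r * P (?z r \<theta>)) has_integral - \<mu> * r * cmean P p r) {0..2*pi}"
  unfolding cmean_def by (intro has_integral_mult_right integrable_integral)
 ultimately have "((\<lambda>\<theta>. - \<mu> * r * P (?z r \<theta>) - (- \<mu> * r * P (?z r \<theta>) - ?k r \<theta>)) has_integral - \<mu> * r * cmean P p r - 0) {0..2*pi}"
  by (intro has_integral_diff)
 then have "integral {0..2*pi} (?k r) = - \<mu> * r * cmean P p r" by (intro integral_unique) simp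
 with D show ?thesis by simp
qed

lemma cmean_continuous:
 assumes "sol \<mu> V P" "ball p R \<subseteq> V"
 shows "continuous_on {-R<..<R} (cmean P p)"
proof -
 have C: "C2f V P" using assms by (simp add: sol_def)
 have "continuous_on {r0-e..r0+e} (cmean P p)" if "\<bar>r0\<bar> < R - e" for r0 e
 proof -
  have "continuous_on ({r0-e..r0+e} \<times> cbox 0 (2*pi)) (\<lambda>(r, \<theta>). P (p + r *\<^sub>R circ \<theta>))"
   unfolding split_beta box_real
   by (rule continuous_on_subset[OF continuous_circle[OF C2f_continuous(1)[OF C] assms(2)]])
     (use that in auto)
  from integral_continuous_on_param[OF this]
  show ?thesis unfolding cmean_def box_real .
 qed
 then have "isCont (cmean P p) r0" if "\<bar>r0\<bar> < R" for r0
 proof -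
  define e where "e = (R - \<bar>r0\<bar>) / 2"
  have "e > 0" "\<bar>r0\<bar> < R - e" using that by (auto simp: e_def field_simps)
  then have "continuous_on {r0-e<..<r0+e} (cmean P p)"
   using \<open>\<And>r0 e. \<bar>r0\<bar> < R - e \<Longrightarrow> continuous_on {r0-e..r0+e} (cmean P p)\<close>[of r0 e]
   by (rule_tac continuous_on_subset[of "{r0-e..r0+e}"]) auto
  then show ?thesis using \<open>e > 0\<close> by (simp add: continuous_on_eq_continuous_at)
 qed
 then show ?thesis by (intro continuous_at_imp_continuous_on ballI) auto
qed

text \<open>Uniqueness for the singular Bessel equation with zero data: integrating the two
  first-order relations from 0 bounds \<open>cmean\<close> on \<open>{0..r}\<close> by
  \<open>\<mu> * r^2 < 1\<close> times its own maximum. Both integrations are mean value arguments,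
  so at radius 0 only continuity of \<open>cmean\<close> is needed.\<close>

lemma cmean_zero:
 assumes P: "sol \<mu> V P" and B: "ball p R \<subseteq> V" and p0: "P p = 0"
  and mu: "\<mu> * r^2 < 1" "0 \<le> \<mu>" and r: "0 \<le> r" "r < R"
 shows "cmean P p r = 0"
proof -
 have "continuous_on {0..r} (\<lambda>t. \<bar>cmean P p t\<bar>)"
  by (intro continuous_intros continuous_on_subset[OF cmean_continuous[OF P B]]) (use r in auto)
 then obtain s where s: "s \<in> {0..r}" "\<And>t. t \<in> {0..r} \<Longrightarrow> \<bar>cmean P p t\<bar> \<le> \<bar>cmean P p s\<bar>"
  using continuous_attains_sup[of "{0..r}" "\<lambda>t. \<bar>cmean P p t\<bar>"] r by auto
 let ?S = "\<bar>cmean P p s\<bar>"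
 have m0: "cmean P p 0 = 0" by (simp add: cmean_def p0)
 have f: "\<bar>cflux P p t\<bar> \<le> \<mu> * t * ?S * t" if "0 < t" "t \<le> r" for t
 proof -
  have "\<exists>z. 0 < z \<and> z < t \<and> cflux P p t - cflux P p 0 = (t - 0) * (- \<mu> * z * cmean P p z)"
   by (rule MVT2) (use cflux_DERIV[OF P B] that r in auto)
  then obtain z where z: "0 < z" "z < t" "cflux P p t = t * (- \<mu> * z * cmean P p z)"
   by (auto simp: cflux_def)
  have "\<bar>cflux P p t\<bar> = (\<mu> * z) * \<bar>cmean P p z\<bar> * t"
   using z mu that by (simp add: abs_mult)
  also have "\<dots> \<le> (\<mu> * t) * ?S * t"
   using s(2)[of z] z that mu r by (intro mult_right_mono mult_mono mult_left_mono) auto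
  finally show ?thesis by simp
 qed
 have "?S = 0"
 proof (cases "s = 0")
  case False
  then have s0: "0 < s" "s \<le> r" using s by auto
  have c: "continuous_on {0..s} (cmean P p)"
   by (rule continuous_on_subset[OF cmean_continuous[OF P B]]) (use s0 r in auto)
  have "(cmean P p has_derivative (*) (cflux P p x / x)) (at x)" if "0 < x" "x < s" for x
   using cmean_DERIV[OF P B, of x] s0 r that by (simp add: has_field_derivative_def)
  from mvt[OF s0(1) c this] obtain z where "0 < z" "z < s" "cmean P p s - cmean P p 0 = (cflux P p z / z) * (s - 0)"
   by blast
  then have z: "0 < z" "z < s" "cmean P p s = s * (cflux P p z / z)" using m0 by auto
  have "?S = s * (\<bar>cflux P p z\<bar> / z)" using z s0 by (simp add: abs_mult)
  also have "\<dots> \<le> s * ((\<mu> * z * ?S * z) / z)"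
   using f[of z] z s0 by (intro mult_left_mono divide_right_mono) auto
  also have "\<dots> = s * z * \<mu> * ?S" using z by simp
  also have "\<dots> \<le> r * r * \<mu> * ?S"
   using z s0 mu by (intro mult_right_mono mult_mono) auto
  finally have "?S * (1 - \<mu> * r^2) \<le> 0" by (simp add: algebra_simps power2_eq_square)
  then show ?thesis using mu by (simp add: mult_le_0_iff)
 qed (use m0 in simp)
 then show ?thesis using s(2)[of r] r by simp
qed

text \<open>\<open>2 \<pi> J\<^sub>0(r sqrt \<mu>)\<close>, with the Bessel function written as the circle mean of a plane wave.\<close>

definition Jmean :: "real \<Rightarrow> real \<Rightarrow> real" where
 "Jmean \<mu> r = integral {0..2*pi} (\<lambda>\<theta>. cos (sqrt \<mu> * (r * cos \<theta>)))"

text \<open>Mean value property: subtracting \<open>P p\<close> times the cosine wave leaves a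
  solution that vanishes at \<open>p\<close>, to which \<open>cmean_zero\<close> applies.\<close>

lemma cmean_eq:
 assumes P: "sol \<mu> V P" and B: "ball p R \<subseteq> V"
  and mu: "\<mu> * r^2 < 1" "0 < \<mu>" and r: "0 \<le> r" "r < R"
 shows "cmean P p r = P p * Jmean \<mu> r"
proof -
 have B': "ball p R \<subseteq> ball p R" by simp
 have P': "sol \<mu> (ball p R) P" by (rule sol_subset[OF P B]) simp
 let ?E = "\<lambda>z. cos (sqrt \<mu> * (ex \<bullet> (z - p)))"
 have E: "sol \<mu> (ball p R) ?E" by (rule sol_subset[OF sol_trig(1)]) (use mu in auto)
 have "sol \<mu> (ball p R) (\<lambda>z. 1 * P z + (- P p) * ?E z)" by (rule sol_lin[OF P' E])
 from cmean_zero[OF this B' _ mu(1) less_imp_le[OF mu(2)] r]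
 have 0: "cmean (\<lambda>z. 1 * P z + (- P p) * ?E z) p r = 0" by simp
 have iP: "(\<lambda>\<theta>. P (p + r *\<^sub>R circ \<theta>)) integrable_on {0..2*pi}"
  using continuous_circle1[OF C2f_continuous(1) B, of P r] P r
  by (intro integrable_continuous_real) (auto simp: sol_def)
 have iE: "(\<lambda>\<theta>. ?E (p + r *\<^sub>R circ \<theta>)) integrable_on {0..2*pi}"
  by (intro integrable_continuous_real continuous_intros)
 have J: "integral {0..2*pi} (\<lambda>\<theta>. ?E (p + r *\<^sub>R circ \<theta>)) = Jmean \<mu> r"
  unfolding Jmean_def by (simp add: circ_def)
 have "cmean (\<lambda>z. 1 * P z + (- P p) * ?E z) p r
   = integral {0..2*pi} (\<lambda>\<theta>. P (p + r *\<^sub>R circ \<theta>)) + (- P p) * integral {0..2*pi} (\<lambda>\<theta>. ?E (p + r *\<^sub>R circ \<theta>))"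
  unfolding cmean_def mult_1 
  by (subst integral_add[OF iP]) (use iE in \<open>auto intro: integrable_on_mult_right simp only: integral_mult_right\<close>)
 then show ?thesis using 0 unfolding J by (simp add: cmean_def)
qed

lemma Jmean_bounds:
 assumes "\<mu> * r^2 < 1" "0 < \<mu>"
 shows "0 < Jmean \<mu> r" "Jmean \<mu> r \<le> 2 * pi"
proof -
 have i: "(\<lambda>\<theta>. cos (sqrt \<mu> * (r * cos \<theta>))) integrable_on {0..2*pi}"
  by (intro integrable_continuous_real continuous_intros)
 have "Jmean \<mu> r \<le> integral {0..2*pi} (\<lambda>\<theta>. 1)"
  unfolding Jmean_def by (rule integral_le[OF i]) auto
 then show "Jmean \<mu> r \<le> 2 * pi" by simp
 have "(sqrt \<mu> * r)^2 < 1^2" using assms by (simp add: power_mult_distrib)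
 then have sq: "\<bar>sqrt \<mu> * r\<bar> < 1" using abs_square_less_1[of "sqrt \<mu> * r"] by simp
 have "integral {0..2*pi} (\<lambda>\<theta>. cos 1) \<le> Jmean \<mu> r"
  unfolding Jmean_def
 proof (rule integral_le[OF _ i])
  fix \<theta>
  have "\<bar>sqrt \<mu> * (r * cos \<theta>)\<bar> \<le> 1 * 1"
   using sq abs_cos_le_one[of \<theta>] unfolding mult.assoc[symmetric] abs_mult[of _ "cos \<theta>"]
   by (intro mult_mono) auto
  then have "cos 1 \<le> cos \<bar>sqrt \<mu> * (r * cos \<theta>)\<bar>"
   using pi_gt3 by (intro cos_monotone_0_pi_le) auto
  then show "cos 1 \<le> cos (sqrt \<mu> * (r * cos \<theta>))" by simp
 qed auto
 moreover have "cos 1 > (0::real)" by (rule cos_gt_zero_pi) (use pi_gt3 in auto)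
 ultimately show "0 < Jmean \<mu> r" by (simp add: zero_less_mult_iff) (smt (verit) mult_pos_pos pi_gt_zero)
qed

text \<open>The mean value property differentiated with respect to the centre of the circle.\<close>

lemma cmean_dd:
 assumes P: "sol \<mu> V P" and B: "ball p R \<subseteq> V"
  and mu: "\<mu> * r^2 < 1" "0 < \<mu>" and r: "0 \<le> r" "r < R"
 shows "integral {0..2*pi} (\<lambda>\<theta>. grad P (p + r *\<^sub>R circ \<theta>) \<bullet> \<nu>) = dd \<nu> P p * Jmean \<mu> r"
proof -
 have C: "C2f V P" using P by (simp add: sol_def)
 define e where "e = R - r"
 have e: "e > 0" using r by (simp add: e_def)
 have sub: "ball p' r' \<subseteq> V" if "dist p p' + r' \<le> R" for p' r'
  using B that by (auto simp: subset_eq) (smt (verit) dist_triangle mem_ball)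
 have "((\<lambda>p. integral {0..2*pi} (\<lambda>\<theta>. 1 * P (p + r *\<^sub>R circ \<theta>))) has_derivative
   (\<lambda>h. integral {0..2*pi} (\<lambda>\<theta>. 1 * (grad P (p + r *\<^sub>R circ \<theta>) \<bullet> h)))) (at p)"
 proof (rule has_derivative_integral_param[OF C2f_D(4)[OF C] C2f_D(1)[OF C], where r=e])
  show "p \<in> V" using B r by (auto simp: subset_eq)
  fix q \<theta> assume q: "q \<in> ball p e"
  have "dist p (q + r *\<^sub>R circ \<theta>) \<le> dist p q + r"
   using dist_triangle[of p "q + r *\<^sub>R circ \<theta>" q] r by (simp add: dist_norm)
  then show "q + r *\<^sub>R circ \<theta> \<in> V" using q B by (auto simp: e_def subset_eq)
 qed (use C2f_continuous(2)[OF C] e in \<open>auto intro!: continuous_intros\<close>)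
 from dd_has_derivative[OF this, of \<nu>]
 have 1: "dd \<nu> (\<lambda>p. cmean P p r) p = integral {0..2*pi} (\<lambda>\<theta>. grad P (p + r *\<^sub>R circ \<theta>) \<bullet> \<nu>)"
  by (simp add: cmean_def[abs_def])
 have "dd \<nu> (\<lambda>p. cmean P p r) p = dd \<nu> (\<lambda>p. Jmean \<mu> r * P p + 0 * P p) p"
 proof (rule dd_cong[of "ball p e"])
  fix q assume "q \<in> ball p e"
  then have "ball q (R - dist p q) \<subseteq> V" "r < R - dist p q" using sub[of q] by (auto simp: e_def)
  from cmean_eq[OF P this(1) mu r(1) this(2)]
  show "cmean P q r = Jmean \<mu> r * P q + 0 * P q" by simp
 qed (use e in auto)
 moreover have "P differentiable at p" using C2f_D(1)[OF C, of p] B r by (auto simp: subset_eq)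
 ultimately show ?thesis using 1 dd_lin(1)[of P p P \<nu> "Jmean \<mu> r" 0] by simp
qed

text \<open>By the divergence theorem this is the integral of the derivative in direction
  \<open>\<nu>\<close> over the disc of radius \<open>r\<close>, written through boundary values of
  \<open>P\<close> only.\<close>

definition cweight :: "point \<Rightarrow> (point \<Rightarrow> real) \<Rightarrow> point \<Rightarrow> real \<Rightarrow> real" where
 "cweight \<nu> P p r = integral {0..2*pi} (\<lambda>\<theta>. r * ((\<nu> \<bullet> circ \<theta>) * P (p + r *\<^sub>R circ \<theta>)))"

lemma cweight_DERIV:
 assumes P: "sol \<mu> V P" and B: "ball p R \<subseteq> V"
  and mu: "\<mu> * r^2 < 1" "0 < \<mu>" and r: "0 \<le> r" "r < R"
 shows "(cweight \<nu> P p has_real_derivative r * (dd \<nu> P p * Jmean \<mu> r)) (at r)"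
proof -
 have C: "C2f V P" using P by (simp add: sol_def)
 have V: "p + r *\<^sub>R circ \<theta> \<in> V" if "\<bar>r\<bar> < R" for r \<theta> using in_ball_circ[OF that] B by blast
 have r': "\<bar>r\<bar> < R" using r by auto
 let ?z = "\<lambda>r \<theta>. p + r *\<^sub>R circ \<theta>"
 have cP: "continuous_on V P" "continuous_on V (grad P)"
  unfolding grad_def using C2f_continuous[OF C] by (auto intro!: continuous_intros)
 let ?k = "\<lambda>r \<theta>. (\<nu> \<bullet> circ \<theta>) * P (?z r \<theta>) + r * ((\<nu> \<bullet> circ \<theta>) * (grad P (?z r \<theta>) \<bullet> circ \<theta>))"
 have D: "(cweight \<nu> P p has_real_derivative integral {0..2*pi} (?k r)) (at r)"
  unfolding cweight_def
 proof (rule DERIV_integral_param[OF _ _ _ r'])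
  fix r \<theta> assume r: "\<bar>r\<bar> < R"
  show "((\<lambda>r. r * ((\<nu> \<bullet> circ \<theta>) * P (?z r \<theta>))) has_real_derivative ?k r \<theta>) (at r)"
   using DERIV_radial[OF C2f_D(1)[OF C V[OF r, of \<theta>]]]
   by (auto intro!: derivative_eq_intros)
 next
  fix r assume r: "\<bar>r\<bar> < R"
  show "continuous_on {0..2*pi} (\<lambda>\<theta>. r * ((\<nu> \<bullet> circ \<theta>) * P (?z r \<theta>)))"
   using continuous_circle1[OF cP(1) B r] by (intro continuous_intros)
 next
  show "continuous_on ({-R<..<R} \<times> {0..2*pi}) (\<lambda>(r, \<theta>). ?k r \<theta>)"
   using continuous_circle[OF cP(1) B] continuous_circle[OF cP(2) B]
   unfolding split_beta by (intro continuous_intros)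
 qed
 obtain n m where nu: "\<nu> = (n, m)" by (cases \<nu>)
 let ?\<tau> = "\<lambda>\<theta>. (n * sin \<theta> - m * cos \<theta>) * P (?z r \<theta>)"
 have "((\<lambda>\<theta>. ?k r \<theta> - r * (grad P (?z r \<theta>) \<bullet> \<nu>)) has_integral 0) {0..2*pi}"
 proof (rule integral_periodic_derivative[of ?\<tau>])
  fix \<theta> :: real
  have sc: "sin \<theta> * sin \<theta> = 1 - cos \<theta> * cos \<theta>" using sin_squared_eq[of \<theta>] by (simp add: power2_eq_square)
  have sc2: "sin \<theta> * (sin \<theta> * x) = x - cos \<theta> * (cos \<theta> * x)" for x
   using sc by (metis left_diff_distrib mult.assoc mult_1)
  obtain g h where gh: "grad P (?z r \<theta>) = (g, h)" by (cases "grad P (?z r \<theta>)")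
  have "(?\<tau> has_real_derivative (n * cos \<theta> + m * sin \<theta>) * P (?z r \<theta>) + (n * sin \<theta> - m * cos \<theta>) * (r * ((g,h) \<bullet> (- sin \<theta>, cos \<theta>)))) (at \<theta>)"
   using DERIV_angular[OF C2f_D(1)[OF C V[OF r', of \<theta>]]] gh
   by (auto intro!: derivative_eq_intros)
  moreover have "(n * cos \<theta> + m * sin \<theta>) * P (?z r \<theta>) + (n * sin \<theta> - m * cos \<theta>) * (r * ((g,h) \<bullet> (- sin \<theta>, cos \<theta>)))
    = ?k r \<theta> - r * (grad P (?z r \<theta>) \<bullet> \<nu>)"
   unfolding gh nu by (simp add: circ_def algebra_simps sc2 sc)
  ultimately show "(?\<tau> has_real_derivative ?k r \<theta> - r * (grad P (?z r \<theta>) \<bullet> \<nu>)) (at \<theta>)"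
   by simp
 qed (simp add: circ_def)
 moreover have "(\<lambda>\<theta>. grad P (?z r \<theta>) \<bullet> \<nu>) integrable_on {0..2*pi}"
  using continuous_circle1[OF cP(2) B r'] by (intro integrable_continuous_real continuous_intros)
 then have "((\<lambda>\<theta>. r * (grad P (?z r \<theta>) \<bullet> \<nu>)) has_integral r * (dd \<nu> P p * Jmean \<mu> r)) {0..2*pi}"
  unfolding cmean_dd[OF P B mu r, of \<nu>, symmetric] by (intro has_integral_mult_right integrable_integral)
 ultimately have "((\<lambda>\<theta>. (?k r \<theta> - r * (grad P (?z r \<theta>) \<bullet> \<nu>)) + r * (grad P (?z r \<theta>) \<bullet> \<nu>)) has_integral 0 + r * (dd \<nu> P p * Jmean \<mu> r)) {0..2*pi}"
  by (intro has_integral_add)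
 then have "integral {0..2*pi} (?k r) = r * (dd \<nu> P p * Jmean \<mu> r)" by (intro integral_unique) simp
 with D show ?thesis by simp
qed

text \<open>By \<open>cweight_DERIV\<close> both sides have the same radial derivative, and both
  vanish at radius 0. So the quotient of \<open>cweight\<close> by the derivative at the centre is
  the same for all solutions and all centres.\<close>

lemma cweight_eq:
 assumes P: "sol \<mu> V P" and B: "ball p R \<subseteq> V"
  and Q: "sol \<mu> V' Q" and B': "ball q R \<subseteq> V'"
  and mu: "\<mu> * r^2 < 1" "0 < \<mu>" and r: "0 \<le> r" "r < R"
 shows "dd \<nu> Q q * cweight \<nu> P p r = dd \<nu> P p * cweight \<nu> Q q r"
proof -
 let ?f = "\<lambda>r. dd \<nu> Q q * cweight \<nu> P p r - dd \<nu> P p * cweight \<nu> Q q r"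
 have "(?f has_real_derivative 0) (at t)" if "t \<in> {0..r}" for t
 proof -
  have "\<mu> * t^2 \<le> \<mu> * r^2" using that mu by (intro mult_left_mono power_mono) auto
  then have t: "\<mu> * t^2 < 1" "0 \<le> t" "t < R" using mu(1) that r by auto
  show ?thesis
   using cweight_DERIV[OF P B t(1) mu(2) t(2,3), of \<nu>] cweight_DERIV[OF Q B' t(1) mu(2) t(2,3), of \<nu>]
   by (auto intro!: derivative_eq_intros)
 qed
 then have "?f r = ?f 0"
  using r has_field_derivative_zero_constant[of "{0..r}" ?f] 
  by (metis (no_types, lifting) atLeastAtMost_iff convex_real_interval(5) has_field_derivative_at_within order_refl)
 then show ?thesis by (simp add: cweight_def)
qed

lemma sin_ge_half:
 fixes t :: real
 assumes "\<bar>t\<bar> \<le> 1"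
 shows "t^2 / 2 \<le> t * sin t"
proof -
 have *: "s / 2 \<le> sin s" if "0 \<le> s" "s \<le> 1" for s :: real
 proof -
  have "sin 0 - 0 / 2 \<le> sin s - s / 2"
  proof (rule DERIV_nonneg_imp_nondecreasing[OF that(1)])
   fix x :: real assume x: "0 \<le> x" "x \<le> s"
   have "cos (pi / 3) \<le> cos x" using x that pi_gt3 by (intro cos_monotone_0_pi_le) auto
   then have "0 \<le> cos x - 1 / 2" by (simp add: cos_60)
   then show "\<exists>y. ((\<lambda>x. sin x - x / 2) has_real_derivative y) (at x) \<and> 0 \<le> y"
    by (intro exI[of _ "cos x - 1/2"]) (auto intro!: derivative_eq_intros)
  qed
  then show ?thesis by simp
 qed
 show ?thesis
 proof (cases "0 \<le> t")
  case True
  then have "t * (t / 2) \<le> t * sin t" using assms *[of t] by (intro mult_left_mono) auto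
  then show ?thesis by (simp add: power2_eq_square)
 next
  case False
  then have "(-t) * ((-t) / 2) \<le> (-t) * sin (-t)" using assms *[of "-t"] by (intro mult_left_mono) auto
  then show ?thesis by (simp add: power2_eq_square)
 qed
qed

lemma integral_circ_inner_sq:
 assumes "norm \<nu> = 1"
 shows "((\<lambda>\<theta>. (\<nu> \<bullet> circ \<theta>)^2) has_integral pi) {0..2*pi}"
proof -
 obtain n m where nu: "\<nu> = (n, m)" by (cases \<nu>)
 have nm: "n * n + m * m = 1" using assms nu by (simp add: norm_Pair power2_eq_square)
 let ?F = "\<lambda>\<theta>. \<theta> / 2 + (n*n - m*m) * (sin \<theta> * cos \<theta>) / 2 + n * m * (sin \<theta> * sin \<theta>)"
 have "((\<lambda>\<theta>. (\<nu> \<bullet> circ \<theta>)^2) has_integral ?F (2*pi) - ?F 0) {0..2*pi}"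
 proof (rule fundamental_theorem_of_calculus)
  fix \<theta> :: real
  have cs: "cos \<theta> * cos \<theta> + sin \<theta> * sin \<theta> = 1" using sin_cos_squared_add2[of \<theta>] by (simp add: power2_eq_square)
  have "(?F has_real_derivative 1 / 2 + (n*n - m*m) * (cos \<theta> * cos \<theta> - sin \<theta> * sin \<theta>) / 2 + 2 * n * m * (sin \<theta> * cos \<theta>)) (at \<theta>)"
   by (auto intro!: derivative_eq_intros simp: field_simps)
  moreover have "1 + (n*n - m*m) * (cos \<theta> * cos \<theta> - sin \<theta> * sin \<theta>) + 4 * n * m * (sin \<theta> * cos \<theta>)
    = 2 * (n * cos \<theta> + m * sin \<theta>)^2"
   using nm cs by algebra
  then have "1 / 2 + (n*n - m*m) * (cos \<theta> * cos \<theta> - sin \<theta> * sin \<theta>) / 2 + 2 * n * m * (sin \<theta> * cos \<theta>) = (\<nu> \<bullet> circ \<theta>)^2"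
   unfolding nu circ_def by simp
  ultimately show "(?F has_vector_derivative (\<nu> \<bullet> circ \<theta>)^2) (at \<theta> within {0..2*pi})"
   by (simp add: has_real_derivative_iff_has_vector_derivative has_vector_derivative_at_within)
 qed simp
 then show ?thesis by simp
qed

text \<open>This universal quotient, read off from the sine wave of slope 1 at the origin. Being
  positive for small \<open>r\<close>, it allows a derivative to be recovered from the values on one
  circle.\<close>

definition Kern :: "real \<Rightarrow> point \<Rightarrow> real \<Rightarrow> real" where
 "Kern \<mu> \<nu> r = cweight \<nu> (\<lambda>z. sin (sqrt \<mu> * (\<nu> \<bullet> (z - 0))) / sqrt \<mu>) 0 r"

lemma sqrt_mult_less_1:
 assumes "\<mu> * r^2 < 1" "0 < \<mu>" "0 \<le> r"
 shows "sqrt \<mu> * r < 1"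
proof -
 have "(sqrt \<mu> * r)^2 < 1^2" using assms by (simp add: power_mult_distrib)
 then show ?thesis using abs_square_less_1[of "sqrt \<mu> * r"] by simp
qed

text \<open>The condition \<open>\<mu> * r^2 < 1\<close> keeps the argument of the sine in the range
  where \<open>t * sin t \<ge> t^2 / 2\<close>; the squared cosine that remains integrates to
  \<open>pi\<close>.\<close>

lemma Kern_ge:
 assumes "norm \<nu> = 1" and mu: "\<mu> * r^2 < 1" "0 < \<mu>" and r: "0 \<le> r"
 shows "pi * r^2 / 2 \<le> Kern \<mu> \<nu> r"
proof -
 have i: "(\<lambda>\<theta>. r * ((\<nu> \<bullet> circ \<theta>) * (sin (sqrt \<mu> * (\<nu> \<bullet> (0 + r *\<^sub>R circ \<theta> - 0))) / sqrt \<mu>))) integrable_on {0..2*pi}"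
  by (intro integrable_continuous_real continuous_intros) (use mu in auto)
 have "((\<lambda>\<theta>. r^2 / 2 * (\<nu> \<bullet> circ \<theta>)^2) has_integral r^2 / 2 * pi) {0..2*pi}"
  by (intro has_integral_mult_right integral_circ_inner_sq assms)
 then have "r^2 / 2 * pi \<le> Kern \<mu> \<nu> r"
  unfolding Kern_def cweight_def
 proof (rule has_integral_le[OF _ integrable_integral[OF i]])
  fix \<theta>
  let ?s = "\<nu> \<bullet> circ \<theta>" let ?k = "sqrt \<mu>"
  have s: "\<bar>?s\<bar> \<le> 1" using circ_inner_le[of \<nu> \<theta>] assms by simp
  have k: "?k > 0" using mu by simp
  have "\<bar>?k * r * ?s\<bar> \<le> 1 * 1"
   unfolding abs_mult[of _ ?s] using sqrt_mult_less_1[OF mu r] s k r by (intro mult_mono) auto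
  then have "(?k * r * ?s)^2 / 2 \<le> (?k * r * ?s) * sin (?k * r * ?s)" by (intro sin_ge_half) simp
  then have "(?k * r * ?s)^2 / 2 / ?k^2 \<le> (?k * r * ?s) * sin (?k * r * ?s) / ?k^2"
   using k by (intro divide_right_mono) auto
  moreover have "(?k * r * ?s)^2 / 2 / ?k^2 = r^2 / 2 * ?s^2"
   using k by (simp add: power_mult_distrib)
  moreover have "(?k * r * ?s) * sin (?k * r * ?s) / ?k^2 = r * (?s * (sin (?k * (\<nu> \<bullet> (0 + r *\<^sub>R circ \<theta> - 0))) / ?k))"
   using k by (simp add: power2_eq_square mult.assoc del: real_sqrt_mult_self)
  ultimately show "r^2 / 2 * ?s^2 \<le> r * (?s * (sin (?k * (\<nu> \<bullet> (0 + r *\<^sub>R circ \<theta> - 0))) / ?k))"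
   by (simp only:)
 qed
 then show ?thesis by (simp add: mult.commute)
qed

lemma Kern_pos:
 assumes "norm \<nu> = 1" "\<mu> * r^2 < 1" "0 < \<mu>" "0 < r"
 shows "0 < Kern \<mu> \<nu> r"
proof -
 have "0 < pi * r^2 / 2" using assms by simp
 then show ?thesis using Kern_ge[OF assms(1-3)] assms(4) by linarith
qed

lemma cweight_Kern:
 assumes P: "sol \<mu> V P" and B: "ball p R \<subseteq> V" and nu: "norm \<nu> = 1"
  and mu: "\<mu> * r^2 < 1" "0 < \<mu>" and r: "0 \<le> r" "r < R"
 shows "cweight \<nu> P p r = dd \<nu> P p * Kern \<mu> \<nu> r"
 using cweight_eq[OF P B sol_trig(2)[OF nu mu(2), of 0] _ mu r, of 0 \<nu>] sol_trig(3)[OF nu mu(2), of 0]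
 unfolding Kern_def by simp

lemma grad_bound_aux:
 assumes P: "sol \<mu> V P" and B: "ball p R \<subseteq> V" and nu: "norm \<nu> = 1"
  and mu: "\<mu> * r^2 < 1" "0 < \<mu>" and r: "0 < r" "r < R"
  and I: "integral {0..2*pi} (\<lambda>\<theta>. \<bar>P (p + r *\<^sub>R circ \<theta>)\<bar>) \<le> 2 * pi * M"
 shows "\<bar>dd \<nu> P p\<bar> \<le> 4 / r * M"
proof -
 have cP: "continuous_on {0..2*pi} (\<lambda>\<theta>. P (p + r *\<^sub>R circ \<theta>))"
  using continuous_circle1[OF C2f_continuous(1) B, of P r] P r by (auto simp: sol_def)
 have "norm (cweight \<nu> P p r) \<le> integral {0..2*pi} (\<lambda>\<theta>. r * \<bar>P (p + r *\<^sub>R circ \<theta>)\<bar>)"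
  unfolding cweight_def
 proof (rule integral_norm_bound_integral)
  fix \<theta> :: real
  have "\<bar>\<nu> \<bullet> circ \<theta>\<bar> * \<bar>P (p + r *\<^sub>R circ \<theta>)\<bar> \<le> 1 * \<bar>P (p + r *\<^sub>R circ \<theta>)\<bar>"
   using circ_inner_le[of \<nu> \<theta>] nu by (intro mult_right_mono) auto
  then show "norm (r * ((\<nu> \<bullet> circ \<theta>) * P (p + r *\<^sub>R circ \<theta>))) \<le> r * \<bar>P (p + r *\<^sub>R circ \<theta>)\<bar>"
   using r by (simp add: abs_mult)
 qed (intro integrable_continuous_real continuous_intros cP)+
 also have "\<dots> = r * integral {0..2*pi} (\<lambda>\<theta>. \<bar>P (p + r *\<^sub>R circ \<theta>)\<bar>)" by simp
 also have "\<dots> \<le> r * (2 * pi * M)" using I r by (intro mult_left_mono) auto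
 finally have 1: "\<bar>dd \<nu> P p\<bar> * Kern \<mu> \<nu> r \<le> r * (2 * pi * M)"
  using cweight_Kern[OF P B nu mu _ r(2)] Kern_pos[OF nu mu r(1)] r by (simp add: abs_mult)
 have "\<bar>dd \<nu> P p\<bar> * (pi * r^2 / 2) \<le> \<bar>dd \<nu> P p\<bar> * Kern \<mu> \<nu> r"
  using Kern_ge[OF nu mu] r by (intro mult_left_mono) auto
 with 1 have "\<bar>dd \<nu> P p\<bar> * (pi * r^2 / 2) \<le> r * (2 * pi * M)" by linarith
 then have "(pi * r / 2) * (\<bar>dd \<nu> P p\<bar> * r) \<le> (pi * r / 2) * (4 * M)" by (simp add: power2_eq_square algebra_simps)
 moreover have "0 < pi * r / 2" using r by simp
 ultimately have "\<bar>dd \<nu> P p\<bar> * r \<le> 4 * M" by (simp only: mult_le_cancel_left_pos)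
 then show ?thesis using r by (simp add: field_simps)
qed

lemma gradient_bound:
 assumes P: "sol \<mu> V P" and B: "ball p R \<subseteq> V" and nu: "norm \<nu> = 1"
  and mu: "\<mu> * r^2 < 1" "0 < \<mu>" and r: "0 < r" "r < R"
  and M: "\<And>z. z \<in> cball p r \<Longrightarrow> \<bar>P z\<bar> \<le> M"
 shows "\<bar>dd \<nu> P p\<bar> \<le> 4 / r * M"
proof (rule grad_bound_aux[OF P B nu mu r])
 have cP: "continuous_on {0..2*pi} (\<lambda>\<theta>. P (p + r *\<^sub>R circ \<theta>))"
  using continuous_circle1[OF C2f_continuous(1) B, of P r] P r by (auto simp: sol_def)
 have "integral {0..2*pi} (\<lambda>\<theta>. \<bar>P (p + r *\<^sub>R circ \<theta>)\<bar>) \<le> integral {0..2*pi} (\<lambda>\<theta>. M)"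
  by (intro integral_le integrable_continuous_real continuous_intros cP M) (use r in \<open>auto simp: dist_norm\<close>)
 then show "integral {0..2*pi} (\<lambda>\<theta>. \<bar>P (p + r *\<^sub>R circ \<theta>)\<bar>) \<le> 2 * pi * M" by simp
qed

text \<open>For a nonnegative solution the mean of \<open>\<bar>P\<bar>\<close> is the mean of
  \<open>P\<close>, which the mean value property bounds by the value at the centre; hence the
  gradient is controlled by the value at the same point.\<close>

lemma harnack_gradient:
 assumes P: "sol \<mu> V P" and B: "ball p R \<subseteq> V" and nu: "norm \<nu> = 1"
  and mu: "\<mu> * r^2 < 1" "0 < \<mu>" and r: "0 < r" "r < R"
  and pos: "\<And>z. z \<in> cball p r \<Longrightarrow> 0 \<le> P z"
 shows "\<bar>dd \<nu> P p\<bar> \<le> 4 / r * P p"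
proof (rule grad_bound_aux[OF P B nu mu r])
 have "integral {0..2*pi} (\<lambda>\<theta>. \<bar>P (p + r *\<^sub>R circ \<theta>)\<bar>) = cmean P p r"
  unfolding cmean_def by (intro integral_cong abs_of_nonneg pos) (use r in \<open>auto simp: dist_norm\<close>)
 also have "\<dots> = P p * Jmean \<mu> r" using cmean_eq[OF P B mu _ r(2)] r by simp
 also have "\<dots> \<le> P p * (2 * pi)"
  using Jmean_bounds[OF mu] pos[of p] r by (intro mult_left_mono) auto
 finally show "integral {0..2*pi} (\<lambda>\<theta>. \<bar>P (p + r *\<^sub>R circ \<theta>)\<bar>) \<le> 2 * pi * P p" by (simp add: mult.commute)
qed

definition cconv :: "(real \<Rightarrow> real) \<Rightarrow> real \<Rightarrow> (point \<Rightarrow> real) \<Rightarrow> point \<Rightarrow> real" where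
 "cconv w r P p = integral {0..2*pi} (\<lambda>\<theta>. w \<theta> * P (p + r *\<^sub>R circ \<theta>))"

lemma circ_shift_in:
 assumes "ball p (3 * r) \<subseteq> V" "q \<in> ball p r" "0 < r"
 shows "q + r *\<^sub>R circ \<theta> \<in> V" "ball q (2 * r) \<subseteq> V" "q \<in> V"
proof -
 show b: "ball q (2 * r) \<subseteq> V"
 proof
  fix z assume "z \<in> ball q (2*r)"
  then have "z \<in> ball p (3*r)" using assms(2) dist_triangle[of p z q] by simp
  then show "z \<in> V" using assms(1) by blast
 qed
 have "q + r *\<^sub>R circ \<theta> \<in> ball q (2 * r)" using assms(3) by (simp add: dist_norm)
 with b show "q + r *\<^sub>R circ \<theta> \<in> V" by blast
 show "q \<in> V" using b assms(3) by auto
qed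

lemma cconv_deriv:
 assumes "open V" "\<And>q. q \<in> V \<Longrightarrow> P differentiable at q"
  "continuous_on V (dd ex P)" "continuous_on V (dd ey P)" "continuous_on {0..2*pi} w"
  and B: "ball p (3 * r) \<subseteq> V" "q \<in> ball p r" "0 < r"
 shows "cconv w r P differentiable at q" "i \<in> {ex,ey} \<Longrightarrow> dd i (cconv w r P) q = cconv w r (dd i P) q"
proof -
 define e where "e = r - dist p q"
 have e: "e > 0" using B by (auto simp: e_def)
 have in_V: "q' + r *\<^sub>R circ \<theta> \<in> V" if "q' \<in> ball q e" for q' \<theta>
 proof -
  have "q' \<in> ball p r" using that dist_triangle[of p q' q] by (simp add: e_def)
  then show ?thesis using circ_shift_in(1)[OF B(1) _ B(3)] by blast
 qed
 have D: "((\<lambda>p. integral {0..2*pi} (\<lambda>\<theta>. w \<theta> * P (p + r *\<^sub>R circ \<theta>))) has_derivative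
   (\<lambda>h. integral {0..2*pi} (\<lambda>\<theta>. w \<theta> * (grad P (q + r *\<^sub>R circ \<theta>) \<bullet> h)))) (at q)"
  by (rule has_derivative_integral_param[OF assms(1-4) _ assms(5) in_V e])
    (auto intro!: continuous_intros)
 then show "cconv w r P differentiable at q" 
  unfolding cconv_def[abs_def] by (rule differentiableI)
 show "dd i (cconv w r P) q = cconv w r (dd i P) q" if "i \<in> {ex,ey}"
  using dd_has_derivative[OF D, of i] that by (auto simp: cconv_def[abs_def] grad_def)
qed

lemma cconv_continuous:
 assumes "continuous_on V P" "continuous_on {0..2*pi} w" and B: "ball p (3 * r) \<subseteq> V" "0 < r"
 shows "continuous_on (ball p r) (cconv w r P)"
proof -
 have "continuous_on (ball p r \<times> cbox 0 (2*pi)) (\<lambda>(q, \<theta>). w \<theta> * P (q + r *\<^sub>R circ \<theta>))"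
  unfolding split_beta box_real
 proof (intro continuous_on_mult)
  show "continuous_on (ball p r \<times> {0..2*pi}) (\<lambda>x. w (snd x))"
   by (rule continuous_on_compose2[OF assms(2) continuous_on_snd[OF continuous_on_id]]) auto
  show "continuous_on (ball p r \<times> {0..2*pi}) (\<lambda>x. P (fst x + r *\<^sub>R circ (snd x)))"
  proof (rule continuous_on_compose2[OF assms(1)])
   show "(\<lambda>x. fst x + r *\<^sub>R circ (snd x)) ` (ball p r \<times> {0..2*pi}) \<subseteq> V"
    by (rule image_subsetI, rule circ_shift_in(1)[OF B(1) _ B(2)]) (simp add: mem_Times_iff)
  qed (intro continuous_intros)
 qed
 from integral_continuous_on_param[OF this] show ?thesis
  unfolding cconv_def[abs_def] box_real .
qed

lemma C2f_local:
 assumes "open V" "\<And>p. p \<in> V \<Longrightarrow> \<exists>r>0. C2f (ball p r) P"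
 shows "C2f V P"
proof -
 have "P differentiable at p \<and> dd ex P differentiable at p \<and> dd ey P differentiable at p" if "p \<in> V" for p
  using assms(2)[OF that] by (auto simp: C2f_def)
 moreover have "continuous_on V (dd i (dd j P))" if "i \<in> {ex,ey}" "j \<in> {ex,ey}" for i j
 proof (rule continuous_at_imp_continuous_on, rule ballI)
  fix p assume "p \<in> V"
  then obtain r where r: "r > 0" "C2f (ball p r) P" using assms(2) by blast
  then have "continuous_on (ball p r) (dd i (dd j P))" using that by (auto simp: C2f_def)
  then show "isCont (dd i (dd j P)) p" using r(1) by (simp add: continuous_on_eq_continuous_at)
 qed
 ultimately show ?thesis using assms(1) unfolding C2f_def by blast
qed

text \<open>One radius and one weight serve every solution on \<open>V\<close> and every centre in
  the ball. This uniformity is what allows the formula to be differentiated in the centre and to be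
  applied to derivatives in turn.\<close>

lemma dd_local_cconv:
 assumes P: "sol \<mu> V P" and mu: "0 < \<mu>" and nu: "norm \<nu> = 1" and p: "p \<in> V"
 obtains r w where "0 < r" "ball p (3 * r) \<subseteq> V" "continuous_on {0..2*pi} w"
  "\<And>Q q. sol \<mu> V Q \<Longrightarrow> q \<in> ball p r \<Longrightarrow> dd \<nu> Q q = cconv w r Q q"
proof -
 have "open V" using P by (simp add: sol_def C2f_def)
 then obtain e where e: "e > 0" "ball p e \<subseteq> V" using p open_contains_ball by blast
 define r where "r = min (e / 3) (1 / (2 * sqrt \<mu>))"
 have r: "0 < r" using e mu by (simp add: r_def)
 have B: "ball p (3 * r) \<subseteq> V" using e by (auto simp: r_def)
 have "r^2 \<le> (1 / (2 * sqrt \<mu>))^2" using r by (intro power_mono) (auto simp: r_def)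
 then have "\<mu> * r^2 \<le> \<mu> * (1 / (2 * sqrt \<mu>))^2" using mu by (intro mult_left_mono) auto
 also have "\<dots> < 1" using mu by (simp add: power_divide power_mult_distrib)
 finally have mr: "\<mu> * r^2 < 1" .
 define w where "w = (\<lambda>\<theta>. r / Kern \<mu> \<nu> r * (\<nu> \<bullet> circ \<theta>))"
 have K: "Kern \<mu> \<nu> r > 0" by (rule Kern_pos[OF nu mr mu r])
 show ?thesis
 proof (rule that[OF r B, of w])
  show "continuous_on {0..2*pi} w" unfolding w_def by (intro continuous_intros)
  fix Q q assume Q: "sol \<mu> V Q" and q: "q \<in> ball p r"
  have "cweight \<nu> Q q r = dd \<nu> Q q * Kern \<mu> \<nu> r"
   by (rule cweight_Kern[OF Q circ_shift_in(2)[OF B q r] nu mr mu]) (use r in auto)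
  then have "dd \<nu> Q q = 1 / Kern \<mu> \<nu> r * cweight \<nu> Q q r" using K by simp
  also have "\<dots> = cconv w r Q q"
   unfolding cweight_def cconv_def w_def integral_mult_right[symmetric]
   by (intro integral_cong) simp
  finally show "dd \<nu> Q q = cconv w r Q q" .
 qed
qed

text \<open>By the circle formula, derivatives of solutions are convolutions with a fixed weight on a small
 circle.  Solutions are therefore smooth, and derivatives commute, without any elliptic regularity theory.\<close>

lemma sol_dd:
 assumes P: "sol \<mu> V P" and mu: "0 < \<mu>" and nu: "norm \<nu> = 1"
 shows "sol \<mu> V (dd \<nu> P)"
proof -
 have C: "C2f V P" using P by (simp add: sol_def)
 have V: "open V" using C by (simp add: C2f_def)
 have *: "\<exists>r>0. sol \<mu> (ball p r) (dd \<nu> P)" if p: "p \<in> V" for p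
 proof -
  obtain r w where r: "0 < r" and B: "ball p (3 * r) \<subseteq> V" and w: "continuous_on {0..2*pi} w"
   and eq: "\<And>Q q. sol \<mu> V Q \<Longrightarrow> q \<in> ball p r \<Longrightarrow> dd \<nu> Q q = cconv w r Q q"
   by (rule dd_local_cconv[OF P mu nu p], rule that)
  have d1: "cconv w r P differentiable at q" "i \<in> {ex,ey} \<Longrightarrow> dd i (cconv w r P) q = cconv w r (dd i P) q"
   if "q \<in> ball p r" for q i
   using cconv_deriv[OF V C2f_D(1)[OF C] C2f_continuous(2)[OF C] C2f_continuous(2)[OF C] w B that r] by auto
  have d2: "cconv w r (dd i P) differentiable at q" 
   "j \<in> {ex,ey} \<Longrightarrow> dd j (cconv w r (dd i P)) q = cconv w r (dd j (dd i P)) q"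
   if "q \<in> ball p r" "i \<in> {ex,ey}" for q i j
   using cconv_deriv[OF V C2f_D(2)[OF C _ that(2)] C2f_D(3)[OF C p _ that(2)] C2f_D(3)[OF C p _ that(2)] w B that(1) r] by auto
  have d3: "dd j (dd i (cconv w r P)) q = cconv w r (dd j (dd i P)) q"
   if "q \<in> ball p r" "i \<in> {ex,ey}" "j \<in> {ex,ey}" for q i j
   using dd_cong[OF open_ball that(1) d1(2)[OF _ that(2)]] d2(2)[OF that] by simp
  have "dd i (cconv w r P) differentiable at q" if "q \<in> ball p r" "i \<in> {ex,ey}" for q i
   by (rule differentiable_cong_open[OF open_ball that(1) d1(2)[OF _ that(2), symmetric] d2(1)[OF that]])
  moreover have "continuous_on (ball p r) (dd j (dd i (cconv w r P)))" if "i \<in> {ex,ey}" "j \<in> {ex,ey}" for i j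
   using cconv_continuous[OF C2f_D(3)[OF C p that(2,1)] w B r] 
   by (subst continuous_on_cong[OF refl d3[OF _ that]])
  ultimately have "C2f (ball p r) (cconv w r P)" unfolding C2f_def using d1(1) by blast
  moreover have "dd ex (dd ex (cconv w r P)) q + dd ey (dd ey (cconv w r P)) q = - \<mu> * cconv w r P q"
   if q: "q \<in> ball p r" for q
  proof -
   have i: "(\<lambda>\<theta>. w \<theta> * f (q + r *\<^sub>R circ \<theta>)) integrable_on {0..2*pi}" if "continuous_on V f" for f
    by (intro integrable_continuous_real continuous_intros w continuous_on_compose2[OF that] image_subsetI circ_shift_in(1)[OF B q r])
   have "dd ex (dd ex (cconv w r P)) q + dd ey (dd ey (cconv w r P)) q 
    = integral {0..2*pi} (\<lambda>\<theta>. w \<theta> * dd ex (dd ex P) (q + r *\<^sub>R circ \<theta>) + w \<theta> * dd ey (dd ey P) (q + r *\<^sub>R circ \<theta>))"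
    by (subst integral_add) (use q C2f_D(3)[OF C p] in \<open>auto simp: d3 cconv_def intro!: i\<close>)
   also have "\<dots> = integral {0..2*pi} (\<lambda>\<theta>. - \<mu> * (w \<theta> * P (q + r *\<^sub>R circ \<theta>)))"
   proof (rule integral_cong)
    fix \<theta>
    have "dd ex (dd ex P) (q + r *\<^sub>R circ \<theta>) + dd ey (dd ey P) (q + r *\<^sub>R circ \<theta>) = - \<mu> * P (q + r *\<^sub>R circ \<theta>)"
     using P circ_shift_in(1)[OF B q r] by (simp add: sol_def)
    then show "w \<theta> * dd ex (dd ex P) (q + r *\<^sub>R circ \<theta>) + w \<theta> * dd ey (dd ey P) (q + r *\<^sub>R circ \<theta>)
      = - \<mu> * (w \<theta> * P (q + r *\<^sub>R circ \<theta>))"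
     unfolding distrib_left[symmetric] by simp
   qed
   also have "\<dots> = - \<mu> * cconv w r P q" unfolding cconv_def by (rule integral_mult_right)
   finally show ?thesis .
  qed
  ultimately have "sol \<mu> (ball p r) (cconv w r P)" by (simp add: sol_def)
  then have "sol \<mu> (ball p r) (dd \<nu> P)" by (rule sol_cong) (use eq[OF P] in simp)
  then show ?thesis using r by blast
 qed
 have "C2f V (dd \<nu> P)" by (rule C2f_local[OF V]) (use * in \<open>unfold sol_def, blast\<close>)
 moreover have "dd ex (dd ex (dd \<nu> P)) p + dd ey (dd ey (dd \<nu> P)) p = - \<mu> * dd \<nu> P p" if "p \<in> V" for p
  using *[OF that] by (auto simp: sol_def)
 ultimately show ?thesis by (simp add: sol_def)
qed

text \<open>Locally \<open>dd \<nu>\<close> is a circular convolution with a fixed weight, so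
  \<open>dd i\<close> passes under the integral; the same formula for the solution
  \<open>dd i P\<close> then reads the result as \<open>dd \<nu> (dd i P)\<close>.\<close>

lemma dd_commute:
 assumes P: "sol \<mu> V P" and mu: "0 < \<mu>" and nu: "norm \<nu> = 1" and p: "p \<in> V" and i: "i \<in> {ex,ey}"
 shows "dd i (dd \<nu> P) p = dd \<nu> (dd i P) p"
proof -
 have C: "C2f V P" using P by (simp add: sol_def)
 have V: "open V" using C by (simp add: C2f_def)
 obtain r w where r: "0 < r" and B: "ball p (3 * r) \<subseteq> V" and w: "continuous_on {0..2*pi} w"
  and eq: "\<And>Q q. sol \<mu> V Q \<Longrightarrow> q \<in> ball p r \<Longrightarrow> dd \<nu> Q q = cconv w r Q q"
  by (rule dd_local_cconv[OF P mu nu p], rule that)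
 have pb: "p \<in> ball p r" using r by simp
 have "dd i (dd \<nu> P) p = dd i (cconv w r P) p"
  by (rule dd_cong[OF open_ball pb eq[OF P]])
 also have "\<dots> = cconv w r (dd i P) p"
  using cconv_deriv(2)[OF V C2f_D(1)[OF C] C2f_continuous(2)[OF C] C2f_continuous(2)[OF C] w B pb r] i by auto
 also have "\<dots> = dd \<nu> (dd i P) p"
  by (rule eq[OF _ pb, symmetric]) (rule sol_dd[OF P mu], use i in \<open>auto simp: norm_Pair\<close>)
 finally show ?thesis .
qed

section \<open>Pointwise second-order calculus\<close>

text \<open>The second-order jet of \<open>\<phi>\<close> at 0. As a relation it is propagated by
  rules through sums, products and compositions, and the barrier computations never evaluate an
  iterated \<open>deriv\<close>.\<close>

definition d2 :: "(real \<Rightarrow> real) \<Rightarrow> real \<Rightarrow> real \<Rightarrow> bool" where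
 "d2 \<phi> a l \<longleftrightarrow> (\<exists>\<phi>'. (\<forall>\<^sub>F t in nhds 0. (\<phi> has_real_derivative \<phi>' t) (at t)) \<and> \<phi>' 0 = a
   \<and> (\<phi>' has_real_derivative l) (at 0))"

lemma d2_DERIV: "d2 \<phi> a l \<Longrightarrow> (\<phi> has_real_derivative a) (at 0)"
 unfolding d2_def by (auto dest: eventually_nhds_x_imp_x)

lemma d2_affine: "d2 (\<lambda>t. c + b * t) b 0"
 unfolding d2_def by (intro exI[of _ "\<lambda>_. b"]) (auto intro!: derivative_eq_intros always_eventually)

lemma d2_cong:
 assumes "d2 \<phi> a l" "\<forall>\<^sub>F t in nhds 0. \<phi> t = \<psi> t"
 shows "d2 \<psi> a l"
proof -
 obtain f where f: "\<forall>\<^sub>F t in nhds 0. (\<phi> has_real_derivative f t) (at t)" "f 0 = a" "(f has_real_derivative l) (at 0)"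
  using assms(1) by (auto simp: d2_def)
 have "\<forall>\<^sub>F t in nhds 0. \<forall>\<^sub>F s in nhds t. \<phi> s = \<psi> s"
  using assms(2) by (simp add: eventually_eventually)
 with f(1) have "\<forall>\<^sub>F t in nhds 0. (\<psi> has_real_derivative f t) (at t)"
  by eventually_elim (metis DERIV_cong_ev)
 with f show ?thesis unfolding d2_def by blast
qed

lemma d2_lin:
 assumes "d2 \<phi> a l" "d2 \<psi> b m"
 shows "d2 (\<lambda>t. c * \<phi> t + d * \<psi> t) (c * a + d * b) (c * l + d * m)"
proof -
 obtain f g where f: "\<forall>\<^sub>F t in nhds 0. (\<phi> has_real_derivative f t) (at t)" "f 0 = a" "(f has_real_derivative l) (at 0)"
  and g: "\<forall>\<^sub>F t in nhds 0. (\<psi> has_real_derivative g t) (at t)" "g 0 = b" "(g has_real_derivative m) (at 0)"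
  using assms by (auto simp: d2_def)
 have "\<forall>\<^sub>F t in nhds 0. ((\<lambda>t. c * \<phi> t + d * \<psi> t) has_real_derivative c * f t + d * g t) (at t)"
  using f(1) g(1) by eventually_elim (auto intro!: derivative_eq_intros)
 moreover have "((\<lambda>t. c * f t + d * g t) has_real_derivative c * l + d * m) (at 0)"
  using f(3) g(3) by (auto intro!: derivative_eq_intros)
 ultimately show ?thesis unfolding d2_def using f(2) g(2) by (intro exI[of _ "\<lambda>t. c * f t + d * g t"]) auto
qed

lemma d2_mult:
 assumes "d2 \<phi> a l" "d2 \<psi> b m"
 shows "d2 (\<lambda>t. \<phi> t * \<psi> t) (a * \<psi> 0 + \<phi> 0 * b) (l * \<psi> 0 + 2 * a * b + \<phi> 0 * m)"
proof -
 obtain f g where f: "\<forall>\<^sub>F t in nhds 0. (\<phi> has_real_derivative f t) (at t)" "f 0 = a" "(f has_real_derivative l) (at 0)"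
  and g: "\<forall>\<^sub>F t in nhds 0. (\<psi> has_real_derivative g t) (at t)" "g 0 = b" "(g has_real_derivative m) (at 0)"
  using assms by (auto simp: d2_def)
 have "\<forall>\<^sub>F t in nhds 0. ((\<lambda>t. \<phi> t * \<psi> t) has_real_derivative f t * \<psi> t + \<phi> t * g t) (at t)"
  using f(1) g(1) by eventually_elim (auto intro!: derivative_eq_intros)
 moreover have "((\<lambda>t. f t * \<psi> t + \<phi> t * g t) has_real_derivative l * \<psi> 0 + 2 * a * b + \<phi> 0 * m) (at 0)"
  using f(2,3) g(2,3) d2_DERIV[OF assms(1)] d2_DERIV[OF assms(2)]
  by (auto intro!: derivative_eq_intros simp: algebra_simps)
 ultimately show ?thesis unfolding d2_def using f(2) g(2)
  by (intro exI[of _ "\<lambda>t. f t * \<psi> t + \<phi> t * g t"]) auto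
qed

lemma d2_compose:
 assumes "d2 \<phi> a l" and I: "open I" "\<phi> 0 \<in> I" "\<And>x. x \<in> I \<Longrightarrow> (F has_real_derivative F' x) (at x)"
  "(F' has_real_derivative F2) (at (\<phi> 0))"
 shows "d2 (\<lambda>t. F (\<phi> t)) (F' (\<phi> 0) * a) (F2 * a^2 + F' (\<phi> 0) * l)"
proof -
 obtain f where f: "\<forall>\<^sub>F t in nhds 0. (\<phi> has_real_derivative f t) (at t)" "f 0 = a" "(f has_real_derivative l) (at 0)"
  using assms by (auto simp: d2_def)
 have "isCont \<phi> 0" using d2_DERIV[OF assms(1)] DERIV_isCont by blast
 then have "(\<phi> \<longlongrightarrow> \<phi> 0) (nhds 0)" using isCont_def tendsto_at_iff_tendsto_nhds by blast
 then have "\<forall>\<^sub>F t in nhds 0. \<phi> t \<in> I" using I topological_tendstoD by blast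
 with f(1) have "\<forall>\<^sub>F t in nhds 0. ((\<lambda>t. F (\<phi> t)) has_real_derivative F' (\<phi> t) * f t) (at t)"
  by eventually_elim (rule DERIV_chain2[OF I(3)])
 moreover have "((\<lambda>t. F' (\<phi> t) * f t) has_real_derivative F2 * a^2 + F' (\<phi> 0) * l) (at 0)"
  using DERIV_mult[OF DERIV_chain2[OF I(4) d2_DERIV[OF assms(1)]] f(3)] f(2)
  by (simp add: power2_eq_square algebra_simps)
 ultimately show ?thesis unfolding d2_def using f(2)
  by (intro exI[of _ "\<lambda>t. F' (\<phi> t) * f t"]) auto
qed

lemma d2_scale:
 assumes "d2 \<phi> a l"
 shows "d2 (\<lambda>t. \<phi> (c * t)) (c * a) (c^2 * l)"
proof -
 obtain f where f: "\<forall>\<^sub>F t in nhds 0. (\<phi> has_real_derivative f t) (at t)" "f 0 = a" "(f has_real_derivative l) (at 0)"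
  using assms by (auto simp: d2_def)
 have "((\<lambda>t. c * t) \<longlongrightarrow> c * 0) (nhds (0::real))" by (intro tendsto_intros filterlim_ident)
 then have "filterlim (\<lambda>t. c * t) (nhds 0) (nhds 0)" by simp
 from eventually_compose_filterlim[OF f(1) this]
 have "\<forall>\<^sub>F t in nhds 0. ((\<lambda>t. \<phi> (c * t)) has_real_derivative c * f (c * t)) (at t)"
 proof eventually_elim
  fix t assume "(\<phi> has_real_derivative f (c * t)) (at (c * t))"
  from DERIV_chain2[of \<phi> "f (c * t)" "\<lambda>t. c * t" t c UNIV, OF this DERIV_cmult_Id] show "((\<lambda>t. \<phi> (c * t)) has_real_derivative c * f (c * t)) (at t)"
   by (simp add: mult.commute)
 qed
 moreover have "((\<lambda>t. c * f (c * t)) has_real_derivative c^2 * l) (at 0)"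
  using DERIV_cmult[OF DERIV_chain2[of f l "\<lambda>t. c * t" 0 c UNIV, OF _ DERIV_cmult_Id], of c] f(3)
  by (simp add: power2_eq_square mult_ac)
 ultimately show ?thesis unfolding d2_def using f(2) by (intro exI[of _ "\<lambda>t. c * f (c * t)"]) auto
qed

lemma d2_max:
 assumes "d2 \<phi> a l" "\<forall>\<^sub>F t in nhds 0. \<phi> t \<le> \<phi> 0"
 shows "a = 0 \<and> l \<le> 0"
proof -
 obtain f where f: "\<forall>\<^sub>F t in nhds 0. (\<phi> has_real_derivative f t) (at t)" "f 0 = a" "(f has_real_derivative l) (at 0)"
  using assms by (auto simp: d2_def)
 obtain e where e: "e > 0" "\<And>t. \<bar>t\<bar> < e \<Longrightarrow> (\<phi> has_real_derivative f t) (at t) \<and> \<phi> t \<le> \<phi> 0"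
  using eventually_conj[OF f(1) assms(2)] by (auto simp: eventually_nhds_metric dist_real_def)
 have a: "a = 0"
  using DERIV_local_max[OF d2_DERIV[OF assms(1)] e(1)] e(2) by simp
 have "l \<le> 0"
 proof (rule ccontr)
  assume "\<not> l \<le> 0"
  then obtain d where d: "d > 0" "\<And>h. h > 0 \<Longrightarrow> h < d \<Longrightarrow> f 0 < f (0 + h)"
   using DERIV_pos_inc_right[OF f(3)] by auto
  define t where "t = min e d / 2"
  have t: "0 < t" "t < e" "t < d" using e d by (auto simp: t_def)
  have "\<exists>z. 0 < z \<and> z < t \<and> \<phi> t - \<phi> 0 = (t - 0) * f z"
   by (rule MVT2) (use t e(2) in auto)
  then obtain z where z: "0 < z" "z < t" "\<phi> t - \<phi> 0 = t * f z" by auto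
  then have "f z > 0" using d(2)[of z] f(2) a t by auto
  then have "\<phi> t > \<phi> 0" using z t by (smt (verit) mult_pos_pos)
  then show False using e(2)[of t] t by auto
 qed
 with a show ?thesis by simp
qed

text \<open>Barriers are only ever differentiated along the two axes at the point of contact, so no joint
 differentiability is asked of them.\<close>

definition lap2 :: "(point \<Rightarrow> real) \<Rightarrow> point \<Rightarrow> real \<Rightarrow> real \<Rightarrow> real \<Rightarrow> bool" where
 "lap2 f p a b l \<longleftrightarrow> (\<exists>m n. d2 (\<lambda>t. f (p + t *\<^sub>R ex)) a m \<and> d2 (\<lambda>t. f (p + t *\<^sub>R ey)) b n \<and> l = m + n)"

lemma eventually_line:
 fixes p e :: "point"
 assumes "\<forall>\<^sub>F z in nhds p. Q z"
 shows "\<forall>\<^sub>F t in nhds (0::real). Q (p + t *\<^sub>R e)"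
proof -
 have "((\<lambda>t. p + t *\<^sub>R e) \<longlongrightarrow> p + 0 *\<^sub>R e) (nhds 0)"
  by (intro tendsto_intros filterlim_ident)
 then have "filterlim (\<lambda>t. p + t *\<^sub>R e) (nhds p) (nhds 0)" by simp
 from eventually_compose_filterlim[OF assms this] show ?thesis .
qed

lemma lap2_max:
 assumes "lap2 f p a b l" "\<forall>\<^sub>F z in nhds p. f z \<le> f p"
 shows "a = 0" "b = 0" "l \<le> 0"
proof -
 obtain m n where mn: "d2 (\<lambda>t. f (p + t *\<^sub>R ex)) a m" "d2 (\<lambda>t. f (p + t *\<^sub>R ey)) b n" "l = m + n"
  using assms(1) by (auto simp: lap2_def)
 have "a = 0 \<and> m \<le> 0" by (rule d2_max[OF mn(1)]) (use eventually_line[OF assms(2), of ex] in \<open>simp add: zero_prod_def[symmetric]\<close>)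
 moreover have "b = 0 \<and> n \<le> 0" by (rule d2_max[OF mn(2)]) (use eventually_line[OF assms(2), of ey] in \<open>simp add: zero_prod_def[symmetric]\<close>)
 ultimately show "a = 0" "b = 0" "l \<le> 0" using mn(3) by auto
qed

lemma lap2_cong:
 assumes "lap2 f p a b l" "\<forall>\<^sub>F z in nhds p. f z = g z"
 shows "lap2 g p a b l"
 using assms(1) d2_cong[OF _ eventually_line[OF assms(2)]] unfolding lap2_def by blast

lemma lap2_eq: "lap2 f p a b l \<Longrightarrow> a = a' \<Longrightarrow> b = b' \<Longrightarrow> l = l' \<Longrightarrow> lap2 f p a' b' l'"
 by simp

lemma lap2_affine: "lap2 (\<lambda>z. c + n \<bullet> z) p (fst n) (snd n) 0"
proof -
 have "d2 (\<lambda>t. c + n \<bullet> (p + t *\<^sub>R e)) (n \<bullet> e) 0" for e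
  using d2_affine[of "c + n \<bullet> p" "n \<bullet> e"] by (simp add: inner_add_right add.assoc mult.commute)
 from this[of ex] this[of ey] show ?thesis
  by (cases n) (auto simp: lap2_def)
qed

lemma lap2_const: "lap2 (\<lambda>z. c) p 0 0 0"
 using lap2_affine[of c 0 p] by simp

lemma lap2_lin:
 assumes "lap2 f p a b l" "lap2 g p a' b' l'"
 shows "lap2 (\<lambda>z. c * f z + d * g z) p (c * a + d * a') (c * b + d * b') (c * l + d * l')"
proof -
 obtain m n where 1: "d2 (\<lambda>t. f (p + t *\<^sub>R ex)) a m" "d2 (\<lambda>t. f (p + t *\<^sub>R ey)) b n" "l = m + n"
  using assms(1) by (auto simp: lap2_def)
 obtain m' n' where 2: "d2 (\<lambda>t. g (p + t *\<^sub>R ex)) a' m'" "d2 (\<lambda>t. g (p + t *\<^sub>R ey)) b' n'" "l' = m' + n'"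
  using assms(2) by (auto simp: lap2_def)
 show ?thesis unfolding lap2_def
  using d2_lin[OF 1(1) 2(1), of c d] d2_lin[OF 1(2) 2(2), of c d] 1(3) 2(3)
  by (intro exI conjI) (assumption | simp add: algebra_simps)+
qed

lemma lap2_mult:
 assumes "lap2 f p a b l" "lap2 g p a' b' l'"
 shows "lap2 (\<lambda>z. f z * g z) p (a * g p + f p * a') (b * g p + f p * b') (l * g p + 2 * (a * a' + b * b') + f p * l')"
proof -
 obtain m n where 1: "d2 (\<lambda>t. f (p + t *\<^sub>R ex)) a m" "d2 (\<lambda>t. f (p + t *\<^sub>R ey)) b n" "l = m + n"
  using assms(1) by (auto simp: lap2_def)
 obtain m' n' where 2: "d2 (\<lambda>t. g (p + t *\<^sub>R ex)) a' m'" "d2 (\<lambda>t. g (p + t *\<^sub>R ey)) b' n'" "l' = m' + n'"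
  using assms(2) by (auto simp: lap2_def)
 show ?thesis unfolding lap2_def
  using d2_mult[OF 1(1) 2(1)] d2_mult[OF 1(2) 2(2)] 1(3) 2(3)
  by (intro exI[of _ "m * g p + 2 * a * a' + f p * m'"] exI[of _ "n * g p + 2 * b * b' + f p * n'"])
   (simp add: algebra_simps zero_prod_def[symmetric])
qed

lemma lap2_compose:
 assumes "lap2 f p a b l" and "open I" "f p \<in> I" "\<And>x. x \<in> I \<Longrightarrow> (F has_real_derivative F' x) (at x)"
  "(F' has_real_derivative F2) (at (f p))"
 shows "lap2 (\<lambda>z. F (f z)) p (F' (f p) * a) (F' (f p) * b) (F2 * (a^2 + b^2) + F' (f p) * l)"
proof -
 obtain m n where 1: "d2 (\<lambda>t. f (p + t *\<^sub>R ex)) a m" "d2 (\<lambda>t. f (p + t *\<^sub>R ey)) b n" "l = m + n"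
  using assms(1) by (auto simp: lap2_def)
 have "d2 (\<lambda>t. F (f (p + t *\<^sub>R ex))) (F' (f p) * a) (F2 * a^2 + F' (f p) * m)"
  "d2 (\<lambda>t. F (f (p + t *\<^sub>R ey))) (F' (f p) * b) (F2 * b^2 + F' (f p) * n)"
  using d2_compose[OF 1(1), of I F F' F2] d2_compose[OF 1(2), of I F F' F2] assms(2-5) by (auto simp: zero_prod_def[symmetric])
 then show ?thesis unfolding lap2_def
  using 1(3) by (intro exI conjI) (assumption | simp add: algebra_simps)+
qed

lemma lap2_exp:
 assumes "lap2 f p a b l"
 shows "lap2 (\<lambda>z. exp (f z)) p (exp (f p) * a) (exp (f p) * b) (exp (f p) * (a^2 + b^2 + l))"
 using lap2_compose[OF assms, of UNIV exp exp "exp (f p)"] by (simp add: distrib_left)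

lemma lap2_ln:
 assumes "lap2 f p a b l" "f p > 0"
 shows "lap2 (\<lambda>z. ln (f z)) p (a / f p) (b / f p) (l / f p - (a^2 + b^2) / (f p)^2)"
proof -
 have "(inverse has_real_derivative - (inverse (f p))\<^sup>2) (at (f p))"
  using DERIV_inverse[of "f p" UNIV] assms(2) by (simp add: power2_eq_square)
 from lap2_compose[OF assms(1), of "{0<..}" ln inverse, OF _ _ _ this]
 have "lap2 (\<lambda>z. ln (f z)) p (inverse (f p) * a) (inverse (f p) * b) (- (inverse (f p))\<^sup>2 * (a\<^sup>2 + b\<^sup>2) + inverse (f p) * l)"
  using assms(2) DERIV_ln by auto
 then show ?thesis by (rule lap2_eq) (use assms(2) in \<open>auto simp: field_simps power2_eq_square\<close>)
qed

lemma lap2_inverse: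
 assumes "lap2 f p a b l" "f p \<noteq> 0"
 shows "lap2 (\<lambda>z. 1 / f z) p (- a / (f p)^2) (- b / (f p)^2) (2 * (a^2 + b^2) / (f p)^3 - l / (f p)^2)"
proof -
 have "lap2 (\<lambda>z. (\<lambda>x. 1 / x) (f z)) p ((\<lambda>x. - 1 / x^2) (f p) * a) ((\<lambda>x. - 1 / x^2) (f p) * b)
   ((2 / (f p)^3) * (a^2 + b^2) + (\<lambda>x. - 1 / x^2) (f p) * l)"
 proof (rule lap2_compose[OF assms(1), of "- {0}"])
  show "((\<lambda>x. 1 / x) has_real_derivative - 1 / x^2) (at x)" if "x \<in> - {0}" for x :: real
   using that by (auto intro!: derivative_eq_intros simp: power2_eq_square)
  show "((\<lambda>x. - 1 / x^2) has_real_derivative 2 / (f p)^3) (at (f p))"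
   using assms(2) by (auto intro!: derivative_eq_intros simp: power2_eq_square power3_eq_cube field_simps)
 qed (use assms(2) in auto)
 then show ?thesis by (rule lap2_eq) auto
qed

lemma d2_dd:
 assumes C: "C2f V P" and p: "p \<in> V" and i: "i \<in> {ex,ey}"
 shows "d2 (\<lambda>t. P (p + t *\<^sub>R i)) (dd i P p) (dd i (dd i P) p)"
 unfolding d2_def
proof (intro exI[of _ "\<lambda>t. dd i P (p + t *\<^sub>R i)"] conjI)
 have "\<forall>\<^sub>F z in nhds p. z \<in> V" using C p by (auto simp: C2f_def eventually_nhds)
 from eventually_line[OF this, of i]
 show "\<forall>\<^sub>F t in nhds 0. ((\<lambda>t. P (p + t *\<^sub>R i)) has_real_derivative dd i P (p + t *\<^sub>R i)) (at t)"
  by eventually_elim (rule has_real_derivative_dd[OF C2f_D(1)[OF C]])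
 show "((\<lambda>t. dd i P (p + t *\<^sub>R i)) has_real_derivative dd i (dd i P) p) (at 0)"
  using has_real_derivative_dd[of "dd i P" p 0 i] C2f_D(2)[OF C p i] by simp
qed simp

lemma lap2_C2f: "C2f V P \<Longrightarrow> p \<in> V \<Longrightarrow> lap2 P p (dd ex P p) (dd ey P p) (dd ex (dd ex P) p + dd ey (dd ey P) p)"
 using d2_dd[of V P p ex] d2_dd[of V P p ey] by (auto simp: lap2_def)

lemma lap2_sol:
 assumes "sol \<mu> V P" "p \<in> V"
 shows "lap2 P p (dd ex P p) (dd ey P p) (- \<mu> * P p)"
 using lap2_C2f[of V P p] assms by (simp add: sol_def)

lemma lap2_sqdist: "lap2 (\<lambda>z. (dist z c)^2) p (2 * (fst p - fst c)) (2 * (snd p - snd c)) 4"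
proof -
 have x: "lap2 (\<lambda>z. - fst c + ex \<bullet> z) p 1 0 0" and y: "lap2 (\<lambda>z. - snd c + ey \<bullet> z) p 0 1 0"
  using lap2_affine[of "- fst c" ex p] lap2_affine[of "- snd c" ey p] by auto
 have "lap2 (\<lambda>z. 1 * ((- fst c + ex \<bullet> z) * (- fst c + ex \<bullet> z)) + 1 * ((- snd c + ey \<bullet> z) * (- snd c + ey \<bullet> z))) p
   (2 * (fst p - fst c)) (2 * (snd p - snd c)) 4"
  by (rule lap2_eq[OF lap2_lin[OF lap2_mult[OF x x] lap2_mult[OF y y]]]) (cases p, auto)+
 moreover have "(\<lambda>z. 1 * ((- fst c + ex \<bullet> z) * (- fst c + ex \<bullet> z)) + 1 * ((- snd c + ey \<bullet> z) * (- snd c + ey \<bullet> z)))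
   = (\<lambda>z. (dist z c)^2)"
 proof
  fix z
  have "(dist z c)^2 = (fst z - fst c)^2 + (snd z - snd c)^2"
   by (simp add: dist_prod_def dist_real_def)
  then show "1 * ((- fst c + ex \<bullet> z) * (- fst c + ex \<bullet> z)) + 1 * ((- snd c + ey \<bullet> z) * (- snd c + ey \<bullet> z)) = (dist z c)^2"
   by (cases z) (simp add: power2_eq_square)
 qed
 ultimately show ?thesis by simp
qed

section \<open>Log-concavity of the first eigenfunction\<close>

definition ground :: "real \<Rightarrow> point set \<Rightarrow> (point \<Rightarrow> real) \<Rightarrow> bool" where
 "ground \<mu> K u \<longleftrightarrow> 0 < \<mu> \<and> compact K \<and> convex K \<and> continuous_on K u \<and> (\<forall>p\<in>frontier K. u p = 0)
   \<and> (\<forall>p\<in>interior K. 0 < u p) \<and> sol \<mu> (interior K) u \<and> (\<forall>p\<in>K. u p \<le> 1) \<and> (\<exists>p\<in>K. u p = 1)"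

lemma ground_nonneg: "ground \<mu> K u \<Longrightarrow> p \<in> K \<Longrightarrow> 0 \<le> u p"
 unfolding ground_def
 by (metis DiffI closure_closed compact_imp_closed frontier_def less_eq_real_def)

lemma ground_pos_iff:
 assumes "ground \<mu> K u" "p \<in> K"
 shows "0 < u p \<longleftrightarrow> p \<in> interior K"
proof
 assume "0 < u p"
 show "p \<in> interior K"
 proof (rule ccontr)
  assume "p \<notin> interior K"
  then have "p \<in> frontier K" using assms(2) closure_subset[of K] by (auto simp: frontier_def)
  then show False using assms \<open>0 < u p\<close> by (auto simp: ground_def)
 qed
qed (use assms in \<open>auto simp: ground_def\<close>)

definition mid :: "point \<times> point \<Rightarrow> point" where
 "mid x = (1/2) *\<^sub>R (fst x + snd x)"

lemma continuous_mid: "continuous_on A mid"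
 unfolding mid_def by (intro continuous_intros)

lemma mid_in:
 assumes "convex V" "fst x \<in> V" "snd x \<in> V" shows "mid x \<in> V"
proof -
 have "(1/2) *\<^sub>R fst x + (1/2) *\<^sub>R snd x \<in> V" using assms by (intro convexD) auto
 then show ?thesis by (simp add: mid_def scaleR_add_right)
qed

text \<open>Comparison with \<open>u (mid x)\<close> is midpoint concavity of \<open>ln u\<close> in
  exponentiated form, which remains meaningful and continuous where \<open>u\<close>
  vanishes.\<close>

definition gmean :: "(point \<Rightarrow> real) \<Rightarrow> point \<times> point \<Rightarrow> real" where
 "gmean u x = sqrt (u (fst x) * u (snd x))"

text \<open>At a contact pair half the sum of \<open>ln u\<close> at the two points, minus
  \<open>ln Y\<close> at the midpoint, is maximal. Moving one point alone makes the three
  logarithmic gradients equal; moving both in parallel compares the Laplacians. Since the Laplacian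
  of \<open>ln u\<close> is \<open>- \<mu>\<close> minus the squared gradient, the gradient terms
  cancel.\<close>

lemma touch_pair:
 assumes u: "sol \<mu> U u" "\<And>z. z \<in> U \<Longrightarrow> 0 < u z" and pq: "p \<in> U" "q \<in> U"
  and Y: "lap2 Y (mid (p, q)) a b l"
  and eq: "gmean u (p, q) = Y (mid (p, q))"
  and le: "\<forall>\<^sub>F x in nhds (p, q). gmean u x \<le> Y (mid x)"
 shows "- l \<le> \<mu> * Y (mid (p, q))"
proof -
 let ?m = "mid (p, q)" let ?v = "\<lambda>z. ln (u z)" let ?y = "\<lambda>z. ln (Y z)"
 have U: "open U" using u by (simp add: sol_def C2f_def)
 have pos: "0 < u p" "0 < u q" using u pq by auto
 have Ypos: "0 < Y ?m" using eq pos by (simp add: gmean_def flip: eq)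
 obtain a1 b1 a2 b2 where lp: "lap2 u p a1 b1 (- \<mu> * u p)" and lq: "lap2 u q a2 b2 (- \<mu> * u q)"
  using lap2_sol[OF u(1)] pq by blast
 have vp: "lap2 ?v p (a1 / u p) (b1 / u p) (- \<mu> * u p / u p - (a1^2 + b1^2) / (u p)^2)"
  by (rule lap2_ln[OF lp pos(1)])
 have vq: "lap2 ?v q (a2 / u q) (b2 / u q) (- \<mu> * u q / u q - (a2^2 + b2^2) / (u q)^2)"
  by (rule lap2_ln[OF lq pos(2)])
 have ym: "lap2 ?y ?m (a / Y ?m) (b / Y ?m) (l / Y ?m - (a^2 + b^2) / (Y ?m)^2)"
  by (rule lap2_ln[OF Y Ypos])
 have "\<forall>\<^sub>F x in nhds (p, q). x \<in> U \<times> U" using U pq by (intro eventually_nhds_in_open open_Times) auto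
 with le have le': "\<forall>\<^sub>F x in nhds (p, q). ?v (fst x) / 2 + ?v (snd x) / 2 - ?y (mid x) \<le> 0"
 proof eventually_elim
  fix x assume x: "gmean u x \<le> Y (mid x)" "x \<in> U \<times> U"
  then have up: "0 < u (fst x)" "0 < u (snd x)" using u(2) by auto
  then have g: "0 < gmean u x" by (simp add: gmean_def)
  have "ln (gmean u x) \<le> ?y (mid x)" using x g by simp
  then show "?v (fst x) / 2 + ?v (snd x) / 2 - ?y (mid x) \<le> 0"
   using up by (simp add: gmean_def ln_sqrt ln_mult add_divide_distrib)
 qed
 have eq': "?v p / 2 + ?v q / 2 - ?y ?m = 0"
 proof -
  have "?y ?m = ln (gmean u (p, q))" using eq by simp
  also have "\<dots> = ?v p / 2 + ?v q / 2" using pos by (simp add: gmean_def ln_sqrt ln_mult add_divide_distrib)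
  finally show ?thesis by simp
 qed
 have ev: "\<forall>\<^sub>F t in nhds (0::real). ?v (p + (\<alpha> * t) *\<^sub>R e) / 2 + ?v (q + (\<beta> * t) *\<^sub>R e) / 2
   - ?y (?m + ((\<alpha> + \<beta>) / 2 * t) *\<^sub>R e) \<le> 0" for \<alpha> \<beta> :: real and e
 proof -
  have "((\<lambda>t. (p + (\<alpha> * t) *\<^sub>R e, q + (\<beta> * t) *\<^sub>R e)) \<longlongrightarrow> (p + (\<alpha> * 0) *\<^sub>R e, q + (\<beta> * 0) *\<^sub>R e)) (nhds 0)"
   by (intro tendsto_intros filterlim_ident)
  then have "filterlim (\<lambda>t. (p + (\<alpha> * t) *\<^sub>R e, q + (\<beta> * t) *\<^sub>R e)) (nhds (p, q)) (nhds 0)" by simp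
  from eventually_compose_filterlim[OF le' this]
  show ?thesis
  proof eventually_elim
   fix t
   have "mid (p + (\<alpha> * t) *\<^sub>R e, q + (\<beta> * t) *\<^sub>R e) = ?m + ((\<alpha> + \<beta>) / 2 * t) *\<^sub>R e"
    by (simp add: mid_def algebra_simps add_divide_distrib)
   then show "?v (fst (p + (\<alpha> * t) *\<^sub>R e, q + (\<beta> * t) *\<^sub>R e)) / 2 + ?v (snd (p + (\<alpha> * t) *\<^sub>R e, q + (\<beta> * t) *\<^sub>R e)) / 2
    - ?y (mid (p + (\<alpha> * t) *\<^sub>R e, q + (\<beta> * t) *\<^sub>R e)) \<le> 0
    \<Longrightarrow> ?v (p + (\<alpha> * t) *\<^sub>R e) / 2 + ?v (q + (\<beta> * t) *\<^sub>R e) / 2 - ?y (?m + ((\<alpha> + \<beta>) / 2 * t) *\<^sub>R e) \<le> 0"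
    by simp
  qed
 qed
 \<comment> \<open>\<open>\<alpha>\<close> and \<open>\<beta>\<close> are the speeds of the two
   points along \<open>e\<close>; the midpoint moves at the mean speed. The pairs (1, 0), (0, 1) and
   (1, 1) are used below.\<close>
 have line: "\<alpha> * g1 / 2 + \<beta> * g2 / 2 - (\<alpha> + \<beta>) / 2 * g = 0 \<and> \<alpha>^2 * l1 / 2 + \<beta>^2 * l2 / 2 - ((\<alpha> + \<beta>) / 2)^2 * l0 \<le> 0"
  if "d2 (\<lambda>t. ?v (p + t *\<^sub>R e)) g1 l1" "d2 (\<lambda>t. ?v (q + t *\<^sub>R e)) g2 l2" "d2 (\<lambda>t. ?y (?m + t *\<^sub>R e)) g l0"
  for \<alpha> \<beta> g1 l1 g2 l2 g l0 e
 proof -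
  have "d2 (\<lambda>t. 1 * (1/2 * ?v (p + (\<alpha> * t) *\<^sub>R e) + 1/2 * ?v (q + (\<beta> * t) *\<^sub>R e)) + (-1) * ?y (?m + ((\<alpha> + \<beta>) / 2 * t) *\<^sub>R e))
   (1 * (1/2 * (\<alpha> * g1) + 1/2 * (\<beta> * g2)) + (-1) * ((\<alpha> + \<beta>) / 2 * g))
   (1 * (1/2 * (\<alpha>^2 * l1) + 1/2 * (\<beta>^2 * l2)) + (-1) * (((\<alpha> + \<beta>) / 2)^2 * l0))"
   by (intro d2_lin d2_scale[of "\<lambda>t. ?v (p + t *\<^sub>R e)"] d2_scale[of "\<lambda>t. ?v (q + t *\<^sub>R e)"]
     d2_scale[of "\<lambda>t. ?y (?m + t *\<^sub>R e)"] that)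
  from d2_max[OF this] ev[of \<alpha> e \<beta>] eq' show ?thesis by simp
 qed
 have vp': "\<exists>m n. d2 (\<lambda>t. ?v (p + t *\<^sub>R ex)) (a1 / u p) m \<and> d2 (\<lambda>t. ?v (p + t *\<^sub>R ey)) (b1 / u p) n \<and> m + n = - \<mu> - (a1^2 + b1^2) / (u p)^2"
  using vp pos by (auto simp: lap2_def)
 then obtain m1 n1 where 1: "d2 (\<lambda>t. ?v (p + t *\<^sub>R ex)) (a1 / u p) m1" "d2 (\<lambda>t. ?v (p + t *\<^sub>R ey)) (b1 / u p) n1"
  "m1 + n1 = - \<mu> - (a1^2 + b1^2) / (u p)^2" by blast
 have vq': "\<exists>m n. d2 (\<lambda>t. ?v (q + t *\<^sub>R ex)) (a2 / u q) m \<and> d2 (\<lambda>t. ?v (q + t *\<^sub>R ey)) (b2 / u q) n \<and> m + n = - \<mu> - (a2^2 + b2^2) / (u q)^2"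
  using vq pos by (auto simp: lap2_def)
 then obtain m2 n2 where 2: "d2 (\<lambda>t. ?v (q + t *\<^sub>R ex)) (a2 / u q) m2" "d2 (\<lambda>t. ?v (q + t *\<^sub>R ey)) (b2 / u q) n2"
  "m2 + n2 = - \<mu> - (a2^2 + b2^2) / (u q)^2" by blast
 obtain m0 n0 where 0: "d2 (\<lambda>t. ?y (?m + t *\<^sub>R ex)) (a / Y ?m) m0" "d2 (\<lambda>t. ?y (?m + t *\<^sub>R ey)) (b / Y ?m) n0"
  "l / Y ?m - (a^2 + b^2) / (Y ?m)^2 = m0 + n0" using ym unfolding lap2_def by blast
 have gx: "a1 / u p = a / Y ?m" "a2 / u q = a / Y ?m"
  using line[OF 1(1) 2(1) 0(1), of 1 0] line[OF 1(1) 2(1) 0(1), of 0 1] by simp_all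
 have gy: "b1 / u p = b / Y ?m" "b2 / u q = b / Y ?m"
  using line[OF 1(2) 2(2) 0(2), of 1 0] line[OF 1(2) 2(2) 0(2), of 0 1] by simp_all
 have "m1 / 2 + m2 / 2 \<le> m0" "n1 / 2 + n2 / 2 \<le> n0"
  using line[OF 1(1) 2(1) 0(1), of 1 1] line[OF 1(2) 2(2) 0(2), of 1 1] by simp_all
 then have "(m1 + n1) / 2 + (m2 + n2) / 2 \<le> m0 + n0" by (simp add: add_divide_distrib)
 then have "- \<mu> - ((a / Y ?m)^2 + (b / Y ?m)^2) \<le> l / Y ?m - ((a / Y ?m)^2 + (b / Y ?m)^2)"
  unfolding 1(3) 2(3) 0(3)[symmetric] add_divide_distrib power_divide[symmetric] gx gy by simp
 then have "- \<mu> \<le> l / Y ?m" by simp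
 then show ?thesis using Ypos by (simp add: field_simps)
qed

lemma touch_pair':
 assumes "sol \<mu> U u" "\<And>z. z \<in> U \<Longrightarrow> 0 < u z" "fst x \<in> U" "snd x \<in> U" "lap2 Y (mid x) a b l"
  "gmean u x = Y (mid x)" "\<forall>\<^sub>F x in nhds x. gmean u x \<le> Y (mid x)"
 shows "- l \<le> \<mu> * Y (mid x)"
proof -
 obtain p q where "x = (p, q)" by (cases x)
 then show ?thesis using touch_pair[of \<mu> U u p q Y a b l] assms by simp
qed

lemma isCont_nhds: "isCont f y \<Longrightarrow> (f \<longlongrightarrow> f y) (nhds y)"
 by (simp only: isCont_def tendsto_at_iff_tendsto_nhds)

text \<open>Walking from \<open>m0\<close> towards \<open>e0\<close>, stop at a point
  \<open>x\<close> whose distance \<open>y\<close> to \<open>F\<close> is small against the distance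
  to the complement of \<open>U\<close>. The open ball of radius \<open>y\<close> about
  \<open>x\<close> misses \<open>F\<close>; the ball of half the radius, internally tangent to it at
  a nearest point \<open>e\<close>, meets \<open>F\<close> only in \<open>e\<close>. This prepares
  the Hopf barrier.\<close>

lemma touching_ball:
 fixes U F :: "'a::euclidean_space set"
 assumes U: "open U" "convex U" and F: "closed F" and m0: "m0 \<in> U" "m0 \<notin> F" and e0: "e0 \<in> U" "e0 \<in> F"
 obtains c e R where "0 < R" "cball c R \<subseteq> U" "e \<in> F" "dist c e = R" "\<And>x. x \<in> F \<Longrightarrow> x \<in> cball c R \<Longrightarrow> x = e"
proof -
 let ?S = "closed_segment m0 e0"
 have S: "compact ?S" "?S \<subseteq> U" "connected ?S" using closed_segment_subset[OF m0(1) e0(1) U(2)] by auto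
 have Fne: "F \<noteq> {}" using e0 by auto
 obtain d where d: "d > 0" "\<And>x. x \<in> ?S \<Longrightarrow> ball x d \<subseteq> U"
 proof -
  obtain d where "d > 0" "(\<Union>x\<in>?S. ball x d) \<subseteq> U"
   using compact_subset_open_imp_ball_epsilon_subset[OF S(1) U(1) S(2)] by blast
  then show ?thesis by (intro that[of d]) auto
 qed
 let ?f = "\<lambda>x. infdist x F"
 have f0: "?f m0 > 0" using F Fne m0 in_closed_iff_infdist_zero[of F m0] infdist_nonneg[of m0 F] by auto
 have f1: "?f e0 = 0" using e0 by simp
 define y where "y = min (?f m0) (d / 2)"
 have y: "0 < y" "y \<le> ?f m0" "y < d" using f0 d(1) by (auto simp: y_def)
 have "connected (?f ` ?S)" by (intro connected_continuous_image continuous_intros S)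
 moreover have "?f m0 \<in> ?f ` ?S" "?f e0 \<in> ?f ` ?S" by auto
 ultimately have "y \<in> ?f ` ?S"
  using y f1 connected_contains_Icc[of "?f ` ?S" "?f e0" "?f m0"] by auto
 then obtain x where x: "x \<in> ?S" "?f x = y" by auto
 obtain e where e: "e \<in> F" "?f x = dist x e" using infdist_attains_inf[OF F Fne] by blast
 define c where "c = midpoint x e"
 have ce: "dist c e = y / 2" "dist x c = y / 2"
  using dist_midpoint[of x e] e x by (auto simp: c_def)
 show ?thesis
 proof (rule that[of "y / 2" c e])
  show "cball c (y / 2) \<subseteq> U"
  proof
   fix z assume "z \<in> cball c (y/2)"
   then have "dist x z < d" using ce(2) y dist_triangle[of x z c] by auto
   then show "z \<in> U" using d(2)[OF x(1)] by auto
  qed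
  fix z assume z: "z \<in> F" "z \<in> cball c (y/2)"
  have "y \<le> dist x z" using infdist_le[OF z(1), of x] x by simp
  then have "y \<le> norm (z - x)" unfolding dist_commute[of x z] by (simp only: dist_norm)
  then have "y^2 \<le> (norm (z - x))^2" using y by (intro power_mono) simp_all
  define v w where "v = z - c" and "w = c - x"
  have "z - x = v + w" by (simp add: v_def w_def)
  then have 1: "(norm (z - x))^2 = (norm v)^2 + 2 * (v \<bullet> w) + (norm w)^2"
   by (simp add: power2_norm_eq_inner inner_add_left inner_add_right inner_commute[of w v])
  have "norm v \<le> y / 2" using z(2) unfolding mem_cball dist_commute[of c z] by (simp add: dist_norm v_def)
  then have zc: "(norm v)^2 \<le> (y/2)^2" by (intro power_mono) simp_all
  have cx: "(norm w)^2 = (y/2)^2"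
   using ce(2) unfolding dist_commute[of x c] w_def by (simp only: dist_norm)
  have ip: "2 * (y/2)^2 \<le> 2 * (v \<bullet> w)"
   using 1 zc cx \<open>y^2 \<le> (norm (z - x))^2\<close> by (simp add: power_divide)
  have "(norm (v - w))^2 = (norm v)^2 + (norm w)^2 - 2 * (v \<bullet> w)"
   by (simp add: power2_norm_eq_inner inner_diff_left inner_diff_right inner_commute[of w v])
  also have "\<dots> \<le> 0" using zc cx ip by simp
  finally have "v = w" by simp
  then have "z - c = c - x" by (simp add: v_def w_def)
  moreover have "2 *\<^sub>R c = x + e" by (simp add: c_def midpoint_def)
  then have "c + c = x + e" by (simp add: scaleR_2)
  then have "e - c = c - x" by (simp add: algebra_simps)
  ultimately have "z - c = e - c" by simp
  then show "z = e" by simp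
 qed (use y ce e in auto)
qed

text \<open>On a convex set the depth below the frontier is the least distance to a supporting line,
  attained for the line through a nearest frontier point. The nonsmooth depth can thus be replaced
  at \<open>m\<close> by an affine function lying above it.\<close>

lemma frontier_support:
 fixes K :: "point set"
 assumes K: "compact K" "convex K" and m: "m \<in> interior K"
 obtains z n where "norm n = 1" "n \<bullet> (m - z) = infdist m (frontier K)"
  "\<And>x. x \<in> K \<Longrightarrow> 0 \<le> n \<bullet> (x - z)" "\<And>x. x \<in> interior K \<Longrightarrow> infdist x (frontier K) \<le> n \<bullet> (x - z)"
proof -
 let ?d = "infdist m (frontier K)"
 have "K \<noteq> {}" using m interior_subset by auto
 moreover have "K \<noteq> UNIV" using compact_imp_bounded[OF K(1)] not_bounded_UNIV[where 'a="point"] by auto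
 ultimately have ne: "frontier K \<noteq> {}" by (rule frontier_not_empty)
 obtain z where z: "z \<in> frontier K" "?d = dist m z" using infdist_attains_inf[OF frontier_closed ne] by blast
 have sub: "ball m ?d \<subseteq> K"
 proof (rule ccontr)
  assume "\<not> ball m ?d \<subseteq> K"
  then obtain y where y: "y \<in> ball m ?d" "y \<notin> K" by blast
  have "m \<in> K" using m interior_subset by blast
  have "closed_segment m y \<inter> frontier K \<noteq> {}"
   by (rule connected_Int_frontier) (use y \<open>m \<in> K\<close> in auto)
  then obtain x where x: "x \<in> closed_segment m y" "x \<in> frontier K" by blast
  have "dist m x \<le> dist m y" using segment_bound(1)[OF x(1)] unfolding dist_commute[of m] by (simp only: dist_norm)
  then show False using infdist_le[OF x(2), of m] y by simp
 qed
 have "z \<notin> interior K" "closed K" using z K by (auto simp: frontier_def compact_imp_closed)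
 have zc: "z \<in> closure K" using z by (simp add: frontier_def)
 have "z \<notin> rel_interior K" 
  using \<open>z \<notin> interior K\<close> m rel_interior_nonempty_interior[of K] by auto
 from supporting_hyperplane_relative_frontier[OF K(2) zc this]
 obtain a where a: "a \<noteq> 0" "\<And>y. y \<in> closure K \<Longrightarrow> a \<bullet> z \<le> a \<bullet> y" by metis
 define n where "n = (1 / norm a) *\<^sub>R a"
 have n: "norm n = 1" using a by (simp add: n_def)
 have nn: "n \<bullet> n = 1" using n by (simp add: norm_eq_1)
 have pos: "0 \<le> n \<bullet> (x - z)" if "x \<in> K" for x
  using a(2)[of x] that closure_subset[of K] a(1) by (auto simp: n_def inner_diff_right divide_right_mono)
 \<comment> \<open>The ball of radius \<open>?d\<close> about \<open>m\<close> lies in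
   \<open>K\<close>, so a supporting line cannot come closer to \<open>m\<close> than
   \<open>?d\<close>.\<close>
 have "?d \<le> n \<bullet> (m - z)"
 proof (rule ccontr)
  assume c: "\<not> ?d \<le> n \<bullet> (m - z)"
  define s where "s = (n \<bullet> (m - z) + ?d) / 2"
  have s: "n \<bullet> (m - z) < s" "s < ?d" "0 \<le> s"
   using c pos[of m] subsetD[OF interior_subset m] infdist_nonneg[of m "frontier K"] by (auto simp: s_def)
  have "m - s *\<^sub>R n \<in> ball m ?d" using s n by (simp add: dist_norm)
  then have "0 \<le> n \<bullet> (m - s *\<^sub>R n - z)" using sub pos by blast
  then show False using s nn by (simp add: inner_diff_right)
 qed
 moreover have "n \<bullet> (m - z) \<le> ?d" using Cauchy_Schwarz_ineq2[of n "m - z"] n z(2) by (simp add: dist_norm)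
 ultimately have "n \<bullet> (m - z) = ?d" by simp
 moreover have "infdist x (frontier K) \<le> n \<bullet> (x - z)" if x: "x \<in> interior K" for x
 proof -
  let ?s = "n \<bullet> (x - z)"
  have xK: "x \<in> K" using x interior_subset by blast
  have "x - ?s *\<^sub>R n \<notin> interior K"
  proof
   assume "x - ?s *\<^sub>R n \<in> interior K"
   then obtain e where e: "e > 0" "cball (x - ?s *\<^sub>R n) e \<subseteq> K"
    using mem_interior_cball by blast
   have "x - ?s *\<^sub>R n - e *\<^sub>R n \<in> cball (x - ?s *\<^sub>R n) e" using n e by (simp add: dist_norm)
   then have "0 \<le> n \<bullet> (x - ?s *\<^sub>R n - e *\<^sub>R n - z)" using e pos by blast
   then show False using e nn by (simp add: inner_diff_right)
  qed
  then have "closed_segment x (x - ?s *\<^sub>R n) \<inter> frontier (interior K) \<noteq> {}"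
   using x by (intro connected_Int_frontier) auto
  moreover have "frontier (interior K) \<subseteq> frontier K" by (rule frontier_interior_subset)
  ultimately obtain y where y: "y \<in> closed_segment x (x - ?s *\<^sub>R n)" "y \<in> frontier K" by blast
  have "dist x y \<le> norm (?s *\<^sub>R n)" using segment_bound(1)[OF y(1)] unfolding dist_commute[of x y] by (simp add: dist_norm)
  then show ?thesis using infdist_le[OF y(2), of x] n pos[OF xK] by simp
 qed
 ultimately show ?thesis using that n pos by blast
qed

lemma continuous_gmean:
 assumes "continuous_on K u"
 shows "continuous_on (K \<times> K) (gmean u)"
proof -
 have 1: "continuous_on (K \<times> K) (\<lambda>x. u (fst x))" "continuous_on (K \<times> K) (\<lambda>x. u (snd x))"
  by (rule continuous_on_compose2[OF assms]; (intro continuous_intros)?; auto)+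
 show ?thesis unfolding gmean_def by (intro continuous_intros 1)
qed

lemma continuous_on_mid:
 assumes "continuous_on K u" "convex K" "A \<subseteq> K \<times> K"
 shows "continuous_on A (\<lambda>x. u (mid x))"
proof (rule continuous_on_compose2[OF assms(1) continuous_mid], rule image_subsetI)
 fix x assume "x \<in> A"
 then show "mid x \<in> K" using assms(3) by (intro mid_in[OF assms(2)]) auto
qed

lemma gmean_pos:
 assumes "ground \<mu> K u" "x \<in> K \<times> K" "0 < gmean u x"
 shows "fst x \<in> interior K" "snd x \<in> interior K" "mid x \<in> interior K"
proof -
 have "0 \<le> u (fst x)" "0 \<le> u (snd x)" using ground_nonneg[OF assms(1)] assms(2) by auto
 moreover have "0 < u (fst x) * u (snd x)" using assms(3) by (simp add: gmean_def)
 ultimately have "0 < u (fst x)" "0 < u (snd x)" by (auto simp: zero_less_mult_iff)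
 then show 1: "fst x \<in> interior K" "snd x \<in> interior K" using ground_pos_iff[OF assms(1)] assms(2) by auto
 show "mid x \<in> interior K" by (rule mid_in[OF _ 1]) (use assms(1) in \<open>auto simp: ground_def convex_interior\<close>)
qed

text \<open>The quotient of \<open>gmean u x\<close> by \<open>u (mid x)\<close> has no meaning when
  the midpoint is on the frontier, so its supremum might escape there. It is maximised over
  midpoints of depth at least \<open>\<delta>\<close>; in the remaining layer a barrier shows that
  the same constant works.\<close>

lemma ground_layer:
 assumes g: "ground \<mu> K u" and m0: "m0 \<in> K" "u m0 = 1"
 obtains \<kappa> x0 where "1 \<le> \<kappa>" "\<And>x. x \<in> K \<times> K \<Longrightarrow> gmean u x \<le> \<kappa> * u (mid x)"
  "x0 \<in> K \<times> K" "mid x0 \<in> interior K" "gmean u x0 = \<kappa> * u (mid x0)"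
proof -
 have K: "compact K" "convex K" "continuous_on K u" "sol \<mu> (interior K) u" "0 < \<mu>"
  using g by (auto simp: ground_def)
 have m0i: "m0 \<in> interior K" using ground_pos_iff[OF g m0(1)] m0(2) by simp
 have "K \<noteq> UNIV" using compact_imp_bounded[OF K(1)] not_bounded_UNIV[where 'a="point"] by auto
 then have ne: "frontier K \<noteq> {}" using m0(1) by (intro frontier_not_empty) auto
 let ?d = "\<lambda>z. infdist z (frontier K)"
 have dpos: "z \<in> interior K" if "z \<in> K" "0 < ?d z" for z
 proof (rule ccontr)
  assume "z \<notin> interior K"
  then have "z \<in> frontier K" using that closure_subset[of K] by (auto simp: frontier_def)
  then show False using that by simp
 qed
 have dm0: "0 < ?d m0"
  using in_closed_iff_infdist_zero[OF frontier_closed[of K] ne, of m0] m0i infdist_nonneg[of m0 "frontier K"]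
  by (auto simp: frontier_def)
 \<comment> \<open>With \<open>k^2 = \<mu> + 1\<close> the profile \<open>\<rho>\<close> below
   satisfies \<open>\<rho>'' = - (\<mu> + 1) * \<rho>\<close>, a strict supersolution in the depth.
   The phase \<open>pi / 8\<close> makes it positive at depth 0, and
   \<open>k * \<delta> \<le> pi / 8\<close> keeps it increasing throughout the layer.\<close>
 define k where "k = sqrt (\<mu> + 1)"
 have k: "k > 0" "k^2 = \<mu> + 1" using K by (auto simp: k_def)
 define \<delta> where "\<delta> = min (?d m0) (pi / (8 * k))"
 have \<delta>: "0 < \<delta>" "\<delta> \<le> ?d m0" "k * \<delta> \<le> pi / 8"
  using dm0 k by (auto simp: \<delta>_def min_def field_simps)
 define \<rho> where "\<rho> t = sin (k * t + pi / 8)" for t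
 have cmid: "continuous_on B (\<lambda>x. ?d (mid x))" for B
  by (intro continuous_intros continuous_mid)
 let ?A = "{x \<in> K \<times> K. \<delta> \<le> ?d (mid x)}"
 have clKK: "closed (K \<times> K)" using K by (simp add: closed_Times compact_imp_closed)
 have "closed ?A" using continuous_closed_preimage[OF cmid clKK, of "{\<delta>..}"] by (simp add: vimage_def Int_def)
 then have cA: "compact ?A"
  using compact_Int_closed[OF compact_Times[OF K(1,1)], of ?A] by (simp add: Int_def conj_commute cong: conj_cong)
 have Apos: "0 < u (mid x)" if "x \<in> ?A" for x
  using that \<delta>(1) dpos[of "mid x"] mid_in[OF K(2), of x] g by (auto simp: ground_def mem_Times_iff)
 have "continuous_on ?A (\<lambda>x. gmean u x / u (mid x))"
  using Apos by (intro continuous_intros continuous_on_mid[OF K(3,2)] continuous_on_subset[OF continuous_gmean[OF K(3)]]) force+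
 moreover have mA: "(m0, m0) \<in> ?A" using m0 \<delta> by (simp add: mid_def flip: scaleR_2)
 ultimately obtain x0 where x0: "x0 \<in> ?A" "\<And>x. x \<in> ?A \<Longrightarrow> gmean u x / u (mid x) \<le> gmean u x0 / u (mid x0)"
  using continuous_attains_sup[OF cA, of "\<lambda>x. gmean u x / u (mid x)"] by blast
 define \<kappa> where "\<kappa> = gmean u x0 / u (mid x0)"
 have mm: "mid (m0, m0) = m0" by (simp add: mid_def flip: scaleR_2)
 have \<kappa>1: "1 \<le> \<kappa>" using x0(2)[OF mA] m0 by (simp add: \<kappa>_def mm gmean_def)
 have A: "gmean u x \<le> \<kappa> * u (mid x)" if "x \<in> ?A" for x
  using x0(2)[OF that] Apos[OF that] by (simp add: \<kappa>_def[symmetric] pos_divide_le_eq)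
 let ?B = "{x \<in> K \<times> K. ?d (mid x) \<le> \<delta>}"
 have "closed ?B" using continuous_closed_preimage[OF cmid clKK, of "{..\<delta>}"] by (simp add: vimage_def Int_def)
 then have cB: "compact ?B"
  using compact_Int_closed[OF compact_Times[OF K(1,1)], of ?B] by (simp add: Int_def conj_commute cong: conj_cong)
 have \<rho>pos: "0 < \<rho> t" if "0 \<le> t" "t \<le> \<delta>" for t
 proof -
  have "k * t \<le> k * \<delta>" "0 \<le> k * t" using that k by auto
  then show ?thesis unfolding \<rho>_def using \<delta>(3) pi_gt_zero by (intro sin_gt_zero) linarith+
 qed
 have le: "gmean u x \<le> \<kappa> * u (mid x)" if xK: "x \<in> K \<times> K" for x
 proof (rule ccontr)
  assume neg: "\<not> gmean u x \<le> \<kappa> * u (mid x)"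
  let ?\<Theta> = "\<lambda>x. (gmean u x - \<kappa> * u (mid x)) / \<rho> (?d (mid x))"
  have \<rho>B: "0 < \<rho> (?d (mid x))" if "x \<in> ?B" for x using \<rho>pos that infdist_nonneg by auto
  have xB: "x \<in> ?B" using neg A[of x] xK by force
  have "continuous_on ?B ?\<Theta>"
  proof (intro continuous_intros continuous_on_mid[OF K(3,2)] continuous_on_subset[OF continuous_gmean[OF K(3)]])
   show "continuous_on ?B (\<lambda>x. \<rho> (?d (mid x)))" unfolding \<rho>_def by (intro continuous_intros cmid)
  qed (use \<rho>B in force)+
  then obtain y where y: "y \<in> ?B" "\<And>x. x \<in> ?B \<Longrightarrow> ?\<Theta> x \<le> ?\<Theta> y"
   using continuous_attains_sup[OF cB, of ?\<Theta>] xB by blast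
  define \<kappa>' where "\<kappa>' = ?\<Theta> y"
  have "0 < ?\<Theta> x" using neg \<rho>B[OF xB] by simp
  then have \<kappa>': "0 < \<kappa>'" using y(2)[OF xB] by (simp add: \<kappa>'_def)
  have gB: "gmean u x \<le> \<kappa> * u (mid x) + \<kappa>' * \<rho> (?d (mid x))" if "x \<in> ?B" for x
   using y(2)[OF that] \<rho>B[OF that] by (simp add: \<kappa>'_def[symmetric] pos_divide_le_eq)
  have gy: "gmean u y = \<kappa> * u (mid y) + \<kappa>' * \<rho> (?d (mid y))"
   using \<rho>B[OF y(1)] by (simp add: \<kappa>'_def)
  have yK: "y \<in> K \<times> K" using y by simp
  have "0 \<le> u (mid y)" using ground_nonneg[OF g mid_in[OF K(2)]] yK by (auto simp: mem_Times_iff)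
  then have "0 \<le> \<kappa> * u (mid y)" using \<kappa>1 by simp
  moreover have "0 < \<kappa>' * \<rho> (?d (mid y))" using \<kappa>' \<rho>B[OF y(1)] by simp
  ultimately have gp: "0 < gmean u y" using gy by linarith
  note int = gmean_pos[OF g yK gp]
  have "?d (mid y) < \<delta>"
  proof (rule ccontr)
   assume "\<not> ?d (mid y) < \<delta>"
   then have "y \<in> ?A" using yK by auto
   from A[OF this] show False using gy \<open>0 < \<kappa>' * \<rho> (?d (mid y))\<close> by linarith
  qed
  \<comment> \<open>Depth is exchanged for the affine function \<open>n \<bullet> (x - z)\<close>,
    which agrees with it at \<open>mid y\<close> and is larger elsewhere. Since
    \<open>\<rho>\<close> increases, contact from above is preserved, now with a smooth comparison
    function.\<close>
  obtain z n where n: "norm n = 1" "n \<bullet> (mid y - z) = ?d (mid y)"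
   "\<And>x. x \<in> K \<Longrightarrow> 0 \<le> n \<bullet> (x - z)" "\<And>x. x \<in> interior K \<Longrightarrow> ?d x \<le> n \<bullet> (x - z)"
   by (rule frontier_support[OF K(1,2) int(3)], rule that)
  let ?l = "\<lambda>x. - (n \<bullet> z) + n \<bullet> x"
  let ?Y = "\<lambda>x. \<kappa> * u x + \<kappa>' * \<rho> (?l x)"
  have l: "?l x = n \<bullet> (x - z)" for x by (simp add: inner_diff_right)
  have nn: "(fst n)^2 + (snd n)^2 = 1" using n(1) by (cases n) (simp add: norm_Pair)
  have "lap2 (\<lambda>x. \<rho> (?l x)) (mid y) (k * cos (k * ?l (mid y) + pi/8) * fst n) (k * cos (k * ?l (mid y) + pi/8) * snd n)
    ((- k\<^sup>2 * \<rho> (?l (mid y))) * ((fst n)\<^sup>2 + (snd n)\<^sup>2) + k * cos (k * ?l (mid y) + pi/8) * 0)"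
   by (rule lap2_compose[OF lap2_affine, of UNIV _ _ _ \<rho> "\<lambda>t. k * cos (k * t + pi/8)"])
     (auto simp: \<rho>_def[abs_def] power2_eq_square intro!: derivative_eq_intros)
  note lin = lap2_lin[OF lap2_sol[OF K(4) int(3)] this, of \<kappa> \<kappa>']
  have Y: "lap2 ?Y (mid y) (\<kappa> * dd ex u (mid y) + \<kappa>' * (k * cos (k * ?l (mid y) + pi/8) * fst n))
    (\<kappa> * dd ey u (mid y) + \<kappa>' * (k * cos (k * ?l (mid y) + pi/8) * snd n))
    (\<kappa> * (- \<mu> * u (mid y)) + \<kappa>' * (- k\<^sup>2 * \<rho> (?l (mid y))))"
   by (rule lap2_eq[OF lin]) (simp_all only: nn mult_1_right mult_zero_right add_0_right)
  have ly: "?l (mid y) = ?d (mid y)" using n(2) by (simp only: l)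
  have "- (\<kappa> * (- \<mu> * u (mid y)) + \<kappa>' * (- k\<^sup>2 * \<rho> (?l (mid y)))) \<le> \<mu> * ?Y (mid y)"
  proof (rule touch_pair'[OF K(4) _ int(1,2) Y])
   show "0 < u z" if "z \<in> interior K" for z using g that by (auto simp: ground_def)
   show "gmean u y = ?Y (mid y)" using gy ly by simp
   have cm: "isCont mid y" unfolding mid_def by (intro continuous_intros)
   have "isCont (\<lambda>x. ?d (mid x)) y" "isCont (\<lambda>x. ?l (mid x)) y"
    by (intro continuous_intros continuous_infdist cm)+
   then have t: "((\<lambda>x. ?d (mid x)) \<longlongrightarrow> ?d (mid y)) (nhds y)"
     "((\<lambda>x. ?l (mid x)) \<longlongrightarrow> ?l (mid y)) (nhds y)"
    by (auto dest: isCont_nhds)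
   have "\<forall>\<^sub>F x in nhds y. ?d (mid x) < \<delta>" using order_tendstoD(2)[OF t(1) \<open>?d (mid y) < \<delta>\<close>] .
   moreover have "?l (mid y) < pi / (4 * k)"
    
   proof -
    have "k * ?d (mid y) < k * \<delta>" using \<open>?d (mid y) < \<delta>\<close> k by (intro mult_strict_left_mono)
    then have "k * ?d (mid y) < pi / 4" using \<delta>(3) pi_gt_zero by linarith
    then show ?thesis unfolding ly using k by (simp add: field_simps)
   qed
   from order_tendstoD(2)[OF t(2) this] have "\<forall>\<^sub>F x in nhds y. ?l (mid x) < pi / (4 * k)" .
   moreover have "\<forall>\<^sub>F x in nhds y. x \<in> interior K \<times> interior K"
    using int by (intro eventually_nhds_in_open open_Times) (auto simp: mem_Times_iff)
   ultimately show "\<forall>\<^sub>F x in nhds y. gmean u x \<le> ?Y (mid x)"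
   proof eventually_elim
    fix x assume x: "?d (mid x) < \<delta>" "?l (mid x) < pi / (4 * k)" "x \<in> interior K \<times> interior K"
    then have xB: "x \<in> ?B" using interior_subset by (auto simp: mem_Times_iff)
    have mi: "mid x \<in> interior K" by (rule mid_in) (use x K(2) in \<open>auto simp: convex_interior\<close>)
    have "\<rho> (?d (mid x)) \<le> \<rho> (?l (mid x))"
     unfolding \<rho>_def
    proof (rule sin_monotone_2pi_le)
     have "0 \<le> k * ?d (mid x)" using k(1) infdist_nonneg[of "mid x" "frontier K"] by simp
     then show "- (pi / 2) \<le> k * ?d (mid x) + pi / 8" using pi_gt_zero by linarith
     show "k * ?d (mid x) + pi / 8 \<le> k * ?l (mid x) + pi / 8"
      using n(4)[OF mi] l k by simp
     have "k * ?l (mid x) < k * (pi / (4 * k))" using x(2) k by (intro mult_strict_left_mono)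
     also have "\<dots> = pi / 4" using k by simp
     finally show "k * ?l (mid x) + pi / 8 \<le> pi / 2" using pi_gt_zero by linarith
    qed
    then have "\<kappa>' * \<rho> (?d (mid x)) \<le> \<kappa>' * \<rho> (?l (mid x))" using \<kappa>' by simp
    then show "gmean u x \<le> ?Y (mid x)" using gB[OF xB] by linarith
   qed
  qed
  then have "\<kappa>' * \<rho> (?d (mid y)) * (k^2 - \<mu>) \<le> 0" unfolding ly by (simp add: algebra_simps)
  then show False using \<open>0 < \<kappa>' * \<rho> (?d (mid y))\<close> k by simp
 qed
 show ?thesis
 proof (rule that[OF \<kappa>1 le])
  show "x0 \<in> K \<times> K" using x0 by simp
  show "mid x0 \<in> interior K" using dpos[of "mid x0"] x0(1) \<delta>(1) mid_in[OF K(2), of x0] by (auto simp: mem_Times_iff)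
  show "gmean u x0 = \<kappa> * u (mid x0)" using Apos[OF x0(1)] by (simp add: \<kappa>_def)
 qed
qed


text \<open>If \<open>\<kappa>\<close> is the least constant with \<open>sqrt (u p * u q) \<le> \<kappa> * u (mid (p, q))\<close>, touching at a pair
 of points propagates to all midpoints by a Hopf barrier, in particular to the maximum point of \<open>u\<close>; hence \<open>\<kappa> = 1\<close>.\<close>

theorem ground_log_concave:
 assumes g: "ground \<mu> K u" and x: "x \<in> K \<times> K"
 shows "gmean u x \<le> u (mid x)"
proof -
 have K: "compact K" "convex K" "continuous_on K u" "sol \<mu> (interior K) u" "0 < \<mu>"
  and le1: "\<And>p. p \<in> K \<Longrightarrow> u p \<le> 1" and upos: "\<And>z. z \<in> interior K \<Longrightarrow> 0 < u z"
  using g by (auto simp: ground_def)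
 obtain m0 where m0: "m0 \<in> K" "u m0 = 1" using g by (auto simp: ground_def)
 obtain \<kappa> x0 where \<kappa>: "1 \<le> \<kappa>" and le: "\<And>x. x \<in> K \<times> K \<Longrightarrow> gmean u x \<le> \<kappa> * u (mid x)"
  and x0: "x0 \<in> K \<times> K" "mid x0 \<in> interior K" "gmean u x0 = \<kappa> * u (mid x0)"
  by (rule ground_layer[OF g m0], rule that)
 have "\<kappa> = 1"
 proof (rule ccontr)
  assume "\<kappa> \<noteq> 1"
  with \<kappa> have \<kappa>1: "1 < \<kappa>" by simp
  have m0i: "m0 \<in> interior K" using ground_pos_iff[OF g m0(1)] m0(2) by simp
  have g1: "gmean u x \<le> 1" if "x \<in> K \<times> K" for x
  proof -
   have "u (fst x) * u (snd x) \<le> 1 * 1"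
    using that le1 ground_nonneg[OF g] by (intro mult_mono) (auto simp: mem_Times_iff)
   then show ?thesis by (simp add: gmean_def)
  qed
  define C where "C = {x \<in> K \<times> K. gmean u x = \<kappa> * u (mid x)}"
  have cKK: "compact (K \<times> K)" using K by (intro compact_Times)
  have cd: "continuous_on (K \<times> K) (\<lambda>x. gmean u x - \<kappa> * u (mid x))"
   by (intro continuous_intros continuous_on_mid[OF K(3,2)] continuous_gmean[OF K(3)] order_refl)
  have "closed {x \<in> K \<times> K. gmean u x - \<kappa> * u (mid x) = 0}"
   using continuous_closed_preimage_constant[OF cd compact_imp_closed[OF cKK]] .
  then have "closed C" by (simp add: C_def)
  then have "compact C" using compact_Int_closed[OF cKK, of C] by (simp add: C_def Int_def conj_commute cong: conj_cong)
  define F where "F = mid ` C"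
  have "compact F" unfolding F_def by (rule compact_continuous_image[OF continuous_mid \<open>compact C\<close>])
  then have F: "closed F" by (rule compact_imp_closed)
  \<comment> \<open>Contact with midpoint at the maximum point of \<open>u\<close> would mean
    \<open>gmean = \<kappa> > 1\<close>, impossible since \<open>u \<le> 1\<close>. So the contact
    set is not everything, and a ball touching it from outside exists.\<close>
  have m0F: "m0 \<notin> F"
  proof
   assume "m0 \<in> F"
   then obtain y where "y \<in> K \<times> K" "gmean u y = \<kappa>" using m0 by (auto simp: F_def C_def)
   then show False using g1[of y] \<kappa>1 by simp
  qed
  have e0: "mid x0 \<in> F" using x0 by (auto simp: F_def C_def)
  obtain c e R where R: "0 < R" "cball c R \<subseteq> interior K" and e: "e \<in> F" "dist c e = R"
   and uniq: "\<And>z. z \<in> F \<Longrightarrow> z \<in> cball c R \<Longrightarrow> z = e"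
   by (rule touching_ball[OF open_interior convex_interior[OF K(2)] F m0i m0F x0(2) e0], rule that)
  have ei: "e \<in> interior K" using R(2) e(2) by auto
  then obtain r' where r': "r' > 0" "cball e r' \<subseteq> interior K"
   using open_contains_cball[of "interior K"] by auto
  define r where "r = min r' (R / 2)"
  have r: "0 < r" "r \<le> R / 2" "cball e r \<subseteq> interior K" using r' R by (auto simp: r_def)
  \<comment> \<open>The Laplacian of the Gaussian is the Gaussian times
    \<open>4 * A^2 * dist^2 - 4 * A\<close>. With \<open>A * R^2 = 5\<close> the bracket is at least
    \<open>A\<close> at distance \<open>R / 2\<close> or more from \<open>c\<close>, and
    \<open>r \<le> R / 2\<close> keeps the small ball about \<open>e\<close> in that region.\<close>
  define A where "A = 5 / R^2"
  have A: "A > 0" "A * R^2 = 5" using R by (auto simp: A_def)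
  define \<eta> where "\<eta> z = exp (- A * (dist z c)^2) - exp (- A * R^2)" for z
  have \<eta>le: "\<eta> z \<le> 1" for z
  proof -
   have "exp (- A * (dist z c)^2) \<le> 1" using A by simp
   then show ?thesis unfolding \<eta>_def using exp_gt_zero[of "- A * R^2"] by linarith
  qed
  have \<eta>pos: "0 \<le> \<eta> z \<longleftrightarrow> z \<in> cball c R" for z
  proof -
   have "0 \<le> \<eta> z \<longleftrightarrow> A * (dist z c)^2 \<le> A * R^2" by (simp add: \<eta>_def)
   also have "\<dots> \<longleftrightarrow> (dist z c)^2 \<le> R^2" using A(1) by simp
   also have "\<dots> \<longleftrightarrow> dist z c \<le> R" using R by (simp add: power2_le_iff_abs_le)
   finally show ?thesis by (simp add: dist_commute)
  qed
  have c\<eta>: "continuous_on B \<eta>" for B unfolding \<eta>_def by (intro continuous_intros)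
  \<comment> \<open>a gap below contact on the part of the small sphere where \<open>\<eta>\<close> is nonnegative\<close>
  define D' where "D' = (K \<times> K) \<inter> mid -` (sphere e r \<inter> cball c R)"
  have "closed D'" unfolding D'_def
   by (rule continuous_closed_preimage[OF continuous_mid]) (use compact_imp_closed[OF cKK] in auto)
  then have cD': "compact D'" using compact_Int_closed[OF cKK, of D'] by (simp add: D'_def Int_absorb1 Int_assoc[symmetric])
  have "\<exists>\<gamma>>0. \<forall>x\<in>D'. \<gamma> \<le> \<kappa> * u (mid x) - gmean u x"
  proof (cases "D' = {}")
   case False
   have "continuous_on D' (\<lambda>x. \<kappa> * u (mid x) - gmean u x)"
    by (rule continuous_on_subset[of "K \<times> K"], intro continuous_intros continuous_on_mid[OF K(3,2)] continuous_gmean[OF K(3)] order_refl)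
      (simp add: D'_def)
   then obtain y where y: "y \<in> D'" "\<And>x. x \<in> D' \<Longrightarrow> \<kappa> * u (mid y) - gmean u y \<le> \<kappa> * u (mid x) - gmean u x"
    using continuous_attains_inf[OF cD' False] by blast
   have "y \<notin> C"
   proof
    assume "y \<in> C"
    then have "mid y \<in> F" by (simp add: F_def)
    then have "mid y = e" using uniq[of "mid y"] y(1) by (simp add: D'_def)
    then show False using y(1) r(1) by (simp add: D'_def)
   qed
   then have "0 < \<kappa> * u (mid y) - gmean u y" using le[of y] y(1) by (auto simp: D'_def C_def)
   then show ?thesis using y(2) by blast
  qed (use zero_less_one in blast)
  then obtain \<gamma> where \<gamma>: "\<gamma> > 0" "\<And>x. x \<in> D' \<Longrightarrow> \<gamma> \<le> \<kappa> * u (mid x) - gmean u x" by blast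
  have cu: "continuous_on (cball e r) u"
   by (rule continuous_on_subset[OF K(3)]) (use r(3) interior_subset in blast)
  obtain z0 where z0: "z0 \<in> cball e r" "\<And>z. z \<in> cball e r \<Longrightarrow> u z0 \<le> u z"
   using continuous_attains_inf[OF compact_cball _ cu] r(1) by (metis cball_eq_empty not_less less_imp_le)
  have uz0: "0 < u z0" using upos z0(1) r(3) by blast
  \<comment> \<open>Small enough that the perturbation can neither close the gap
    \<open>\<gamma>\<close> on the small sphere nor make the comparison function \<open>?Y\<close>
    nonpositive.\<close>
  define \<theta> where "\<theta> = min (\<gamma> / 2) (u z0 / 2)"
  have \<theta>: "0 < \<theta>" "\<theta> < \<gamma>" "\<theta> < u z0" using \<gamma> uz0 by (auto simp: \<theta>_def)
  let ?Y = "\<lambda>z. \<kappa> * u z + (- \<theta>) * \<eta> z"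
  have Ypos: "0 < ?Y z" if "z \<in> cball e r" for z
  proof -
   have "\<theta> * \<eta> z \<le> \<theta> * 1" using \<theta>(1) \<eta>le by (intro mult_left_mono) auto
   moreover have "1 * u z \<le> \<kappa> * u z" using z0(2)[OF that] uz0 \<kappa> by (intro mult_right_mono) auto
   ultimately show ?thesis using z0(2)[OF that] \<theta> by linarith
  qed
  define D where "D = (K \<times> K) \<inter> mid -` cball e r"
  have "closed D" unfolding D_def
   by (rule continuous_closed_preimage[OF continuous_mid]) (use compact_imp_closed[OF cKK] in auto)
  then have cD: "compact D" using compact_Int_closed[OF cKK, of D] by (simp add: D_def Int_absorb1 Int_assoc[symmetric])
  have Dpos: "0 < ?Y (mid x)" if "x \<in> D" for x using that Ypos by (simp add: D_def)
  have DK: "D \<subseteq> K \<times> K" by (auto simp: D_def)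
  have c\<eta>m: "continuous_on D (\<lambda>x. \<eta> (mid x))"
   by (rule continuous_on_compose2[OF c\<eta>[of UNIV] continuous_mid]) simp
  have "continuous_on D (\<lambda>x. gmean u x / ?Y (mid x))"
   by (intro continuous_intros continuous_on_mid[OF K(3,2) DK] continuous_on_subset[OF continuous_gmean[OF K(3)] DK] c\<eta>m ballI)
     (use Dpos in force)
  moreover obtain xe where xe: "xe \<in> C" "mid xe = e" using e(1) by (auto simp: F_def)
  have xeD: "xe \<in> D" using xe r(1) by (simp add: D_def C_def)
  ultimately obtain y where y: "y \<in> D" "\<And>x. x \<in> D \<Longrightarrow> gmean u x / ?Y (mid x) \<le> gmean u y / ?Y (mid y)"
   using continuous_attains_sup[OF cD, of "\<lambda>x. gmean u x / ?Y (mid x)"] by blast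
  \<comment> \<open>Scaling \<open>?Y\<close> to contact. At \<open>e\<close>, where
    \<open>\<eta>\<close> vanishes, there is contact already, so \<open>\<beta> \<ge> 1\<close>;
    consequently the new contact point lies where \<open>\<eta> \<ge> 0\<close> and strictly inside
    the small ball.\<close>
  define \<beta> where "\<beta> = gmean u y / ?Y (mid y)"
  have "\<eta> e = 0" using e(2) by (simp add: \<eta>_def dist_commute)
  then have "gmean u xe / ?Y (mid xe) = 1" using xe Dpos[OF xeD] by (auto simp: C_def)
  then have \<beta>1: "1 \<le> \<beta>" using y(2)[OF xeD] by (simp add: \<beta>_def)
  have gl: "gmean u x \<le> \<beta> * ?Y (mid x)" if "x \<in> D" for x
   using y(2)[OF that] Dpos[OF that] by (simp only: \<beta>_def[symmetric] pos_divide_le_eq)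
  have gy: "gmean u y = \<beta> * ?Y (mid y)" using Dpos[OF y(1)] by (simp add: \<beta>_def)
  have yK: "y \<in> K \<times> K" using y(1) DK by blast
  have "0 < \<beta> * ?Y (mid y)" using \<beta>1 Dpos[OF y(1)] by simp
  then have gp: "0 < gmean u y" using gy by simp
  note int = gmean_pos[OF g yK gp]
  have Yle: "?Y (mid y) \<le> gmean u y"
   using mult_right_mono[OF \<beta>1, of "?Y (mid y)"] Dpos[OF y(1)] gy by simp
  have \<eta>y: "0 \<le> \<eta> (mid y)"
  proof (rule ccontr)
   assume "\<not> 0 \<le> \<eta> (mid y)"
   then have "(- \<theta>) * \<eta> (mid y) > 0" using \<theta>(1) by (simp add: mult_pos_neg)
   then show False using Yle le[OF yK] by linarith
  qed
  then have yR: "mid y \<in> cball c R" using \<eta>pos by blast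
  have yr: "dist e (mid y) < r"
  proof (rule ccontr)
   assume "\<not> dist e (mid y) < r"
   then have "y \<in> D'" using y(1) yR by (auto simp: D_def D'_def)
   then have "\<gamma> \<le> \<kappa> * u (mid y) - gmean u y" by (rule \<gamma>(2))
   moreover have "\<theta> * \<eta> (mid y) \<le> \<theta> * 1" using \<theta>(1) \<eta>le by (intro mult_left_mono) auto
   ultimately show False using Yle \<theta>(2) by linarith
  qed
  let ?E = "exp (- A * (dist (mid y) c)^2)"
  define a where "a = 2 * (fst (mid y) - fst c)"
  define b where "b = 2 * (snd (mid y) - snd c)"
  have ab: "a^2 + b^2 = 4 * (dist (mid y) c)^2"
   by (simp add: a_def b_def dist_prod_def dist_real_def) (simp add: power2_eq_square algebra_simps)
  define lE where "lE = ?E * (A^2 * (4 * (dist (mid y) c)^2) - 4 * A)"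
  have l1: "lap2 (\<lambda>z. (- A) * (dist z c)^2 + 0 * 0) (mid y) ((- A) * a + 0 * 0) ((- A) * b + 0 * 0) ((- A) * 4 + 0 * 0)"
   unfolding a_def b_def by (rule lap2_lin[OF lap2_sqdist lap2_const])
  have l2: "lap2 (\<lambda>z. exp (- A * (dist z c)^2)) (mid y) (?E * (- A * a)) (?E * (- A * b)) lE"
  proof (rule lap2_eq[OF lap2_cong[OF lap2_exp[OF l1]]])
   have "(A * a)^2 + (A * b)^2 = A^2 * (4 * (dist (mid y) c)^2)" by (simp add: power_mult_distrib flip: ab distrib_left)
   then show "exp (- A * (dist (mid y) c)^2 + 0 * 0) * ((- A * a + 0 * 0)^2 + (- A * b + 0 * 0)^2 + (- A * 4 + 0 * 0)) = lE"
    by (simp add: lE_def)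
  qed simp_all
  have l3: "lap2 (\<lambda>z. 1 * exp (- A * (dist z c)^2) + (- 1) * exp (- A * R^2)) (mid y) (1 * (?E * (- A * a)) + (- 1) * 0)
    (1 * (?E * (- A * b)) + (- 1) * 0) (1 * lE + (- 1) * 0)"
   by (rule lap2_lin[OF l2 lap2_const])
  have l4: "lap2 \<eta> (mid y) (?E * (- A * a)) (?E * (- A * b)) lE"
   by (rule lap2_eq[OF lap2_cong[OF l3]]) (simp_all add: \<eta>_def)
  note l5 = lap2_lin[OF lap2_sol[OF K(4) int(3)] l4, of \<kappa> "- \<theta>"]
  note l6 = lap2_lin[OF l5 lap2_const[of 0], of \<beta> 0]
  have "- (\<beta> * (\<kappa> * (- \<mu> * u (mid y)) + - \<theta> * lE) + 0 * 0) \<le> \<mu> * (\<beta> * ?Y (mid y) + 0 * 0)"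
  proof (rule touch_pair'[OF K(4) upos int(1,2) l6])
   show "gmean u y = \<beta> * ?Y (mid y) + 0 * 0" using gy by simp
   have "isCont mid y" unfolding mid_def by (intro continuous_intros)
   then have "isCont (\<lambda>x. dist e (mid x)) y" by (intro continuous_intros)
   then have "((\<lambda>x. dist e (mid x)) \<longlongrightarrow> dist e (mid y)) (nhds y)" by (rule isCont_nhds)
   from order_tendstoD(2)[OF this yr] have "\<forall>\<^sub>F x in nhds y. dist e (mid x) < r" .
   moreover have "\<forall>\<^sub>F x in nhds y. x \<in> interior K \<times> interior K"
    using int by (intro eventually_nhds_in_open open_Times) (auto simp: mem_Times_iff)
   ultimately show "\<forall>\<^sub>F x in nhds y. gmean u x \<le> \<beta> * ?Y (mid x) + 0 * 0"
   proof eventually_elim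
    fix x assume "dist e (mid x) < r" "x \<in> interior K \<times> interior K"
    then have "x \<in> D" using interior_subset by (auto simp: D_def mem_Times_iff)
    then show "gmean u x \<le> \<beta> * ?Y (mid x) + 0 * 0" using gl by simp
   qed
  qed
  then have "\<beta> * (\<theta> * (lE + \<mu> * \<eta> (mid y))) \<le> 0" by (simp add: algebra_simps)
  moreover have "R \<le> dist (mid y) c + dist e (mid y)" using dist_triangle[of c e "mid y"] e(2) by (simp add: dist_commute)
  then have "R / 2 \<le> dist (mid y) c" using yr r(2) by linarith
  then have "(R / 2)^2 \<le> (dist (mid y) c)^2" using R(1) by (intro power_mono) auto
  then have "A * (A * R^2) \<le> A * (A * (4 * (dist (mid y) c)^2))"
   using A(1) by (intro mult_left_mono) (auto simp: power_divide)
  then have "A * 5 \<le> A^2 * (4 * (dist (mid y) c)^2)"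
   unfolding A(2) power2_eq_square[of A] mult.assoc .
  then have "0 < lE" using A(1) by (simp add: lE_def)
  moreover have "0 \<le> \<mu> * \<eta> (mid y)" using \<eta>y K(5) by simp
  ultimately show False using \<beta>1 \<theta>(1)
   by (smt (verit, best) mult_pos_pos)
 qed
 then show ?thesis using le[OF x] by simp
qed

section \<open>Consequences of log-concavity along lines\<close>

lemma d2_dir:
 assumes P: "sol \<mu> V P" and mu: "0 < \<mu>" and nu: "norm \<xi> = 1" and p: "p \<in> V"
 shows "d2 (\<lambda>t. P (p + t *\<^sub>R \<xi>)) (dd \<xi> P p) (dd \<xi> (dd \<xi> P) p)"
 unfolding d2_def
proof (intro exI[of _ "\<lambda>t. dd \<xi> P (p + t *\<^sub>R \<xi>)"] conjI)
 have C: "C2f V P" using P by (simp add: sol_def)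
 have C': "C2f V (dd \<xi> P)" using sol_dd[OF P mu nu] by (simp add: sol_def)
 have "\<forall>\<^sub>F z in nhds p. z \<in> V" using C p by (auto simp: C2f_def eventually_nhds)
 from eventually_line[OF this, of \<xi>]
 show "\<forall>\<^sub>F t in nhds 0. ((\<lambda>t. P (p + t *\<^sub>R \<xi>)) has_real_derivative dd \<xi> P (p + t *\<^sub>R \<xi>)) (at t)"
  by eventually_elim (rule has_real_derivative_dd[OF C2f_D(1)[OF C]])
 show "((\<lambda>t. dd \<xi> P (p + t *\<^sub>R \<xi>)) has_real_derivative dd \<xi> (dd \<xi> P) p) (at 0)"
  using has_real_derivative_dd[of "dd \<xi> P" p 0 \<xi>] C2f_D(1)[OF C' p] by simp
qed simp

text \<open>For a unit vector \<open>\<xi>\<close> this is minus the second derivative of \<open>ln u\<close> in the direction \<open>\<xi>\<close>.\<close>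

definition whess :: "(point \<Rightarrow> real) \<Rightarrow> point \<Rightarrow> point \<Rightarrow> real" where
 "whess u \<xi> p = (dd \<xi> u p / u p)^2 - dd \<xi> (dd \<xi> u) p / u p"

lemma ground_D:
 assumes "ground \<mu> K u"
 shows "0 < \<mu>" "compact K" "convex K" "continuous_on K u" "sol \<mu> (interior K) u"
  "p \<in> interior K \<Longrightarrow> 0 < u p" "p \<in> K \<Longrightarrow> u p \<le> 1" "p \<in> frontier K \<Longrightarrow> u p = 0"
 using assms by (auto simp: ground_def)

lemma d2_ln:
 assumes "d2 \<phi> a l" "0 < \<phi> 0"
 shows "d2 (\<lambda>t. ln (\<phi> t)) (a / \<phi> 0) (l / \<phi> 0 - (a / \<phi> 0)^2)"
proof -
 have "(inverse has_real_derivative - (inverse (\<phi> 0))\<^sup>2) (at (\<phi> 0))"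
  using DERIV_inverse[of "\<phi> 0" UNIV] assms(2) by (simp add: power2_eq_square)
 from d2_compose[OF assms(1), of "{0<..}" ln inverse, OF _ _ _ this]
 have "d2 (\<lambda>t. ln (\<phi> t)) (inverse (\<phi> 0) * a) (- (inverse (\<phi> 0))\<^sup>2 * a\<^sup>2 + inverse (\<phi> 0) * l)"
  using assms(2) DERIV_ln by auto
 moreover have "inverse (\<phi> 0) * a = a / \<phi> 0" "- (inverse (\<phi> 0))\<^sup>2 * a\<^sup>2 + inverse (\<phi> 0) * l = l / \<phi> 0 - (a / \<phi> 0)\<^sup>2"
  using assms(2) by (auto simp: field_simps power2_eq_square)
 ultimately show ?thesis by simp
qed

text \<open>Log-concavity for the symmetric pair at \<open>p + t *\<^sub>R \<xi>\<close> and
  \<open>p - t *\<^sub>R \<xi>\<close> says that the even part of \<open>ln u\<close> along this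
  line is maximal at \<open>t = 0\<close>.\<close>

lemma whess_nonneg:
 assumes g: "ground \<mu> K u" and p: "p \<in> interior K" and nu: "norm \<xi> = 1"
 shows "0 \<le> whess u \<xi> p"
proof -
 note G = ground_D[OF g]
 let ?v = "\<lambda>t. ln (u (p + t *\<^sub>R \<xi>))"
 have d: "d2 ?v (dd \<xi> u p / u p) (- whess u \<xi> p)"
  using d2_ln[OF d2_dir[OF G(5) G(1) nu p]] G(6)[OF p] by (simp add: whess_def)
 have "d2 (\<lambda>t. 1 * ?v t + 1 * ?v ((- 1) * t)) (1 * (dd \<xi> u p / u p) + 1 * ((- 1) * (dd \<xi> u p / u p)))
   (1 * (- whess u \<xi> p) + 1 * ((- 1)^2 * (- whess u \<xi> p)))"
  by (rule d2_lin[OF d d2_scale[OF d]])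
 moreover have "\<forall>\<^sub>F t in nhds 0. 1 * ?v t + 1 * ?v ((- 1) * t) \<le> 1 * ?v 0 + 1 * ?v ((- 1) * 0)"
 proof -
  have e: "\<forall>\<^sub>F z in nhds p. z \<in> interior K" using p by (intro eventually_nhds_in_open) auto
  from eventually_line[OF e, of \<xi>] eventually_line[OF e, of "- \<xi>"]
  show ?thesis
  proof eventually_elim
   fix t assume t: "p + t *\<^sub>R \<xi> \<in> interior K" "p + t *\<^sub>R - \<xi> \<in> interior K"
   let ?x = "(p + t *\<^sub>R \<xi>, p + t *\<^sub>R - \<xi>)"
   have "gmean u ?x \<le> u (mid ?x)"
    by (rule ground_log_concave[OF g]) (use t interior_subset in auto)
   moreover have "mid ?x = p" by (simp add: mid_def flip: scaleR_2)
   moreover have up: "0 < u (p + t *\<^sub>R \<xi>)" "0 < u (p + t *\<^sub>R - \<xi>)" using G(6) t by auto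
   moreover have "0 < gmean u ?x" using up by (simp add: gmean_def)
   ultimately have "ln (gmean u ?x) \<le> ln (u p)" by simp
   moreover have "ln (gmean u ?x) = ?v t / 2 + ?v (- t) / 2"
    using up by (simp add: gmean_def ln_sqrt ln_mult add_divide_distrib)
   ultimately show "1 * ?v t + 1 * ?v ((- 1) * t) \<le> 1 * ?v 0 + 1 * ?v ((- 1) * 0)" by simp
  qed
 qed
 ultimately have "1 * (- whess u \<xi> p) + 1 * ((- 1)^2 * (- whess u \<xi> p)) \<le> 0"
  using d2_max by blast
 then show ?thesis by simp
qed

lemma DERIV_ln_line:
 assumes g: "ground \<mu> K u" and nu: "norm \<xi> = 1" and p: "p + t *\<^sub>R \<xi> \<in> interior K"
 shows "((\<lambda>t. ln (u (p + t *\<^sub>R \<xi>))) has_real_derivative dd \<xi> u (p + t *\<^sub>R \<xi>) / u (p + t *\<^sub>R \<xi>)) (at t)"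
  "((\<lambda>t. dd \<xi> u (p + t *\<^sub>R \<xi>) / u (p + t *\<^sub>R \<xi>)) has_real_derivative - whess u \<xi> (p + t *\<^sub>R \<xi>)) (at t)"
  "((\<lambda>t. u (p + t *\<^sub>R \<xi>)) has_real_derivative dd \<xi> u (p + t *\<^sub>R \<xi>)) (at t)"
  "((\<lambda>t. dd \<xi> u (p + t *\<^sub>R \<xi>)) has_real_derivative dd \<xi> (dd \<xi> u) (p + t *\<^sub>R \<xi>)) (at t)"
proof -
 note G = ground_D[OF g]
 have C: "C2f (interior K) u" using G(5) by (simp add: sol_def)
 have C': "C2f (interior K) (dd \<xi> u)" using sol_dd[OF G(5) G(1) nu] by (simp add: sol_def)
 show 1: "((\<lambda>t. u (p + t *\<^sub>R \<xi>)) has_real_derivative dd \<xi> u (p + t *\<^sub>R \<xi>)) (at t)"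
  by (rule has_real_derivative_dd[OF C2f_D(1)[OF C p]])
 show 2: "((\<lambda>t. dd \<xi> u (p + t *\<^sub>R \<xi>)) has_real_derivative dd \<xi> (dd \<xi> u) (p + t *\<^sub>R \<xi>)) (at t)"
  by (rule has_real_derivative_dd[OF C2f_D(1)[OF C' p]])
 have up: "0 < u (p + t *\<^sub>R \<xi>)" using G(6) p by auto
 show "((\<lambda>t. ln (u (p + t *\<^sub>R \<xi>))) has_real_derivative dd \<xi> u (p + t *\<^sub>R \<xi>) / u (p + t *\<^sub>R \<xi>)) (at t)"
  using DERIV_chain2[of ln "1 / u (p + t *\<^sub>R \<xi>)" "\<lambda>t. u (p + t *\<^sub>R \<xi>)", OF DERIV_ln_divide[OF up] 1] by simp
 have quot: "(h * c - g * g) / (c * c) = - ((g / c)^2 - h / c)" if "c \<noteq> 0" for c g h :: real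
  using that by (simp add: field_simps power2_eq_square)
 show "((\<lambda>t. dd \<xi> u (p + t *\<^sub>R \<xi>) / u (p + t *\<^sub>R \<xi>)) has_real_derivative - whess u \<xi> (p + t *\<^sub>R \<xi>)) (at t)"
  unfolding whess_def using DERIV_divide[OF 2 1] up by (subst quot[symmetric]) auto
qed

lemma line_in_interior:
 fixes K :: "'a::real_normed_vector set"
 assumes "convex K" "p \<in> interior K" "p + T *\<^sub>R \<xi> \<in> interior K" "0 \<le> t" "t \<le> T"
 shows "p + t *\<^sub>R \<xi> \<in> interior K"
proof (cases "T = 0")
 case False
 then have T: "T > 0" using assms(4,5) by simp
 have "(1 - t / T) *\<^sub>R p + (t / T) *\<^sub>R (p + T *\<^sub>R \<xi>) \<in> interior K"
  by (rule convexD_alt[OF convex_interior[OF assms(1)] assms(2,3)]) (use assms(4,5) T in auto)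
 moreover have "(1 - t / T) *\<^sub>R p + (t / T) *\<^sub>R (p + T *\<^sub>R \<xi>) = p + t *\<^sub>R \<xi>"
  unfolding scaleR_add_right scaleR_left_diff_distrib scaleR_scaleR using T by simp
 ultimately show ?thesis by simp
qed (use assms(2,4,5) in simp)

lemma ln_u_line:
 assumes g: "ground \<mu> K u" and nu: "norm \<xi> = 1" and p: "p \<in> interior K" "p + T *\<^sub>R \<xi> \<in> interior K" and T: "0 \<le> T"
 shows "ln (u (p + T *\<^sub>R \<xi>)) - ln (u p) \<le> T * (dd \<xi> u p / u p)"
  "dd \<xi> u (p + T *\<^sub>R \<xi>) / u (p + T *\<^sub>R \<xi>) \<le> dd \<xi> u p / u p"
proof -
 note G = ground_D[OF g]
 let ?d = "\<lambda>t. dd \<xi> u (p + t *\<^sub>R \<xi>) / u (p + t *\<^sub>R \<xi>)"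
 have int: "p + t *\<^sub>R \<xi> \<in> interior K" if "0 \<le> t" "t \<le> T" for t
  using line_in_interior[OF G(3) p that] .
 have mono: "?d t \<le> ?d 0" if t: "0 \<le> t" "t \<le> T" for t
 proof (rule DERIV_nonpos_imp_nonincreasing[OF t(1)])
  fix x assume "0 \<le> x" "x \<le> t"
  then have i: "p + x *\<^sub>R \<xi> \<in> interior K" using t by (intro int) simp_all
  show "\<exists>y. (?d has_real_derivative y) (at x) \<and> y \<le> 0"
   by (rule exI, rule conjI, rule DERIV_ln_line(2)[OF g nu i]) (use whess_nonneg[OF g i nu] in simp)
 qed
 show "dd \<xi> u (p + T *\<^sub>R \<xi>) / u (p + T *\<^sub>R \<xi>) \<le> dd \<xi> u p / u p" using mono[of T] T by simp
 show "ln (u (p + T *\<^sub>R \<xi>)) - ln (u p) \<le> T * (dd \<xi> u p / u p)"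
 proof (cases "T = 0")
  case False
  then have "0 < T" using T by simp
  have "\<exists>z>0. z < T \<and> ln (u (p + T *\<^sub>R \<xi>)) - ln (u (p + 0 *\<^sub>R \<xi>)) = (T - 0) * ?d z"
   by (rule MVT2[OF \<open>0 < T\<close>], rule DERIV_ln_line(1)[OF g nu int])
  then obtain z where "z > 0" "z < T" and "ln (u (p + T *\<^sub>R \<xi>)) - ln (u p) = T * ?d z" by auto
  moreover have "T * ?d z \<le> T * ?d 0"
   by (rule mult_left_mono[OF mono T]) (use \<open>z > 0\<close> \<open>z < T\<close> in simp_all)
  ultimately show ?thesis by simp
 qed simp
qed

lemma ln_u_grad:
 assumes g: "ground \<mu> K u" and p: "p \<in> interior K" and q: "q \<in> interior K"
 shows "ln (u q) - ln (u p) \<le> (grad u p \<bullet> (q - p)) / u p"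
proof (cases "q = p")
 case False
 let ?T = "norm (q - p)" let ?\<xi> = "(1 / ?T) *\<^sub>R (q - p)"
 have T: "?T > 0" using False by simp
 have e: "p + ?T *\<^sub>R ?\<xi> = q" using T by simp
 have "ln (u (p + ?T *\<^sub>R ?\<xi>)) - ln (u p) \<le> ?T * (dd ?\<xi> u p / u p)"
  by (rule ln_u_line(1)[OF g _ p]) (use T q e in auto)
 moreover have "u differentiable at p" using ground_D(5)[OF g] p by (auto simp: sol_def C2f_def)
 then have "dd ?\<xi> u p = grad u p \<bullet> ?\<xi>" by (rule dd_eq_grad)
 then have "?T * dd ?\<xi> u p = grad u p \<bullet> (q - p)" using T by simp
 ultimately show ?thesis unfolding e by (simp only: times_divide_eq_right)
qed simp

lemma ln_u_concave:
 assumes g: "ground \<mu> K u" and p: "p \<in> interior K" and q: "q \<in> interior K" and t: "0 \<le> t" "t \<le> 1"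
 shows "(1 - t) * ln (u p) + t * ln (u q) \<le> ln (u ((1 - t) *\<^sub>R p + t *\<^sub>R q))"
proof -
 let ?z = "(1 - t) *\<^sub>R p + t *\<^sub>R q"
 have z: "?z \<in> interior K" 
  by (rule convexD_alt[OF convex_interior[OF ground_D(3)[OF g]] p q t])
 have "(1 - t) * (ln (u p) - ln (u ?z)) \<le> (1 - t) * ((grad u ?z \<bullet> (p - ?z)) / u ?z)"
  using ln_u_grad[OF g z p] t by (intro mult_left_mono) auto
 moreover have "t * (ln (u q) - ln (u ?z)) \<le> t * ((grad u ?z \<bullet> (q - ?z)) / u ?z)"
  using ln_u_grad[OF g z q] t by (intro mult_left_mono) auto
 moreover have "(1 - t) *\<^sub>R (p - ?z) + t *\<^sub>R (q - ?z) = 0" by (simp add: algebra_simps)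
 then have "grad u ?z \<bullet> ((1 - t) *\<^sub>R (p - ?z) + t *\<^sub>R (q - ?z)) = 0" by simp
 then have "(1 - t) * (grad u ?z \<bullet> (p - ?z)) + t * (grad u ?z \<bullet> (q - ?z)) = 0"
  by (simp only: inner_add_right inner_scaleR_right)
 then have "(1 - t) * ((grad u ?z \<bullet> (p - ?z)) / u ?z) + t * ((grad u ?z \<bullet> (q - ?z)) / u ?z) = 0"
  by (simp add: add_divide_distrib[symmetric])
 ultimately show ?thesis by (simp add: algebra_simps)
qed

lemma convex_superlevel:
 assumes g: "ground \<mu> K u" and \<eta>: "0 < \<eta>"
 shows "convex {p \<in> K. \<eta> \<le> u p}"
proof (rule convexI)
 fix p q :: "point" and a b :: real
 assume pq: "p \<in> {p \<in> K. \<eta> \<le> u p}" "q \<in> {p \<in> K. \<eta> \<le> u p}" and ab: "0 \<le> a" "0 \<le> b" "a + b = 1"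
 have i: "p \<in> interior K" "q \<in> interior K" using pq \<eta> ground_pos_iff[OF g] by (smt (verit) mem_Collect_eq)+
 have "ln \<eta> = (1 - b) * ln \<eta> + b * ln \<eta>" by (simp add: algebra_simps)
 also have "\<dots> \<le> (1 - b) * ln (u p) + b * ln (u q)"
  using pq ab \<eta> by (intro add_mono mult_left_mono) auto
 also have "\<dots> \<le> ln (u ((1 - b) *\<^sub>R p + b *\<^sub>R q))" by (rule ln_u_concave[OF g i]) (use ab in auto)
 finally have 1: "ln \<eta> \<le> ln (u ((1 - b) *\<^sub>R p + b *\<^sub>R q))" .
 have z: "(1 - b) *\<^sub>R p + b *\<^sub>R q \<in> interior K" 
  by (rule convexD_alt[OF convex_interior[OF ground_D(3)[OF g]] i]) (use ab in auto)
 have "\<eta> \<le> u ((1 - b) *\<^sub>R p + b *\<^sub>R q)" using 1 ground_D(6)[OF g z] \<eta> by simp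
 moreover have "a = 1 - b" using ab by simp
 ultimately show "a *\<^sub>R p + b *\<^sub>R q \<in> {p \<in> K. \<eta> \<le> u p}" using z interior_subset by auto
qed

section \<open>Maximum principles and comparison of eigenvalues\<close>

lemma max_principle:
 assumes g: "ground \<mu> K u" and A: "A \<subseteq> K" "compact A" and Qc: "continuous_on A Q"
  and bd: "\<And>z. z \<in> A \<Longrightarrow> z \<notin> interior A \<Longrightarrow> u z \<le> Q z"
  and Q: "\<And>z. z \<in> interior A \<Longrightarrow> z \<in> interior K \<Longrightarrow> u z > Q z \<Longrightarrow> \<exists>a b l. lap2 Q z a b l \<and> l < - \<mu> * u z"
  and z: "z \<in> A"
  and bd': "\<And>z. z \<in> A \<Longrightarrow> u z = 0 \<Longrightarrow> 0 \<le> Q z"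
 shows "u z \<le> Q z"
proof (rule ccontr)
 assume neg: "\<not> u z \<le> Q z"
 note G = ground_D[OF g]
 have "continuous_on A (\<lambda>z. u z - Q z)" by (intro continuous_intros Qc continuous_on_subset[OF G(4) A(1)])
 then obtain y where y: "y \<in> A" "\<And>x. x \<in> A \<Longrightarrow> u x - Q x \<le> u y - Q y"
  using continuous_attains_sup[OF A(2), of "\<lambda>z. u z - Q z"] z by blast
 have pos: "u y - Q y > 0" using y(2)[OF z] neg by simp
 have yi: "y \<in> interior A" using bd[OF y(1)] pos by force
 have yK: "y \<in> interior K" using yi A(1) interior_mono by blast
 obtain a b l where l: "lap2 Q y a b l" "l < - \<mu> * u y" using Q[OF yi yK] pos by auto
 have "lap2 (\<lambda>z. 1 * u z + (- 1) * Q z) y (1 * dd ex u y + (- 1) * a) (1 * dd ey u y + (- 1) * b) (1 * (- \<mu> * u y) + (- 1) * l)"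
  by (rule lap2_lin[OF lap2_sol[OF G(5) yK] l(1)])
 moreover have "\<forall>\<^sub>F x in nhds y. x \<in> interior A" using yi by (intro eventually_nhds_in_open) auto
 then have "\<forall>\<^sub>F x in nhds y. 1 * u x + (- 1) * Q x \<le> 1 * u y + (- 1) * Q y"
  by eventually_elim (use y(2) interior_subset[of A] in \<open>force\<close>)
 ultimately have "1 * (- \<mu> * u y) + (- 1) * l \<le> 0" by (rule lap2_max(3))
 then show False using l by simp
qed

text \<open>Here, unlike in \<open>max_principle\<close>, the inequality for the barrier involves
  \<open>Q\<close> itself. The zero-order term has the wrong sign for differences, so the quotient
  \<open>u / Q\<close> is maximised: at its maximum \<open>u\<close> equals \<open>k * Q\<close> and
  the zero-order terms match.\<close>

lemma max_principle_ratio: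
 assumes g: "ground \<mu> K u" and A: "A \<subseteq> K" "compact A" and Qc: "continuous_on A Q"
  and Qpos: "\<And>z. z \<in> A \<Longrightarrow> 0 < Q z"
  and bd: "\<And>z. z \<in> A \<Longrightarrow> z \<notin> interior A \<Longrightarrow> u z \<le> Q z"
  and Q: "\<And>z. z \<in> interior A \<Longrightarrow> z \<in> interior K \<Longrightarrow> \<exists>a b l. lap2 Q z a b l \<and> l < - \<mu> * Q z"
  and z: "z \<in> A"
 shows "u z \<le> Q z"
proof (rule ccontr)
 assume neg: "\<not> u z \<le> Q z"
 note G = ground_D[OF g]
 have "continuous_on A (\<lambda>z. u z / Q z)"
  by (intro continuous_intros Qc continuous_on_subset[OF G(4) A(1)]) (use Qpos in force)
 then obtain y where y: "y \<in> A" "\<And>x. x \<in> A \<Longrightarrow> u x / Q x \<le> u y / Q y"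
  using continuous_attains_sup[OF A(2), of "\<lambda>z. u z / Q z"] z by blast
 define k where "k = u y / Q y"
 have "1 < u z / Q z" using neg Qpos[OF z] by simp
 then have k: "1 < k" using y(2)[OF z] by (simp add: k_def)
 have uy: "u y = k * Q y" using Qpos[OF y(1)] by (simp add: k_def)
 have "1 * Q y < k * Q y" using k Qpos[OF y(1)] by (intro mult_strict_right_mono)
 then have gt: "Q y < u y" using uy by simp
 have yi: "y \<in> interior A" using bd[OF y(1)] gt by force
 have yK: "y \<in> interior K" using yi A(1) interior_mono by blast
 obtain a b l where l: "lap2 Q y a b l" "l < - \<mu> * Q y" using Q[OF yi yK] by auto
 have "lap2 (\<lambda>z. 1 * u z + (- k) * Q z) y (1 * dd ex u y + (- k) * a) (1 * dd ey u y + (- k) * b) (1 * (- \<mu> * u y) + (- k) * l)"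
  by (rule lap2_lin[OF lap2_sol[OF G(5) yK] l(1)])
 moreover have "\<forall>\<^sub>F x in nhds y. x \<in> interior A" using yi by (intro eventually_nhds_in_open) auto
 then have "\<forall>\<^sub>F x in nhds y. 1 * u x + (- k) * Q x \<le> 1 * u y + (- k) * Q y"
 proof eventually_elim
  fix x assume "x \<in> interior A"
  then have x: "x \<in> A" using interior_subset by blast
  then have "u x \<le> k * Q x" using y(2)[OF x] Qpos[OF x] unfolding k_def[symmetric] by (simp add: pos_divide_le_eq)
  then show "1 * u x + (- k) * Q x \<le> 1 * u y + (- k) * Q y" using uy by simp
 qed
 ultimately have "1 * (- \<mu> * u y) + (- k) * l \<le> 0" by (rule lap2_max(3))
 moreover have "k * l < k * (- \<mu> * Q y)" using l(2) k by (intro mult_strict_left_mono) auto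
 ultimately show False unfolding uy by (simp add: algebra_simps)
qed

lemma lap2_cos:
 "lap2 (\<lambda>z. cos (c + n \<bullet> z)) p (- sin (c + n \<bullet> p) * fst n) (- sin (c + n \<bullet> p) * snd n)
   (- (((fst n)^2 + (snd n)^2) * cos (c + n \<bullet> p)))"
proof -
 have "lap2 (\<lambda>z. cos (c + n \<bullet> z)) p ((\<lambda>x. - sin x) (c + n \<bullet> p) * fst n) ((\<lambda>x. - sin x) (c + n \<bullet> p) * snd n)
   (- cos (c + n \<bullet> p) * ((fst n)^2 + (snd n)^2) + (\<lambda>x. - sin x) (c + n \<bullet> p) * 0)"
  by (rule lap2_compose[OF lap2_affine, of UNIV]) (auto intro!: derivative_eq_intros)
 then show ?thesis by (rule lap2_eq) simp_all
qed

lemma mem_box_pair: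
 "z \<in> box (c, d) (e, f) \<longleftrightarrow> c < fst z \<and> fst z < e \<and> d < snd z \<and> snd z < (f::real)" for c e :: real
 by (cases z) (auto simp: mem_box Basis_prod_def)

lemma mem_cbox_pair:
 "z \<in> cbox (c, d) (e, f) \<longleftrightarrow> c \<le> fst z \<and> fst z \<le> e \<and> d \<le> snd z \<and> snd z \<le> (f::real)" for c e :: real
 by (cases z) (auto simp: mem_box Basis_prod_def)

text \<open>Domain monotonicity by Barta's argument instead of a variational principle: where the
  quotient of a product of cosines by the positive function \<open>u\<close> is maximal, the
  second-order test compares the two eigenvalues.\<close>

lemma ground_rectangle_le:
 assumes g: "ground \<mu> K u" and AB: "0 < A" "0 < B"
  and sub: "cbox (x0 - A, y0 - B) (x0 + A, y0 + B) \<subseteq> K"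
 shows "\<mu> \<le> (pi / (2 * A))^2 + (pi / (2 * B))^2"
proof (rule ccontr)
 let ?S = "(pi / (2 * A))^2 + (pi / (2 * B))^2"
 assume "\<not> \<mu> \<le> ?S"
 then have lt: "?S < \<mu>" by simp
 note G = ground_D[OF g]
 have S: "0 < ?S" using AB by (simp add: add_pos_pos)
 \<comment> \<open>The strict inequality leaves room to shrink the rectangle by \<open>s\<close>
   into the interior, where \<open>u > 0\<close> and the quotient is continuous.\<close>
 obtain s where s: "0 < s" "s < 1" "?S / s^2 < \<mu>"
 proof -
  define T where "T = ?S / \<mu>"
  have "0 < T" "T < 1" unfolding T_def using S lt G(1) by (simp_all only: zero_less_divide_iff pos_divide_less_eq) simp_all
  define q where "q = (T + 1) / 2"
  have q: "0 < q" "q < 1" "T < q" using \<open>0 < T\<close> \<open>T < 1\<close> by (simp_all add: q_def)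
  have "?S < q * \<mu>" using q(3) G(1) unfolding T_def by (simp only: pos_divide_less_eq)
  then have q': "?S / q < \<mu>" using q(1) by (simp only: pos_divide_less_eq mult.commute)
  show ?thesis
  proof (rule that[of "sqrt q"])
   show "0 < sqrt q" "sqrt q < 1" using q by auto
   show "?S / (sqrt q)^2 < \<mu>" using q q' by simp
  qed
 qed
 define k l where "k = pi / (2 * (s * A))" and "l = pi / (2 * (s * B))"
 have kl: "k^2 + l^2 = ?S / s^2" using s AB by (simp add: k_def l_def field_simps power2_eq_square)
 have kA: "k * (s * A) = pi / 2" "l * (s * B) = pi / 2" "k > 0" "l > 0"
  using s AB by (auto simp: k_def l_def)
 let ?R = "cbox (x0 - s * A, y0 - s * B) (x0 + s * A, y0 + s * B)"
 have R: "z \<in> ?R \<longleftrightarrow> \<bar>fst z - x0\<bar> \<le> s * A \<and> \<bar>snd z - y0\<bar> \<le> s * B" for z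
  unfolding mem_cbox_pair by auto
 have sA: "s * A < A" "s * B < B" using s AB by auto
 have RK: "?R \<subseteq> interior K"
 proof -
  have "?R \<subseteq> box (x0 - A, y0 - B) (x0 + A, y0 + B)"
  proof
   fix z assume "z \<in> ?R"
   then show "z \<in> box (x0 - A, y0 - B) (x0 + A, y0 + B)"
    unfolding R mem_box_pair using sA by auto
  qed
  also have "\<dots> \<subseteq> interior K" using sub box_subset_cbox by (intro interior_maximal open_box) blast
  finally show ?thesis .
 qed
 define \<phi> where "\<phi> z = cos (- k * x0 + (k, 0) \<bullet> z) * cos (- l * y0 + (0, l) \<bullet> z)" for z
 have \<phi>: "\<phi> z = cos (k * (fst z - x0)) * cos (l * (snd z - y0))" for z
  by (cases z) (simp add: \<phi>_def algebra_simps)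
 have "continuous_on ?R (\<lambda>z. \<phi> z / u z)"
  unfolding \<phi> using RK G(6) by (intro continuous_intros continuous_on_subset[OF G(4)]) (use RK interior_subset in \<open>force+\<close>)
 moreover have c: "(x0, y0) \<in> ?R" unfolding R using s AB by simp
 ultimately obtain y where y: "y \<in> ?R" "\<And>z. z \<in> ?R \<Longrightarrow> \<phi> z / u z \<le> \<phi> y / u y"
  using continuous_attains_sup[OF compact_cbox, of _ _ "\<lambda>z. \<phi> z / u z"] by blast
 define \<kappa> where "\<kappa> = \<phi> y / u y"
 have upos: "0 < u z" if "z \<in> ?R" for z using RK G(6) that by blast
 have "0 < \<phi> (x0, y0) / u (x0, y0)" using upos[OF c] by (simp add: \<phi>)
 then have \<kappa>: "0 < \<kappa>" using y(2)[OF c] by (simp add: \<kappa>_def)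
 have \<phi>y: "\<phi> y = \<kappa> * u y" using upos[OF y(1)] by (simp add: \<kappa>_def)
 then have \<phi>pos: "0 < \<phi> y" using \<kappa> upos[OF y(1)] by simp
 have cz: "cos (k * t) = 0" if "\<bar>t\<bar> = s * A" for t
 proof -
  have "cos (k * t) = cos (k * \<bar>t\<bar>)" by (cases "t \<ge> 0") (auto simp: abs_if)
  then show ?thesis using that kA by simp
 qed
 have cz': "cos (l * t) = 0" if "\<bar>t\<bar> = s * B" for t
 proof -
  have "cos (l * t) = cos (l * \<bar>t\<bar>)" by (cases "t \<ge> 0") (auto simp: abs_if)
  then show ?thesis using that kA by simp
 qed
 have "\<bar>fst y - x0\<bar> \<noteq> s * A" "\<bar>snd y - y0\<bar> \<noteq> s * B"
  using \<phi>pos cz[of "fst y - x0"] cz'[of "snd y - y0"] unfolding \<phi> by auto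
 then have "\<bar>fst y - x0\<bar> < s * A" "\<bar>snd y - y0\<bar> < s * B" using y(1) unfolding R by auto
 then have yb: "y \<in> box (x0 - s * A, y0 - s * B) (x0 + s * A, y0 + s * B)"
  unfolding mem_box_pair by auto
 have yK: "y \<in> interior K" using y(1) RK by blast
 have l1: "\<exists>a b. lap2 \<phi> y a b (- (k^2 + l^2) * \<phi> y)"
  unfolding \<phi>_def
  by (intro exI, rule lap2_eq[OF lap2_mult[OF lap2_cos[of "- k * x0" "(k, 0)" y] lap2_cos[of "- l * y0" "(0, l)" y]]])
    (simp_all add: algebra_simps)
 then obtain a b where "lap2 \<phi> y a b (- (k^2 + l^2) * \<phi> y)" by blast
 from lap2_lin[OF this lap2_sol[OF G(5) yK], of 1 "- \<kappa>"]
 have "lap2 (\<lambda>z. 1 * \<phi> z + (- \<kappa>) * u z) y (1 * a + (- \<kappa>) * dd ex u y) (1 * b + (- \<kappa>) * dd ey u y)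
   (1 * (- (k^2 + l^2) * \<phi> y) + (- \<kappa>) * (- \<mu> * u y))" .
 moreover have "\<forall>\<^sub>F z in nhds y. z \<in> box (x0 - s * A, y0 - s * B) (x0 + s * A, y0 + s * B)"
  using yb by (intro eventually_nhds_in_open) auto
 then have "\<forall>\<^sub>F z in nhds y. 1 * \<phi> z + (- \<kappa>) * u z \<le> 1 * \<phi> y + (- \<kappa>) * u y"
 proof eventually_elim
  fix z assume "z \<in> box (x0 - s * A, y0 - s * B) (x0 + s * A, y0 + s * B)"
  then have z: "z \<in> ?R" using box_subset_cbox by blast
  then have "\<phi> z \<le> \<kappa> * u z" using y(2)[OF z] upos[OF z] unfolding \<kappa>_def[symmetric] by (simp add: pos_divide_le_eq)
  then show "1 * \<phi> z + (- \<kappa>) * u z \<le> 1 * \<phi> y + (- \<kappa>) * u y" using \<phi>y by simp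
 qed
 ultimately have "1 * (- (k^2 + l^2) * \<phi> y) + (- \<kappa>) * (- \<mu> * u y) \<le> 0" by (rule lap2_max(3))
 then have "(\<mu> - (k^2 + l^2)) * \<phi> y \<le> 0" unfolding \<phi>y by (simp add: algebra_simps)
 then show False using \<phi>pos s(3) kl by (simp add: mult_le_0_iff)
qed

section \<open>Upper bounds on normalised domains\<close>

text \<open>What is used of a normalised domain: \<open>xs\<close> carries a vertical chord of length \<open>1\<close>, the
 first rectangle comes from the interval defining \<open>L\<close>, and the bound on vertical sections from the failure
 of \<open>2 * L\<close> as a length scale.  The predicate is invariant under reflections in both coordinates.\<close>

definition dom :: "point set \<Rightarrow> real \<Rightarrow> (point \<Rightarrow> real) \<Rightarrow> real \<Rightarrow> real \<Rightarrow> bool" where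
 "dom K \<mu> u xs L \<longleftrightarrow> ground \<mu> K u \<and> (\<forall>z\<in>K. 0 \<le> snd z \<and> snd z \<le> 1) \<and> (xs, 0) \<in> K \<and> (xs, 1) \<in> K \<and> 1 \<le> L
   \<and> (2 \<le> L \<longrightarrow> (\<exists>\<alpha>. cbox (\<alpha> - L/2, 1/2 - (1/2 - 1/L^2)) (\<alpha> + L/2, 1/2 + (1/2 - 1/L^2)) \<subseteq> K))
   \<and> (\<exists>\<alpha>. cbox (\<alpha> - 1/16, 1/2 - 1/4) (\<alpha> + 1/16, 1/2 + 1/4) \<subseteq> K)
   \<and> (\<forall>x y y'. (x, y) \<in> K \<longrightarrow> (x, y') \<in> K \<longrightarrow> 2 * L \<le> \<bar>x - xs\<bar> \<longrightarrow> \<bar>y - y'\<bar> \<le> 1 - \<bar>x - xs\<bar> / (8 * L^3))"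

lemma dom_D:
 assumes "dom K \<mu> u xs L"
 shows "ground \<mu> K u" "z \<in> K \<Longrightarrow> 0 \<le> snd z" "z \<in> K \<Longrightarrow> snd z \<le> 1" "(xs, 0) \<in> K" "(xs, 1) \<in> K" "1 \<le> L"
  "(x, y) \<in> K \<Longrightarrow> (x, y') \<in> K \<Longrightarrow> 2 * L \<le> \<bar>x - xs\<bar> \<Longrightarrow> \<bar>y - y'\<bar> \<le> 1 - \<bar>x - xs\<bar> / (8 * L^3)"
 using assms by (auto simp: dom_def)

lemma pi_sq_bounds: "9 < pi^2" "pi^2 < 10"
proof -
 have "3^2 < pi^2" by (rule power_strict_mono) (use pi_gt3 in auto)
 then show "9 < pi^2" by simp
 have "pi < 3.15" using pi_approx by simp
 then have "pi^2 < 3.15^2" by (intro power_strict_mono) auto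
 then show "pi^2 < 10" by (simp add: power2_eq_square)
qed

text \<open>For \<open>L \<ge> 2\<close> the long rectangle gives \<open>pi^2 + O(1 / L^2)\<close>.
  For \<open>L < 2\<close> the small fixed rectangle gives
  \<open>68 * pi^2 \<le> pi^2 + 670\<close>, and \<open>670 = 2680 / 2^2\<close> fixes the constant
  2680; with \<open>L \<ge> 1\<close> and \<open>pi^2 < 10\<close> this yields 2690.\<close>

lemma dom_mu_le:
 assumes d: "dom K \<mu> u xs L"
 shows "\<mu> \<le> pi^2 + 2680 / L^2" "\<mu> < 2690" "0 < \<mu>"
proof -
 note D = dom_D[OF d] 
 note G = ground_D[OF D(1)]
 show "0 < \<mu>" by (rule G(1))
 show 1: "\<mu> \<le> pi^2 + 2680 / L^2"
 proof (cases "2 \<le> L")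
  case True
  then obtain \<alpha> where "cbox (\<alpha> - L/2, 1/2 - (1/2 - 1/L^2)) (\<alpha> + L/2, 1/2 + (1/2 - 1/L^2)) \<subseteq> K"
   using d by (auto simp: dom_def)
  have L4: "4 \<le> L^2" using power_mono[OF True, of 2] by simp
  define z where "z = 2 / L^2"
  have "0 < L^2" using True by simp
  then have z: "0 < z" "z \<le> 1/2" using L4 by (simp_all add: z_def pos_divide_le_eq)
  have "\<mu> \<le> (pi / (2 * (L/2)))^2 + (pi / (2 * (1/2 - 1/L^2)))^2"
  proof (rule ground_rectangle_le[OF D(1)])
   show "cbox (\<alpha> - L/2, 1/2 - (1/2 - 1/L^2)) (\<alpha> + L/2, 1/2 + (1/2 - 1/L^2)) \<subseteq> K" by fact
   show "0 < 1/2 - 1/L^2" using z by (simp add: z_def)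
  qed (use True in simp)
  also have "pi / (2 * (1/2 - 1/L^2)) = pi / (1 - z)" by (simp add: z_def algebra_simps)
  also have "(pi / (2 * (L/2)))^2 = pi^2 * (z / 2)" by (simp add: z_def power_divide)
  also have "(pi / (1 - z))^2 \<le> pi^2 * (1 + 6 * z)"
  proof -
   have "1 \<le> (1 + 6 * z) * (1 - z)^2"
   proof -
    have "(1 + 6 * z) * (1 - z)^2 - 1 = z * (4 - 11 * z + 6 * z^2)" by (simp add: power2_eq_square algebra_simps)
    also have "4 - 11 * z + 6 * z^2 = (1 - 2 * z) * (4 - 3 * z)" by (simp add: power2_eq_square algebra_simps)
    finally have "(1 + 6 * z) * (1 - z)^2 - 1 = z * ((1 - 2 * z) * (4 - 3 * z))" .
    moreover have "0 \<le> z * ((1 - 2 * z) * (4 - 3 * z))" using z by (intro mult_nonneg_nonneg) simp_all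
    ultimately show ?thesis by linarith
   qed
   then have "1 / (1 - z)^2 \<le> 1 + 6 * z" using z by (simp add: pos_divide_le_eq)
   then have "pi^2 * (1 / (1 - z)^2) \<le> pi^2 * (1 + 6 * z)" by (intro mult_left_mono) auto
   then show ?thesis by (simp add: power_divide)
  qed
  finally have "\<mu> \<le> pi^2 + pi^2 * (13/2 * z)" by (simp add: algebra_simps)
  also have "pi^2 * (13/2 * z) \<le> 10 * (13/2 * z)" using pi_sq_bounds z by (intro mult_right_mono) auto
  also have "\<dots> \<le> 2680 / L^2" using L4 by (simp add: z_def divide_right_mono)
  finally show ?thesis by simp
 next
  case False
  obtain \<alpha> where s: "cbox (\<alpha> - 1/16, 1/2 - 1/4) (\<alpha> + 1/16, 1/2 + 1/4) \<subseteq> K" using d by (auto simp: dom_def)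
  have "\<mu> \<le> (pi / (2 * (1/16)))^2 + (pi / (2 * (1/4)))^2"
   by (rule ground_rectangle_le[OF D(1) _ _ s]) auto
  also have "\<dots> = pi^2 + 67 * pi^2" by (simp add: power_mult_distrib)
  also have "\<dots> \<le> pi^2 + 670" using pi_sq_bounds by simp
  also have "670 \<le> 2680 / L^2"
  proof -
   have "L^2 \<le> 2^2" using False D(6) by (intro power_mono) auto
   moreover have "0 < L^2" using D(6) by simp
   ultimately show ?thesis by (simp add: field_simps)
  qed
  finally show ?thesis by simp
 qed
 have "1 \<le> L^2" using D(6) by simp
 then have "2680 / L^2 \<le> 2680 / 1" by (intro divide_left_mono) auto
 then have "2680 / L^2 \<le> 2680" by simp
 with 1 pi_sq_bounds show "\<mu> < 2690" by linarith
qed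

lemma lap2_quad:
 assumes n: "norm n = 1"
 shows "\<exists>a b. lap2 (\<lambda>z. A * (n \<bullet> z - c) - B * (n \<bullet> z - c)^2) p a b (- 2 * B)"
proof -
 have nn: "(fst n)^2 + (snd n)^2 = 1" using n by (cases n) (simp add: norm_Pair)
 have "lap2 (\<lambda>z. (\<lambda>t. A * t - B * t^2) (- c + n \<bullet> z)) p ((\<lambda>t. A - 2 * B * t) (- c + n \<bullet> p) * fst n) ((\<lambda>t. A - 2 * B * t) (- c + n \<bullet> p) * snd n)
   ((- 2 * B) * ((fst n)^2 + (snd n)^2) + (\<lambda>t. A - 2 * B * t) (- c + n \<bullet> p) * 0)"
  by (rule lap2_compose[OF lap2_affine, of UNIV]) (auto intro!: derivative_eq_intros)
 then show ?thesis unfolding nn by auto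
qed

lemma quad_nonneg:
 fixes t :: real
 assumes "0 \<le> t" "t \<le> 1"
 shows "0 \<le> 1350 * t - 1349 * t^2"
proof -
 have "t^2 \<le> t * 1" unfolding power2_eq_square using assms by (intro mult_left_mono) auto
 then show ?thesis using assms by linarith
qed

lemma interior_IntI_open:
 assumes "z \<in> interior K" "open V" "z \<in> V" "V \<inter> interior K \<subseteq> A"
 shows "z \<in> interior A"
 using assms by (meson IntI interiorI open_Int open_interior)

text \<open>The profile \<open>1350 * t - 1349 * t^2\<close> in the distance \<open>t\<close> to the
  line equals 1 at \<open>t = 1\<close> and has Laplacian \<open>- 2698\<close>, which is below
  \<open>- \<mu> * u\<close> because \<open>\<mu> < 2690\<close> and
  \<open>u \<le> 1\<close>.\<close>

lemma dom_linear_bound: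
 assumes d: "dom K \<mu> u xs L" and n: "norm n = 1" and c: "\<And>z. z \<in> K \<Longrightarrow> c \<le> n \<bullet> z" and z: "z \<in> K"
 shows "u z \<le> 1350 * (n \<bullet> z - c)"
proof (cases "n \<bullet> z - c \<le> 1")
 case True
 note D = dom_D[OF d]
 note G = ground_D[OF D(1)]
 note M = dom_mu_le[OF d]
 let ?A = "{z \<in> K. n \<bullet> z \<le> c + 1}"
 let ?Q = "\<lambda>z. 1350 * (n \<bullet> z - c) - 1349 * (n \<bullet> z - c)^2"
 have cA: "compact ?A"
  using compact_Int_closed[OF G(2) closed_halfspace_le[of n "c + 1"]] by (simp add: Int_def)
 have Q0: "0 \<le> ?Q z" if "z \<in> ?A" for z
 proof -
  have t: "0 \<le> n \<bullet> z - c" "n \<bullet> z - c \<le> 1" using that c[of z] by auto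
  then show ?thesis by (rule quad_nonneg)
 qed
 have "u z \<le> ?Q z"
 proof (rule max_principle[OF D(1) _ cA])
  show "continuous_on ?A ?Q" by (intro continuous_intros)
  show "z \<in> ?A" using z True by auto
  fix w assume w: "w \<in> ?A"
  show "0 \<le> ?Q w" using Q0[OF w] .
  assume wi: "w \<notin> interior ?A"
  show "u w \<le> ?Q w"
  proof (cases "w \<in> interior K")
   case True
   have "\<not> n \<bullet> w < c + 1"
    using wi interior_IntI_open[OF True open_halfspace_lt[of n "c+1"], of ?A] interior_subset[of K] by fastforce
   then have "n \<bullet> w - c = 1" using w by auto
   then show ?thesis using G(7)[of w] w by simp
  next
   case False
   then have "u w \<le> 0" using ground_pos_iff[OF D(1), of w] w by auto
   then show ?thesis using Q0[OF w] by linarith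
  qed
 next
  fix w assume "w \<in> interior ?A" "w \<in> interior K"
  then have "w \<in> K" using interior_subset by blast
  have "\<mu> * u w \<le> 2690 * 1"
   using M G(7)[OF \<open>w \<in> K\<close>] ground_nonneg[OF D(1) \<open>w \<in> K\<close>] by (intro mult_mono) auto
  then show "\<exists>a b l. lap2 ?Q w a b l \<and> l < - \<mu> * u w"
   using lap2_quad[OF n, of 1350 c 1349 w] by fastforce
 qed auto
 moreover have "?Q z \<le> 1350 * (n \<bullet> z - c)" by simp
 ultimately show ?thesis by linarith
next
 case False
 then show ?thesis using ground_D(7)[OF dom_D(1)[OF d] z] by simp
qed

text \<open>The same profile scaled by the local bound \<open>\<eta>\<close>. The term
  \<open>\<eta> * (x - x3)^2\<close> lifts the barrier to at least \<open>\<eta>\<close> on the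
  vertical lines at distance 1 and costs only \<open>2 * \<eta>\<close> in the Laplacian.\<close>

lemma dom_edge_bound:
 assumes d: "dom K \<mu> u xs L" and n: "norm n = 1" and c: "\<And>z. z \<in> K \<Longrightarrow> c \<le> n \<bullet> z \<and> n \<bullet> z \<le> c + 1"
  and \<eta>: "0 < \<eta>" "\<And>z. z \<in> K \<Longrightarrow> x2 \<le> fst z \<Longrightarrow> u z \<le> \<eta>"
  and z: "z \<in> K" "x2 + 1 \<le> fst z"
 shows "u z \<le> 1350 * \<eta> * (n \<bullet> z - c)"
proof -
 note D = dom_D[OF d]
 note G = ground_D[OF D(1)]
 note M = dom_mu_le[OF d]
 define x3 where "x3 = fst z"
 let ?A = "{w \<in> K. \<bar>fst w - x3\<bar> \<le> 1}"
 let ?q = "\<lambda>z. 1350 * (n \<bullet> z - c) - 1349 * (n \<bullet> z - c)^2"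
 let ?Q = "\<lambda>z. \<eta> * (- x3 + ex \<bullet> z)^2 + \<eta> * ?q z"
 have "closed {w :: point. \<bar>fst w - x3\<bar> \<le> 1}" by (intro closed_Collect_le continuous_intros)
 from compact_Int_closed[OF G(2) this] have cA: "compact ?A" by (simp add: Int_def)
 have q0: "0 \<le> ?q z" if "z \<in> K" for z
 proof -
  have t: "0 \<le> n \<bullet> z - c" "n \<bullet> z - c \<le> 1" using c[OF that] by auto
  then show ?thesis by (rule quad_nonneg)
 qed
 have Q0: "0 \<le> ?Q z" if "z \<in> ?A" for z using q0[of z] that \<eta>(1) by simp
 have "u z \<le> ?Q z"
 proof (rule max_principle[OF D(1) _ cA])
  show "continuous_on ?A ?Q" by (intro continuous_intros)
  show "z \<in> ?A" using z by (auto simp: x3_def)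
  fix w assume w: "w \<in> ?A"
  show "0 \<le> ?Q w" using Q0[OF w] .
  assume wi: "w \<notin> interior ?A"
  show "u w \<le> ?Q w"
  proof (cases "w \<in> interior K")
   case True
   have o: "open {w :: point. \<bar>fst w - x3\<bar> < 1}" by (intro open_Collect_less continuous_intros)
   have "\<not> \<bar>fst w - x3\<bar> < 1"
    using wi interior_IntI_open[OF True o, of ?A] interior_subset[of K] by fastforce
   then have "\<bar>fst w - x3\<bar> = 1" using w by auto
   then have "(fst w - x3)^2 = 1" by (metis power2_abs power_one)
   then have sq: "(- x3 + ex \<bullet> w)^2 = 1" by (cases w) simp
   have "x2 \<le> fst w" using w z(2) by (auto simp: x3_def)
   then have "u w \<le> \<eta> * 1" using \<eta>(2)[of w] w by simp
   moreover have "0 \<le> \<eta> * ?q w" using \<eta>(1) q0[of w] w by (intro mult_nonneg_nonneg) simp_all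
   ultimately show ?thesis unfolding sq by linarith
  next
   case False
   then have "u w \<le> 0" using ground_pos_iff[OF D(1), of w] w by auto
   then show ?thesis using Q0[OF w] by linarith
  qed
 next
  fix w assume w: "w \<in> interior ?A" "w \<in> interior K"
  then have wA: "w \<in> ?A" using interior_subset by blast
  then have uw: "u w \<le> \<eta>" "0 \<le> u w" using \<eta>(2)[of w] z(2) ground_nonneg[OF D(1), of w] by (auto simp: x3_def)
  have "\<mu> * u w \<le> 2690 * \<eta>" using M uw by (intro mult_mono) auto
  obtain a b where q: "lap2 ?q w a b (- 2 * 1349)" using lap2_quad[OF n, of 1350 c 1349 w] by blast
  have a: "lap2 (\<lambda>z. - x3 + ex \<bullet> z) w 1 0 0" using lap2_affine[of "- x3" ex w] by simp
  have "lap2 (\<lambda>z. \<eta> * ((- x3 + ex \<bullet> z) * (- x3 + ex \<bullet> z)) + \<eta> * ?q z) w (\<eta> * (1 * (- x3 + ex \<bullet> w) + (- x3 + ex \<bullet> w) * 1) + \<eta> * a)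
    (\<eta> * (0 * (- x3 + ex \<bullet> w) + (- x3 + ex \<bullet> w) * 0) + \<eta> * b) (\<eta> * (0 * (- x3 + ex \<bullet> w) + 2 * (1 * 1 + 0 * 0) + (- x3 + ex \<bullet> w) * 0) + \<eta> * (- 2 * 1349))"
   by (rule lap2_lin[OF lap2_mult[OF a a] q])
  moreover have "\<eta> * (0 * (- x3 + ex \<bullet> w) + 2 * (1 * 1 + 0 * 0) + (- x3 + ex \<bullet> w) * 0) + \<eta> * (- 2 * 1349) < - \<mu> * u w"
   using \<open>\<mu> * u w \<le> 2690 * \<eta>\<close> \<eta>(1) by simp
  ultimately show "\<exists>a b l. lap2 ?Q w a b l \<and> l < - \<mu> * u w" unfolding power2_eq_square[of "- x3 + ex \<bullet> _"] by blast
 qed auto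
 moreover have "- x3 + ex \<bullet> z = 0" by (cases z) (simp add: x3_def)
 ultimately have "u z \<le> \<eta> * ?q z" by simp
 also have "\<dots> \<le> \<eta> * (1350 * (n \<bullet> z - c))" using \<eta>(1) by (intro mult_left_mono) auto
 finally show ?thesis by (simp add: mult_ac)
qed

text \<open>A line separating \<open>K\<close> from an outside point is fed into the linear bound,
  which turns the size of \<open>u p\<close> into a distance.\<close>

lemma dom_ball:
 assumes d: "dom K \<mu> u xs L" and p: "p \<in> K"
 shows "ball p (u p / 1350) \<subseteq> interior K"
proof -
 note D = dom_D[OF d]
 note G = ground_D[OF D(1)]
 have "ball p (u p / 1350) \<subseteq> K"
 proof
  fix w assume w: "w \<in> ball p (u p / 1350)"
  show "w \<in> K"
  proof (rule ccontr)
   assume wK: "w \<notin> K"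
   obtain a b where ab: "a \<bullet> w < b" "\<And>x. x \<in> K \<Longrightarrow> b < a \<bullet> x"
    using separating_hyperplane_closed_point[OF G(3) compact_imp_closed[OF G(2)] wK] by blast
   have "a \<noteq> 0" using ab(1) ab(2)[OF p] by auto
   then have na: "norm a > 0" by simp
   define n where "n = (1 / norm a) *\<^sub>R a"
   have n: "norm n = 1" using na by (simp add: n_def)
   have "u p \<le> 1350 * (n \<bullet> p - b / norm a)"
    by (rule dom_linear_bound[OF d n _ p]) (use ab(2) na in \<open>simp add: n_def divide_right_mono less_imp_le\<close>)
   moreover have "n \<bullet> w \<le> b / norm a" using ab(1) na by (simp add: n_def divide_right_mono less_imp_le)
   ultimately have "u p \<le> 1350 * (n \<bullet> p - n \<bullet> w)" by argo
   also have "n \<bullet> p - n \<bullet> w \<le> dist p w"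
    using Cauchy_Schwarz_ineq2[of n "p - w"] n by (simp add: dist_norm inner_diff_right)
   finally show False using w by simp
  qed
 qed
 then show ?thesis by (intro interior_maximal) auto
qed

lemma support_at:
 fixes K :: "point set"
 assumes K: "convex K" "interior K \<noteq> {}" and p: "p \<in> K" "p \<notin> interior K"
 shows "\<exists>n. norm n = 1 \<and> (\<forall>x\<in>K. n \<bullet> p \<le> n \<bullet> x)"
proof -
 have "p \<notin> rel_interior K" using p K rel_interior_nonempty_interior[of K] by simp
 from supporting_hyperplane_relative_frontier[OF K(1) subsetD[OF closure_subset p(1)] this]
 obtain a where a: "a \<noteq> 0" "\<And>y. y \<in> closure K \<Longrightarrow> a \<bullet> p \<le> a \<bullet> y" by metis
 have na: "norm a > 0" using a by simp
 have "((1 / norm a) *\<^sub>R a) \<bullet> p \<le> ((1 / norm a) *\<^sub>R a) \<bullet> x" if "x \<in> K" for x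
  using a(2)[OF subsetD[OF closure_subset that]] na by (simp add: divide_right_mono)
 then show ?thesis using na by (intro exI[of _ "(1 / norm a) *\<^sub>R a"]) simp
qed

section \<open>Reflections of the domain\<close>

definition mirror :: "real \<Rightarrow> real \<Rightarrow> real \<Rightarrow> point \<Rightarrow> point" where
 "mirror \<sigma> \<tau> b z = (\<sigma> * fst z, b + \<tau> * snd z)"

definition rlin :: "real \<Rightarrow> real \<Rightarrow> point \<Rightarrow> point" where
 "rlin \<sigma> \<tau> z = (\<sigma> * fst z, \<tau> * snd z)"

lemma refl_add: "mirror \<sigma> \<tau> b (p + t *\<^sub>R \<nu>) = mirror \<sigma> \<tau> b p + t *\<^sub>R rlin \<sigma> \<tau> \<nu>"
 by (simp add: mirror_def rlin_def algebra_simps)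

lemma dd_refl: "dd \<nu> (\<lambda>z. P (mirror \<sigma> \<tau> b z)) = (\<lambda>z. dd (rlin \<sigma> \<tau> \<nu>) P (mirror \<sigma> \<tau> b z))"
 by (rule ext) (simp add: dd_def refl_add)

lemma dd_scale:
 assumes "P differentiable at q" shows "dd (c *\<^sub>R \<nu>) P q = c * dd \<nu> P q"
 using assms by (simp add: dd_eq_grad)

lemma refl_has_derivative: "(mirror \<sigma> \<tau> b has_derivative rlin \<sigma> \<tau>) (at z)"
 unfolding mirror_def[abs_def] rlin_def[abs_def]
 by (auto intro!: derivative_eq_intros has_derivative_Pair)

lemma continuous_refl: "continuous_on A (mirror \<sigma> \<tau> b)"
 unfolding mirror_def[abs_def] by (intro continuous_intros)

lemma rlin_basis: "rlin \<sigma> \<tau> ex = \<sigma> *\<^sub>R ex" "rlin \<sigma> \<tau> ey = \<tau> *\<^sub>R ey"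
 by (simp_all add: rlin_def)

lemma differentiable_refl:
 fixes P :: "point \<Rightarrow> real"
 assumes "P differentiable at (mirror \<sigma> \<tau> b z)"
 shows "(\<lambda>z. P (mirror \<sigma> \<tau> b z)) differentiable at z"
 using has_derivative_compose[OF refl_has_derivative grad_has_derivative[OF assms]] by (rule differentiableI)

lemma sol_refl:
 assumes P: "sol \<mu> V P" and s: "\<sigma>^2 = 1" "\<tau>^2 = 1"
 shows "sol \<mu> (mirror \<sigma> \<tau> b -` V) (\<lambda>z. P (mirror \<sigma> \<tau> b z))"
proof -
 let ?T = "mirror \<sigma> \<tau> b" let ?W = "?T -` V"
 have C: "C2f V P" using P by (simp add: sol_def)
 have W: "open ?W" using C continuous_refl[of UNIV] by (simp add: C2f_def open_vimage)
 define s where "s i = (if i = ex then \<sigma> else \<tau>)" for i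
 have si: "rlin \<sigma> \<tau> i = s i *\<^sub>R i" if "i \<in> {ex, ey}" for i using that by (auto simp: rlin_basis s_def)
 have d1: "dd i (\<lambda>z. P (?T z)) z = s i * dd i P (?T z)" if "z \<in> ?W" "i \<in> {ex,ey}" for z i
  using dd_scale[OF C2f_D(1)[OF C], of "?T z" "s i" i] that by (simp add: dd_refl si[OF that(2)])
 have e1: "(\<lambda>z. s i * dd i P (?T z)) differentiable at z" if "z \<in> ?W" "i \<in> {ex,ey}" for z i
  by (intro differentiable_mult differentiable_const differentiable_refl C2f_D(2)[OF C]) (use that in auto)
 have d2: "dd j (dd i (\<lambda>z. P (?T z))) z = s i * s j * dd j (dd i P) (?T z)" if z: "z \<in> ?W" and ij: "i \<in> {ex,ey}" "j \<in> {ex,ey}" for z i j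
 proof -
  have "dd j (dd i (\<lambda>z. P (?T z))) z = dd j (\<lambda>z. s i * dd i P (?T z) + 0 * dd i P (?T z)) z"
   by (rule dd_cong[OF W z]) (simp only: d1 ij mult_zero_left add_0_right)
  also have "\<dots> = s i * dd j (\<lambda>z. dd i P (?T z)) z + 0 * dd j (\<lambda>z. dd i P (?T z)) z"
   by (rule dd_lin(1); rule differentiable_refl, rule C2f_D(2)[OF C _ ij(1)], use z in simp)
  also have "dd j (\<lambda>z. dd i P (?T z)) z = s j * dd j (dd i P) (?T z)"
   using dd_scale[OF C2f_D(2)[OF C _ ij(1)], of "?T z" "s j" j] z by (simp add: dd_refl si[OF ij(2)])
  finally show ?thesis by simp
 qed
 have "C2f ?W (\<lambda>z. P (?T z))"
  unfolding C2f_def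
 proof (intro conjI ballI W)
  fix z assume z: "z \<in> ?W"
  then show "(\<lambda>z. P (?T z)) differentiable at z" by (intro differentiable_refl C2f_D(1)[OF C]) simp
  show "dd ex (\<lambda>z. P (?T z)) differentiable at z"
   by (rule differentiable_cong_open[OF W z d1[symmetric] e1[OF z]]) auto
  show "dd ey (\<lambda>z. P (?T z)) differentiable at z"
   by (rule differentiable_cong_open[OF W z d1[symmetric] e1[OF z]]) auto
 next
  fix i j assume ij: "i \<in> {ex, ey}" "j \<in> {ex, ey}"
  have cc: "continuous_on V (dd i (dd j P))" using C ij unfolding C2f_def by blast
  have "continuous_on ?W (\<lambda>z. s j * s i * dd i (dd j P) (?T z))"
   by (intro continuous_intros continuous_on_compose2[OF cc continuous_refl]) auto
  then show "continuous_on ?W (dd i (dd j (\<lambda>z. P (?T z))))"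
   by (subst continuous_on_cong[OF refl d2[OF _ ij(2,1)]])
 qed
 moreover have "dd ex (dd ex (\<lambda>z. P (?T z))) z + dd ey (dd ey (\<lambda>z. P (?T z))) z = - \<mu> * P (?T z)" if z: "z \<in> ?W" for z
 proof -
  have "s ex * s ex = 1" "s ey * s ey = 1" using s by (auto simp: s_def power2_eq_square)
  then show ?thesis using d2[OF z, of ex ex] d2[OF z, of ey ey] P z by (simp add: sol_def)
 qed
 ultimately show ?thesis by (simp add: sol_def)
qed

lemma interior_vimage_involution:
 fixes T :: "'a::topological_space \<Rightarrow> 'a"
 assumes T: "\<And>x. T (T x) = x" and c: "continuous_on UNIV T"
 shows "interior (T -` K) = T -` interior K" "closure (T -` K) = T -` closure K" "frontier (T -` K) = T -` frontier K"
proof -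
 have *: "interior (T -` K) = T -` interior K" for K
 proof
  show "T -` interior K \<subseteq> interior (T -` K)"
   by (intro interior_maximal open_vimage[OF open_interior c] vimage_mono interior_subset)
  have "T -` interior (T -` K) \<subseteq> interior K"
  proof (intro interior_maximal open_vimage[OF open_interior c])
   show "T -` interior (T -` K) \<subseteq> K"
    using interior_subset[of "T -` K"] T by (metis subsetD subsetI vimageD vimageE)
  qed
  then show "interior (T -` K) \<subseteq> T -` interior K" using T by (metis subsetD subsetI vimageI2)
 qed
 show "interior (T -` K) = T -` interior K" by (rule *)
 show cl: "closure (T -` K) = T -` closure K"
  unfolding closure_interior using *[of "- K"] by (simp add: vimage_Compl)
 show "frontier (T -` K) = T -` frontier K"
  unfolding frontier_def * cl by (simp add: vimage_Diff)
qed

lemma ground_refl: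
 assumes g: "ground \<mu> K u" and s: "\<sigma>^2 = 1" "\<tau>^2 = 1" and T: "\<And>z. mirror \<sigma> \<tau> b (mirror \<sigma> \<tau> b z) = z"
 shows "ground \<mu> (mirror \<sigma> \<tau> b -` K) (\<lambda>z. u (mirror \<sigma> \<tau> b z))"
proof -
 let ?T = "mirror \<sigma> \<tau> b"
 note G = ground_D[OF g]
 note I = interior_vimage_involution[OF T continuous_refl]
 have im: "?T -` K = ?T ` K" using T by (metis (no_types, lifting) image_eqI subsetI subset_antisym vimageE vimageI2 image_subsetI)
 have "compact (?T -` K)" unfolding im by (rule compact_continuous_image[OF continuous_refl G(2)])
 moreover have "convex (?T -` K)"
 proof (rule convexI)
  fix x y :: "point" and a c :: real
  assume *: "x \<in> ?T -` K" "y \<in> ?T -` K" "0 \<le> a" "0 \<le> c" "a + c = 1"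
  have "b = a * b + c * b" using *(5) by (metis distrib_right mult_1)
  then have "?T (a *\<^sub>R x + c *\<^sub>R y) = a *\<^sub>R ?T x + c *\<^sub>R ?T y" by (simp add: mirror_def algebra_simps)
  then show "a *\<^sub>R x + c *\<^sub>R y \<in> ?T -` K" using convexD[OF G(3), of "?T x" "?T y" a c] * by simp
 qed
 moreover have "continuous_on (?T -` K) (\<lambda>z. u (?T z))"
  by (rule continuous_on_compose2[OF G(4) continuous_refl]) auto
 moreover have "\<exists>p\<in>?T -` K. u (?T p) = 1"
 proof -
  obtain m where "m \<in> K" "u m = 1" using g by (auto simp: ground_def)
  then show ?thesis using T by (intro bexI[of _ "?T m"]) auto
 qed
 ultimately show ?thesis unfolding ground_def I
  using G(1,6-8) sol_refl[OF G(5) s, of b] by simp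
qed

lemma refl_involution: "mirror (-1) 1 0 (mirror (-1) 1 0 z) = z" "mirror 1 (-1) 1 (mirror 1 (-1) 1 z) = z"
 by (simp_all add: mirror_def)

lemma dom_refl_x:
 assumes d: "dom K \<mu> u xs L"
 shows "dom (mirror (-1) 1 0 -` K) \<mu> (\<lambda>z. u (mirror (-1) 1 0 z)) (- xs) L"
proof -
 let ?T = "mirror (-1) 1 0"
 note D = dom_D[OF d]
 have box: "cbox (- \<alpha> - A, c) (- \<alpha> + A, e) \<subseteq> ?T -` K" if "cbox (\<alpha> - A, c) (\<alpha> + A, e) \<subseteq> K" for \<alpha> A c e :: real
 proof
  fix z assume "z \<in> cbox (- \<alpha> - A, c) (- \<alpha> + A, e)"
  then have "?T z \<in> cbox (\<alpha> - A, c) (\<alpha> + A, e)" unfolding mem_cbox_pair by (auto simp: mirror_def)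
  then show "z \<in> ?T -` K" using that by blast
 qed
 have "ground \<mu> (?T -` K) (\<lambda>z. u (?T z))" by (rule ground_refl[OF D(1) _ _ refl_involution(1)]) auto
 moreover have "\<forall>z\<in>?T -` K. 0 \<le> snd z \<and> snd z \<le> 1" using D(2,3) by (fastforce simp: mirror_def)
 moreover have "(- xs, 0) \<in> ?T -` K" "(- xs, 1) \<in> ?T -` K" using D(4,5) by (simp_all add: mirror_def)
 moreover have "2 \<le> L \<longrightarrow> (\<exists>\<alpha>. cbox (\<alpha> - L/2, 1/2 - (1/2 - 1/L^2)) (\<alpha> + L/2, 1/2 + (1/2 - 1/L^2)) \<subseteq> ?T -` K)"
  using d box unfolding dom_def by meson
 moreover have "\<exists>\<alpha>. cbox (\<alpha> - 1/16, 1/2 - 1/4) (\<alpha> + 1/16, 1/2 + 1/4) \<subseteq> ?T -` K"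
  using d box unfolding dom_def by meson
 moreover have "\<bar>y - y'\<bar> \<le> 1 - \<bar>x - - xs\<bar> / (8 * L^3)" if "(x, y) \<in> ?T -` K" "(x, y') \<in> ?T -` K" "2 * L \<le> \<bar>x - - xs\<bar>" for x y y'
 proof -
  have "\<bar>- x - xs\<bar> = \<bar>x - - xs\<bar>" by simp
  then show ?thesis using D(7)[of "- x" y y'] that by (simp add: mirror_def)
 qed
 ultimately show ?thesis unfolding dom_def using D(6) by blast
qed

lemma dom_refl_y:
 assumes d: "dom K \<mu> u xs L"
 shows "dom (mirror 1 (-1) 1 -` K) \<mu> (\<lambda>z. u (mirror 1 (-1) 1 z)) xs L"
proof -
 let ?T = "mirror 1 (-1) 1"
 note D = dom_D[OF d]
 have box: "cbox (\<alpha> - A, 1/2 - c) (\<alpha> + A, 1/2 + c) \<subseteq> ?T -` K" if "cbox (\<alpha> - A, 1/2 - c) (\<alpha> + A, 1/2 + c) \<subseteq> K" for \<alpha> A c :: real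
 proof
  fix z assume "z \<in> cbox (\<alpha> - A, 1/2 - c) (\<alpha> + A, 1/2 + c)"
  then have "?T z \<in> cbox (\<alpha> - A, 1/2 - c) (\<alpha> + A, 1/2 + c)" unfolding mem_cbox_pair by (auto simp: mirror_def)
  then show "z \<in> ?T -` K" using that by blast
 qed
 have "ground \<mu> (?T -` K) (\<lambda>z. u (?T z))" by (rule ground_refl[OF D(1) _ _ refl_involution(2)]) auto
 moreover have "\<forall>z\<in>?T -` K. 0 \<le> snd z \<and> snd z \<le> 1" using D(2,3) by (fastforce simp: mirror_def)
 moreover have "(xs, 0) \<in> ?T -` K" "(xs, 1) \<in> ?T -` K" using D(4,5) by (simp_all add: mirror_def)
 moreover have "2 \<le> L \<longrightarrow> (\<exists>\<alpha>. cbox (\<alpha> - L/2, 1/2 - (1/2 - 1/L^2)) (\<alpha> + L/2, 1/2 + (1/2 - 1/L^2)) \<subseteq> ?T -` K)"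
  using d box unfolding dom_def by meson
 moreover have "\<exists>\<alpha>. cbox (\<alpha> - 1/16, 1/2 - 1/4) (\<alpha> + 1/16, 1/2 + 1/4) \<subseteq> ?T -` K"
  using d box unfolding dom_def by meson
 moreover have "\<bar>y - y'\<bar> \<le> 1 - \<bar>x - xs\<bar> / (8 * L^3)" if "(x, y) \<in> ?T -` K" "(x, y') \<in> ?T -` K" "2 * L \<le> \<bar>x - xs\<bar>" for x y y'
  using D(7)[of x "1 - y" "1 - y'"] that by (simp add: mirror_def)
 ultimately show ?thesis unfolding dom_def using D(6) by blast
qed

section \<open>Exponential decay away from the unit chord\<close>

lemma sin_ge_quarter:
 assumes "0 \<le> t" "t \<le> pi / 2" shows "t / 4 \<le> sin t"
proof (cases "t \<le> 1")
 case True
 show ?thesis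
 proof (cases "t = 0")
  case False
  then have "0 < t" using assms by simp
  have "t * (t / 2) \<le> t * sin t" using sin_ge_half[of t] True assms by (simp add: power2_eq_square)
  then have "t / 2 \<le> sin t" using \<open>0 < t\<close> by (simp only: mult_le_cancel_left_pos)
  then show ?thesis using assms by linarith
 qed simp
next
 case False
 have "sin 1 \<le> sin t" using False assms pi_gt3 by (intro sin_monotone_2pi_le) auto
 moreover have "(1::real) / 2 \<le> sin 1" using sin_ge_half[of 1] by simp
 moreover have "pi / 2 < 2" using pi_less_4 by simp
 ultimately show ?thesis using assms by linarith
qed

text \<open>Converts the linear bounds at the two ends of a section into a cosine barrier; the
  factor 3/4 turns 1350 into 1800.\<close>

lemma cos_ge_dist:
 assumes H: "0 < H" "H \<le> 1" and b: "0 \<le> \<beta>" "\<beta> * H \<le> pi" and s: "\<bar>s\<bar> \<le> H / 2"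
 shows "3 / 4 * (H / 2 - \<bar>s\<bar>) \<le> cos (\<beta> * s)"
proof -
 have bH: "\<beta> \<le> pi / H" using b H by (simp add: pos_le_divide_eq)
 have "\<beta> * \<bar>s\<bar> \<le> pi / H * \<bar>s\<bar>" using bH by (intro mult_right_mono) auto
 then have 1: "pi / H * (H / 2 - \<bar>s\<bar>) \<le> pi / 2 - \<beta> * \<bar>s\<bar>" using H by (simp add: right_diff_distrib)
 have "3 \<le> pi / H" using H pi_gt3 by (simp add: pos_le_divide_eq)
 then have "3 * (H / 2 - \<bar>s\<bar>) \<le> pi / H * (H / 2 - \<bar>s\<bar>)" using s by (intro mult_right_mono) auto
 with 1 have 2: "3 * (H / 2 - \<bar>s\<bar>) \<le> pi / 2 - \<beta> * \<bar>s\<bar>" by linarith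
 have "0 \<le> 3 * (H / 2 - \<bar>s\<bar>)" using s by simp
 then have "0 \<le> pi / 2 - \<beta> * \<bar>s\<bar>" using 2 by (rule order_trans)
 moreover have "pi / 2 - \<beta> * \<bar>s\<bar> \<le> pi / 2" using b by simp
 ultimately have "(pi / 2 - \<beta> * \<bar>s\<bar>) / 4 \<le> sin (pi / 2 - \<beta> * \<bar>s\<bar>)" by (rule sin_ge_quarter)
 also have "\<dots> = cos (\<beta> * \<bar>s\<bar>)" by (simp add: sin_diff)
 also have "\<dots> = cos (\<beta> * s)" by (cases "s \<ge> 0") (auto simp: abs_if)
 finally have "(pi / 2 - \<beta> * \<bar>s\<bar>) / 4 \<le> cos (\<beta> * s)" .
 moreover have "3 / 4 * (H / 2 - \<bar>s\<bar>) \<le> (pi / 2 - \<beta> * \<bar>s\<bar>) / 4" using 2 by simp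
 ultimately show ?thesis by (rule order_trans[rotated])
qed

lemma cos_pos_dist:
 assumes "0 \<le> \<beta>" "\<beta> * H < pi" "\<bar>s\<bar> \<le> H / 2"
 shows "0 < cos (\<beta> * s)"
proof -
 have "\<beta> * \<bar>s\<bar> \<le> \<beta> * (H / 2)" using assms by (intro mult_left_mono) auto
 then have "\<bar>\<beta> * s\<bar> < pi / 2" using assms by (simp add: abs_mult)
 then show ?thesis by (intro cos_gt_zero_pi) auto
qed

text \<open>A supporting line at the lower end of the section, whatever its slope, is used in the
  linear bound; a vertical move by \<open>t\<close> changes the distance to it by at most
  \<open>t\<close>.\<close>

lemma dom_section_bound:
 assumes d: "dom K \<mu> u xs L" and y: "(x, y) \<in> K" "(x, y0) \<in> K" and lo: "\<And>y'. (x, y') \<in> K \<Longrightarrow> y0 \<le> y'"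
 shows "u (x, y) \<le> 1350 * (y - y0)"
proof -
 note D = dom_D[OF d]
 note G = ground_D[OF D(1)]
 have ne: "interior K \<noteq> {}"
 proof -
  obtain m where "m \<in> K" "u m = 1" using D(1) by (auto simp: ground_def)
  then show ?thesis using ground_pos_iff[OF D(1), of m] by auto
 qed
 have "(x, y0) \<notin> interior K"
 proof
  assume "(x, y0) \<in> interior K"
  then obtain e where e: "e > 0" "cball (x, y0) e \<subseteq> K" using mem_interior_cball by blast
  have "(x, y0 - e) \<in> cball (x, y0) e" using e by (simp add: dist_prod_def dist_real_def)
  then show False using lo[of "y0 - e"] e by auto
 qed
 from support_at[OF G(3) ne y(2) this] obtain n where n: "norm n = 1" "\<forall>z\<in>K. n \<bullet> (x, y0) \<le> n \<bullet> z" by blast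
 have "u (x, y) \<le> 1350 * (n \<bullet> (x, y) - n \<bullet> (x, y0))"
  by (rule dom_linear_bound[OF d n(1) _ y(1)]) (use n(2) in blast)
 also have "n \<bullet> (x, y) - n \<bullet> (x, y0) = snd n * (y - y0)" by (cases n) (simp add: algebra_simps)
 also have "\<dots> \<le> 1 * (y - y0)"
 proof (rule mult_right_mono)
  show "snd n \<le> 1" using n(1) norm_snd_le[of "snd n" "fst n"] by simp
 qed (use lo[OF y(1)] in simp)
 finally show ?thesis by simp
qed

lemma dom_section_bound':
 assumes d: "dom K \<mu> u xs L" and y: "(x, y) \<in> K" "(x, y1) \<in> K" and hi: "\<And>y'. (x, y') \<in> K \<Longrightarrow> y' \<le> y1"
 shows "u (x, y) \<le> 1350 * (y1 - y)"
proof -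
 let ?T = "mirror 1 (-1) 1"
 have "u (?T (x, 1 - y)) \<le> 1350 * ((1 - y) - (1 - y1))"
  by (rule dom_section_bound[OF dom_refl_y[OF d]]) (use y hi in \<open>auto simp: mirror_def\<close>, fastforce)
 then show ?thesis by (simp add: mirror_def)
qed

lemma lap2_exp_cos:
 "\<exists>a b. lap2 (\<lambda>z. c * (exp (e + (- \<alpha>, 0) \<bullet> z) * cos (k + (0, \<beta>) \<bullet> z))) p a b
   ((\<alpha>^2 - \<beta>^2) * (c * (exp (e + (- \<alpha>, 0) \<bullet> p) * cos (k + (0, \<beta>) \<bullet> p))))"
proof -
 note 1 = lap2_lin[OF lap2_mult[OF lap2_exp[OF lap2_affine[of e "(- \<alpha>, 0)" p]] lap2_cos[of k "(0, \<beta>)" p]] lap2_const[of 0 p], of c 0]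
 show ?thesis
  by (intro exI, rule lap2_eq[OF lap2_cong[OF 1]]) (simp_all add: algebra_simps)
qed

lemma closed_fst_ge: "closed {w :: point. x \<le> fst w}" "closed {w :: point. fst w \<le> x}"
 "open {w :: point. x < fst w}" "open {w :: point. fst w < x}"
 by (intro closed_Collect_le open_Collect_less continuous_intros)+

text \<open>Separation of variables beyond a section of height at most \<open>H\<close>: a decaying
  exponential in \<open>x\<close> times a cosine fitted to that section is a strict supersolution as
  soon as \<open>\<mu> < \<beta>^2 - \<alpha>^2\<close>.\<close>

lemma dom_decay:
 assumes d: "dom K \<mu> u xs L" and x1: "xs < x1"
  and sec: "\<And>y y'. (x1, y) \<in> K \<Longrightarrow> (x1, y') \<in> K \<Longrightarrow> \<bar>y - y'\<bar> \<le> H"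
  and H: "0 < H" "H \<le> 1" and b: "0 \<le> \<beta>" "\<beta> * H < pi" and ab: "\<mu> < \<beta>^2 - \<alpha>^2"
  and z: "z \<in> K" "x1 \<le> fst z"
 shows "u z \<le> 1800 * exp (- \<alpha> * (fst z - x1))"
proof -
 note D = dom_D[OF d]
 note G = ground_D[OF D(1)]
 define S where "S = {y. (x1, y) \<in> K}"
 have comb: "(x1, t * snd w + (1 - t) * c) \<in> K" if w: "w \<in> K" "x1 \<le> fst w" and t: "t = (x1 - xs) / (fst w - xs)" and c: "c \<in> {0, 1}" for w t c
 proof -
  have pos: "0 < fst w - xs" using w x1 by simp
  have "0 \<le> t" "t \<le> 1" using w x1 unfolding t by (auto simp: divide_le_eq)
  then have "(1 - t) *\<^sub>R (xs, c) + t *\<^sub>R w \<in> K" using convexD_alt[OF G(3), of "(xs, c)" w t] D(4,5) w(1) c by auto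
  moreover have "t * (fst w - xs) = x1 - xs" unfolding t using pos by simp
  then have "(1 - t) * xs + t * fst w = x1" by (simp add: algebra_simps)
  ultimately show ?thesis by (cases w) (simp add: algebra_simps)
 qed
 have "S \<noteq> {}" using comb[OF z refl, of 0] by (auto simp: S_def)
 have Sim: "S = snd ` (K \<inter> {w. x1 \<le> fst w} \<inter> {w. fst w \<le> x1})" by (force simp: S_def)
 have "compact S" unfolding Sim
  by (intro compact_continuous_image continuous_intros compact_Int_closed G(2) closed_fst_ge)
 then obtain y0 y1 where y0: "y0 \<in> S" "\<And>y. y \<in> S \<Longrightarrow> y0 \<le> y" and y1: "y1 \<in> S" "\<And>y. y \<in> S \<Longrightarrow> y \<le> y1"
  using compact_attains_inf[OF _ \<open>S \<noteq> {}\<close>] compact_attains_sup[OF _ \<open>S \<noteq> {}\<close>] by metis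
 \<comment> \<open>The segments from \<open>w\<close> to \<open>(xs, 0)\<close> and to
   \<open>(xs, 1)\<close> cross the line at \<open>x1\<close> below and above the height of
   \<open>w\<close>, and both crossings lie in the section there. So the cosine fits everything to
   the right.\<close>
 have range: "y0 \<le> snd w \<and> snd w \<le> y1" if w: "w \<in> K" "x1 \<le> fst w" for w
 proof -
  define t where "t = (x1 - xs) / (fst w - xs)"
  have t: "0 \<le> t" "t \<le> 1" using w x1 by (auto simp: t_def divide_le_eq)
  have "t * snd w \<in> S" "t * snd w + (1 - t) \<in> S"
   using comb[OF w t_def, of 0] comb[OF w t_def, of 1] by (auto simp: S_def)
  then have "y0 \<le> t * snd w" "t * snd w + (1 - t) \<le> y1" using y0(2) y1(2) by auto
  moreover have "t * snd w \<le> 1 * snd w" using t D(2)[OF w(1)] by (intro mult_right_mono) auto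
  moreover have "(1 - t) * snd w \<le> (1 - t) * 1" using t D(3)[OF w(1)] by (intro mult_left_mono) auto
  ultimately show ?thesis by (simp add: algebra_simps)
 qed
 have yH: "y1 - y0 \<le> H" "y0 \<le> y1" using sec[of y1 y0] y0 y1 by (auto simp: S_def)
 define m where "m = (y0 + y1) / 2"
 let ?A = "{w \<in> K. x1 \<le> fst w}"
 have cA: "compact ?A" using compact_Int_closed[OF G(2) closed_fst_ge(1)[of x1]] by (simp add: Int_def)
 define Q where "Q w = 1800 * (exp (\<alpha> * x1 + (- \<alpha>, 0) \<bullet> w) * cos (- \<beta> * m + (0, \<beta>) \<bullet> w))" for w :: "point"
 have Q: "Q w = 1800 * exp (- \<alpha> * (fst w - x1)) * cos (\<beta> * (snd w - m))" for w
  by (cases w) (simp add: Q_def algebra_simps)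
 have mm: "\<bar>snd w - m\<bar> \<le> (y1 - y0) / 2" if "w \<in> ?A" for w using range[of w] that by (auto simp: m_def abs_if field_simps)
 have Qpos: "0 < Q w" if "w \<in> ?A" for w
  unfolding Q using mm[OF that] yH cos_pos_dist[OF b, of "snd w - m"] by simp
 have "u z \<le> Q z"
 proof (rule max_principle_ratio[OF D(1) _ cA])
  show "?A \<subseteq> K" by auto
  show "continuous_on ?A Q" unfolding Q by (intro continuous_intros)
  show "z \<in> ?A" using z by simp
  fix w assume w: "w \<in> ?A"
  show "0 < Q w" using Qpos[OF w] .
  assume wi: "w \<notin> interior ?A"
  show "u w \<le> Q w"
  proof (cases "w \<in> interior K")
   case True
   have "\<not> x1 < fst w"
    using wi interior_IntI_open[OF True closed_fst_ge(3)[of x1], of ?A] interior_subset[of K] by fastforce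
   then have fw: "fst w = x1" using w by auto
   then have ws: "(x1, snd w) \<in> K" using w by (cases w) auto
   have lo: "u w \<le> 1350 * (snd w - y0)"
    using dom_section_bound[OF d ws, of y0] y0 fw by (cases w) (auto simp: S_def)
   have hi: "u w \<le> 1350 * (y1 - snd w)"
    using dom_section_bound'[OF d ws, of y1] y1 fw by (cases w) (auto simp: S_def)
   have "u w \<le> 1350 * ((y1 - y0) / 2 - \<bar>snd w - m\<bar>)"
    using lo hi by (cases "m \<le> snd w") (simp_all add: m_def field_simps)
   also have "\<dots> \<le> 1350 * (H / 2 - \<bar>snd w - m\<bar>)" using yH by simp
   also have "\<dots> = 1800 * (3 / 4 * (H / 2 - \<bar>snd w - m\<bar>))" by simp
   also have "\<dots> \<le> 1800 * cos (\<beta> * (snd w - m))"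
    using cos_ge_dist[OF H b(1) less_imp_le[OF b(2)], of "snd w - m"] mm[OF w] yH by (intro mult_left_mono) auto
   finally show ?thesis unfolding Q fw by simp
  next
   case False
   then have "u w \<le> 0" using ground_pos_iff[OF D(1), of w] w by auto
   then show ?thesis using Qpos[OF w] by linarith
  qed
 next
  fix w assume w: "w \<in> interior ?A"
  then have "w \<in> ?A" using interior_subset by blast
  have "(\<alpha>^2 - \<beta>^2) * Q w < - \<mu> * Q w"
   using Qpos[OF \<open>w \<in> ?A\<close>] ab by (intro mult_strict_right_mono) auto
  then show "\<exists>a b l. lap2 Q w a b l \<and> l < - \<mu> * Q w"
   using lap2_exp_cos[of 1800 "\<alpha> * x1" \<alpha> "- \<beta> * m" \<beta> w] unfolding Q_def by blast
 qed
 also have "Q z \<le> 1800 * exp (- \<alpha> * (fst z - x1)) * 1"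
  unfolding Q by (intro mult_left_mono) auto
 finally show ?thesis by simp
qed

text \<open>With \<open>t = \<kappa> / L^2\<close> take \<open>\<beta>^2 = pi^2 * (1 + t)\<close>,
  admissible because \<open>(1 + t) * (1 - t)^2 < 1\<close>, and \<open>\<alpha>^2 = t\<close>. The
  gain \<open>(pi^2 - 1) * t > 8 * t\<close> must beat the eigenvalue excess
  \<open>2680 / L^2\<close>, and \<open>8 * 336 = 2688\<close>.\<close>

lemma dom_decay2:
 assumes d: "dom K \<mu> u xs L" and x1: "xs < x1"
  and sec: "\<And>y y'. (x1, y) \<in> K \<Longrightarrow> (x1, y') \<in> K \<Longrightarrow> \<bar>y - y'\<bar> \<le> 1 - \<kappa> / L^2"
  and \<kappa>: "336 \<le> \<kappa>" "\<kappa> / L^2 \<le> 1/2" and z: "z \<in> K" "x1 \<le> fst z"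
 shows "u z \<le> 1800 * exp (- (sqrt \<kappa> / L) * (fst z - x1))"
proof -
 note D = dom_D[OF d]
 define t where "t = \<kappa> / L^2"
 have L2: "0 < L^2" using D(6) by simp
 have t: "0 < t" "t \<le> 1/2" using \<kappa> L2 by (auto simp: t_def)
 define \<beta> where "\<beta> = pi * sqrt (1 + t)"
 have "\<beta> * (1 - t) < pi * 1"
  unfolding \<beta>_def mult.assoc
 proof (rule mult_strict_left_mono)
  have "(1 + t) * (1 - t)^2 = (1 - t^2) * (1 - t)" by (simp add: power2_eq_square algebra_simps)
  also have "\<dots> < 1 * 1" using t by (intro mult_strict_mono) auto
  finally have "sqrt ((1 + t) * (1 - t)^2) < 1" by simp
  then show "sqrt (1 + t) * (1 - t) < 1" using t by (simp add: real_sqrt_mult)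
 qed auto
 then have b: "\<beta> * (1 - t) < pi" by simp
 have \<beta>2: "\<beta>^2 = pi^2 * (1 + t)" using t by (simp add: \<beta>_def power_mult_distrib)
 have \<alpha>2: "(sqrt \<kappa> / L)^2 = t" using \<kappa> by (simp add: power_divide t_def)
 have "2680 / L^2 < 8 * t" using \<kappa> L2 by (simp add: t_def divide_strict_right_mono)
 moreover have "9 * t \<le> pi^2 * t" using pi_sq_bounds t by (intro mult_right_mono) auto
 ultimately have "\<mu> < \<beta>^2 - (sqrt \<kappa> / L)^2"
  using dom_mu_le(1)[OF d] unfolding \<beta>2 \<alpha>2 by (simp add: algebra_simps)
 moreover have "0 \<le> \<beta>" "0 < 1 - t" "1 - t \<le> 1" using t by (auto simp: \<beta>_def)
 ultimately show ?thesis using dom_decay[OF d x1 sec[folded t_def] _ _ _ b _ z] by blast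
qed

text \<open>At distance \<open>5376 * L = 8 * 672 * L\<close> from the unit chord, sections have
  height at most \<open>1 - 672 / L^2\<close>. As 672 is twice 336, nonemptiness of the section
  gives \<open>336 / L^2 \<le> 1/2\<close>, and the decay applies.\<close>

lemma dom_extent_right:
 assumes d: "dom K \<mu> u xs L" and \<eta>: "0 < \<eta>" and z: "z \<in> K" "\<eta> \<le> u z"
 shows "fst z - xs \<le> (5376 + ln (1800 / \<eta>)) * L"
proof (cases "fst z - xs \<le> 5376 * L")
 case True
 have "\<eta> \<le> 1" using z ground_D(7)[OF dom_D(1)[OF d], of z] by simp
 then have "0 \<le> ln (1800 / \<eta>)" using \<eta> by (intro ln_ge_zero) (simp add: pos_le_divide_eq)
 then have "5376 * L \<le> (5376 + ln (1800 / \<eta>)) * L" using dom_D(6)[OF d] by (intro mult_right_mono) auto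
 with True show ?thesis by linarith
next
 case False
 note D = dom_D[OF d]
 note G = ground_D[OF D(1)]
 define x1 where "x1 = xs + 5376 * L"
 have x1: "xs < x1" "x1 \<le> fst z" using False D(6) by (auto simp: x1_def)
 have sec: "\<bar>y - y'\<bar> \<le> 1 - 672 / L^2" if "(x1, y) \<in> K" "(x1, y') \<in> K" for y y'
 proof -
  have e: "\<bar>x1 - xs\<bar> = 5376 * L" using D(6) by (simp add: x1_def)
  have "\<bar>y - y'\<bar> \<le> 1 - \<bar>x1 - xs\<bar> / (8 * L^3)" by (rule D(7)[OF that]) (use e D(6) in simp)
  also have "\<bar>x1 - xs\<bar> / (8 * L^3) = 672 / L^2" unfolding e using D(6) by (simp add: power2_eq_square power3_eq_cube)
  finally show ?thesis .
 qed
 obtain y where y: "(x1, y) \<in> K"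
 proof -
  define t where "t = (x1 - xs) / (fst z - xs)"
  have pos: "0 < fst z - xs" using x1 by simp
  have "0 \<le> t" "t \<le> 1" using x1 unfolding t_def by (auto simp: divide_le_eq)
  then have "(1 - t) *\<^sub>R (xs, 0) + t *\<^sub>R z \<in> K" using convexD_alt[OF G(3), of "(xs, 0)" z t] D(4) z(1) by auto
  moreover have "t * (fst z - xs) = x1 - xs" unfolding t_def using pos by simp
  then have "(1 - t) * xs + t * fst z = x1" by (simp add: algebra_simps)
  ultimately have "(x1, t * snd z) \<in> K" by (cases z) simp
  then show ?thesis by (rule that)
 qed
 have L2: "672 / L^2 \<le> 1" using sec[OF y y] by simp
 have "u z \<le> 1800 * exp (- (sqrt 336 / L) * (fst z - x1))"
 proof (rule dom_decay2[OF d x1(1) _ _ _ z(1) x1(2)])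
  show "336 / L^2 \<le> 1 / 2" using L2 by simp
  fix y y' assume "(x1, y) \<in> K" "(x1, y') \<in> K"
  moreover have "336 / L^2 \<le> 672 / L^2" by (intro divide_right_mono) auto
  ultimately show "\<bar>y - y'\<bar> \<le> 1 - 336 / L^2" using sec[of y y'] by linarith
 qed simp
 also have "\<dots> \<le> 1800 * exp (- (1 / L) * (fst z - x1))"
 proof -
  have "1 \<le> sqrt (336::real)" by simp
  then have "1 / L \<le> sqrt 336 / L" using D(6) by (intro divide_right_mono) auto
  then have "(1 / L) * (fst z - x1) \<le> (sqrt 336 / L) * (fst z - x1)" using x1 by (intro mult_right_mono) auto
  then show ?thesis by simp
 qed
 finally have "\<eta> \<le> 1800 * exp (- (1 / L) * (fst z - x1))" using z by simp
 then have "\<eta> / 1800 \<le> exp (- (1 / L) * (fst z - x1))" by simp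
 then have "ln (\<eta> / 1800) \<le> - (1 / L) * (fst z - x1)" using \<eta> ln_le_cancel_iff[of "\<eta> / 1800" "exp (- (1 / L) * (fst z - x1))"] by simp
 then have "(fst z - x1) / L \<le> ln (1800 / \<eta>)" using \<eta> by (simp add: ln_div)
 then have "fst z - x1 \<le> ln (1800 / \<eta>) * L" using D(6) by (simp add: pos_divide_le_eq)
 then show ?thesis by (simp add: x1_def algebra_simps)
qed

lemma dom_extent:
 assumes d: "dom K \<mu> u xs L" and \<eta>: "0 < \<eta>" and z: "z \<in> K" "\<eta> \<le> u z"
 shows "\<bar>fst z - xs\<bar> \<le> (5376 + ln (1800 / \<eta>)) * L"
proof -
 have "fst (mirror (-1) 1 0 z) - (- xs) \<le> (5376 + ln (1800 / \<eta>)) * L"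
  by (rule dom_extent_right[OF dom_refl_x[OF d] \<eta>]) (use z refl_involution in simp_all)
 moreover have "fst z - xs \<le> (5376 + ln (1800 / \<eta>)) * L" by (rule dom_extent_right[OF d \<eta> z])
 ultimately show ?thesis by (simp add: mirror_def abs_le_iff)
qed

section \<open>Horizontal reach of superlevel sets and tall columns\<close>

lemma lap2_quad_cos:
 "\<exists>a b. lap2 (\<lambda>z. (\<lambda>t. A * (e + t * (2 - t))) (c + (- k, 0) \<bullet> z) * cos (d + (0, \<beta>) \<bullet> z)) p a b
   (- (2 * A * k^2 + \<beta>^2 * (A * (e + (c + (- k, 0) \<bullet> p) * (2 - (c + (- k, 0) \<bullet> p))))) * cos (d + (0, \<beta>) \<bullet> p))"
proof -
 let ?F = "\<lambda>t. A * (e + t * (2 - t))" let ?F' = "\<lambda>t. A * (2 - 2 * t)"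
 have 1: "lap2 (\<lambda>z. ?F (c + (- k, 0) \<bullet> z)) p (?F' (c + (- k, 0) \<bullet> p) * fst (- k, 0::real)) (?F' (c + (- k, 0) \<bullet> p) * snd (- k, 0::real))
   ((- 2 * A) * ((fst (- k, 0::real))^2 + (snd (- k, 0::real))^2) + ?F' (c + (- k, 0) \<bullet> p) * 0)"
  by (rule lap2_compose[OF lap2_affine, of UNIV]) (auto intro!: derivative_eq_intros simp: algebra_simps)
 show ?thesis
  by (intro exI, rule lap2_eq[OF lap2_mult[OF 1 lap2_cos[of d "(0, \<beta>)" p]] HOL.refl HOL.refl]) (simp add: algebra_simps)
qed

text \<open>If the column had no point of level \<open>\<eta> / 7200\<close>, convexity of
  superlevel sets would keep \<open>u\<close> below that level further right, and a barrier concave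
  in \<open>x\<close> over a length comparable to \<open>L\<close> would force
  \<open>u p < \<eta>\<close>.\<close>

lemma dom_side_right:
 assumes d: "dom K \<mu> u xs L" and \<eta>: "0 < \<eta>" "\<eta> \<le> 1" and L: "10^6 / \<eta> \<le> L" and p: "p \<in> K" "\<eta> \<le> u p"
 shows "\<exists>q\<in>K. fst q = fst p + \<eta> / 10^6 * L \<and> \<eta> / 7200 \<le> u q"
proof (rule ccontr)
 assume neg: "\<not> (\<exists>q\<in>K. fst q = fst p + \<eta> / 10^6 * L \<and> \<eta> / 7200 \<le> u q)"
 note D = dom_D[OF d]
 note G = ground_D[OF D(1)]
 define x2 where "x2 = fst p + \<eta> / 10^6 * L"
 define e where "e = \<eta> / 7200"
 have e: "0 < e" "e \<le> 1" "e \<le> \<eta>" using \<eta> by (auto simp: e_def)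
 have "10^6 / 1 \<le> 10^6 / \<eta>" using \<eta> by (intro divide_left_mono) auto
 then have L1: "10^6 \<le> L" using L by simp
 have \<eta>L: "1 \<le> \<eta> / 10^6 * L" using L \<eta> by (simp add: field_simps)
 have small: "u w \<le> e" if w: "w \<in> K" "x2 \<le> fst w" for w
 proof (rule ccontr)
  assume "\<not> u w \<le> e"
  then have wS: "w \<in> {p \<in> K. e \<le> u p}" using w by simp
  have pS: "p \<in> {p \<in> K. e \<le> u p}" using p e by simp
  have lt: "fst p < fst w" using w(2) \<eta>L by (simp add: x2_def)
  define t where "t = (x2 - fst p) / (fst w - fst p)"
  have t: "0 \<le> t" "t \<le> 1" using w(2) \<eta>L lt by (auto simp: t_def x2_def divide_le_eq)
  have "(1 - t) *\<^sub>R p + t *\<^sub>R w \<in> {p \<in> K. e \<le> u p}"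
   by (rule convexD_alt[OF convex_superlevel[OF D(1) e(1)] pS wS t])
  moreover have "t * (fst w - fst p) = x2 - fst p" using lt by (simp add: t_def)
  then have "fst ((1 - t) *\<^sub>R p + t *\<^sub>R w) = x2" by (simp add: algebra_simps)
  ultimately show False using neg by (auto simp: x2_def e_def)
 qed
 \<comment> \<open>The curvature \<open>3600 / l^2\<close> of the quadratic profile must exceed
   \<open>(\<mu> - \<beta>^2) * F\<close>, which is at most \<open>2681 / L^2 * 3600\<close>; and
   \<open>52^2 = 2704\<close>.\<close>
 define l where "l = L / 52"
 have l: "0 < l" using L1 by (simp add: l_def)
 define x1 where "x1 = x2 + 1 - l"
 \<comment> \<open>Slightly below \<open>pi\<close>, so that the cosine is positive on the closed
   strip of height 1; the price is one more \<open>1 / L^2\<close>, whence 2681.\<close>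
 define \<beta> where "\<beta> = sqrt (pi^2 - 1 / L^2)"
 have L2: "0 < L^2" "1 \<le> L^2" using L1 by auto
 have iL2: "0 < 1 / L^2" "1 / L^2 \<le> 1" using L2 by (auto simp: divide_le_eq)
 have "0 \<le> pi^2 - 1 / L^2" using iL2 pi_sq_bounds by linarith
 then have \<beta>2: "\<beta>^2 = pi^2 - 1 / L^2" by (simp only: \<beta>_def real_sqrt_pow2)
 have \<beta>: "0 \<le> \<beta>" "\<beta> * 1 < pi"
 proof -
  show "0 \<le> \<beta>" using \<open>0 \<le> pi^2 - 1 / L^2\<close> unfolding \<beta>_def by (rule real_sqrt_ge_zero)
  have "\<beta>^2 < pi^2" using \<beta>2 iL2 by simp
  then show "\<beta> * 1 < pi" by (metis mult_1_right pi_ge_zero power2_less_imp_less)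
 qed
 define F where "F t = 1800 * (e + t * (2 - t))" for t :: real
 define Q where "Q w = F ((x2 + 1) / l + (- (1 / l), 0) \<bullet> w) * cos (- \<beta> / 2 + (0, \<beta>) \<bullet> w)" for w :: "point"
 define T where "T w = (x2 + 1 - fst w) / l" for w :: "point"
 have T: "(x2 + 1) / l + (- (1 / l), 0) \<bullet> w = T w" for w by (cases w) (simp add: T_def diff_divide_distrib)
 have C: "cos (- \<beta> / 2 + (0, \<beta>) \<bullet> w) = cos (\<beta> * (snd w - 1/2))" for w by (cases w) (simp add: algebra_simps)
 have Q: "Q w = F (T w) * cos (\<beta> * (snd w - 1/2))" for w unfolding Q_def T C ..
 let ?A = "{w \<in> K. x1 \<le> fst w \<and> fst w \<le> x2 + 1}"
 have "?A = K \<inter> {w. x1 \<le> fst w} \<inter> {w. fst w \<le> x2 + 1}" by auto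
 then have cA: "compact ?A" by (simp only:) (intro compact_Int_closed G(2) closed_fst_ge)
 have Tr: "0 \<le> T w" "T w \<le> 1" if "w \<in> ?A" for w using that l by (auto simp: T_def x1_def divide_le_eq)
 have Fb: "1800 * e \<le> F t" "F t \<le> 3600" if "0 \<le> t" "t \<le> 1" for t
 proof -
  have "0 \<le> t * (2 - t)" using that by simp
  moreover have "0 \<le> (1 - t)^2" by simp
  then have "t * (2 - t) \<le> 1" by (simp add: power2_eq_square algebra_simps)
  ultimately show "1800 * e \<le> F t" "F t \<le> 3600" using e by (auto simp: F_def)
 qed
 have sy: "\<bar>snd w - 1/2\<bar> \<le> 1 / 2" if "w \<in> K" for w using D(2,3)[OF that] unfolding abs_le_iff by linarith
 have cpos: "0 < cos (\<beta> * (snd w - 1/2))" if "w \<in> K" for w by (rule cos_pos_dist[OF \<beta> sy[OF that]])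
 have cge: "3 / 4 * (1 / 2 - \<bar>snd w - 1/2\<bar>) \<le> cos (\<beta> * (snd w - 1/2))" if "w \<in> K" for w
  by (rule cos_ge_dist) (use \<beta> sy[OF that] in auto)
 have Qpos: "0 < Q w" if "w \<in> ?A" for w
 proof -
  have "0 < F (T w)" using Fb(1)[OF Tr[OF that]] e by linarith
  then show ?thesis unfolding Q using cpos[of w] that by simp
 qed
 have md: "1 / 2 - \<bar>y - 1/2\<bar> = min y (1 - y)" for y :: real by (simp add: min_def abs_if)
 have ub: "u w \<le> 1800 * c * cos (\<beta> * (snd w - 1/2))"
  if w: "w \<in> K" and c: "0 \<le> c" "u w \<le> 1350 * c * snd w" "u w \<le> 1350 * c * (1 - snd w)" for w c
 proof -
  have "u w \<le> 1350 * c * (1 / 2 - \<bar>snd w - 1/2\<bar>)" unfolding md using c by (simp add: min_def)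
  also have "\<dots> = 1800 * c * (3 / 4 * (1 / 2 - \<bar>snd w - 1/2\<bar>))" by simp
  also have "\<dots> \<le> 1800 * c * cos (\<beta> * (snd w - 1/2))" using cge[OF w] c by (intro mult_left_mono) auto
  finally show ?thesis .
 qed
 have pA: "p \<in> ?A"
 proof -
  have "\<eta> / 10^6 * L \<le> 1 / 10^6 * L" using \<eta> L1 by (intro mult_right_mono divide_right_mono) auto
  moreover have "1 / 10^6 * L + 1 \<le> l" using L1 by (simp add: l_def)
  ultimately have "\<eta> / 10^6 * L + 1 \<le> l" by linarith
  then show ?thesis using p \<eta>L by (simp add: x1_def x2_def)
 qed
 have "u p \<le> Q p"
 proof (rule max_principle_ratio[OF D(1) _ cA])
  show "?A \<subseteq> K" by auto
  show "continuous_on ?A Q" unfolding Q F_def T_def by (intro continuous_intros) (use l in auto)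
  show "p \<in> ?A" by (rule pA)
  fix w assume w: "w \<in> ?A"
  then have wK: "w \<in> K" by simp
  show "0 < Q w" using Qpos[OF w] .
  assume wi: "w \<notin> interior ?A"
  show "u w \<le> Q w"
  proof (cases "w \<in> interior K")
   case True
   have "\<not> (x1 < fst w \<and> fst w < x2 + 1)"
   proof
    assume "x1 < fst w \<and> fst w < x2 + 1"
    then have "w \<in> interior ?A"
     using interior_IntI_open[OF True open_Int[OF closed_fst_ge(3)[of x1] closed_fst_ge(4)[of "x2+1"]], of ?A]
      interior_subset[of K] by fastforce
    with wi show False by simp
   qed
   then consider "fst w = x1" | "fst w = x2 + 1" using w by force
   then show ?thesis
   proof cases
    case 1
    have "u w \<le> 1350 * ((0, 1) \<bullet> w - 0)" by (rule dom_linear_bound[OF d _ _ wK]) (use D(2) in \<open>auto simp: norm_Pair inner_prod_def\<close>)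
    moreover have "u w \<le> 1350 * ((0, -1) \<bullet> w - (-1))" by (rule dom_linear_bound[OF d _ _ wK]) (use D(3) in \<open>auto simp: norm_Pair inner_prod_def\<close>)
    ultimately have "u w \<le> 1800 * 1 * cos (\<beta> * (snd w - 1/2))"
     by (intro ub[OF wK]) (auto simp: inner_prod_def)
    also have "\<dots> \<le> F (T w) * cos (\<beta> * (snd w - 1/2))"
    proof (rule mult_right_mono)
     have "T w = 1" using 1 l by (simp add: T_def x1_def)
     then show "1800 * 1 \<le> F (T w)" using e by (simp add: F_def)
    qed (use cpos[OF wK] in simp)
    finally show ?thesis unfolding Q .
   next
    case 2
    have "u w \<le> 1350 * e * ((0, 1) \<bullet> w - 0)"
     by (rule dom_edge_bound[OF d _ _ e(1) small wK]) (use D(2,3) 2 in \<open>auto simp: norm_Pair inner_prod_def\<close>)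
    moreover have "u w \<le> 1350 * e * ((0, -1) \<bullet> w - (-1))"
     by (rule dom_edge_bound[OF d _ _ e(1) small wK]) (use D(2,3) 2 in \<open>auto simp: norm_Pair inner_prod_def\<close>)
    ultimately have "u w \<le> 1800 * e * cos (\<beta> * (snd w - 1/2))"
     by (intro ub[OF wK]) (use e in \<open>auto simp: inner_prod_def\<close>)
    moreover have "F (T w) = 1800 * e" using 2 by (simp add: T_def F_def)
    ultimately show ?thesis unfolding Q by simp
   qed
  next
   case False
   then have "u w \<le> 0" using ground_pos_iff[OF D(1), of w] w by auto
   then show ?thesis using Qpos[OF w] by linarith
  qed
 next
  fix w assume w: "w \<in> interior ?A"
  then have wA: "w \<in> ?A" using interior_subset by blast
  have "(\<mu> - \<beta>\<^sup>2) * F (T w) < 3600 * (1 / l)\<^sup>2"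
  proof -
   have "\<mu> - \<beta>\<^sup>2 \<le> 2681 / L\<^sup>2" using dom_mu_le(1)[OF d] unfolding \<beta>2 by (simp add: add_divide_distrib[symmetric])
   moreover have "0 < F (T w)" using Fb(1)[OF Tr[OF wA]] e by linarith
   ultimately have "(\<mu> - \<beta>\<^sup>2) * F (T w) \<le> 2681 / L\<^sup>2 * F (T w)" by (intro mult_right_mono) auto
   also have "\<dots> \<le> 2681 / L^2 * 3600" using Fb(2)[OF Tr[OF wA]] by (intro mult_left_mono) auto
   also have "\<dots> < 3600 * (1 / l)^2" using L2 by (simp add: l_def power_divide divide_strict_right_mono)
   finally show ?thesis .
  qed
  then have "\<mu> * F (T w) < 2 * 1800 * (1 / l)^2 + \<beta>^2 * F (T w)" by (simp add: algebra_simps)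
  then have "\<mu> * F (T w) * cos (\<beta> * (snd w - 1/2)) < (2 * 1800 * (1 / l)^2 + \<beta>^2 * F (T w)) * cos (\<beta> * (snd w - 1/2))"
   using cpos[of w] wA by (intro mult_strict_right_mono) auto
  then have *: "- (2 * 1800 * (1 / l)^2 + \<beta>^2 * F (T w)) * cos (\<beta> * (snd w - 1/2)) < - \<mu> * Q w" unfolding Q by (simp add: algebra_simps)
  obtain a b where ab: "lap2 (\<lambda>z. F ((x2 + 1) / l + (- (1 / l), 0) \<bullet> z) * cos (- \<beta> / 2 + (0, \<beta>) \<bullet> z)) w a b
    (- (2 * 1800 * (1 / l)^2 + \<beta>^2 * F ((x2 + 1) / l + (- (1 / l), 0) \<bullet> w)) * cos (- \<beta> / 2 + (0, \<beta>) \<bullet> w))"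
   using lap2_quad_cos[of 1800 e "(x2 + 1) / l" "1 / l" "- \<beta> / 2" \<beta> w] unfolding F_def by blast
  have "lap2 Q w a b (- (2 * 1800 * (1 / l)^2 + \<beta>^2 * F (T w)) * cos (\<beta> * (snd w - 1/2)))"
   using ab unfolding T C Q_def[symmetric, abs_def] Q_def[abs_def] by (simp add: T C Q_def)
  with * show "\<exists>a b l. lap2 Q w a b l \<and> l < - \<mu> * Q w" by blast
 qed
 also have "Q p \<le> F (T p) * 1" unfolding Q using Fb(1)[OF Tr[OF pA]] e by (intro mult_left_mono) auto
 also have "F (T p) \<le> 1800 * (e + 2 * T p)" using Tr[OF pA] by (simp add: F_def algebra_simps)
 also have "T p = 52 * (\<eta> / 10^6 + 1 / L)" using L1 by (simp add: T_def x2_def l_def field_simps)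
 also have "1800 * (e + 2 * (52 * (\<eta> / 10^6 + 1 / L))) \<le> 1800 * (\<eta> / 7200 + 2 * (52 * (\<eta> / 10^6 + \<eta> / 10^6)))"
 proof -
  have "1 / L \<le> \<eta> / 10^6" using L \<eta> L1 by (simp add: field_simps)
  then show ?thesis unfolding e_def by simp
 qed
 also have "\<dots> < \<eta>" using \<eta> by simp
 finally show False using p by simp
qed

lemma dom_side:
 assumes d: "dom K \<mu> u xs L" and \<eta>: "0 < \<eta>" "\<eta> \<le> 1" and L: "10^6 / \<eta> \<le> L" and p: "p \<in> K" "\<eta> \<le> u p"
  and s: "s \<in> {-1, 1}"
 shows "\<exists>q\<in>K. fst q = fst p + s * (\<eta> / 10^6 * L) \<and> \<eta> / 7200 \<le> u q"
proof (cases "s = 1")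
 case True
 then show ?thesis using dom_side_right[OF d \<eta> L p] by simp
next
 case False
 let ?T = "mirror (-1) 1 0"
 have "\<exists>q\<in>?T -` K. fst q = fst (?T p) + \<eta> / 10^6 * L \<and> \<eta> / 7200 \<le> u (?T q)"
  by (rule dom_side_right[OF dom_refl_x[OF d] \<eta> L]) (use p refl_involution in simp_all)
 then obtain q where "q \<in> ?T -` K" "fst q = fst (?T p) + \<eta> / 10^6 * L" "\<eta> / 7200 \<le> u (?T q)" by blast
 then show ?thesis using False s by (intro bexI[of _ "?T q"]) (auto simp: mirror_def)
qed

definition goodcol :: "point set \<Rightarrow> real \<Rightarrow> real \<Rightarrow> bool" where
 "goodcol K \<epsilon> x \<longleftrightarrow> (\<forall>y. \<epsilon> \<le> y \<longrightarrow> y \<le> 1 - \<epsilon> \<longrightarrow> (x, y) \<in> K)"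

lemma goodcol_between:
 assumes "convex K" "goodcol K \<epsilon> x1" "goodcol K \<epsilon> x2" "x1 \<le> x" "x \<le> x2"
 shows "goodcol K \<epsilon> x"
 unfolding goodcol_def
proof (intro allI impI)
 fix y assume y: "\<epsilon> \<le> y" "y \<le> 1 - \<epsilon>"
 show "(x, y) \<in> K"
 proof (cases "x1 = x2")
  case False
  then have lt: "x1 < x2" using assms(4,5) by simp
  define t where "t = (x - x1) / (x2 - x1)"
  have t: "0 \<le> t" "t \<le> 1" using assms(4,5) lt by (auto simp: t_def divide_le_eq)
  have "(1 - t) *\<^sub>R (x1, y) + t *\<^sub>R (x2, y) \<in> K"
   by (rule convexD_alt[OF assms(1) _ _ t]) (use assms(2,3) y in \<open>auto simp: goodcol_def\<close>)
  moreover have "t * (x2 - x1) = x - x1" using lt by (simp add: t_def)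
  then have "(1 - t) * x1 + t * x2 = x" by (simp add: algebra_simps)
  moreover have "(1 - t) * y + t * y = y" by (simp add: algebra_simps)
  ultimately show ?thesis by simp
 qed (use assms y in \<open>auto simp: goodcol_def\<close>)
qed

text \<open>Contrapositive of the decay: a value at \<open>q\<close> above the bound propagated from
  the column \<open>e\<close> forces a section of height more than \<open>1 - \<kappa> / L^2\<close>
  there, and within the strip of height 1 such a section covers the middle.\<close>

lemma dom_goodcol_right:
 assumes d: "dom K \<mu> u xs L" and \<kappa>: "336 \<le> \<kappa>" "\<kappa> / L^2 \<le> 1/2" and e: "xs \<le> e"
  and q: "q \<in> K" "e \<le> fst q" and big: "1800 * exp (- (sqrt \<kappa> / L) * (fst q - e)) < u q"
 shows "goodcol K (\<kappa> / L^2) e"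
proof (cases "e = xs")
 case True
 note D = dom_D[OF d]
 show ?thesis unfolding goodcol_def
 proof (intro allI impI)
  fix y assume y: "\<kappa> / L^2 \<le> y" "y \<le> 1 - \<kappa> / L^2"
  have "0 \<le> \<kappa> / L^2" using \<kappa> by simp
  then have "(1 - y) *\<^sub>R (xs, 0) + y *\<^sub>R (xs, 1) \<in> K"
   using y D(4,5) ground_D(3)[OF D(1)] by (intro convexD_alt) auto
  then show "(e, y) \<in> K" using True by (simp add: algebra_simps)
 qed
next
 case False
 note D = dom_D[OF d]
 have "\<exists>y y'. (e, y) \<in> K \<and> (e, y') \<in> K \<and> \<not> \<bar>y - y'\<bar> \<le> 1 - \<kappa> / L^2"
 proof (rule ccontr)
  assume "\<not> ?thesis"
  then have "u q \<le> 1800 * exp (- (sqrt \<kappa> / L) * (fst q - e))"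
   using False e by (intro dom_decay2[OF d _ _ \<kappa> q]) auto
  then show False using big by simp
 qed
 then obtain y y' where "(e, y) \<in> K" "(e, y') \<in> K" "\<not> \<bar>y - y'\<bar> \<le> 1 - \<kappa> / L^2" by blast
 then obtain a b where ab: "(e, a) \<in> K" "(e, b) \<in> K" "b - a > 1 - \<kappa> / L^2"
  by (metis abs_minus_commute abs_of_nonneg abs_of_nonpos linear diff_ge_0_iff_ge minus_diff_eq not_less diff_le_0_iff_le)
 have r: "a < \<kappa> / L^2" "1 - \<kappa> / L^2 < b" using ab(3) D(2)[OF ab(1)] D(3)[OF ab(2)] by auto
 show ?thesis unfolding goodcol_def
 proof (intro allI impI)
  fix z assume z: "\<kappa> / L^2 \<le> z" "z \<le> 1 - \<kappa> / L^2"
  have lt: "a < b" using ab(3) \<kappa>(2) by linarith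
  define t where "t = (z - a) / (b - a)"
  have "a \<le> z" "z \<le> b" using z r by linarith+
  then have t: "0 \<le> t" "t \<le> 1" using lt by (auto simp: t_def divide_le_eq)
  have "(1 - t) *\<^sub>R (e, a) + t *\<^sub>R (e, b) \<in> K"
   by (rule convexD_alt[OF ground_D(3)[OF D(1)] ab(1,2) t])
  moreover have "t * (b - a) = z - a" using lt by (simp add: t_def)
  then have "(1 - t) * a + t * b = z" by (simp add: algebra_simps)
  moreover have "(1 - t) * e + t * e = e" by (simp add: algebra_simps)
  ultimately show "(e, z) \<in> K" by simp
 qed
qed

text \<open>Every column of the window lies between \<open>xs\<close>, which carries the unit chord,
  and the edge of the window on its own side of \<open>xs\<close>. That edge is good because
  \<open>u\<close> is still at least \<open>\<eta> / 7200\<close> a further \<open>c * L\<close>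
  away; convexity fills in between.\<close>

lemma dom_window:
 assumes \<eta>: "0 < \<eta>" "\<eta> \<le> 1"
 shows "\<exists>\<kappa>>0. \<exists>L0\<ge>10^6/\<eta>. \<forall>K \<mu> u xs L p x. dom K \<mu> u xs L \<longrightarrow> L0 \<le> L \<longrightarrow> p \<in> K \<longrightarrow> \<eta> \<le> u p \<longrightarrow>
   \<bar>x - fst p\<bar> \<le> \<eta> / (2 * 10^6) * L \<longrightarrow> goodcol K (\<kappa> / L^2) x"
proof -
 define c where "c = \<eta> / (2 * 10^6)"
 have c: "0 < c" using \<eta> by (simp add: c_def)
 \<comment> \<open>The logarithmic summand makes
   \<open>1800 * exp (- (s * c)) < \<eta> / 7200\<close>, with \<open>1 / c\<close> for strictness;
   the summand 20 ensures \<open>s^2 \<ge> 336\<close>.\<close>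
 define s where "s = 20 + ln (1800 * 7200 / \<eta>) / c + 1 / c"
 have ln0: "0 \<le> ln (1800 * 7200 / \<eta>)" using \<eta> by (intro ln_ge_zero) (simp add: pos_le_divide_eq)
 have s: "20 \<le> s" using c ln0 by (simp add: s_def)
 define \<kappa> where "\<kappa> = s^2"
 have \<kappa>: "336 \<le> \<kappa>" "sqrt \<kappa> = s" using s power_mono[OF s, of 2] by (auto simp: \<kappa>_def)
 have "s * c = 20 * c + ln (1800 * 7200 / \<eta>) + 1" using c by (simp add: s_def field_simps)
 then have "ln (1800 * 7200 / \<eta>) < s * c" using c by simp
 then have "exp (ln (1800 * 7200 / \<eta>)) < exp (s * c)" by simp
 then have "1800 * 7200 / \<eta> < exp (s * c)" using \<eta> by simp
 then have "1800 * 7200 < exp (s * c) * \<eta>" using \<eta> by (simp add: pos_divide_less_eq)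
 then have "1800 * 7200 * exp (- (s * c)) < exp (s * c) * \<eta> * exp (- (s * c))" by (intro mult_strict_right_mono) auto
 then have sc: "1800 * exp (- (s * c)) < \<eta> / 7200" by (simp add: exp_minus field_simps)
 define L0 where "L0 = max (10^6 / \<eta>) (2 * s)"
 have right: "goodcol K (\<kappa> / L^2) (fst p + c * L)"
  if d: "dom K \<mu> u xs L" and L: "L0 \<le> L" and p: "p \<in> K" "\<eta> \<le> u p" and e: "xs \<le> fst p + c * L" for K \<mu> u xs L p
 proof -
  have Lb: "10^6 / \<eta> \<le> L" "2 * s \<le> L" using L by (auto simp: L0_def)
  obtain q where q: "q \<in> K" "fst q = fst p + \<eta> / 10^6 * L" "\<eta> / 7200 \<le> u q" using dom_side_right[OF d \<eta> Lb(1) p] by blast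
  have Lp: "0 < L" using dom_D(6)[OF d] by simp
  have fq: "fst q - (fst p + c * L) = c * L" using q(2) by (simp add: c_def)
  show ?thesis
  proof (rule dom_goodcol_right[OF d \<kappa>(1) _ e q(1)])
   have "(2 * s)^2 \<le> L^2" using Lb s by (intro power_mono) auto
   then have "4 * s^2 \<le> L^2" by (simp add: power_mult_distrib)
   moreover have "0 \<le> s^2" by simp
   ultimately have "s^2 * 2 \<le> L^2" by linarith
   moreover have "0 < L^2" using Lp by simp
   ultimately show "\<kappa> / L^2 \<le> 1 / 2" by (simp add: \<kappa>_def pos_divide_le_eq)
   show "fst p + c * L \<le> fst q" using fq c Lp by (smt (verit) mult_pos_pos)
   show "1800 * exp (- (sqrt \<kappa> / L) * (fst q - (fst p + c * L))) < u q"
    unfolding fq \<kappa>(2) using sc q(3) Lp by simp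
  qed
 qed
 have left: "goodcol K (\<kappa> / L^2) (fst p - c * L)"
  if d: "dom K \<mu> u xs L" and L: "L0 \<le> L" and p: "p \<in> K" "\<eta> \<le> u p" and e: "fst p - c * L \<le> xs" for K \<mu> u xs L p
 proof -
  let ?T = "mirror (-1) 1 0"
  have "goodcol (?T -` K) (\<kappa> / L^2) (fst (?T p) + c * L)"
   by (rule right[OF dom_refl_x[OF d] L]) (use p e refl_involution in \<open>auto simp: mirror_def\<close>)
  then show ?thesis by (auto simp: goodcol_def mirror_def)
 qed
 have centre: "goodcol K (\<kappa> / L^2) xs" if d: "dom K \<mu> u xs L" for K \<mu> u xs L
  unfolding goodcol_def
 proof (intro allI impI)
  fix y assume y: "\<kappa> / L^2 \<le> y" "y \<le> 1 - \<kappa> / L^2"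
  have "0 \<le> \<kappa> / L^2" using \<kappa> by simp
  then have "(1 - y) *\<^sub>R (xs, 0) + y *\<^sub>R (xs, 1) \<in> K"
   using y dom_D(4,5)[OF d] ground_D(3)[OF dom_D(1)[OF d]] by (intro convexD_alt) auto
  then show "(xs, y) \<in> K" by (simp add: algebra_simps)
 qed
 have "goodcol K (\<kappa> / L^2) x"
  if d: "dom K \<mu> u xs L" and L: "L0 \<le> L" and p: "p \<in> K" "\<eta> \<le> u p" and x: "\<bar>x - fst p\<bar> \<le> c * L" for K \<mu> u xs L p x
 proof -
  note cv = ground_D(3)[OF dom_D(1)[OF d]]
  have x': "fst p - c * L \<le> x" "x \<le> fst p + c * L" using x by auto
  show ?thesis
  proof (cases "x \<le> xs")
   case True
   then have "goodcol K (\<kappa> / L^2) (fst p - c * L)" using x' by (intro left[OF d L p]) simp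
   then show ?thesis by (rule goodcol_between[OF cv _ centre[OF d] x'(1) True])
  next
   case False
   then have "goodcol K (\<kappa> / L^2) (fst p + c * L)" using x' by (intro right[OF d L p]) simp
   then show ?thesis by (rule goodcol_between[OF cv centre[OF d] _ _ x'(2)]) (use False in simp)
  qed
 qed
 then show ?thesis using \<kappa>(1) by (intro exI[of _ \<kappa>] exI[of _ L0] conjI allI impI) (auto simp: L0_def c_def)
qed

section \<open>Harnack inequality and linear lower bounds across the strip\<close>

lemma harnack_path:
 assumes P: "sol \<mu> V P" and nu: "norm \<nu> = 1" and mu: "\<mu> * r^2 < 1" "0 < \<mu>" and r: "0 < r" "r < R"
  and T: "0 \<le> T" and B: "\<And>t. 0 \<le> t \<Longrightarrow> t \<le> T \<Longrightarrow> ball (p + t *\<^sub>R \<nu>) R \<subseteq> V"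
  and pos: "\<And>t z. 0 \<le> t \<Longrightarrow> t \<le> T \<Longrightarrow> z \<in> ball (p + t *\<^sub>R \<nu>) R \<Longrightarrow> 0 \<le> P z"
 shows "exp (- (4 / r) * T) * P p \<le> P (p + T *\<^sub>R \<nu>)"
proof -
 have C: "C2f V P" using P by (simp add: sol_def)
 let ?g = "\<lambda>t. P (p + t *\<^sub>R \<nu>) * exp (4 / r * t)"
 have "?g 0 \<le> ?g T"
 proof (rule DERIV_nonneg_imp_nondecreasing[OF T])
  fix t assume t: "0 \<le> t" "t \<le> T"
  let ?z = "p + t *\<^sub>R \<nu>"
  have "?z \<in> V" using subsetD[OF B[OF t], of ?z] r by simp
  then have D: "((\<lambda>t. P (p + t *\<^sub>R \<nu>)) has_real_derivative dd \<nu> P ?z) (at t)"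
   by (intro has_real_derivative_dd C2f_D(1)[OF C])
  have E: "((\<lambda>t. exp (4 / r * t)) has_real_derivative exp (4 / r * t) * (4 / r)) (at t)"
   using r by (auto intro!: derivative_eq_intros)
  have "\<bar>dd \<nu> P ?z\<bar> \<le> 4 / r * P ?z"
  proof (rule harnack_gradient[OF P B[OF t] nu mu r])
   fix z assume "z \<in> cball ?z r"
   then have "z \<in> ball ?z R" using r by simp
   then show "0 \<le> P z" using pos[OF t] by blast
  qed
  then have "0 \<le> (dd \<nu> P ?z + 4 / r * P ?z) * exp (4 / r * t)" by (intro mult_nonneg_nonneg) auto
  then show "\<exists>y. (?g has_real_derivative y) (at t) \<and> 0 \<le> y"
   using DERIV_mult[OF D E] by (intro exI[of _ "(dd \<nu> P ?z + 4 / r * P ?z) * exp (4 / r * t)"]) (simp add: algebra_simps)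
 qed
 then have "exp (- (4 / r) * T) * (P p) \<le> exp (- (4 / r) * T) * (P (p + T *\<^sub>R \<nu>) * exp (4 / r * T))"
  by (intro mult_left_mono) auto
 also have "\<dots> = P (p + T *\<^sub>R \<nu>) * (exp (- (4 / r) * T) * exp (4 / r * T))" by (simp only: mult_ac)
 also have "exp (- (4 / r) * T) * exp (4 / r * T) = 1" by (simp flip: exp_add)
 finally show ?thesis by simp
qed

lemma harnack_vertical:
 assumes P: "sol \<mu> V P" and mu: "\<mu> * r^2 < 1" "0 < \<mu>" and r: "0 < r" "r < R" "R \<le> 1"
  and box: "\<And>z. \<bar>fst z - x\<bar> < R \<Longrightarrow> a - R < snd z \<Longrightarrow> snd z < b + R \<Longrightarrow> z \<in> V \<and> 0 \<le> P z"
  and y: "a \<le> y" "y \<le> b" "a \<le> y'" "y' \<le> b" and ab: "b - a \<le> 1"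
 shows "exp (- (4 / r)) * P (x, y) \<le> P (x, y')"
proof -
 have yb: "a - R < y" "y < b + R" using y r by auto
 have P0: "0 \<le> P (x, y)" using box[of "(x, y)"] yb r by simp
 define s where "s = (if y \<le> y' then 1 else - 1 :: real)"
 define T where "T = \<bar>y' - y\<bar>"
 have T: "0 \<le> T" "T \<le> 1" using y ab by (auto simp: T_def abs_if)
 have yT: "y + s * T = y'" by (auto simp: s_def T_def)
 have bb: "z \<in> V \<and> 0 \<le> P z" if "0 \<le> t" "t \<le> T" "z \<in> ball ((x, y) + t *\<^sub>R (0, s)) R" for t z
 proof (rule box)
  have "dist (x, y + t * s) z < R" using that(3) by simp
  then have d: "\<bar>x - fst z\<bar> < R" "\<bar>y + t * s - snd z\<bar> < R"
   using dist_fst_le[of "(x, y + t * s)" z] dist_snd_le[of "(x, y + t * s)" z] by (auto simp: dist_real_def)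
  show "\<bar>fst z - x\<bar> < R" using d(1) by (simp add: abs_minus_commute)
  have "a \<le> y + t * s" "y + t * s \<le> b" using that(1,2) y by (auto simp: s_def T_def split: if_splits)
  then show "a - R < snd z" "snd z < b + R" using d(2) by (auto simp: abs_less_iff)
 qed
 have "exp (- (4 / r) * T) * P (x, y) \<le> P ((x, y) + T *\<^sub>R (0, s))"
 proof (rule harnack_path[OF P _ mu r(1,2) T(1)])
  show "norm (0::real, s) = 1" by (simp add: norm_Pair s_def)
 qed (use bb in blast)+
 moreover have "(x, y) + T *\<^sub>R (0, s) = (x, y')" using yT by (simp add: mult.commute)
 moreover have "exp (- (4 / r)) * P (x, y) \<le> exp (- (4 / r) * T) * P (x, y)"
  using T r P0 by (intro mult_right_mono) (auto simp: divide_right_mono mult_left_le)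
 ultimately show ?thesis by simp
qed

lemma dom_y_bounds:
 assumes d: "dom K \<mu> u xs L" and z: "(x, y) \<in> K"
 shows "u (x, y) \<le> 1350 * y" "u (x, y) \<le> 1350 * (1 - y)"
proof -
 note D = dom_D[OF d]
 have "u (x, y) \<le> 1350 * ((0, 1) \<bullet> (x, y) - 0)" by (rule dom_linear_bound[OF d _ _ z]) (use D(2) in \<open>auto simp: norm_Pair inner_prod_def\<close>)
 then show "u (x, y) \<le> 1350 * y" by simp
 have "u (x, y) \<le> 1350 * ((0, -1) \<bullet> (x, y) - (-1))" by (rule dom_linear_bound[OF d _ _ z]) (use D(3) in \<open>auto simp: norm_Pair inner_prod_def\<close>)
 then show "u (x, y) \<le> 1350 * (1 - y)" by simp
qed

lemma goodcol_box_interior: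
 assumes "\<And>x. \<bar>x - x0\<bar> \<le> c \<Longrightarrow> goodcol K \<epsilon> x" "\<bar>fst z - x0\<bar> < c" "\<epsilon> < snd z" "snd z < 1 - \<epsilon>"
 shows "z \<in> interior K"
proof -
 have "box (x0 - c, \<epsilon>) (x0 + c, 1 - \<epsilon>) \<subseteq> K"
 proof
  fix w assume "w \<in> box (x0 - c, \<epsilon>) (x0 + c, 1 - \<epsilon>)"
  then have "\<bar>fst w - x0\<bar> \<le> c" "\<epsilon> \<le> snd w" "snd w \<le> 1 - \<epsilon>" unfolding mem_box_pair by auto
  then show "w \<in> K" using assms(1)[of "fst w"] unfolding goodcol_def by (metis prod.collapse)
 qed
 moreover have "z \<in> box (x0 - c, \<epsilon>) (x0 + c, 1 - \<epsilon>)" unfolding mem_box_pair using assms(2-4) by auto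
 ultimately show ?thesis by (meson interiorI open_box)
qed

lemma mu_small:
 fixes \<mu> r :: real
 assumes "\<mu> < 2690" "0 \<le> r" "r \<le> 1 / 100" shows "\<mu> * r^2 < 1"
proof (cases "\<mu> \<le> 0")
 case True
 then have "\<mu> * r^2 \<le> 0" by (simp add: mult_nonpos_nonneg)
 then show ?thesis by linarith
next
 case False
 have "r^2 \<le> (1/100)^2" using assms by (intro power_mono) auto
 then have "\<mu> * r^2 \<le> \<mu> * (1/100)^2" using False by (intro mult_left_mono) auto
 then show ?thesis using assms by (simp add: power_divide)
qed

text \<open>By convexity of superlevel sets between \<open>p\<close> and a far point, column
  \<open>x\<close> contains a point of level \<open>\<eta> / 7200\<close>, which the linear bound
  keeps away from the sides. Harnack with radius \<open>\<eta> / (4 * 10^8)\<close> carries its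
  value through the column; this gives the exponent \<open>16 * 10^8 / \<eta>\<close>.\<close>

lemma dom_mid_lower:
 assumes \<eta>: "0 < \<eta>" "\<eta> \<le> 1" and d: "dom K \<mu> u xs L" and L: "10^6 / \<eta> \<le> L" and p: "p \<in> K" "\<eta> \<le> u p"
  and c: "0 < c" "c \<le> \<eta> / (2 * 10^6)" and good: "\<And>x. \<bar>x - fst p\<bar> \<le> c * L \<Longrightarrow> goodcol K \<epsilon> x"
  and \<epsilon>: "\<epsilon> \<le> \<eta> / (2 * 10^8)" "\<eta> \<le> c * L" and x: "\<bar>x - fst p\<bar> \<le> c / 2 * L" and y: "\<eta> / 10^8 \<le> y" "y \<le> 1 - \<eta> / 10^8"
 shows "exp (- (16 * 10^8 / \<eta>)) * (\<eta> / 7200) \<le> u (x, y)"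
proof -
 note D = dom_D[OF d]
 note G = ground_D[OF D(1)]
 have Lp: "0 < L" using D(6) by simp
 define s where "s = (if fst p \<le> x then 1 else - 1 :: real)"
 have s: "s \<in> {-1, 1}" by (auto simp: s_def)
 from dom_side[OF d \<eta> L p s] obtain q where q: "q \<in> K" "fst q = fst p + s * (\<eta> / 10^6 * L)" "\<eta> / 7200 \<le> u q" by blast
 define l where "l = \<eta> / 10^6 * L"
 have l: "0 < l" using \<eta> Lp by (simp add: l_def)
 have "c / 2 * L \<le> \<eta> / (2 * 10^6) / 2 * L" using c Lp by (intro mult_right_mono divide_right_mono) auto
 also have "\<dots> \<le> l" using \<eta> Lp by (simp add: l_def)
 finally have xl: "\<bar>x - fst p\<bar> \<le> l" using x by simp
 define t where "t = \<bar>x - fst p\<bar> / l"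
 have t: "0 \<le> t" "t \<le> 1" using xl l by (auto simp: t_def)
 define z where "z = (1 - t) *\<^sub>R p + t *\<^sub>R q"
 have "z \<in> {w \<in> K. \<eta> / 7200 \<le> u w}"
  unfolding z_def by (rule convexD_alt[OF convex_superlevel[OF D(1)] _ _ t]) (use p q \<eta> in auto)
 then have z: "z \<in> K" "\<eta> / 7200 \<le> u z" by auto
 have "fst z = fst p + t * (s * l)" unfolding z_def using q(2) by (simp add: l_def algebra_simps)
 also have "t * (s * l) = x - fst p" using l by (auto simp: t_def s_def)
 finally have fz: "fst z = x" by simp
 have zx: "z = (x, snd z)" using fz by (cases z) simp
 have sz: "\<eta> / 10^8 \<le> snd z" "snd z \<le> 1 - \<eta> / 10^8"
  using dom_y_bounds[OF d, of x "snd z"] z zx \<eta> by (simp_all flip: zx)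
 define R where "R = \<eta> / (2 * 10^8)"
 have R: "0 < R" "R \<le> 1" "R / 2 < R" "R / 2 \<le> 1/100" using \<eta> by (auto simp: R_def)
 have h: "exp (- (4 / (R / 2))) * u (x, snd z) \<le> u (x, y)"
 proof (rule harnack_vertical[OF G(5) _ G(1) _ R(3,2) _ sz y])
  show "\<mu> * (R / 2)^2 < 1" using dom_mu_le[OF d] R by (intro mu_small) auto
  fix w assume w: "\<bar>fst w - x\<bar> < R" "\<eta> / 10^8 - R < snd w" "snd w < 1 - \<eta> / 10^8 + R"
  have "R \<le> c / 2 * L" using \<epsilon>(2) \<eta> by (simp add: R_def)
  moreover have "\<bar>fst w - fst p\<bar> \<le> \<bar>fst w - x\<bar> + \<bar>x - fst p\<bar>" by linarith
  ultimately have "\<bar>fst w - fst p\<bar> < c * L" using w(1) x by linarith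
  moreover have "\<epsilon> < snd w" "snd w < 1 - \<epsilon>" using w(2,3) \<epsilon>(1) by (auto simp: R_def)
  ultimately have "w \<in> interior K" by (rule goodcol_box_interior[of "fst p" "c * L" K \<epsilon> w, rotated]) (rule good)
  then show "w \<in> interior K \<and> 0 \<le> u w" using G(6)[of w] by simp
 qed (use R \<eta> in auto)
 have e: "4 / (R / 2) = 16 * 10^8 / \<eta>" using \<eta> by (simp add: R_def)
 have "exp (- (16 * 10^8 / \<eta>)) * (\<eta> / 7200) \<le> exp (- (16 * 10^8 / \<eta>)) * u (x, snd z)"
  using z(2) zx by (intro mult_left_mono) auto
 also note h[unfolded e]
 finally show ?thesis .
qed

lemma lap2_hopf:
 "\<exists>a b. lap2 (\<lambda>z. c * ((- y0 + ey \<bullet> z) + (- y0 + ey \<bullet> z) * (- y0 + ey \<bullet> z)) + (- c) * ((- x0 + ex \<bullet> z) * (- x0 + ex \<bullet> z))) p a b 0"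
proof -
 have x: "lap2 (\<lambda>z. - x0 + ex \<bullet> z) p 1 0 0" and y: "lap2 (\<lambda>z. - y0 + ey \<bullet> z) p 0 1 0"
  using lap2_affine[of "- x0" ex p] lap2_affine[of "- y0" ey p] by auto
 note 1 = lap2_lin[OF lap2_lin[OF y lap2_mult[OF y y], of 1 1] lap2_mult[OF x x], of c "- c"]
 show ?thesis
  by (intro exI, rule lap2_eq[OF lap2_cong[OF 1] HOL.refl HOL.refl]) (simp_all add: algebra_simps)
qed

text \<open>The barrier is \<open>c\<close> times the harmonic polynomial
  \<open>Y + Y^2 - X^2\<close> in coordinates centred at \<open>(x, y0)\<close>: nonpositive at the
  bottom, negative on the sides, at most \<open>c\<close> on top, whereas \<open>u\<close> is
  superharmonic. On the axis \<open>X = 0\<close> it is at least \<open>c * Y\<close>.\<close>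

lemma hopf_barrier:
 assumes g: "ground \<mu> K u" and box: "cbox (x - 1, y0) (x + 1, y0 + 1/4) \<subseteq> K"
  and top: "\<And>x'. \<bar>x' - x\<bar> \<le> 1 \<Longrightarrow> c \<le> u (x', y0 + 1/4)" and c: "0 < c" and y: "y0 \<le> y" "y \<le> y0 + 1/4"
 shows "c * (y - y0) \<le> u (x, y)"
proof -
 note G = ground_D[OF g]
 let ?R = "cbox (x - 1, y0) (x + 1, y0 + 1/4)"
 define B where "B z = c * ((- y0 + ey \<bullet> z) + (- y0 + ey \<bullet> z) * (- y0 + ey \<bullet> z)) + (- c) * ((- x + ex \<bullet> z) * (- x + ex \<bullet> z))" for z
 have B: "B z = c * ((snd z - y0) + (snd z - y0) * (snd z - y0) - (fst z - x) * (fst z - x))" for z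
  by (cases z) (simp add: B_def algebra_simps)
 have "B z \<le> u z" if "z \<in> ?R" for z
 proof (rule ccontr)
  assume neg: "\<not> B z \<le> u z"
  have "continuous_on ?R (\<lambda>z. B z - u z)" unfolding B by (intro continuous_intros continuous_on_subset[OF G(4) box])
  moreover have "?R \<noteq> {}" using that by blast
  ultimately obtain w where w: "w \<in> ?R" "\<And>z. z \<in> ?R \<Longrightarrow> B z - u z \<le> B w - u w"
   using continuous_attains_sup[OF compact_cbox, of "(x - 1, y0)" "(x + 1, y0 + 1/4)" "\<lambda>z. B z - u z"] by blast
  have pos: "0 < B w - u w" using neg w(2)[OF that] by simp
  have u0: "0 \<le> u w" using ground_nonneg[OF g] w(1) box by blast
  have wr: "\<bar>fst w - x\<bar> \<le> 1" "y0 \<le> snd w" "snd w \<le> y0 + 1/4" using w(1) unfolding mem_cbox_pair by auto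
  have Bp: "0 < B w" using pos u0 by simp
  then have br: "0 < (snd w - y0) + (snd w - y0) * (snd w - y0) - (fst w - x) * (fst w - x)"
   unfolding B using c by (simp add: zero_less_mult_iff)
  have yq: "(snd w - y0) * (snd w - y0) \<le> 1/4 * (1/4)" using wr by (intro mult_mono) auto
  have "\<bar>fst w - x\<bar> \<noteq> 1"
  proof
   assume "\<bar>fst w - x\<bar> = 1"
   then have "(fst w - x) * (fst w - x) = 1" by (metis abs_mult_self_eq mult_1)
   then show False using br yq wr by linarith
  qed
  moreover have "snd w \<noteq> y0"
  proof
   assume "snd w = y0"
   then show False using br by (simp add: not_less)
  qed
  moreover have "snd w \<noteq> y0 + 1/4"
  proof
   assume e: "snd w = y0 + 1/4"
   then have "c \<le> u w" using top[of "fst w"] wr(1) by (metis prod.collapse)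
   moreover have "B w \<le> c * 1" unfolding B
    by (rule mult_left_mono) (use e c zero_le_square[of "fst w - x"] in \<open>auto simp: algebra_simps\<close>)
   ultimately show False using pos by simp
  qed
  ultimately have "w \<in> box (x - 1, y0) (x + 1, y0 + 1/4)" unfolding mem_box_pair using wr by auto
  moreover have "box (x - 1, y0) (x + 1, y0 + 1/4) \<subseteq> interior K"
   using box box_subset_cbox by (intro interior_maximal open_box) blast
  ultimately have wb: "w \<in> interior K" "\<forall>\<^sub>F z in nhds w. z \<in> box (x - 1, y0) (x + 1, y0 + 1/4)"
   by (blast, intro eventually_nhds_in_open open_box)
  obtain a b where "lap2 B w a b 0" using lap2_hopf[of c y0 x w] unfolding B_def[abs_def] by blast
  from lap2_lin[OF this lap2_sol[OF G(5) wb(1)], of 1 "- 1"]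
  have "lap2 (\<lambda>z. 1 * B z + (- 1) * u z) w (1 * a + (- 1) * dd ex u w) (1 * b + (- 1) * dd ey u w) (1 * 0 + (- 1) * (- \<mu> * u w))" .
  moreover have "\<forall>\<^sub>F z in nhds w. 1 * B z + (- 1) * u z \<le> 1 * B w + (- 1) * u w"
   using wb(2)
  proof eventually_elim
   fix z assume "z \<in> box (x - 1, y0) (x + 1, y0 + 1/4)"
   then have "z \<in> ?R" using box_subset_cbox by blast
   then show "1 * B z + (- 1) * u z \<le> 1 * B w + (- 1) * u w" using w(2)[of z] by simp
  qed
  ultimately have "1 * 0 + (- 1) * (- \<mu> * u w) \<le> 0" by (rule lap2_max(3))
  then show False using G(1) G(6)[OF wb(1)] by (simp add: mult_le_0_iff)
 qed
 from this[of "(x, y)"] have "B (x, y) \<le> u (x, y)" using y unfolding mem_cbox_pair by auto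
 moreover have "c * (y - y0) \<le> B (x, y)" unfolding B using c by simp
 ultimately show ?thesis by simp
qed

lemma dom_hopf:
 assumes \<eta>: "0 < \<eta>" "\<eta> \<le> 1" and d: "dom K \<mu> u xs L" and L: "10^6 / \<eta> \<le> L" and p: "p \<in> K" "\<eta> \<le> u p"
  and c: "0 < c" "c \<le> \<eta> / (2 * 10^6)" and good: "\<And>x. \<bar>x - fst p\<bar> \<le> c * L \<Longrightarrow> goodcol K \<epsilon> x"
  and \<epsilon>: "0 \<le> \<epsilon>" "\<epsilon> \<le> \<eta> / (2 * 10^8)" "4 \<le> c * L" and x: "\<bar>x - fst p\<bar> \<le> c / 4 * L"
  and y: "\<epsilon> \<le> y" "y \<le> 1 / 2"
 shows "exp (- (16 * 10^8 / \<eta>)) * (\<eta> / 7200) * (y - \<epsilon>) \<le> u (x, y)"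
proof -
 let ?c = "exp (- (16 * 10^8 / \<eta>)) * (\<eta> / 7200)"
 note D = dom_D[OF d]
 have \<eta>c: "\<eta> \<le> c * L" using \<epsilon> \<eta> by simp
 have mid: "?c \<le> u (x', y')" if "\<bar>x' - fst p\<bar> \<le> c / 2 * L" "\<eta> / 10^8 \<le> y'" "y' \<le> 1 - \<eta> / 10^8" for x' y'
  by (rule dom_mid_lower[OF \<eta> d L p c good \<epsilon>(2) \<eta>c that])
 have x1: "\<bar>x' - fst p\<bar> \<le> c / 2 * L" if "\<bar>x' - x\<bar> \<le> 1" for x'
 proof -
  have "\<bar>x' - fst p\<bar> \<le> \<bar>x' - x\<bar> + \<bar>x - fst p\<bar>" by linarith
  then show ?thesis using that x \<epsilon>(3) by linarith
 qed
 have cL: "0 < c * L" using c D(6) by simp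
 have \<eta>8: "\<eta> / 10^8 \<le> 1/8" "\<epsilon> \<le> 1/8" using \<eta> \<epsilon> by auto
 show ?thesis
 proof (cases "y \<le> \<epsilon> + 1/4")
  case True
  show ?thesis
  proof (rule hopf_barrier[OF D(1) _ _ _ y(1) True])
   show "cbox (x - 1, \<epsilon>) (x + 1, \<epsilon> + 1/4) \<subseteq> K"
   proof
    fix z assume z: "z \<in> cbox (x - 1, \<epsilon>) (x + 1, \<epsilon> + 1/4)"
    then have "\<bar>fst z - x\<bar> \<le> 1" unfolding mem_cbox_pair by auto
    then have "\<bar>fst z - fst p\<bar> \<le> c * L" using x1[of "fst z"] cL by simp
    from good[OF this] show "z \<in> K" using z \<eta>8 unfolding mem_cbox_pair goodcol_def by (cases z) auto
   qed
   fix x' assume "\<bar>x' - x\<bar> \<le> 1"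
   from mid[OF x1[OF this], of "\<epsilon> + 1/4"] show "?c \<le> u (x', \<epsilon> + 1/4)" using \<eta>8 \<epsilon>(1) by simp
  qed (use \<eta> in simp)
 next
  case False
  have "?c * (y - \<epsilon>) \<le> ?c * 1" using y \<epsilon>(1) \<eta> by (intro mult_left_mono) auto
  also have "?c * 1 \<le> u (x, y)" using mid[OF x1[of x], of y] False \<eta>8 y \<epsilon>(1) by simp
  finally show ?thesis .
 qed
qed

lemma goodcol_mirror: "goodcol (mirror 1 (-1) 1 -` K) \<epsilon> x \<longleftrightarrow> goodcol K \<epsilon> x"
proof -
 have "goodcol K \<epsilon> x \<Longrightarrow> goodcol (mirror 1 (-1) 1 -` K) \<epsilon> x" for K
  unfolding goodcol_def by (auto simp: mirror_def)
 from this[of K] this[of "mirror 1 (-1) 1 -` K"] show ?thesis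
  using refl_involution(2) by (auto simp: vimage_def)
qed

lemma dom_hopf2:
 assumes \<eta>: "0 < \<eta>" "\<eta> \<le> 1" and d: "dom K \<mu> u xs L" and L: "10^6 / \<eta> \<le> L" and p: "p \<in> K" "\<eta> \<le> u p"
  and c: "0 < c" "c \<le> \<eta> / (2 * 10^6)" and good: "\<And>x. \<bar>x - fst p\<bar> \<le> c * L \<Longrightarrow> goodcol K \<epsilon> x"
  and \<epsilon>: "0 \<le> \<epsilon>" "\<epsilon> \<le> \<eta> / (2 * 10^8)" "4 \<le> c * L" and x: "\<bar>x - fst p\<bar> \<le> c / 4 * L"
  and y: "\<epsilon> \<le> y" "y \<le> 1 - \<epsilon>"
 shows "exp (- (16 * 10^8 / \<eta>)) * (\<eta> / 7200) * (min y (1 - y) - \<epsilon>) \<le> u (x, y)"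
proof (cases "y \<le> 1/2")
 case True
 then show ?thesis using dom_hopf[OF \<eta> d L p c good \<epsilon> x y(1)] by (simp add: min_def)
next
 case False
 let ?T = "mirror 1 (-1) 1"
 have "exp (- (16 * 10^8 / \<eta>)) * (\<eta> / 7200) * ((1 - y) - \<epsilon>) \<le> u (?T (x, 1 - y))"
  by (rule dom_hopf[OF \<eta> dom_refl_y[OF d] L _ _ c _ \<epsilon>, of "?T p"])
    (use p refl_involution(2) x y False good in \<open>simp_all add: goodcol_mirror, simp_all add: mirror_def\<close>)
 then show ?thesis using False by (simp add: mirror_def min_def)
qed

section \<open>Bounds for the first and second derivative in \<open>x\<close>\<close>

lemma dd_minus: "P differentiable at q \<Longrightarrow> dd (- \<nu>) P q = - dd \<nu> P q"
 by (simp add: dd_eq_grad)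

text \<open>Concavity bounds the slope of \<open>ln u\<close> by its differences over the length
  \<open>c / 8 * L\<close> to either side. Upper and lower bounds for \<open>u\<close> are both
  proportional to \<open>min y (1 - y)\<close>, so this factor cancels and the estimate holds up to
  depth \<open>2 * \<epsilon>\<close>.\<close>

lemma dom_vx:
 assumes \<eta>: "0 < \<eta>" "\<eta> \<le> 1" and d: "dom K \<mu> u xs L" and L: "10^6 / \<eta> \<le> L" and p: "p \<in> K" "\<eta> \<le> u p"
  and c: "0 < c" "c \<le> \<eta> / (2 * 10^6)" and good: "\<And>x. \<bar>x - fst p\<bar> \<le> c * L \<Longrightarrow> goodcol K \<epsilon> x"
  and \<epsilon>: "0 < \<epsilon>" "\<epsilon> \<le> \<eta> / (2 * 10^8)" "4 \<le> c * L" and x: "\<bar>x - fst p\<bar> \<le> c / 8 * L"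
  and y: "2 * \<epsilon> \<le> y" "y \<le> 1 - 2 * \<epsilon>" and c2: "c2 = exp (- (16 * 10^8 / \<eta>)) * (\<eta> / 7200)"
 shows "\<bar>dd ex u (x, y)\<bar> \<le> (8 / c * ln (2700 / c2)) / L * u (x, y)" "(x, y) \<in> interior K"
proof -
 note D = dom_D[OF d]
 note G = ground_D[OF D(1)]
 have Lp: "0 < L" using D(6) by simp
 have cL: "0 < c * L" using c Lp by simp
 have c2p: "0 < c2" unfolding c2 using \<eta> by simp
 let ?m = "min y (1 - y)"
 have m: "2 * \<epsilon> \<le> ?m" "0 < ?m" using y \<epsilon>(1) by (auto simp: min_def)
 have pt: "(x', y) \<in> interior K \<and> c2 * ?m / 2 \<le> u (x', y)" if "\<bar>x' - fst p\<bar> \<le> c / 4 * L" for x'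
 proof -
  have "c2 * (?m - \<epsilon>) \<le> u (x', y)" unfolding c2
   by (rule dom_hopf2[OF \<eta> d L p c good less_imp_le[OF \<epsilon>(1)] \<epsilon>(2,3) that]) (use y \<epsilon> in auto)
  moreover have "c2 * (?m / 2) \<le> c2 * (?m - \<epsilon>)" using m c2p by (intro mult_left_mono) auto
  ultimately have le: "c2 * ?m / 2 \<le> u (x', y)" by simp
  have "goodcol K \<epsilon> x'" using that cL by (intro good) simp
  then have "(x', y) \<in> K" using y \<epsilon> by (simp add: goodcol_def)
  moreover have "0 < c2 * ?m / 2" using c2p m by simp
  ultimately show ?thesis using le ground_pos_iff[OF D(1), of "(x', y)"] by auto
 qed
 define T where "T = c / 8 * L"
 have T: "0 < T" using cL by (simp add: T_def)
 have xr: "\<bar>x - fst p\<bar> \<le> c / 4 * L" "\<bar>(x + T) - fst p\<bar> \<le> c / 4 * L" "\<bar>(x - T) - fst p\<bar> \<le> c / 4 * L"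
  using x T unfolding T_def abs_le_iff by linarith+
 note P = pt[OF xr(1), THEN conjunct1] and P1 = pt[OF xr(2)] and P2 = pt[OF xr(3)]
 show "(x, y) \<in> interior K" by (rule P)
 have K: "(x, y) \<in> K" using P interior_subset by blast
 have up: "0 < u (x, y)" by (rule G(6)[OF P])
 have "u (x, y) \<le> 1350 * ?m" using dom_y_bounds[OF d K] by (simp add: min_def)
 then have lnu: "ln (u (x, y)) \<le> ln (1350 * ?m)" using up by (subst ln_le_cancel_iff) linarith+
 have lq: "ln (c2 * ?m / 2) \<le> ln (u (x', y))" if "c2 * ?m / 2 \<le> u (x', y)" for x'
 proof -
  have "0 < c2 * ?m / 2" using c2p m by simp
  then show ?thesis using that by simp
 qed
 have "ln (1350 * ?m) - ln (c2 * ?m / 2) = ln ((1350 * ?m) / (c2 * ?m / 2))"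
  using m c2p by (subst ln_div) auto
 also have "(1350 * ?m) / (c2 * ?m / 2) = 2700 / c2" using less_imp_neq[OF m(2)] by simp
 finally have e: "ln (1350 * ?m) - ln (c2 * ?m / 2) = ln (2700 / c2)" .
 have diff: "u differentiable at (x, y)" using G(5) P by (auto simp: sol_def C2f_def)
 have "ln (u ((x, y) + T *\<^sub>R ex)) - ln (u (x, y)) \<le> T * (dd ex u (x, y) / u (x, y))"
  by (rule ln_u_line(1)[OF D(1) _ P]) (use P1 T in \<open>auto simp: norm_Pair\<close>)
 then have 1: "- ln (2700 / c2) \<le> T * (dd ex u (x, y) / u (x, y))"
  using lq[of "x + T"] P1 lnu e by simp
 have "ln (u ((x, y) + T *\<^sub>R - ex)) - ln (u (x, y)) \<le> T * (dd (- ex) u (x, y) / u (x, y))"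
  by (rule ln_u_line(1)[OF D(1) _ P]) (use P2 T in \<open>auto simp: norm_Pair\<close>)
 then have 2: "- ln (2700 / c2) \<le> - (T * (dd ex u (x, y) / u (x, y)))"
  using lq[of "x - T"] P2 lnu e unfolding dd_minus[OF diff] by simp
 have "\<bar>T * (dd ex u (x, y) / u (x, y))\<bar> \<le> ln (2700 / c2)" using 1 2 by linarith
 then have "T * (\<bar>dd ex u (x, y)\<bar> / u (x, y)) \<le> ln (2700 / c2)" using T up by (simp add: abs_mult)
 then have "\<bar>dd ex u (x, y)\<bar> / u (x, y) \<le> ln (2700 / c2) / T" using T by (simp add: pos_le_divide_eq mult.commute)
 then have "\<bar>dd ex u (x, y)\<bar> \<le> ln (2700 / c2) / T * u (x, y)" using up by (simp add: pos_divide_le_eq)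
 also have "ln (2700 / c2) / T = (8 / c * ln (2700 / c2)) / L" using c Lp by (simp add: T_def)
 finally show "\<bar>dd ex u (x, y)\<bar> \<le> (8 / c * ln (2700 / c2)) / L * u (x, y)" .
qed

text \<open>\<open>u\<^sub>y s - u s\<^sub>y\<close>, with \<open>s\<close> the sine vanishing at \<open>\<epsilon>\<close> and \<open>1 - \<epsilon>\<close>, has derivative close to
 \<open>(- u\<^sub>x\<^sub>x + m u) s\<close> and small boundary values.\<close>

lemma section_estimate:
 assumes g: "ground \<mu> K u" and \<epsilon>: "0 \<le> \<epsilon>" "\<epsilon> \<le> 1/8"
  and int: "\<And>y. \<epsilon> \<le> y \<Longrightarrow> y \<le> 1 - \<epsilon> \<Longrightarrow> (x, y) \<in> interior K"
  and mu: "\<mu> + m \<le> pi^2 + D" "0 \<le> D"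
  and P: "\<And>y. \<epsilon> \<le> y \<Longrightarrow> y \<le> 1 - \<epsilon> \<Longrightarrow> 0 \<le> - dd ex (dd ex u) (x, y) + m * u (x, y)"
  and B: "\<And>y. 1/4 \<le> y \<Longrightarrow> y \<le> 3/4 \<Longrightarrow> B \<le> - dd ex (dd ex u) (x, y) + m * u (x, y)" "0 \<le> B"
  and edge: "u (x, \<epsilon>) \<le> e" "u (x, 1 - \<epsilon>) \<le> e"
 shows "B / 32 \<le> 14 * e + D"
proof -
 note G = ground_D[OF g]
 define k where "k = pi / (1 - 2 * \<epsilon>)"
 have k: "pi \<le> k" "k \<le> 7" "k * (1 - 2 * \<epsilon>) = pi"
 proof -
  show "k * (1 - 2 * \<epsilon>) = pi" using \<epsilon> by (simp add: k_def)
  show "pi \<le> k" using \<epsilon> by (simp add: k_def pos_le_divide_eq algebra_simps)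
  have "pi < 3.2" using pi_approx by simp
  moreover have "7 * (3/4) \<le> 7 * (1 - 2 * \<epsilon>)" using \<epsilon> by simp
  ultimately have "pi \<le> 7 * (1 - 2 * \<epsilon>)" by linarith
  then show "k \<le> 7" using \<epsilon> by (simp add: k_def pos_divide_le_eq)
 qed
 have k0: "0 < k" using k(1) pi_gt_zero by linarith
 have k2: "pi^2 \<le> k^2" using k(1) by (intro power_mono) auto
 let ?P = "\<lambda>y. - dd ex (dd ex u) (x, y) + m * u (x, y)"
 let ?s = "\<lambda>y. sin (k * (y - \<epsilon>))"
 \<comment> \<open>The term \<open>D * y\<close> absorbs the possible negative part of
   \<open>(k^2 - \<mu> - m) * u * ?s\<close>, so that the derivative of \<open>f\<close> is at least
   \<open>?P * ?s\<close>.\<close>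
 define f where "f y = dd ey u (x, y) * ?s y - u (x, y) * (k * cos (k * (y - \<epsilon>))) + D * y" for y
 have s01: "0 \<le> ?s y" "?s y \<le> 1" if "\<epsilon> \<le> y" "y \<le> 1 - \<epsilon>" for y
 proof -
  have "k * (y - \<epsilon>) \<le> k * (1 - 2 * \<epsilon>)" using that k0 by (intro mult_left_mono) auto
  moreover have "0 \<le> k * (y - \<epsilon>)" using that k0 by (intro mult_nonneg_nonneg) auto
  ultimately show "0 \<le> ?s y" unfolding k(3) by (intro sin_ge_zero) auto
 qed simp
 have Df: "\<exists>d. (f has_real_derivative d) (at y) \<and> ?P y * ?s y \<le> d" if y: "\<epsilon> \<le> y" "y \<le> 1 - \<epsilon>" for y
 proof -
  have e: "(x, 0) + t *\<^sub>R ey = (x, t)" for t by simp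
  have i: "(x, 0) + y *\<^sub>R ey \<in> interior K" using int[OF y] by simp
  have n: "norm ey = 1" by (simp add: norm_Pair)
  have d1: "((\<lambda>t. u (x, t)) has_real_derivative dd ey u (x, y)) (at y)"
   using DERIV_ln_line(3)[OF g n i] unfolding e .
  have d2: "((\<lambda>t. dd ey u (x, t)) has_real_derivative dd ey (dd ey u) (x, y)) (at y)"
   using DERIV_ln_line(4)[OF g n i] unfolding e .
  have "(f has_real_derivative dd ey (dd ey u) (x, y) * ?s y + k^2 * u (x, y) * ?s y + D) (at y)"
   unfolding f_def using d1 d2
   by (auto intro!: derivative_eq_intros simp: power2_eq_square algebra_simps)
  moreover have "dd ey (dd ey u) (x, y) = - \<mu> * u (x, y) - dd ex (dd ex u) (x, y)"
   using G(5) int[OF y] by (simp add: sol_def algebra_simps)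
  then have "dd ey (dd ey u) (x, y) * ?s y + k^2 * u (x, y) * ?s y + D = ?P y * ?s y + ((k^2 - \<mu> - m) * (u (x, y) * ?s y) + D)"
   by (simp only:) (simp add: algebra_simps)
  moreover have "0 \<le> (k^2 - \<mu> - m) * (u (x, y) * ?s y) + D"
  proof -
   have u01: "0 \<le> u (x, y)" "u (x, y) \<le> 1" using G(6,7)[of "(x, y)"] int[OF y] interior_subset[of K] by (auto simp: less_imp_le)
   have w: "0 \<le> u (x, y) * ?s y" "u (x, y) * ?s y \<le> 1" using u01 s01[OF y] by (auto intro: mult_le_one)
   have "- D * (u (x, y) * ?s y) \<le> (k^2 - \<mu> - m) * (u (x, y) * ?s y)" using mu k2 w by (intro mult_right_mono) auto
   moreover have "D * (u (x, y) * ?s y) \<le> D * 1" using mu w by (intro mult_left_mono) auto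
   ultimately show ?thesis by linarith
  qed
  ultimately show ?thesis by (intro exI[of _ "?P y * ?s y + ((k^2 - \<mu> - m) * (u (x, y) * ?s y) + D)"]) auto
 qed
 have mono: "f a \<le> f b" if "\<epsilon> \<le> a" "a \<le> b" "b \<le> 1 - \<epsilon>" for a b
 proof (rule DERIV_nonneg_imp_nondecreasing[OF that(2)])
  fix y assume "a \<le> y" "y \<le> b"
  then have y: "\<epsilon> \<le> y" "y \<le> 1 - \<epsilon>" using that by auto
  have "0 \<le> ?P y * ?s y" by (rule mult_nonneg_nonneg[OF P[OF y] s01(1)[OF y]])
  then show "\<exists>d. (f has_real_derivative d) (at y) \<and> 0 \<le> d" using Df[OF y] order_trans by blast
 qed
 \<comment> \<open>On the middle half the sine is at least 1/16, so \<open>f\<close> gains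
   \<open>B / 16\<close> per unit length there, in total \<open>B / 32\<close>.\<close>
 have "f (1/4) - B / 16 * (1/4) \<le> f (3/4) - B / 16 * (3/4)"
 proof (rule DERIV_nonneg_imp_nondecreasing[of "1/4" "3/4" "\<lambda>y. f y - B / 16 * y"])
  fix y :: real assume y': "1/4 \<le> y" "y \<le> 3/4"
  then have y: "\<epsilon> \<le> y" "y \<le> 1 - \<epsilon>" using \<epsilon> by auto
  obtain d where d: "(f has_real_derivative d) (at y)" "?P y * ?s y \<le> d" using Df[OF y] by blast
  have "1/16 \<le> ?s y"
  proof -
   let ?t = "k * (y - \<epsilon>)"
   have "pi * (1/8) \<le> ?t" using k(1) k0 y' \<epsilon> by (intro mult_mono) auto
   moreover have "pi * (1/8) \<le> k * (1 - \<epsilon> - y)" using k(1) k0 y' \<epsilon> by (intro mult_mono) auto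
   moreover have "k * (1 - \<epsilon> - y) = pi - ?t" using k(3) by (simp add: algebra_simps)
   ultimately have t: "pi / 8 \<le> ?t" "pi / 8 \<le> pi - ?t" by auto
   show ?thesis
   proof (cases "?t \<le> pi / 2")
    case True
    then have "?t / 4 \<le> sin ?t" using t pi_gt_zero by (intro sin_ge_quarter) linarith+
    then show ?thesis using t pi_gt3 by linarith
   next
    case False
    then have "(pi - ?t) / 4 \<le> sin (pi - ?t)" using t pi_gt_zero by (intro sin_ge_quarter) linarith+
    then show ?thesis using t pi_gt3 by simp
   qed
  qed
  then have "B * (1/16) \<le> ?P y * ?s y" using B(1)[OF y'] B(2) by (intro mult_mono) auto
  then have "0 \<le> d - B / 16" using d(2) by simp
  then show "\<exists>d. ((\<lambda>y. f y - B / 16 * y) has_real_derivative d) (at y) \<and> 0 \<le> d"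
   using d(1) by (intro exI[of _ "d - B / 16"]) (auto intro!: derivative_eq_intros)
 qed simp
 moreover have "f \<epsilon> \<le> f (1/4)" "f (3/4) \<le> f (1 - \<epsilon>)" using mono \<epsilon> by auto
 moreover have "f \<epsilon> = - k * u (x, \<epsilon>) + D * \<epsilon>" by (simp add: f_def)
 moreover have "k * (1 - \<epsilon> - \<epsilon>) = pi" using k(3) by simp
 then have "f (1 - \<epsilon>) = k * u (x, 1 - \<epsilon>) + D * (1 - \<epsilon>)" by (simp add: f_def)
 moreover have "0 \<le> u (x, \<epsilon>)" "0 \<le> u (x, 1 - \<epsilon>)" using G(6)[OF int[of \<epsilon>]] G(6)[OF int[of "1 - \<epsilon>"]] \<epsilon> by auto
 then have "k * u (x, \<epsilon>) \<le> 7 * e" "k * u (x, 1 - \<epsilon>) \<le> 7 * e"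
  using mult_mono[OF k(2) edge(1)] mult_mono[OF k(2) edge(2)] by auto
 moreover have "0 \<le> D * \<epsilon>" using mu \<epsilon> by simp
 ultimately show ?thesis by (simp add: right_diff_distrib)
qed

text \<open>The bound \<open>u_xx \<le> u_x^2 / u\<close> from log-concavity settles one sign and
  makes \<open>P\<close> nonnegative. Harnack in the column turns \<open>P p\<close> into a lower
  bound for \<open>P\<close> on the middle half; the section estimate tolerates this only if
  \<open>P p = O(1 / L^2)\<close>, because the edge values of \<open>u\<close> and the eigenvalue
  excess have that size.\<close>

lemma dom_dxx_large:
 assumes \<eta>: "0 < \<eta>" "\<eta> \<le> 1"
 shows "\<exists>C>0. \<exists>L0\<ge>1. \<forall>K \<mu> u xs L p. dom K \<mu> u xs L \<longrightarrow> L0 \<le> L \<longrightarrow> p \<in> K \<longrightarrow> \<eta> \<le> u p \<longrightarrow>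
   \<bar>dd ex u p\<bar> \<le> C / L \<and> \<bar>dd ex (dd ex u) p\<bar> \<le> C / L^2"
proof -
 obtain \<kappa> L0 where \<kappa>: "0 < \<kappa>" and L0: "10^6 / \<eta> \<le> L0" and win: "\<And>K \<mu> u xs L p x. dom K \<mu> u xs L \<Longrightarrow> L0 \<le> L \<Longrightarrow> p \<in> K \<Longrightarrow> \<eta> \<le> u p \<Longrightarrow>
   \<bar>x - fst p\<bar> \<le> \<eta> / (2 * 10^6) * L \<Longrightarrow> goodcol K (\<kappa> / L^2) x"
  using dom_window[OF \<eta>] by metis
 define c where "c = \<eta> / (2 * 10^6)"
 define c2 where "c2 = exp (- (16 * 10^8 / \<eta>)) * (\<eta> / 7200)"
 define M where "M = 8 / c * ln (2700 / c2)"
 define e0 where "e0 = exp (- (16 * 10^8 / \<eta>))"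
 define C where "C = M^2 + \<bar>M\<bar> + 32 / e0 * (37800 * \<kappa> + 2680 + M^2)"
 \<comment> \<open>\<open>8 / c\<close> makes the window wide against the Harnack balls;
   \<open>8 * 10^8 * \<kappa> / \<eta>\<close> makes the defect \<open>\<kappa> / L^2\<close> of the
   columns small against their radius.\<close>
 define L1 where "L1 = max (max L0 (8 / c)) (max 1 (8 * 10^8 * \<kappa> / \<eta>))"
 have cp: "0 < c" using \<eta> by (simp add: c_def)
 have "0 < 32 / e0 * (37800 * \<kappa> + 2680 + M^2)" using \<kappa> by (intro mult_pos_pos) (auto simp: e0_def add_pos_nonneg)
 then have Cp: "0 < C" unfolding C_def by (simp add: add_nonneg_pos)
 have "\<bar>dd ex u p\<bar> \<le> C / L \<and> \<bar>dd ex (dd ex u) p\<bar> \<le> C / L^2"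
  if d: "dom K \<mu> u xs L" and L: "L1 \<le> L" and p: "p \<in> K" "\<eta> \<le> u p" for K \<mu> u xs L p
 proof -
  note D = dom_D[OF d]
  note G = ground_D[OF D(1)]
  have Lb: "L0 \<le> L" "8 / c \<le> L" "1 \<le> L" "8 * 10^8 * \<kappa> / \<eta> \<le> L" using L by (auto simp: L1_def)
  have L6: "10^6 / \<eta> \<le> L" using L0 Lb(1) by simp
  have L2: "0 < L^2" "L \<le> L^2" using Lb(3) by (auto simp: power2_eq_square)
  define \<epsilon> where "\<epsilon> = \<kappa> / L^2"
  have \<epsilon>p: "0 < \<epsilon>" using \<kappa> L2 by (simp add: \<epsilon>_def)
  have "8 * 10^8 * \<kappa> / \<eta> \<le> L^2" using Lb(4) L2(2) by linarith
  then have "8 * 10^8 * \<kappa> \<le> L^2 * \<eta>" using \<eta> by (simp add: pos_divide_le_eq)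
  then have \<epsilon>s: "\<epsilon> \<le> \<eta> / (8 * 10^8)"
   unfolding \<epsilon>_def using L2 by (simp add: pos_divide_le_eq mult.commute)
  have cL: "8 \<le> c * L" using Lb(2) cp by (simp add: pos_divide_le_eq mult.commute)
  have good: "goodcol K \<epsilon> x" if "\<bar>x - fst p\<bar> \<le> c * L" for x
   unfolding \<epsilon>_def by (rule win[OF d Lb(1) p]) (use that in \<open>simp add: c_def\<close>)
  have vx: "\<bar>dd ex u (x, y)\<bar> \<le> M / L * u (x, y)" "(x, y) \<in> interior K"
   if "\<bar>x - fst p\<bar> \<le> c / 8 * L" "2 * \<epsilon> \<le> y" "y \<le> 1 - 2 * \<epsilon>" for x y
  proof -
   have a: "c \<le> \<eta> / (2 * 10^6)" "\<epsilon> \<le> \<eta> / (2 * 10^8)" "4 \<le> c * L" using \<epsilon>s \<eta> cL by (auto simp: c_def)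
   show "\<bar>dd ex u (x, y)\<bar> \<le> M / L * u (x, y)" unfolding M_def
    by (rule dom_vx(1)[OF \<eta> d L6 p cp a(1) good \<epsilon>p a(2,3) that c2_def])
   show "(x, y) \<in> interior K"
    by (rule dom_vx(2)[OF \<eta> d L6 p cp a(1) good \<epsilon>p a(2,3) that c2_def])
  qed
  define m where "m = M^2 / L^2"
  define P where "P z = (- 1) * dd ex (dd ex u) z + m * u z" for z
  have nx: "norm ex = 1" by (simp add: norm_Pair)
  have solP: "sol \<mu> (interior K) P" unfolding P_def
   by (intro sol_lin sol_dd[OF sol_dd[OF G(5) G(1) nx] G(1) nx] G(5))
  have P0: "0 \<le> P (x, y)" if "\<bar>x - fst p\<bar> \<le> c / 8 * L" "2 * \<epsilon> \<le> y" "y \<le> 1 - 2 * \<epsilon>" for x y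
  proof -
   note i = vx(2)[OF that]
   have up: "0 < u (x, y)" by (rule G(6)[OF i])
   have "0 \<le> whess u ex (x, y)" by (rule whess_nonneg[OF D(1) i nx])
   then have "0 \<le> whess u ex (x, y) * u (x, y)" using up by simp
   then have "dd ex (dd ex u) (x, y) \<le> (dd ex u (x, y) / u (x, y))^2 * u (x, y)"
    using up by (simp add: whess_def left_diff_distrib)
   moreover have "\<bar>dd ex u (x, y) / u (x, y)\<bar> \<le> M / L" using vx(1)[OF that] up by (simp add: pos_divide_le_eq)
   then have "\<bar>dd ex u (x, y) / u (x, y)\<bar>^2 \<le> (M / L)^2" by (intro power_mono) auto
   then have "(dd ex u (x, y) / u (x, y))^2 \<le> (M / L)^2" by (simp only: power2_abs)
   then have "(dd ex u (x, y) / u (x, y))^2 * u (x, y) \<le> m * u (x, y)" using up by (intro mult_right_mono) (auto simp: m_def power_divide)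
   ultimately show ?thesis by (simp add: P_def)
  qed
  define \<theta> where "\<theta> = \<eta> / 10^8"
  have \<theta>: "0 < \<theta>" "\<theta> \<le> 1/100" using \<eta> by (auto simp: \<theta>_def)
  have pp: "p = (fst p, snd p)" by simp
  have yp: "\<theta> \<le> snd p" "snd p \<le> 1 - \<theta>"
   using dom_y_bounds[OF d, of "fst p" "snd p"] p \<eta> by (simp_all add: \<theta>_def)
  have har: "e0 * P p \<le> P (fst p, y')" if "\<theta> \<le> y'" "y' \<le> 1 - \<theta>" for y'
  proof -
   have "exp (- (4 / (\<theta> / 4))) * P (fst p, snd p) \<le> P (fst p, y')"
   proof (rule harnack_vertical[OF solP _ G(1) _ _ _ _ yp that, where R = "\<theta> / 2"])
    show "\<mu> * (\<theta> / 4)^2 < 1" using dom_mu_le[OF d] \<theta> by (intro mu_small) auto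
    fix z :: "point" assume z: "\<bar>fst z - fst p\<bar> < \<theta> / 2" "\<theta> - \<theta> / 2 < snd z" "snd z < 1 - \<theta> + \<theta> / 2"
    have "\<theta> / 2 \<le> c / 8 * L" using \<theta> cL by simp
    then have "\<bar>fst z - fst p\<bar> \<le> c / 8 * L" using z(1) by linarith
    moreover have "2 * \<epsilon> \<le> snd z" "snd z \<le> 1 - 2 * \<epsilon>" using z(2,3) \<epsilon>s \<eta> by (auto simp: \<theta>_def)
    ultimately show "z \<in> interior K \<and> 0 \<le> P z" using vx(2)[of "fst z" "snd z"] P0[of "fst z" "snd z"] by simp
   qed (use \<theta> in auto)
   moreover have "4 / (\<theta> / 4) = 16 * 10^8 / \<eta>" using \<eta> by (simp add: \<theta>_def)
   ultimately show ?thesis by (simp add: e0_def)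
  qed
  have x0: "\<bar>fst p - fst p\<bar> \<le> c / 8 * L" using cL by simp
  have py2: "2 * \<epsilon> \<le> snd p" "snd p \<le> 1 - 2 * \<epsilon>" using yp \<epsilon>s \<eta> by (auto simp: \<theta>_def)
  have Pp: "0 \<le> P p" using P0[OF x0 py2] by simp
  have \<epsilon>8: "2 * \<epsilon> \<le> 1 / 8" using \<epsilon>s \<eta> by simp
  have "e0 * P p / 32 \<le> 14 * (2700 * \<epsilon>) + (2680 + M^2) / L^2"
  proof (rule section_estimate[OF D(1) _ \<epsilon>8, where x = "fst p" and m = m])
   show "(fst p, y) \<in> interior K" if "2 * \<epsilon> \<le> y" "y \<le> 1 - 2 * \<epsilon>" for y by (rule vx(2)[OF x0 that])
   show "\<mu> + m \<le> pi^2 + (2680 + M^2) / L^2" using dom_mu_le(1)[OF d] by (simp add: m_def add_divide_distrib)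
   show "0 \<le> - dd ex (dd ex u) (fst p, y) + m * u (fst p, y)" if "2 * \<epsilon> \<le> y" "y \<le> 1 - 2 * \<epsilon>" for y
    using P0[OF x0 that] by (simp add: P_def)
   show "e0 * P p \<le> - dd ex (dd ex u) (fst p, y) + m * u (fst p, y)" if "1/4 \<le> y" "y \<le> 3/4" for y
    using har[of y] that \<theta> by (simp add: P_def)
   have "(fst p, 2 * \<epsilon>) \<in> K" "(fst p, 1 - 2 * \<epsilon>) \<in> K"
    using vx(2)[OF x0, of "2 * \<epsilon>"] vx(2)[OF x0, of "1 - 2 * \<epsilon>"] \<epsilon>8 interior_subset[of K] by auto
   from dom_y_bounds(1)[OF d this(1)] dom_y_bounds(2)[OF d this(2)]
   show "u (fst p, 2 * \<epsilon>) \<le> 2700 * \<epsilon>" "u (fst p, 1 - 2 * \<epsilon>) \<le> 2700 * \<epsilon>" by auto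
  qed (use \<epsilon>p Pp in \<open>auto simp: e0_def\<close>)
  also have "\<dots> = (37800 * \<kappa> + 2680 + M^2) / L^2" by (simp add: \<epsilon>_def add_divide_distrib)
  finally have "e0 * P p / 32 \<le> (37800 * \<kappa> + 2680 + M^2) / L^2" .
  moreover have e0: "0 < e0" by (simp add: e0_def)
  ultimately have "32 / e0 * (e0 * P p / 32) \<le> 32 / e0 * ((37800 * \<kappa> + 2680 + M^2) / L^2)"
   by (intro mult_left_mono) auto
  then have "P p \<le> 32 / e0 * ((37800 * \<kappa> + 2680 + M^2) / L^2)" using e0 by simp
  then have Ple: "P p \<le> (C - M^2 - \<bar>M\<bar>) / L^2" by (simp add: C_def)
  have ip: "p \<in> interior K" using vx(2)[OF x0 py2] by simp
  have u01: "0 < u p" "u p \<le> 1" using G(6)[OF ip] G(7)[OF p(1)] by auto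
  have mu: "0 \<le> m * u p" "m * u p \<le> M^2 / L^2"
   using u01 mult_left_le[of "u p" m] by (auto simp: m_def)
  have "\<bar>dd ex (dd ex u) p\<bar> \<le> P p + m * u p" using Pp mu(1) by (auto simp: P_def abs_le_iff)
  also have "\<dots> \<le> (C - M^2 - \<bar>M\<bar>) / L^2 + M^2 / L^2" using Ple mu(2) by linarith
  also have "\<dots> \<le> C / L^2" using L2 by (simp add: add_divide_distrib[symmetric] divide_right_mono)
  finally have 2: "\<bar>dd ex (dd ex u) p\<bar> \<le> C / L^2" .
  have "\<bar>dd ex u p\<bar> \<le> M / L * u p" using vx(1)[OF x0 py2] by simp
  also have "\<dots> \<le> \<bar>M\<bar> / L * 1" using u01 Lb(3) by (intro mult_mono divide_right_mono) auto
  also have "\<dots> \<le> C / L"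
  proof -
   have "0 \<le> 32 / e0 * (37800 * \<kappa> + 2680 + M^2)" using \<kappa> by (intro mult_nonneg_nonneg) (auto simp: e0_def)
   then have "\<bar>M\<bar> \<le> C" by (simp add: C_def)
   then show ?thesis using Lb(3) by (simp add: divide_right_mono)
  qed
  finally show ?thesis using 2 by simp
 qed
 then show ?thesis using Cp by (intro exI[of _ C] exI[of _ L1] conjI allI impI) (auto simp: L1_def)
qed

section \<open>Derivative bounds on superlevel sets\<close>

lemma dom_ball_level:
 assumes d: "dom K \<mu> u xs L" and \<eta>: "0 < \<eta>" "\<eta> \<le> 1" and p: "p \<in> K" "\<eta> \<le> u p"
 shows "ball p (\<eta> / 1350) \<subseteq> interior K"
proof -
 have "ball p (\<eta> / 1350) \<subseteq> ball p (u p / 1350)" using p(2) by (intro subset_ball divide_right_mono) auto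
 then show ?thesis using dom_ball[OF d p(1)] by blast
qed

lemma dom_grad_near:
 assumes d: "dom K \<mu> u xs L" and \<eta>: "0 < \<eta>" "\<eta> \<le> 1" and p: "p \<in> K" "\<eta> \<le> u p"
  and nu: "norm \<nu> = 1" and z: "dist p z \<le> \<eta> / 2700"
 shows "\<bar>dd \<nu> u z\<bar> \<le> 21600 / \<eta>"
proof -
 note D = dom_D[OF d]
 note G = ground_D[OF D(1)]
 have sub: "ball z (\<eta> / 2700) \<subseteq> interior K"
 proof
  fix w assume "w \<in> ball z (\<eta> / 2700)"
  then have "dist p w < \<eta> / 1350" using z dist_triangle[of p w z] by simp
  then show "w \<in> interior K" using dom_ball_level[OF d \<eta> p] by auto
 qed
 have "\<bar>dd \<nu> u z\<bar> \<le> 4 / (\<eta> / 5400) * 1"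
 proof (rule gradient_bound[OF G(5) sub nu _ G(1)])
  show "\<mu> * (\<eta> / 5400)^2 < 1" using dom_mu_le[OF d] \<eta> by (intro mu_small) auto
  fix w assume "w \<in> cball z (\<eta> / 5400)"
  then have "w \<in> ball z (\<eta> / 2700)" using \<eta> by simp
  then have "w \<in> interior K" using sub by blast
  then show "\<bar>u w\<bar> \<le> 1" using G(6)[of w] G(7)[of w] interior_subset[of K] by auto
 qed (use \<eta> in auto)
 then show ?thesis by simp
qed

lemma line_dist: "norm \<xi> = 1 \<Longrightarrow> dist p (p + t *\<^sub>R \<xi>) = \<bar>t\<bar>"
 by (simp add: dist_norm)

lemma unit_line:
 fixes p z :: "'a::real_normed_vector"
 assumes "z \<noteq> p"
 obtains \<xi> where "norm \<xi> = 1" "z = p + dist p z *\<^sub>R \<xi>"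
proof (rule that[of "(1 / norm (z - p)) *\<^sub>R (z - p)"])
 show "norm ((1 / norm (z - p)) *\<^sub>R (z - p)) = 1" using assms by simp
 have "dist p z = norm (z - p)" by (metis dist_commute dist_norm)
 then show "z = p + dist p z *\<^sub>R (1 / norm (z - p)) *\<^sub>R (z - p)" using assms by simp
qed

text \<open>The radius \<open>\<eta>^2 / 43200\<close> times the gradient bound
  \<open>21600 / \<eta>\<close> is \<open>\<eta> / 2\<close>, so at most half of the level is
  lost.\<close>

lemma dom_nbhd:
 assumes d: "dom K \<mu> u xs L" and \<eta>: "0 < \<eta>" "\<eta> \<le> 1" and p: "p \<in> K" "\<eta> \<le> u p"
  and z: "dist p z \<le> \<eta>^2 / 43200"
 shows "z \<in> K" "\<eta> / 2 \<le> u z"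
proof -
 note D = dom_D[OF d]
 note G = ground_D[OF D(1)]
 have "\<eta>^2 \<le> \<eta> * 1" unfolding power2_eq_square using \<eta> by (intro mult_left_mono) auto
 then have z2: "dist p z \<le> \<eta> / 2700" using z \<eta> by simp
 have sub: "ball p (\<eta> / 1350) \<subseteq> interior K" by (rule dom_ball_level[OF d \<eta> p])
 have "z \<in> ball p (\<eta> / 1350)" using z2 \<eta> by simp
 then have zi: "z \<in> interior K" using sub by blast
 then show "z \<in> K" using interior_subset by blast
 show "\<eta> / 2 \<le> u z"
 proof (cases "z = p")
  case False
  then obtain \<xi> where x: "norm \<xi> = 1" "z = p + dist p z *\<^sub>R \<xi>" by (rule unit_line)
  define T where "T = dist p z"
  have T: "0 < T" using False by (simp add: T_def)
  have b: "dist p (p + t *\<^sub>R \<xi>) \<le> \<eta> / 2700" if "0 \<le> t" "t \<le> T" for t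
   using that z2 line_dist[OF x(1), of p t] by (simp add: T_def)
  have "\<exists>t>0. t < T \<and> u (p + T *\<^sub>R \<xi>) - u (p + 0 *\<^sub>R \<xi>) = (T - 0) * dd \<xi> u (p + t *\<^sub>R \<xi>)"
  proof (rule MVT2[OF T])
   fix t assume t: "0 \<le> t" "t \<le> T"
   have "p + t *\<^sub>R \<xi> \<in> ball p (\<eta> / 1350)" using b[OF t] \<eta> by simp
   then have "p + t *\<^sub>R \<xi> \<in> interior K" using sub by blast
   then show "((\<lambda>t. u (p + t *\<^sub>R \<xi>)) has_real_derivative dd \<xi> u (p + t *\<^sub>R \<xi>)) (at t)"
    by (rule DERIV_ln_line(3)[OF D(1) x(1)])
  qed
  then obtain t where t: "0 < t" "t < T" "u z - u p = T * dd \<xi> u (p + t *\<^sub>R \<xi>)"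
   using x(2) by (auto simp: T_def)
  have "\<bar>dd \<xi> u (p + t *\<^sub>R \<xi>)\<bar> \<le> 21600 / \<eta>" by (rule dom_grad_near[OF d \<eta> p x(1) b]) (use t in auto)
  then have "T * \<bar>dd \<xi> u (p + t *\<^sub>R \<xi>)\<bar> \<le> \<eta>^2 / 43200 * (21600 / \<eta>)"
   using z T by (intro mult_mono) (auto simp: T_def)
  also have "\<dots> = \<eta> / 2" using \<eta> by (simp add: power2_eq_square)
  finally have "\<bar>u z - u p\<bar> \<le> \<eta> / 2" using t(3) T by (simp add: abs_mult)
  then show ?thesis using p by linarith
 qed (use p \<eta> in simp)
qed

lemma dom_sol_grad:
 assumes \<eta>: "0 < \<eta>" "\<eta> \<le> 1" and d: "dom K \<mu> u xs L" and P: "sol \<mu> (interior K) P"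
  and B: "\<And>z. z \<in> K \<Longrightarrow> \<eta> / 2 \<le> u z \<Longrightarrow> \<bar>P z\<bar> \<le> B" and p: "p \<in> K" "\<eta> \<le> u p" and nu: "norm \<nu> = 1"
 shows "\<bar>dd \<nu> P p\<bar> \<le> 345600 / \<eta>^2 * B"
proof -
 note D = dom_D[OF d]
 note G = ground_D[OF D(1)]
 define r where "r = \<eta>^2 / 86400"
 have e2: "\<eta>^2 \<le> \<eta> * 1" unfolding power2_eq_square using \<eta> by (intro mult_left_mono) auto
 have r: "0 < r" "r \<le> 1 / 100" "r < \<eta> / 1350" using \<eta> e2 by (auto simp: r_def)
 have "\<bar>dd \<nu> P p\<bar> \<le> 4 / r * B"
 proof (rule gradient_bound[OF P dom_ball_level[OF d \<eta> p] nu _ G(1) r(1,3)])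
  show "\<mu> * r^2 < 1" using dom_mu_le[OF d] r by (intro mu_small) auto
  fix z assume "z \<in> cball p r"
  then have "dist p z \<le> \<eta>^2 / 43200" using \<eta> zero_le_power2[of \<eta>] unfolding r_def mem_cball by linarith
  then show "\<bar>P z\<bar> \<le> B" using dom_nbhd[OF d \<eta> p] by (intro B) auto
 qed
 then show ?thesis by (simp add: r_def)
qed

lemma norm_basis [simp]: "norm ex = 1" "norm ey = 1"
 by (simp_all add: norm_Pair)

text \<open>The scaling of a smooth function of \<open>x / L\<close> and \<open>y\<close>: each
  derivative in \<open>x\<close> gains a factor \<open>1 / L\<close>.\<close>

definition deriv_bounds :: "(point \<Rightarrow> real) \<Rightarrow> real \<Rightarrow> real \<Rightarrow> point \<Rightarrow> bool" where
 "deriv_bounds u L C p \<longleftrightarrow> \<bar>dd ex u p\<bar> \<le> C / L \<and> \<bar>dd ex (dd ex u) p\<bar> \<le> C / L^2 \<and> \<bar>dd ey u p\<bar> \<le> C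
   \<and> \<bar>dd ey (dd ey u) p\<bar> \<le> C \<and> \<bar>dd ey (dd ex u) p\<bar> \<le> C / L"

text \<open>For \<open>L \<ge> L0\<close> the mixed derivative comes from the interior gradient
  estimate for the solution \<open>dd ex u\<close>, which is itself of size \<open>1 / L\<close> on
  a slightly lower superlevel set. For \<open>L < L0\<close> the scales 1 and \<open>L\<close> are
  comparable, and powers of \<open>L0\<close> are absorbed into \<open>C\<close>.\<close>

lemma dom_derivs:
 assumes \<eta>: "0 < \<eta>" "\<eta> \<le> 1"
 shows "\<exists>C\<ge>1. \<forall>K \<mu> u xs L p. dom K \<mu> u xs L \<longrightarrow> p \<in> K \<longrightarrow> \<eta> \<le> u p \<longrightarrow>
   deriv_bounds u L C p"
proof -
 have h: "0 < \<eta> / 2" "\<eta> / 2 \<le> 1" using \<eta> by auto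
 obtain C1 L0 where C1: "0 < C1" "1 \<le> L0" and big: "\<And>K \<mu> u xs L p. dom K \<mu> u xs L \<Longrightarrow> L0 \<le> L \<Longrightarrow> p \<in> K \<Longrightarrow> \<eta> / 2 \<le> u p \<Longrightarrow>
   \<bar>dd ex u p\<bar> \<le> C1 / L \<and> \<bar>dd ex (dd ex u) p\<bar> \<le> C1 / L^2"
  using dom_dxx_large[OF h] by metis
 define A where "A = 345600 / \<eta>^2"
 define g where "g = 43200 / \<eta>"
 define C where "C = 1 + (A + 1) * (g + 1) * (C1 + 1) * L0^2"
 have A: "0 < A" "0 < g" using \<eta> by (auto simp: A_def g_def)
 have Cge: "A * g \<le> C" "g \<le> C" "C1 \<le> C" "A * C1 \<le> C" "g * L0 \<le> C" "A * g * L0 \<le> C" "A * g * L0^2 \<le> C" "1 \<le> C"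
 proof -
  have L2: "1 \<le> L0^2" "L0 \<le> L0^2" "0 \<le> L0^2" using C1 by (auto simp: self_le_power)
  have m: "a * b * c * e \<le> C" if "0 \<le> a" "a \<le> A + 1" "0 \<le> b" "b \<le> g + 1" "0 \<le> c" "c \<le> C1 + 1" "0 \<le> e" "e \<le> L0^2" for a b c e
  proof -
   have "a * b * c * e \<le> (A + 1) * (g + 1) * (C1 + 1) * L0^2"
    using that A C1 by (intro mult_mono) (auto intro!: mult_nonneg_nonneg add_nonneg_nonneg)
   then show ?thesis by (simp add: C_def)
  qed
  show "A * g \<le> C" using m[of A g 1 1] A C1 L2 by simp
  show "g \<le> C" using m[of 1 g 1 1] A C1 L2 by simp
  show "C1 \<le> C" using m[of 1 1 C1 1] A C1 L2 by simp
  show "A * C1 \<le> C" using m[of A 1 C1 1] A C1 L2 by simp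
  show "g * L0 \<le> C" using m[of 1 g 1 L0] A C1 L2 by simp
  show "A * g * L0 \<le> C" using m[of A g 1 L0] A C1 L2 by simp
  show "A * g * L0^2 \<le> C" using m[of A g 1 "L0^2"] A C1 L2 by simp
  show "1 \<le> C" using m[of 0 0 0 0] A C1 L2 by (simp add: C_def)
 qed
 have "\<bar>dd ex u p\<bar> \<le> C / L \<and> \<bar>dd ex (dd ex u) p\<bar> \<le> C / L^2 \<and> \<bar>dd ey u p\<bar> \<le> C
   \<and> \<bar>dd ey (dd ey u) p\<bar> \<le> C \<and> \<bar>dd ey (dd ex u) p\<bar> \<le> C / L"
  if d: "dom K \<mu> u xs L" and p: "p \<in> K" "\<eta> \<le> u p" for K \<mu> u xs L p
 proof -
  note D = dom_D[OF d]
  note G = ground_D[OF D(1)]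
  have Lp: "0 < L" "0 < L^2" "1 \<le> L" using D(6) by auto
  have gr: "\<bar>dd \<nu> u z\<bar> \<le> g" if "z \<in> K" "\<eta> / 2 \<le> u z" "norm \<nu> = 1" for z \<nu>
   using dom_grad_near[OF d h that, of z] \<eta> by (simp add: g_def)
  have s1: "sol \<mu> (interior K) (dd \<nu> u)" if "norm \<nu> = 1" for \<nu> by (rule sol_dd[OF G(5) G(1) that])
  have gr2: "\<bar>dd \<xi> (dd \<nu> u) p\<bar> \<le> A * g" if "norm \<nu> = 1" "norm \<xi> = 1" for \<nu> \<xi>
   unfolding A_def by (rule dom_sol_grad[OF \<eta> d s1[OF that(1)] _ p that(2)]) (rule gr[OF _ _ that(1)])
  have p2: "\<eta> / 2 \<le> u p" using p \<eta> by simp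
  have y: "\<bar>dd ey u p\<bar> \<le> C" using gr[OF p(1) p2, of ey] Cge(2) by simp
  have yy: "\<bar>dd ey (dd ey u) p\<bar> \<le> C" using gr2[of ey ey] Cge(1) by simp
  show ?thesis
  proof (cases "L0 \<le> L")
   case True
   note b = big[OF d True]
   have x: "\<bar>dd ex u p\<bar> \<le> C / L" using b[OF p(1) p2] divide_right_mono[OF Cge(3), of L] Lp by simp
   have xx: "\<bar>dd ex (dd ex u) p\<bar> \<le> C / L^2" using b[OF p(1) p2] divide_right_mono[OF Cge(3), of "L^2"] Lp by simp
   have "\<bar>dd ey (dd ex u) p\<bar> \<le> A * (C1 / L)"
    unfolding A_def by (rule dom_sol_grad[OF \<eta> d s1 _ p]) (use b in auto)
   also have "\<dots> \<le> C / L" using divide_right_mono[OF Cge(4), of L] Lp by simp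
   finally show ?thesis using x xx y yy by simp
  next
   case False
   have LL: "L \<le> L0" "L^2 \<le> L0^2" using False Lp by (auto intro: power_mono)
   have "g * L \<le> g * L0" using A LL by (intro mult_left_mono) auto
   then have "g \<le> C / L" using Cge(5) Lp by (simp add: pos_le_divide_eq)
   then have x: "\<bar>dd ex u p\<bar> \<le> C / L" using gr[OF p(1) p2, of ex] by simp
   have "A * g * L \<le> A * g * L0" using A LL by (intro mult_left_mono) auto
   then have "A * g \<le> C / L" using Cge(6) Lp by (simp add: pos_le_divide_eq)
   then have xy: "\<bar>dd ey (dd ex u) p\<bar> \<le> C / L" using gr2[of ex ey] by simp
   have "A * g * L^2 \<le> A * g * L0^2" using A LL by (intro mult_left_mono) auto
   then have "A * g \<le> C / L^2" using Cge(7) Lp by (simp add: pos_le_divide_eq)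
   then have xx: "\<bar>dd ex (dd ex u) p\<bar> \<le> C / L^2" using gr2[of ex ex] by simp
   show ?thesis using x xx xy y yy by simp
  qed
 qed
 then show ?thesis using Cge(8) unfolding deriv_bounds_def by blast
qed

section \<open>Lower bounds for the Hessian of the logarithm\<close>

definition hessq :: "(point \<Rightarrow> real) \<Rightarrow> point \<Rightarrow> point \<Rightarrow> point \<Rightarrow> real" where
 "hessq u i j p = dd i u p / u p * (dd j u p / u p) - dd i (dd j u) p / u p"

lemma norm_pair_eq_1: "norm (\<xi> :: point) = 1 \<longleftrightarrow> (fst \<xi>)^2 + (snd \<xi>)^2 = 1"
 by (cases \<xi>) (simp add: norm_Pair)

lemma dd_components:
 assumes P: "sol \<mu> V P" and mu: "0 < \<mu>" and p: "p \<in> V"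
 shows "dd \<xi> P p = fst \<xi> * dd ex P p + snd \<xi> * dd ey P p"
proof -
 have "C2f V P" using P by (simp add: sol_def)
 from dd_eq_grad[OF C2f_D(1)[OF this p], of \<xi>] show ?thesis
  by (cases \<xi>) (simp add: grad_def mult.commute)
qed

lemma dd_hess:
 assumes P: "sol \<mu> V P" and mu: "0 < \<mu>" and p: "p \<in> V" and x: "norm \<xi> = 1"
 shows "dd ex (dd \<xi> P) p = fst \<xi> * dd ex (dd ex P) p + snd \<xi> * dd ex (dd ey P) p"
  "dd ey (dd \<xi> P) p = fst \<xi> * dd ex (dd ey P) p + snd \<xi> * dd ey (dd ey P) p"
  "dd ey (dd ex P) p = dd ex (dd ey P) p"
proof -
 show c: "dd ey (dd ex P) p = dd ex (dd ey P) p"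
  by (rule dd_commute[OF P mu _ p]) auto
 have i: "dd i (dd \<xi> P) p = fst \<xi> * dd ex (dd i P) p + snd \<xi> * dd ey (dd i P) p" if "i \<in> {ex, ey}" for i
 proof -
  have n: "norm i = 1" using that by auto
  show ?thesis unfolding dd_commute[OF P mu x p that] by (rule dd_components[OF sol_dd[OF P mu n] mu p])
 qed
 show "dd ex (dd \<xi> P) p = fst \<xi> * dd ex (dd ex P) p + snd \<xi> * dd ex (dd ey P) p" using i[of ex] unfolding c by blast
 show "dd ey (dd \<xi> P) p = fst \<xi> * dd ex (dd ey P) p + snd \<xi> * dd ey (dd ey P) p" using i[of ey] by blast
qed

lemma whess_quadratic:
 assumes P: "sol \<mu> V u" and mu: "0 < \<mu>" and p: "p \<in> V" and x: "norm \<xi> = 1" and u: "u p \<noteq> 0"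
 shows "whess u \<xi> p = (fst \<xi>)^2 * hessq u ex ex p + 2 * fst \<xi> * snd \<xi> * hessq u ex ey p + (snd \<xi>)^2 * hessq u ey ey p"
 unfolding whess_def hessq_def dd_components[OF P mu p, of \<xi>] dd_components[OF sol_dd[OF P mu x] mu p, of \<xi>] dd_hess[OF P mu p x]
 using u by (simp add: power2_eq_square field_simps)

text \<open>Both functions have the same zero-order coefficient, so it drops out: a quotient
  \<open>w\<close> of solutions is annihilated by the Laplacian plus twice the drift along the
  gradient of \<open>ln u\<close>.\<close>

lemma lap2_quotient:
 assumes P: "lap2 P z a b (- \<mu> * P z)" and u: "lap2 u z a' b' (- \<mu> * u z)" "u z \<noteq> 0"
 defines "c \<equiv> (a - P z / u z * a') / u z" and "d \<equiv> (b - P z / u z * b') / u z"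
 shows "lap2 (\<lambda>y. P y / u y) z c d (- 2 * (a' / u z * c + b' / u z * d))"
proof -
 have "lap2 (\<lambda>y. P y * (1 / u y)) z c d (- 2 * (a' / u z * c + b' / u z * d))"
  by (rule lap2_eq[OF lap2_mult[OF P lap2_inverse[OF u]]])
   (use u(2) in \<open>simp_all add: c_def d_def field_simps power2_eq_square power3_eq_cube\<close>)
 then show ?thesis by simp
qed

text \<open>The form is the square of \<open>dd \<xi> u / u\<close> minus
  \<open>dd \<xi> (dd \<xi> u) / u\<close>. The drift Laplacian of \<open>lap2_quotient\<close>
  annihilates both quotients, so only twice the squared gradient of the first survives, and that
  gradient is \<open>- W \<xi>\<close> with components \<open>- c\<close>,
  \<open>- d\<close>.\<close>

lemma lap2_whess:
 assumes g: "ground \<mu> K u" and z: "z \<in> interior K" and x: "norm \<xi> = 1"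
 defines "c \<equiv> fst \<xi> * hessq u ex ex z + snd \<xi> * hessq u ex ey z"
  and "d \<equiv> fst \<xi> * hessq u ex ey z + snd \<xi> * hessq u ey ey z"
 shows "\<exists>a b l. lap2 (whess u \<xi>) z a b l \<and> l + 2 * (dd ex u z / u z * a + dd ey u z / u z * b) = 2 * (c^2 + d^2)"
proof -
 note G = ground_D[OF g]
 have up: "u z \<noteq> 0" using G(6)[OF z] by simp
 note s1 = sol_dd[OF G(5) G(1) x]
 note s2 = sol_dd[OF s1 G(1) x]
 note q1 = lap2_quotient[OF lap2_sol[OF s1 z] lap2_sol[OF G(5) z] up]
 note q2 = lap2_quotient[OF lap2_sol[OF s2 z] lap2_sol[OF G(5) z] up]
 have c: "(dd ex (dd \<xi> u) z - dd \<xi> u z / u z * dd ex u z) / u z = - c"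
  and d: "(dd ey (dd \<xi> u) z - dd \<xi> u z / u z * dd ey u z) / u z = - d"
  unfolding c_def d_def hessq_def dd_hess[OF G(5,1) z x] dd_components[OF G(5,1) z, of \<xi>]
  using up by (simp_all add: field_simps)
 note l = lap2_lin[OF lap2_mult[OF q1 q1] q2, of 1 "- 1", unfolded c d]
 have "(\<lambda>y. 1 * (dd \<xi> u y / u y * (dd \<xi> u y / u y)) + - 1 * (dd \<xi> (dd \<xi> u) y / u y)) = whess u \<xi>"
  by (rule ext) (simp add: whess_def power2_eq_square)
 note l' = l[unfolded this]
 have i: "1 * (- 2 * (v * - c + w * - d) * s + 2 * (- c * - c + - d * - d) + s * (- 2 * (v * - c + w * - d))) + - 1 * (- 2 * (v * m + w * n))
    + 2 * (v * (1 * (- c * s + s * - c) + - 1 * m) + w * (1 * (- d * s + s * - d) + - 1 * n)) = 2 * (c^2 + d^2)"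
  for m n s v w :: real by (simp add: power2_eq_square algebra_simps)
 show ?thesis by (intro exI conjI, rule l') (rule i)
qed

lemma continuous_hessq:
 assumes g: "ground \<mu> K u" and i: "i \<in> {ex, ey}" "j \<in> {ex, ey}"
 shows "continuous_on (interior K) (hessq u i j)"
proof -
 note G = ground_D[OF g]
 have C: "C2f (interior K) u" using G(5) by (simp add: sol_def)
 have n: "\<And>z. z \<in> interior K \<Longrightarrow> u z \<noteq> 0" using G(6) by fastforce
 have "continuous_on (interior K) (dd i (dd j u))" using C i unfolding C2f_def by blast
 then show ?thesis unfolding hessq_def
  using C2f_continuous(1)[OF C] C2f_continuous(2)[OF C i(1)] C2f_continuous(2)[OF C i(2)] n
  by (intro continuous_intros) auto
qed

text \<open>First-order condition at a minimum over the unit circle: after rotating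
  \<open>(x, y)\<close> by a small parameter \<open>t\<close>, the coefficient \<open>B\<close> of
  the linear term has to vanish.\<close>

lemma quadratic_form_eigen:
 fixes P Q R l x y :: real
 assumes xy: "x^2 + y^2 = 1" and l: "x^2 * P + 2 * x * y * Q + y^2 * R = l"
  and m: "\<And>a b. a^2 + b^2 = 1 \<Longrightarrow> l \<le> a^2 * P + 2 * a * b * Q + b^2 * R"
 shows "x * P + y * Q = l * x" "x * Q + y * R = l * y"
proof -
 define q where "q a b = a^2 * P + 2 * a * b * Q + b^2 * R" for a b
 define B where "B = - y * (x * P + y * Q) + x * (x * Q + y * R)"
 define E where "E = q (- y) x - l"
 have hom: "q (a / n) (b / n) = q a b / n^2" for a b n
  by (simp add: q_def power2_eq_square add_divide_distrib mult.assoc)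
 have h: "0 \<le> 2 * t * B + t^2 * E" for t
 proof -
  define n where "n = sqrt (1 + t^2)"
  have n: "0 < n" "n^2 = 1 + t^2" by (auto simp: n_def add_pos_nonneg)
  have n0: "1 + t^2 \<noteq> 0" using zero_le_power2[of t] by linarith
  have "(x - t * y)^2 + (y + t * x)^2 = (1 + t^2) * (x^2 + y^2)" by (simp add: power2_eq_square algebra_simps)
  then have "((x - t * y) / n)^2 + ((y + t * x) / n)^2 = 1"
   using n xy n0 by (simp add: power_divide flip: add_divide_distrib)
  from m[OF this] have "l \<le> q ((x - t * y) / n) ((y + t * x) / n)" by (simp add: q_def)
  also have "\<dots> = q (x - t * y) (y + t * x) / n^2"
   using hom .
  finally have "l \<le> q (x - t * y) (y + t * x) / n^2" .
  then have "l * (1 + t^2) \<le> q (x - t * y) (y + t * x)" using n by (simp add: pos_le_divide_eq add_pos_nonneg)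
  also have "\<dots> = l + 2 * t * B + t^2 * (E + l)"
   unfolding l[symmetric] q_def B_def E_def by (simp add: power2_eq_square algebra_simps)
  finally show ?thesis by (simp add: algebra_simps)
 qed
 have "B = 0"
 proof (rule ccontr)
  assume B: "B \<noteq> 0"
  \<comment> \<open>For this \<open>t\<close> the quadratic term is at most \<open>- t * B\<close>,
    so a nonzero \<open>B\<close> would make the expression in \<open>h\<close> negative.\<close>
  define t where "t = - B / (\<bar>E\<bar> + 1)"
  have "t^2 * E \<le> t^2 * (\<bar>E\<bar> + 1)" by (intro mult_left_mono) auto
  also have "\<dots> = - t * B" unfolding t_def by (simp add: power2_eq_square)
  finally have "0 \<le> t * B" using h[of t] by linarith
  moreover have "t * B = - (B^2 / (\<bar>E\<bar> + 1))" by (simp add: t_def power2_eq_square)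
  moreover have "0 < B^2 / (\<bar>E\<bar> + 1)" using B by (intro divide_pos_pos) auto
  ultimately show False by linarith
 qed
 let ?X = "x * P + y * Q" and ?Y = "x * Q + y * R"
 have a: "x * ?X + y * ?Y = l" using l by (simp add: power2_eq_square algebra_simps)
 have b: "x * ?Y = y * ?X" using \<open>B = 0\<close> by (simp add: B_def)
 have "(x^2 + y^2) * ?X = x * (x * ?X + y * ?Y) - y * (x * ?Y - y * ?X)" by (simp add: power2_eq_square algebra_simps)
 then show "?X = l * x" using a b xy by simp
 have "(x^2 + y^2) * ?Y = y * (x * ?X + y * ?Y) + x * (x * ?Y - y * ?X)" by (simp add: power2_eq_square algebra_simps)
 then show "?Y = l * y" using a b xy by simp
qed

text \<open>At a negative minimum \<open>l\<close> of \<open>\<xi> \<bullet> W \<xi> - h (\<xi> \<bullet> a)\<^sup>2\<close> over points and unit vectors, \<open>\<xi>\<close> is an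
 eigenvector of \<open>W - h a a\<^sup>T\<close>, so \<open>\<bar>W \<xi>\<bar>\<^sup>2 = l\<^sup>2 + 2 l h (\<xi> \<bullet> a)\<^sup>2 + h\<^sup>2 (\<xi> \<bullet> a)\<^sup>2 \<le> h\<^sup>2 (\<xi> \<bullet> a)\<^sup>2\<close>.\<close>

lemma whess_comparison:
 assumes g: "ground \<mu> K u" and C: "compact C" "C \<subseteq> interior K" and a: "norm a = 1"
  and gc: "continuous_on C h"
  and bd: "\<And>z \<xi>. z \<in> C \<Longrightarrow> z \<notin> interior C \<Longrightarrow> norm \<xi> = 1 \<Longrightarrow> h z * (\<xi> \<bullet> a)^2 \<le> whess u \<xi> z"
  and pde: "\<And>z. z \<in> interior C \<Longrightarrow> 0 < h z \<Longrightarrow> \<exists>a b l. lap2 h z a b l \<and>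
    2 * (h z)^2 < l + 2 * (dd ex u z / u z * a + dd ey u z / u z * b)"
  and z: "z \<in> C" and x: "norm \<xi> = 1"
 shows "h z * (\<xi> \<bullet> a)^2 \<le> whess u \<xi> z"
proof (rule ccontr)
 assume neg: "\<not> ?thesis"
 note G = ground_D[OF g]
 obtain a1 a2 where a12: "a = (a1, a2)" by (cases a)
 have an: "a1^2 + a2^2 = 1" using a by (simp add: a12 norm_pair_eq_1)
 define P where "P y = hessq u ex ex y - h y * a1^2" for y
 define Q where "Q y = hessq u ex ey y - h y * (a1 * a2)" for y
 define R where "R y = hessq u ey ey y - h y * a2^2" for y
 define q where "q w = (fst (snd w))^2 * P (fst w) + 2 * fst (snd w) * snd (snd w) * Q (fst w) + (snd (snd w))^2 * R (fst w)" for w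
 have cc: "continuous_on C P" "continuous_on C Q" "continuous_on C R" unfolding P_def Q_def R_def
  using continuous_on_subset[OF continuous_hessq[OF g] C(2)] gc by (auto intro!: continuous_intros)
 have q: "q (y, \<zeta>) = whess u \<zeta> y - h y * (\<zeta> \<bullet> a)^2" if y: "y \<in> interior K" and n: "norm \<zeta> = 1" for y \<zeta>
 proof -
  have "u y \<noteq> 0" using G(6)[OF y] by simp
  from whess_quadratic[OF G(5,1) y n this] show ?thesis
   by (simp add: q_def P_def Q_def R_def a12 inner_prod_def power2_eq_square algebra_simps)
 qed
 have comp: "compact (C \<times> sphere (0::point) 1)" using C by (intro compact_Times) auto
 have qc: "continuous_on (C \<times> sphere (0::point) 1) q" unfolding q_def
  by (intro continuous_intros continuous_on_compose2[OF cc(1)] continuous_on_compose2[OF cc(2)] continuous_on_compose2[OF cc(3)]) auto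
 have "(z, \<xi>) \<in> C \<times> sphere 0 1" using z x by simp
 then obtain w where w: "w \<in> C \<times> sphere 0 1" "\<And>w'. w' \<in> C \<times> sphere 0 1 \<Longrightarrow> q w \<le> q w'"
  using continuous_attains_inf[OF comp _ qc] by (metis empty_iff)
 obtain y \<zeta> where wy: "w = (y, \<zeta>)" by (cases w)
 have y: "y \<in> C" and n: "norm \<zeta> = 1" using w(1) by (auto simp: wy)
 have yK: "y \<in> interior K" using y C by blast
 define l where "l = q (y, \<zeta>)"
 have lneg: "l < 0"
 proof -
  have "l \<le> q (z, \<xi>)" unfolding l_def using w(2)[of "(z, \<xi>)"] z x by (simp add: wy)
  also have "\<dots> < 0" using neg q[of z \<xi>] z x C by auto
  finally show ?thesis .
 qed
 have yint: "y \<in> interior C"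
 proof (rule ccontr)
  assume "y \<notin> interior C"
  then have "h y * (\<zeta> \<bullet> a)^2 \<le> whess u \<zeta> y" by (rule bd[OF y _ n])
  then show False using lneg q[OF yK n] by (simp add: l_def)
 qed
 define s where "s = \<zeta> \<bullet> a"
 have wl: "whess u \<zeta> y = l + h y * s^2" using q[OF yK n] by (simp add: l_def s_def)
 have pos: "0 \<le> l + h y * s^2" using whess_nonneg[OF g yK n] wl by simp
 then have hs: "0 < h y * s^2" using lneg by linarith
 then have hp: "0 < h y" by (meson not_le mult_nonpos_nonneg zero_le_power2)
 have sp: "0 < s^2" using hs by (auto simp: zero_less_mult_iff)
 obtain x1 x2 where z12: "\<zeta> = (x1, x2)" by (cases \<zeta>)
 have n12: "x1^2 + x2^2 = 1" using n by (simp add: z12 norm_pair_eq_1)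
 have eig: "x1 * P y + x2 * Q y = l * x1" "x1 * Q y + x2 * R y = l * x2"
 proof -
  have 1: "x1^2 * P y + 2 * x1 * x2 * Q y + x2^2 * R y = l" by (simp add: l_def q_def z12)
  have 2: "l \<le> b^2 * P y + 2 * b * c * Q y + c^2 * R y" if "b^2 + c^2 = 1" for b c
   using w(2)[of "(y, (b, c))"] y that by (simp add: l_def wy q_def norm_Pair)
  show "x1 * P y + x2 * Q y = l * x1" "x1 * Q y + x2 * R y = l * x2"
   using quadratic_form_eigen[OF n12 1 2] by auto
 qed
 have s12: "s = x1 * a1 + x2 * a2" by (simp add: s_def z12 a12)
 define c where "c = x1 * hessq u ex ex y + x2 * hessq u ex ey y"
 define d where "d = x1 * hessq u ex ey y + x2 * hessq u ey ey y"
 have cd: "c = l * x1 + h y * s * a1" "d = l * x2 + h y * s * a2"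
  using eig by (auto simp: c_def d_def P_def Q_def R_def s12 power2_eq_square algebra_simps)
 have "c^2 + d^2 = l^2 * (x1^2 + x2^2) + 2 * l * (h y * s) * (x1 * a1 + x2 * a2) + (h y * s)^2 * (a1^2 + a2^2)"
  unfolding cd by (simp add: power2_eq_square algebra_simps)
 then have "c^2 + d^2 = l * (l + 2 * (h y * s^2)) + (h y)^2 * s^2"
  unfolding n12 an s12[symmetric] by (simp add: power2_eq_square algebra_simps)
 moreover have "l * (l + 2 * (h y * s^2)) \<le> 0" using lneg pos hs by (intro mult_nonpos_nonneg) auto
 ultimately have up: "c^2 + d^2 \<le> (h y)^2 * s^2" by linarith
 obtain f1 f2 fl where f: "lap2 (whess u \<zeta>) y f1 f2 fl" "fl + 2 * (dd ex u y / u y * f1 + dd ey u y / u y * f2) = 2 * (c^2 + d^2)"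
  using lap2_whess[OF g yK n] by (auto simp: z12 c_def d_def)
 obtain h1 h2 hl where hh: "lap2 h y h1 h2 hl" "2 * (h y)^2 < hl + 2 * (dd ex u y / u y * h1 + dd ey u y / u y * h2)"
  using pde[OF yint hp] by blast
 \<comment> \<open>The direction is frozen at \<open>\<zeta>\<close>; what remains is a scalar
   extremum in the point alone, to which the second-order test applies.\<close>
 have ev: "\<forall>\<^sub>F y' in nhds y. (- 1) * whess u \<zeta> y' + s^2 * h y' \<le> (- 1) * whess u \<zeta> y + s^2 * h y"
 proof -
  have "\<forall>\<^sub>F y' in nhds y. y' \<in> interior C" using yint by (intro eventually_nhds_in_open) auto
  then show ?thesis
  proof (rule eventually_mono)
   fix y' assume "y' \<in> interior C"
   then have y': "y' \<in> C" "y' \<in> interior K" using interior_subset C(2) by blast+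
   have "q (y, \<zeta>) \<le> q (y', \<zeta>)" using w(2)[of "(y', \<zeta>)"] y'(1) n by (simp add: wy)
   then show "(- 1) * whess u \<zeta> y' + s^2 * h y' \<le> (- 1) * whess u \<zeta> y + s^2 * h y"
    unfolding q[OF yK n] q[OF y'(2) n] s_def by (simp add: mult.commute)
  qed
 qed
 note m = lap2_max[OF lap2_lin[OF f(1) hh(1)] ev]
 have e: "f1 = s^2 * h1" "f2 = s^2 * h2" "s^2 * hl \<le> fl" using m by auto
 have "s^2 * (hl + 2 * (dd ex u y / u y * h1 + dd ey u y / u y * h2)) \<le> 2 * (c^2 + d^2)"
  using e(3) unfolding f(2)[symmetric] e(1,2) by (simp add: algebra_simps)
 moreover have "s^2 * (2 * (h y)^2) < s^2 * (hl + 2 * (dd ex u y / u y * h1 + dd ey u y / u y * h2))"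
  using hh(2) sp by (rule mult_strict_left_mono)
 ultimately show False using up by (simp add: mult.commute)
qed

text \<open>Near the boundary of \<open>K\<close> only the sign of the Hessian is known. The summand
  \<open>k * ln u\<close> drives the exponential to 0 there, and after subtracting
  \<open>\<epsilon>\<close> the barrier is nonpositive off a compact part of the interior, where
  \<open>whess_comparison\<close> applies; finally \<open>\<epsilon>\<close> tends to 0.\<close>

lemma whess_barrier:
 assumes g: "ground \<mu> K u" and a: "norm a = 1" and S: "closed S" and Fc: "continuous_on UNIV F" and F0: "\<And>z. z \<in> S \<Longrightarrow> F z \<le> 0"
  and k: "0 < k" and \<kappa>: "0 < \<kappa>"
  and bd: "\<And>z \<xi>. z \<in> S \<Longrightarrow> z \<notin> interior S \<Longrightarrow> z \<in> interior K \<Longrightarrow> norm \<xi> = 1 \<Longrightarrow>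
   \<kappa> * exp (F z + k * ln (u z)) * (\<xi> \<bullet> a)^2 \<le> whess u \<xi> z"
  and pde: "\<And>z. z \<in> interior S \<Longrightarrow> z \<in> interior K \<Longrightarrow> \<exists>a b l. lap2 F z a b l \<and>
    2 * \<kappa> \<le> l + 2 * (dd ex u z / u z * a + dd ey u z / u z * b) + k * ((dd ex u z / u z)^2 + (dd ey u z / u z)^2 - \<mu>)
     + (a + k * (dd ex u z / u z))^2 + (b + k * (dd ey u z / u z))^2"
  and z: "z \<in> S" "z \<in> interior K" and x: "norm \<xi> = 1"
 shows "\<kappa> * exp (F z + k * ln (u z)) * (\<xi> \<bullet> a)^2 \<le> whess u \<xi> z"
proof -
 note G = ground_D[OF g]
 define E where "E y = F y + k * ln (u y)" for y
 have lnu: "ln (u y) \<le> 0" if "y \<in> interior K" for y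
  using G(6)[OF that] G(7)[of y] interior_subset[of K] that by (auto simp del: split_paired_All)
 have *: "\<kappa> * (exp (E z) - \<epsilon>) * (\<xi> \<bullet> a)^2 \<le> whess u \<xi> z" if \<epsilon>: "0 < \<epsilon>" for \<epsilon>
 proof (cases "0 < exp (E z) - \<epsilon>")
  case False
  then have "\<kappa> * (exp (E z) - \<epsilon>) \<le> 0" using \<kappa> by (intro mult_nonneg_nonpos) auto
  then have "\<kappa> * (exp (E z) - \<epsilon>) * (\<xi> \<bullet> a)^2 \<le> 0" by (rule mult_nonpos_nonneg) simp
  then show ?thesis using whess_nonneg[OF g z(2) x] by linarith
 next
  case zp: True
  define \<eta> where "\<eta> = exp (ln \<epsilon> / k)"
  have \<eta>: "0 < \<eta>" by (simp add: \<eta>_def)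
  have ule: "exp (E y) \<le> \<epsilon>" if "y \<in> S" "y \<in> interior K" "u y \<le> \<eta>" for y
  proof -
   have "ln (u y) \<le> ln \<eta>" using G(6)[OF that(2)] that(3) \<eta> by simp
   then have "k * ln (u y) \<le> k * (ln \<epsilon> / k)" using k by (intro mult_left_mono) (auto simp: \<eta>_def)
   then have "E y \<le> ln \<epsilon>" using F0[OF that(1)] k by (simp add: E_def)
   then have "exp (E y) \<le> exp (ln \<epsilon>)" by simp
   then show ?thesis using \<epsilon> by simp
  qed
  define C where "C = {y \<in> K. \<eta> \<le> u y} \<inter> S"
  have CK: "C \<subseteq> interior K"
  proof
   fix y assume "y \<in> C"
   then have y: "y \<in> K" "\<eta> \<le> u y" by (auto simp: C_def)
   then have "y \<notin> frontier K" using G(8)[of y] \<eta> by auto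
   then show "y \<in> interior K" using y(1) by (simp add: frontier_def closure_def)
  qed
  have Cc: "compact C"
  proof -
   have "closed (K \<inter> u -` {\<eta>..})"
    using G(4) compact_imp_closed[OF G(2)] by (intro continuous_closed_preimage) auto
   moreover have "{y \<in> K. \<eta> \<le> u y} = K \<inter> u -` {\<eta>..}" by auto
   ultimately have "closed C" using S unfolding C_def by auto
   then show ?thesis using G(2) compact_Int_closed[of K C] by (simp add: C_def Int_absorb1 Collect_conj_eq Int_assoc)
  qed
  have uc: "continuous_on (interior K) u" using continuous_on_subset[OF G(4) interior_subset] .
  have Ec: "continuous_on C E" unfolding E_def
   using CK G(6) by (intro continuous_intros continuous_on_subset[OF Fc] continuous_on_subset[OF uc]) (auto simp: subset_iff less_imp_neq[symmetric])
  have "\<not> u z \<le> \<eta>" using ule[OF z] zp by linarith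
  then have zC: "z \<in> C" using z interior_subset[of K] by (auto simp: C_def)
  show ?thesis
  proof (rule whess_comparison[OF g Cc CK a _ _ _ zC x, where h = "\<lambda>y. \<kappa> * (exp (E y) - \<epsilon>)"])
   show "continuous_on C (\<lambda>y. \<kappa> * (exp (E y) - \<epsilon>))" using Ec by (intro continuous_intros)
  next
   fix y \<zeta> :: "point" assume y: "y \<in> C" "y \<notin> interior C" and n: "norm \<zeta> = 1"
   have yK: "y \<in> interior K" and yS: "y \<in> S" using y CK by (auto simp: C_def)
   show "\<kappa> * (exp (E y) - \<epsilon>) * (\<zeta> \<bullet> a)^2 \<le> whess u \<zeta> y"
   proof (cases "y \<in> interior S \<and> \<eta> < u y")
    case True
    have "open (interior K \<inter> u -` {\<eta><..})" using uc by (intro continuous_open_preimage) auto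
    then have "open (interior S \<inter> (interior K \<inter> u -` {\<eta><..}))" by auto
    moreover have "interior S \<inter> (interior K \<inter> u -` {\<eta><..}) \<subseteq> C"
     using interior_subset[of S] interior_subset[of K] by (auto simp: C_def)
    ultimately have "interior S \<inter> (interior K \<inter> u -` {\<eta><..}) \<subseteq> interior C" by (rule interior_maximal[rotated])
    then show ?thesis using True yK y(2) by blast
   next
    case False
    then show ?thesis
    proof (cases "y \<in> interior S")
     case True
     then have "exp (E y) - \<epsilon> \<le> 0" using False ule[OF yS yK] by simp
     then have "\<kappa> * (exp (E y) - \<epsilon>) * (\<zeta> \<bullet> a)^2 \<le> 0" using \<kappa> by (intro mult_nonpos_nonneg[OF mult_nonneg_nonpos]) auto
     then show ?thesis using whess_nonneg[OF g yK n] by linarith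
    next
     case False
     have "\<kappa> * (exp (E y) - \<epsilon>) * (\<zeta> \<bullet> a)^2 \<le> \<kappa> * exp (E y) * (\<zeta> \<bullet> a)^2"
      using \<kappa> \<epsilon> by (intro mult_right_mono mult_left_mono) auto
     also have "\<dots> \<le> whess u \<zeta> y" unfolding E_def by (rule bd[OF yS False yK n])
     finally show ?thesis .
    qed
   qed
  next
   fix y assume y: "y \<in> interior C" and hp: "0 < \<kappa> * (exp (E y) - \<epsilon>)"
   have yC: "y \<in> C" using y interior_subset by blast
   have yK: "y \<in> interior K" using yC CK by blast
   have yS: "y \<in> interior S" using y interior_mono[of C S] by (auto simp: C_def)
   let ?vx = "dd ex u y / u y" and ?vy = "dd ey u y / u y"
   obtain b c l where f: "lap2 F y b c l" "2 * \<kappa> \<le> l + 2 * (?vx * b + ?vy * c) + k * (?vx^2 + ?vy^2 - \<mu>)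
     + (b + k * ?vx)^2 + (c + k * ?vy)^2" using pde[OF yS yK] by blast
   have up: "0 < u y" by (rule G(6)[OF yK])
   let ?l = "- \<mu> - (?vx^2 + ?vy^2)"
   have v: "lap2 (\<lambda>y. ln (u y)) y ?vx ?vy ?l"
    by (rule lap2_eq[OF lap2_ln[OF lap2_sol[OF G(5) yK] up]]) (use up in \<open>simp_all add: power_divide add_divide_distrib\<close>)
   have E: "lap2 E y (b + k * ?vx) (c + k * ?vy) (l + k * ?l)"
    using lap2_lin[OF f(1) v, of 1 k] by (simp add: E_def[abs_def])
   let ?e = "exp (E y)"
   note h = lap2_lin[OF lap2_exp[OF E] lap2_const[of 1], of \<kappa> "- \<kappa> * \<epsilon>"]
   have eq: "(\<lambda>z. \<kappa> * exp (E z) + - \<kappa> * \<epsilon> * 1) = (\<lambda>y. \<kappa> * (exp (E y) - \<epsilon>))" by (rule ext) (simp add: algebra_simps)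
   have "y \<in> S" using yS interior_subset by blast
   then have "E y \<le> 0" using F0[of y] mult_nonneg_nonpos[OF less_imp_le[OF k] lnu[OF yK]] unfolding E_def by linarith
   then have e1: "?e \<le> 1" by simp
   have "2 * (\<kappa> * (?e - \<epsilon>))^2 < 2 * (\<kappa> * ?e)^2"
    using hp \<kappa> \<epsilon> by (intro mult_strict_left_mono power_strict_mono) auto
   also have "\<dots> = \<kappa> * ?e * (2 * \<kappa> * ?e)" by (simp add: power2_eq_square)
   also have "\<dots> \<le> \<kappa> * ?e * (2 * \<kappa>)" using \<kappa> e1 by (intro mult_left_mono) auto
   also have "\<dots> \<le> \<kappa> * ?e * (l + 2 * (?vx * b + ?vy * c) + k * (?vx^2 + ?vy^2 - \<mu>) + (b + k * ?vx)^2 + (c + k * ?vy)^2)"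
    using f(2) \<kappa> by (intro mult_left_mono) auto
   also have "\<dots> = (\<kappa> * (?e * ((b + k * ?vx)^2 + (c + k * ?vy)^2 + (l + k * ?l))) + - \<kappa> * \<epsilon> * 0)
     + 2 * (?vx * (\<kappa> * (?e * (b + k * ?vx)) + - \<kappa> * \<epsilon> * 0) + ?vy * (\<kappa> * (?e * (c + k * ?vy)) + - \<kappa> * \<epsilon> * 0))"
    by (simp add: algebra_simps power2_eq_square)
   finally show "\<exists>b c l. lap2 (\<lambda>y. \<kappa> * (exp (E y) - \<epsilon>)) y b c l \<and> 2 * (\<kappa> * (exp (E y) - \<epsilon>))^2 < l + 2 * (?vx * b + ?vy * c)"
    using h unfolding eq by blast
  qed
 qed
 show ?thesis
 proof (rule field_le_epsilon)
  fix e :: real assume e: "0 < e"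
  define \<epsilon> where "\<epsilon> = e / (\<kappa> * ((\<xi> \<bullet> a)^2 + 1))"
  have p: "0 < \<kappa> * ((\<xi> \<bullet> a)^2 + 1)" using \<kappa> by (intro mult_pos_pos add_nonneg_pos) auto
  have \<epsilon>: "0 < \<epsilon>" using e p by (simp add: \<epsilon>_def)
  have "\<kappa> * \<epsilon> * (\<xi> \<bullet> a)^2 \<le> \<epsilon> * (\<kappa> * ((\<xi> \<bullet> a)^2 + 1))" using \<kappa> \<epsilon> by (simp add: algebra_simps)
  also have "\<dots> = e" using p unfolding \<epsilon>_def by (metis less_irrefl nonzero_divide_eq_eq)
  finally show "\<kappa> * exp (F z + k * ln (u z)) * (\<xi> \<bullet> a)^2 \<le> whess u \<xi> z + e"
   using *[OF \<epsilon>] by (simp add: E_def algebra_simps)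
 qed
qed

section \<open>Explicit barriers and the starting point for the Hessian bound\<close>

lemma ground_interiorI: "ground \<mu> K u \<Longrightarrow> z \<in> K \<Longrightarrow> 0 < u z \<Longrightarrow> z \<in> interior K"
 by (simp add: ground_pos_iff)

lemma ln_u_nonpos: "ground \<mu> K u \<Longrightarrow> z \<in> interior K \<Longrightarrow> ln (u z) \<le> 0"
 using ground_D(6)[of \<mu> K u z] ground_D(7)[of \<mu> K u z] interior_subset[of K]
 by (auto simp del: split_paired_All)

lemma mult_exp_le:
 fixes \<kappa> :: real
 assumes "0 \<le> \<kappa>" "F \<le> 0" "0 \<le> k" "v \<le> 0"
 shows "\<kappa> * exp (F + k * v) \<le> \<kappa>"
proof -
 have "F + k * v \<le> 0" using assms mult_nonneg_nonpos[of k v] by linarith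
 then have "\<kappa> * exp (F + k * v) \<le> \<kappa> * 1" using assms by (intro mult_left_mono) auto
 then show ?thesis by simp
qed

text \<open>A Gaussian about \<open>p\<close>. Concavity bounds the inner product of the gradient of
  \<open>ln u\<close> with \<open>y - p\<close> by 1, as \<open>ln (u p) \<ge> - 1\<close>. Outside
  the ball of radius \<open>c\<close> the term \<open>4 * A^2 * dist^2 \<ge> 240 * A\<close> then
  dominates the rest, including \<open>\<mu> < 2690\<close>, since
  \<open>A \<ge> 60\<close>.\<close>

lemma whess_radial:
 assumes g: "ground \<mu> K u" and mu: "\<mu> < 2690" and p: "p \<in> interior K" "1/2 \<le> u p" and a: "norm a = 1"
  and c: "0 < c" "c \<le> 1" and \<kappa>: "0 < \<kappa>" "\<kappa> \<le> 1/2" and k: "0 < k" "k \<le> 1"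
  and start: "\<And>z \<xi>. dist z p \<le> c \<Longrightarrow> z \<in> interior K \<Longrightarrow> norm \<xi> = 1 \<Longrightarrow> \<kappa> * (\<xi> \<bullet> a)^2 \<le> whess u \<xi> z"
  and z: "z \<in> interior K" and x: "norm \<xi> = 1"
 shows "\<kappa> * exp (- (60 / c^2) * (dist z p)^2 + k * ln (u z)) * (\<xi> \<bullet> a)^2 \<le> whess u \<xi> z"
proof -
 note G = ground_D[OF g]
 define A where "A = 60 / c^2"
 have A: "0 < A" "A * c^2 = 60" "60 \<le> A"
 proof -
  have "c^2 \<le> 1" using c by (simp add: power_le_one)
  then show "60 \<le> A" using c by (simp add: A_def pos_le_divide_eq)
 qed (use c in \<open>auto simp: A_def\<close>)
 let ?F = "\<lambda>z. - A * (dist z p)^2"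
 have near: "\<kappa> * exp (?F y + k * ln (u y)) * (\<zeta> \<bullet> a)^2 \<le> whess u \<zeta> y"
  if "dist y p \<le> c" "y \<in> interior K" "norm \<zeta> = 1" for y \<zeta>
 proof -
  have "\<kappa> * exp (?F y + k * ln (u y)) \<le> \<kappa>"
   using \<kappa> k A ln_u_nonpos[OF g that(2)] by (intro mult_exp_le) auto
  then have "\<kappa> * exp (?F y + k * ln (u y)) * (\<zeta> \<bullet> a)^2 \<le> \<kappa> * (\<zeta> \<bullet> a)^2" by (intro mult_right_mono) auto
  then show ?thesis using start[OF that] by linarith
 qed
 show ?thesis
 proof (cases "dist z p \<le> c")
  case True
  then show ?thesis using near[OF True z x] by (simp add: A_def)
 next
  case False
  have S: "closed (- ball p c)" by (simp add: closed_def)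
  have "\<kappa> * exp (?F z + k * ln (u z)) * (\<xi> \<bullet> a)^2 \<le> whess u \<xi> z"
  proof (rule whess_barrier[OF g a S _ _ k(1) \<kappa>(1) _ _ _ z x])
   show "continuous_on UNIV ?F" by (intro continuous_intros)
   show "?F y \<le> 0" for y using A by simp
   show "z \<in> - ball p c" using False by (simp add: dist_commute)
  next
   fix y \<zeta> :: "point" assume y: "y \<notin> interior (- ball p c)" "y \<in> interior K" and n: "norm \<zeta> = 1"
   have "y \<in> cball p c" using y(1) c by (simp add: interior_complement)
   then show "\<kappa> * exp (?F y + k * ln (u y)) * (\<zeta> \<bullet> a)^2 \<le> whess u \<zeta> y"
    using y(2) n by (intro near) (auto simp: dist_commute)
  next
   fix y assume y: "y \<in> interior (- ball p c)" and yK: "y \<in> interior K"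
   let ?vx = "dd ex u y / u y" and ?vy = "dd ey u y / u y"
   let ?X = "fst y - fst p" and ?Y = "snd y - snd p"
   have up: "0 < u y" by (rule G(6)[OF yK])
   have r: "c \<le> dist y p" using y interior_subset[of "- ball p c"] by (auto simp: dist_commute subset_iff simp del: split_paired_All)
   have d2: "(dist y p)^2 = ?X^2 + ?Y^2" by (simp add: dist_prod_def dist_real_def)
   have "ln (u p) - ln (u y) \<le> (grad u y \<bullet> (p - y)) / u y" by (rule ln_u_grad[OF g yK p(1)])
   also have "\<dots> = - (?vx * ?X + ?vy * ?Y)" using up by (simp add: grad_def inner_prod_def field_simps)
   finally have "?vx * ?X + ?vy * ?Y \<le> ln (u y) - ln (u p)" by simp
   moreover have "- 1 \<le> ln (u p)"
   proof -
    have "ln (1/2) \<le> ln (u p)" using p by (intro ln_mono) auto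
    moreover have "ln (1/2) = - ln (2::real)" by (simp add: ln_div)
    ultimately show ?thesis using ln2_le_25_over_36 by linarith
   qed
   ultimately have D: "?vx * ?X + ?vy * ?Y \<le> 1" using ln_u_nonpos[OF g yK] by linarith
   have lap: "lap2 ?F y (- 2 * A * ?X) (- 2 * A * ?Y) (- 4 * A)"
    using lap2_lin[OF lap2_sqdist[of p y] lap2_const[of 0 y], of "- A" 0] by (simp add: mult_ac)
   have "A^2 * c^2 \<le> A^2 * (dist y p)^2" using r c by (intro mult_left_mono power_mono) auto
   moreover have "A^2 * c^2 = 60 * A" using A by (simp add: power2_eq_square)
   ultimately have q: "60 * A \<le> A^2 * (?X^2 + ?Y^2)" by (simp add: d2)
   have "A * (1 + k) * (?vx * ?X + ?vy * ?Y) \<le> A * (1 + k) * 1" using A k D by (intro mult_left_mono) auto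
   also have "\<dots> \<le> A * 2" using A k by (simp add: mult_left_mono)
   finally have m: "A * (1 + k) * (?vx * ?X + ?vy * ?Y) \<le> 2 * A" by simp
   have km: "k * \<mu> \<le> 2690" using k mu G(1) mult_mono[of k 1 \<mu> 2690] by simp
   have id: "- 4 * A + 2 * (v * (- 2 * A * X) + w * (- 2 * A * Y)) + k * (v^2 + w^2 - \<mu>)
     + (- 2 * A * X + k * v)^2 + (- 2 * A * Y + k * w)^2
     = - 4 * A - 4 * (A * (1 + k) * (v * X + w * Y)) + 4 * (A^2 * (X^2 + Y^2)) - k * \<mu>
     + (k + k^2) * (v^2 + w^2)"
    for v w X Y by (simp add: power2_eq_square algebra_simps)
   have r0: "0 \<le> (k + k^2) * (?vx^2 + ?vy^2)" using k by (intro mult_nonneg_nonneg) auto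
   have fin: "2 * \<kappa> \<le> - 4 * A - 4 * m + 4 * q - km + r" if "m \<le> 2 * A" "60 * A \<le> q" "km \<le> 2690" "0 \<le> r" for m q km r
    using that \<kappa> A by linarith
   have "2 * \<kappa> \<le> - 4 * A + 2 * (?vx * (- 2 * A * ?X) + ?vy * (- 2 * A * ?Y)) + k * (?vx^2 + ?vy^2 - \<mu>)
     + (- 2 * A * ?X + k * ?vx)^2 + (- 2 * A * ?Y + k * ?vy)^2"
    unfolding id by (rule fin[OF m q km r0])
   then show "\<exists>a b l. lap2 ?F y a b l \<and> 2 * \<kappa> \<le> l + 2 * (?vx * a + ?vy * b) + k * (?vx^2 + ?vy^2 - \<mu>)
     + (a + k * ?vx)^2 + (b + k * ?vy)^2" using lap by blast
  qed
  then show ?thesis by (simp add: A_def)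
 qed
qed

text \<open>The barrier decays in \<open>x\<close> at rate \<open>300 * B\<close> with
  \<open>B = C / L\<close>, losing only an absolute factor over a length comparable to
  \<open>L\<close>. The logarithmic derivative in \<open>y\<close>, which enters through the bound
  on the drift, is absorbed by its square with coefficient \<open>k = 8 * B^2\<close>.\<close>

lemma whess_side:
 fixes C :: real
 assumes g: "ground \<mu> K u" and mu: "\<mu> < 2690" and s: "s \<in> {-1, 1}" and C: "1 \<le> C" and L: "3 * C \<le> L"
  and \<kappa>: "0 < \<kappa>" "\<kappa> \<le> 1/2"
  and vx: "\<And>z. z \<in> interior K \<Longrightarrow> 0 \<le> s * (fst z - x1) \<Longrightarrow> s * (dd ex u z / u z) \<le> C / L * (1 + \<bar>dd ey u z / u z\<bar>)"
  and start: "\<And>z \<xi>. fst z = x1 \<Longrightarrow> z \<in> interior K \<Longrightarrow> norm \<xi> = 1 \<Longrightarrow>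
   \<kappa> / L^2 * exp (8 * C^2 / L^2 * ln (u z)) * (fst \<xi>)^2 \<le> whess u \<xi> z"
  and z: "0 \<le> s * (fst z - x1)" "z \<in> interior K" and x: "norm \<xi> = 1"
 shows "\<kappa> / L^2 * exp (- (300 * C / L) * (s * (fst z - x1)) + 8 * C^2 / L^2 * ln (u z)) * (fst \<xi>)^2 \<le> whess u \<xi> z"
proof -
 note G = ground_D[OF g]
 have Lp: "0 < L" "1 \<le> L" using C L by auto
 define B where "B = C / L"
 define k where "k = 8 * B^2"
 have B: "0 < B" "B \<le> 1/3" using C L Lp by (auto simp: B_def pos_divide_le_eq)
 have k: "0 < k" "k \<le> 1"
 proof -
  have "B^2 \<le> (1/3)^2" using B by (intro power_mono) auto
  then show "k \<le> 1" by (simp add: k_def power2_eq_square)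
 qed (use B in \<open>simp add: k_def\<close>)
 have ss: "s * s = 1" using s by auto
 let ?F = "\<lambda>z. - (300 * B) * (s * (fst z - x1))"
 let ?S = "{z :: point. 0 \<le> s * (fst z - x1)}"
 have So: "interior ?S = {z. 0 < s * (fst z - x1)}"
 proof -
  have i: "(- s, 0) \<bullet> z = - s * fst z" for z :: "point" by (cases z) simp
  have "(- s, 0) \<noteq> (0 :: point)" using s by (auto simp: zero_prod_def)
  from interior_halfspace_le[OF this, of "- s * x1"] show ?thesis unfolding i right_diff_distrib by simp
 qed
 have fe: "\<xi> \<bullet> ex = fst \<xi>" for \<xi> :: "point" by (cases \<xi>) simp
 have kL: "8 * C^2 / L^2 = k" by (simp add: k_def B_def power_divide)
 have "\<kappa> / L^2 * exp (?F z + k * ln (u z)) * (\<xi> \<bullet> ex)^2 \<le> whess u \<xi> z"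
 proof (rule whess_barrier[OF g norm_basis(1) _ _ _ k(1) _ _ _ _ z(2) x, where S = ?S])
  show "closed ?S" by (intro closed_Collect_le continuous_intros)
  show "continuous_on UNIV ?F" by (intro continuous_intros)
  show "?F y \<le> 0" if "y \<in> ?S" for y
   using mult_nonneg_nonneg[of "300 * B" "s * (fst y - x1)"] that B by simp
  show "0 < \<kappa> / L^2" using \<kappa> Lp by simp
  show "z \<in> ?S" using z by simp
 next
  fix y \<zeta> :: "point" assume y: "y \<in> ?S" "y \<notin> interior ?S" "y \<in> interior K" and n: "norm \<zeta> = 1"
  have "s * (fst y - x1) = 0" using y(1,2) unfolding So by simp
  then have "fst y = x1" using ss by auto
  from start[OF this y(3) n] show "\<kappa> / L^2 * exp (?F y + k * ln (u y)) * (\<zeta> \<bullet> ex)^2 \<le> whess u \<zeta> y"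
   unfolding kL fe using \<open>fst y = x1\<close> by simp
 next
  fix y assume y: "y \<in> interior ?S" and yK: "y \<in> interior K"
  let ?vx = "dd ex u y / u y" and ?vy = "dd ey u y / u y"
  have lap: "lap2 ?F y (- (300 * B) * s) 0 0"
   using lap2_affine[of "300 * B * (s * x1)" "(- (300 * B) * s, 0)" y]
   by (simp add: inner_prod_def algebra_simps)
  have 1: "s * ?vx \<le> B * (1 + \<bar>?vy\<bar>)" using vx[OF yK] y So by (simp add: B_def)
  have "600 * B * (1 + k) * (s * ?vx) \<le> 600 * B * (1 + k) * (B * (1 + \<bar>?vy\<bar>))"
   using 1 B k by (intro mult_left_mono) auto
  also have "\<dots> \<le> 600 * B * 2 * (B * (1 + \<bar>?vy\<bar>))" using B k by (intro mult_right_mono mult_left_mono) auto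
  finally have m: "600 * B * (1 + k) * (s * ?vx) \<le> 1200 * B^2 + 1200 * B^2 * \<bar>?vy\<bar>"
   by (simp add: power2_eq_square algebra_simps)
  \<comment> \<open>Completing the square at 75. In units of \<open>B^2\<close> the balance is
    \<open>90000 - 1200 - 45000 - 21520\<close>, which exceeds the 1 needed for
    \<open>2 * (\<kappa> / L^2)\<close>.\<close>
  have am: "1200 * B^2 * \<bar>w\<bar> \<le> k * w^2 + 45000 * B^2" for w
  proof -
   have "0 \<le> B^2 * (8 * (\<bar>w\<bar> - 75)^2)" by (intro mult_nonneg_nonneg) auto
   then show ?thesis by (simp add: k_def power2_diff algebra_simps)
  qed
  have "k * \<mu> \<le> k * 2690" using k mu by (intro mult_left_mono) auto
  then have km: "k * \<mu> \<le> 21520 * B^2" by (simp add: k_def)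
  have "1 \<le> C^2" using C by simp
  then have "2 * \<kappa> \<le> C^2" using \<kappa> by linarith
  then have \<kappa>B: "2 * (\<kappa> / L^2) \<le> B^2" using Lp by (simp add: B_def power_divide divide_right_mono)
  have id: "0 + 2 * (v * (- (300 * B) * s) + w * 0) + k * (v^2 + w^2 - \<mu>) + (- (300 * B) * s + k * v)^2 + (0 + k * w)^2
   = 90000 * B^2 * (s * s) - 600 * B * (1 + k) * (s * v) + k * w^2 - k * \<mu> + (k * v^2 + (k * v)^2 + (k * w)^2)"
   for v w by (simp add: power2_eq_square algebra_simps)
  have r0: "0 \<le> k * ?vx^2 + (k * ?vx)^2 + (k * ?vy)^2" using k by (intro add_nonneg_nonneg mult_nonneg_nonneg) auto
  have fin: "2 * (\<kappa> / L^2) \<le> 90000 * B^2 * 1 - m + w2 - km + r" if "m \<le> 1200 * B^2 + w" "w \<le> w2 + 45000 * B^2" "km \<le> 21520 * B^2" "0 \<le> r" for m w w2 km r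
   using that \<kappa>B zero_le_power2[of B] by linarith
  have "2 * (\<kappa> / L^2) \<le> 0 + 2 * (?vx * (- (300 * B) * s) + ?vy * 0) + k * (?vx^2 + ?vy^2 - \<mu>) + (- (300 * B) * s + k * ?vx)^2 + (0 + k * ?vy)^2"
   unfolding id ss by (rule fin[OF m am km r0])
  then show "\<exists>a b l. lap2 ?F y a b l \<and> 2 * (\<kappa> / L^2) \<le> l + 2 * (?vx * a + ?vy * b) + k * (?vx^2 + ?vy^2 - \<mu>)
     + (a + k * ?vx)^2 + (b + k * ?vy)^2" using lap by blast
 qed
 then show ?thesis by (simp add: kL fe B_def)
qed

text \<open>If \<open>\<mu> \<le> 1\<close>, the barrier \<open>y - y^2\<close> with Laplacian
  \<open>- 2\<close> would keep \<open>u\<close> below 1/4. The bound makes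
  \<open>- u_yy / u = \<mu> + u_xx / u\<close> bounded below for large \<open>L\<close>.\<close>

lemma dom_mu_gt:
 assumes d: "dom K \<mu> u xs L"
 shows "1 < \<mu>"
proof (rule ccontr)
 assume "\<not> 1 < \<mu>"
 then have mu: "\<mu> \<le> 1" by simp
 note D = dom_D[OF d]
 note G = ground_D[OF D(1)]
 let ?Q = "\<lambda>z. 1 * (ey \<bullet> z - 0) - 1 * (ey \<bullet> z - 0)^2"
 have Qe: "?Q z = snd z - (snd z)^2" for z :: "point" by (cases z) simp
 have Q0: "0 \<le> ?Q z" "?Q z \<le> 1/4" if "z \<in> K" for z
 proof -
  have "0 \<le> snd z * (1 - snd z)" using D(2,3)[OF that] by (intro mult_nonneg_nonneg) auto
  then show "0 \<le> ?Q z" unfolding Qe by (simp add: power2_eq_square algebra_simps)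
  have "0 \<le> (snd z - 1/2)^2" by simp
  then show "?Q z \<le> 1/4" unfolding Qe by (simp add: power2_eq_square algebra_simps)
 qed
 obtain p where p: "p \<in> K" "u p = 1" using D(1) unfolding ground_def by blast
 have "u p \<le> ?Q p"
 proof (rule max_principle[OF D(1) HOL.refl[THEN equalityD1] G(2) _ _ _ p(1)])
  show "continuous_on K ?Q" by (intro continuous_intros)
  show "u z \<le> ?Q z" if "z \<in> K" "z \<notin> interior K" for z
   using Q0(1)[OF that(1)] ground_interiorI[OF D(1) that(1)] that(2) by fastforce
  show "0 \<le> ?Q z" if "z \<in> K" "u z = 0" for z using Q0(1)[OF that(1)] .
  fix z assume z: "z \<in> interior K"
  have "\<mu> * u z \<le> 1 * 1" using mu G(1) G(6)[OF z] G(7)[of z] z interior_subset by (intro mult_mono) auto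
  then have "- 2 * 1 < - \<mu> * u z" by simp
  moreover obtain a b where "lap2 ?Q z a b (- 2 * 1)" using lap2_quad[OF norm_basis(2), of 1 0 1 z] by blast
  ultimately show "\<exists>a b l. lap2 ?Q z a b l \<and> l < - \<mu> * u z" by blast
 qed
 then show False using p Q0(2)[OF p(1)] by linarith
qed

text \<open>Concavity of \<open>ln u\<close> towards a point \<open>q\<close> beyond
  \<open>p\<close>, at horizontal distance at least \<open>L / (2 * 10^6)\<close> from
  \<open>z\<close> and still of level 1/14400. The difference in height, at most 1, produces the
  term with the derivative in \<open>y\<close>.\<close>

lemma dom_side_vx:
 assumes d: "dom K \<mu> u xs L" and L: "2 * 10^6 \<le> L" and p: "p \<in> K" "1/2 \<le> u p" and s: "s \<in> {-1, 1}"
  and z: "z \<in> interior K" "0 \<le> s * (fst z - fst p)"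
 shows "s * (dd ex u z / u z) \<le> 2 * 10^6 * (ln 14400 + 1) / L * (1 + \<bar>dd ey u z / u z\<bar>)"
proof -
 note D = dom_D[OF d]
 note G = ground_D[OF D(1)]
 have s': "- s \<in> {-1, 1}" "s * s = 1" using s by auto
 have h: "0 < (1/2::real)" "(1/2::real) \<le> 1" "10^6 / (1/2) \<le> L" using L by auto
 obtain q where q: "q \<in> K" "fst q = fst p + - s * (1/2 / 10^6 * L)" "1/2 / 7200 \<le> u q"
  using dom_side[OF d h p s'(1)] by blast
 have qi: "q \<in> interior K" using q by (intro ground_interiorI[OF D(1)]) auto
 have up: "0 < u z" by (rule G(6)[OF z(1)])
 let ?vx = "dd ex u z / u z" and ?vy = "dd ey u z / u z"
 define c where "c = s * (fst z - fst q)"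
 have "c = s * (fst z - fst p) + s * s * (L / (2 * 10^6))" by (simp add: c_def q(2) algebra_simps)
 then have c: "L / (2 * 10^6) \<le> c" using z(2) s'(2) by simp
 have e: "fst q - fst z = - (s * c)" using s'(2) by (simp add: c_def mult.assoc[symmetric])
 have "ln (u q) - ln (u z) \<le> (grad u z \<bullet> (q - z)) / u z" by (rule ln_u_grad[OF D(1) z(1) qi])
 also have "\<dots> = ?vx * (fst q - fst z) + ?vy * (snd q - snd z)"
  using up by (simp add: grad_def inner_prod_def add_divide_distrib)
 finally have 1: "ln (u q) - ln (u z) \<le> - (c * (s * ?vx)) + ?vy * (snd q - snd z)" unfolding e by (simp add: mult_ac)
 have "ln (1 / 14400) \<le> ln (u q)" using q(3) by (intro ln_mono) auto
 then have "- ln 14400 \<le> ln (u q)" by (simp add: ln_div)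
 moreover have "z \<in> K" using z(1) interior_subset by blast
 then have "\<bar>snd q - snd z\<bar> \<le> 1" using D(2,3)[of q] D(2,3)[of z] q(1) by linarith
 then have "\<bar>?vy\<bar> * \<bar>snd q - snd z\<bar> \<le> \<bar>?vy\<bar> * 1" by (intro mult_left_mono) auto
 then have "?vy * (snd q - snd z) \<le> \<bar>?vy\<bar> * 1" by (metis abs_mult abs_le_D1)
 ultimately have 2: "c * (s * ?vx) \<le> ln 14400 + \<bar>?vy\<bar>" using 1 ln_u_nonpos[OF D(1) z(1)] by linarith
 have Lp: "0 < L" using L by simp
 have l: "0 \<le> ln (14400::real)" by simp
 have R: "0 \<le> 2 * 10^6 * (ln 14400 + 1) / L * (1 + \<bar>?vy\<bar>)" using Lp l by (intro mult_nonneg_nonneg divide_nonneg_nonneg) auto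
 show ?thesis
 proof (cases "0 \<le> s * ?vx")
  case True
  have "L / (2 * 10^6) * (s * ?vx) \<le> c * (s * ?vx)" using c True by (rule mult_right_mono)
  also have "\<dots> \<le> (ln 14400 + 1) * (1 + \<bar>?vy\<bar>)"
  proof -
   have "0 \<le> ln (14400::real) * \<bar>?vy\<bar>" using l by simp
   then show ?thesis using 2 unfolding distrib_left distrib_right mult_1_right mult_1_left by linarith
  qed
  finally have "L / (2 * 10^6) * (s * ?vx) \<le> (ln 14400 + 1) * (1 + \<bar>?vy\<bar>)" .
  then have "s * ?vx \<le> (ln 14400 + 1) * (1 + \<bar>?vy\<bar>) / (L / (2 * 10^6))"
   using Lp by (simp only: pos_le_divide_eq divide_pos_pos mult.commute zero_less_numeral zero_less_power mult_pos_pos)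
  also have "\<dots> = 2 * 10^6 * (ln 14400 + 1) / L * (1 + \<bar>?vy\<bar>)" by simp
  finally show ?thesis .
 qed (use R in linarith)
qed

text \<open>Adding a small multiple of an anisotropic quadratic to \<open>ln u\<close> moves the
  maximum, and the second-order test at the new maximum is the claim. It stays in
  \<open>{u > 1/2}\<close> because on \<open>{u \<ge> 1/2}\<close> the quadratic is at most
  \<open>4 * C^2 + 1\<close> by the extent bound, and the inner \<open>\<kappa>\<close> makes this
  contribute at most \<open>1/4 < ln 2\<close>.\<close>

lemma dom_start_point:
 "\<exists>\<kappa>>0. \<forall>K \<mu> u xs L. dom K \<mu> u xs L \<longrightarrow> (\<exists>p\<in>K. 1/2 \<le> u p \<and>
   (\<forall>\<xi>. norm \<xi> = 1 \<longrightarrow> \<kappa> * ((fst \<xi>)^2 / L^2 + (snd \<xi>)^2) \<le> whess u \<xi> p))"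
proof -
 define C where "C = 5376 + ln (1800 / (1/2) :: real)"
 have C: "0 < C" unfolding C_def by (simp add: add_pos_nonneg)
 define \<kappa> where "\<kappa> = 1 / (4 * (4 * C^2 + 1))"
 have q: "0 < 4 * C^2 + 1" by (simp add: add_nonneg_pos)
 have \<kappa>: "0 < \<kappa>" "\<kappa> * (4 * C^2 + 1) = 1/4"
 proof -
  show "0 < \<kappa>" unfolding \<kappa>_def using q by (intro divide_pos_pos) auto
  show "\<kappa> * (4 * C^2 + 1) = 1/4" using q unfolding \<kappa>_def by (simp add: divide_simps)
 qed
 have "\<exists>p\<in>K. 1/2 \<le> u p \<and> (\<forall>\<xi>. norm \<xi> = 1 \<longrightarrow> (2 * \<kappa>) * ((fst \<xi>)^2 / L^2 + (snd \<xi>)^2) \<le> whess u \<xi> p)"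
  if d: "dom K \<mu> u xs L" for K \<mu> u xs L
 proof -
  note D = dom_D[OF d]
  note G = ground_D[OF D(1)]
  have Lp: "0 < L" using D(6) by simp
  obtain x0 where x0: "x0 \<in> K" "u x0 = 1" using D(1) unfolding ground_def by blast
  define r where "r z = (fst z - fst x0)^2 / L^2 + (snd z - snd x0)^2" for z
  define H where "H = K \<inter> u -` {1/2..}"
  have "closed H" unfolding H_def using G(4) compact_imp_closed[OF G(2)] by (intro continuous_closed_preimage) auto
  then have Hc: "compact H" using compact_Int_closed[OF G(2), of H] by (simp add: H_def Int_absorb1)
  have HK: "z \<in> K" "1/2 \<le> u z" "z \<in> interior K" if "z \<in> H" for z
   using that ground_interiorI[OF D(1), of z] by (auto simp: H_def)
  define F where "F z = ln (u z) + \<kappa> * r z" for z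
  have "continuous_on H u" using G(4) by (rule continuous_on_subset) (auto simp: H_def)
  moreover have "\<And>z. z \<in> H \<Longrightarrow> u z \<noteq> 0" using HK(2) by fastforce
  ultimately have Fc: "continuous_on H F" unfolding F_def r_def using Lp by (intro continuous_intros) auto
  have x0H: "x0 \<in> H" using x0 by (simp add: H_def)
  then have "H \<noteq> {}" by blast
  from continuous_attains_sup[OF Hc this Fc] obtain p where p: "p \<in> H" "\<And>z. z \<in> H \<Longrightarrow> F z \<le> F p" by blast
  note pK = HK[OF p(1)]
  have rp: "\<kappa> * r p \<le> 1/4"
  proof -
   have h: "0 < (1/2 :: real)" by simp
   have "\<bar>fst p - fst x0\<bar> \<le> \<bar>2 * C * L\<bar>"
    using dom_extent[OF d h pK(1,2)] dom_extent[OF d h x0(1)] x0(2) C Lp by (simp add: C_def algebra_simps)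
   then have "(fst p - fst x0)^2 \<le> (2 * C * L)^2" by (simp only: abs_le_square_iff)
   then have "(fst p - fst x0)^2 / L^2 \<le> 4 * C^2" using Lp by (simp add: pos_divide_le_eq power_mult_distrib)
   moreover have "\<bar>snd p - snd x0\<bar> \<le> \<bar>1\<bar>" using D(2,3)[OF pK(1)] D(2,3)[OF x0(1)] by linarith
   then have "(snd p - snd x0)^2 \<le> 1^2" by (simp only: abs_le_square_iff)
   ultimately have "r p \<le> 4 * C^2 + 1" by (simp add: r_def)
   then have "\<kappa> * r p \<le> \<kappa> * (4 * C^2 + 1)" using \<kappa> by (intro mult_left_mono) auto
   then show ?thesis using \<kappa> by simp
  qed
  have up: "1/2 < u p"
  proof -
   have "0 \<le> F p" using p(2)[OF x0H] x0 by (simp add: F_def r_def)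
   then have "- 1/4 \<le> ln (u p)" using rp by (simp add: F_def)
   moreover have "ln (1/2 :: real) < - 1/4" using ln2_ge_two_thirds by (simp add: ln_div)
   ultimately have "ln (1/2) < ln (u p)" by linarith
   then show ?thesis using G(6)[OF pK(3)] by simp
  qed
  have "2 * \<kappa> * ((fst \<xi>)^2 / L^2 + (snd \<xi>)^2) \<le> whess u \<xi> p" if x: "norm \<xi> = 1" for \<xi>
  proof -
   have up0: "0 < u (p + 0 *\<^sub>R \<xi>)" using up by simp
   note v = d2_ln[OF d2_dir[OF G(5,1) x pK(3)] up0]
   have sq: "d2 (\<lambda>t. (a + b * t) * (a + b * t)) (2 * a * b) (2 * b^2)" for a b
    using d2_mult[OF d2_affine[of a b] d2_affine[of a b]] by (simp add: power2_eq_square mult.assoc)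
   let ?a = "fst p - fst x0" and ?b = "snd p - snd x0"
   note l = d2_lin[OF v d2_lin[OF sq[of ?a "fst \<xi>"] sq[of ?b "snd \<xi>"], of "1 / L^2" 1], of 1 \<kappa>]
   have e: "1 * ln (u (p + t *\<^sub>R \<xi>)) + \<kappa> * (1 / L^2 * ((?a + fst \<xi> * t) * (?a + fst \<xi> * t)) + 1 * ((?b + snd \<xi> * t) * (?b + snd \<xi> * t)))
     = F (p + t *\<^sub>R \<xi>)" for t
  proof -
   have "fst (p + t *\<^sub>R \<xi>) - fst x0 = ?a + fst \<xi> * t" "snd (p + t *\<^sub>R \<xi>) - snd x0 = ?b + snd \<xi> * t" by simp_all
   then show ?thesis unfolding F_def r_def by (simp only: power2_eq_square) simp
  qed
   have ev: "\<forall>\<^sub>F z in nhds p. F z \<le> F p"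
   proof -
    have "open (interior K \<inter> u -` {1/2<..})"
     using continuous_on_subset[OF G(4) interior_subset] by (intro continuous_open_preimage) auto
    then have "\<forall>\<^sub>F z in nhds p. z \<in> interior K \<inter> u -` {1/2<..}" using pK(3) up by (intro eventually_nhds_in_open) auto
    then show ?thesis
    proof (rule eventually_mono)
     fix z assume "z \<in> interior K \<inter> u -` {1/2<..}"
     then have "z \<in> H" using interior_subset[of K] by (auto simp: H_def simp del: split_paired_All)
     then show "F z \<le> F p" by (rule p(2))
    qed
   qed
   from eventually_line[OF this, of \<xi>] have "\<forall>\<^sub>F t in nhds 0. F (p + t *\<^sub>R \<xi>) \<le> F (p + 0 *\<^sub>R \<xi>)" by simp
   with l have "1 * (dd \<xi> (dd \<xi> u) p / u (p + 0 *\<^sub>R \<xi>) - (dd \<xi> u p / u (p + 0 *\<^sub>R \<xi>))^2)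
     + \<kappa> * (1 / L^2 * (2 * (fst \<xi>)^2) + 1 * (2 * (snd \<xi>)^2)) \<le> 0"
    unfolding e by (rule d2_max[THEN conjunct2])
   then show ?thesis by (simp add: whess_def algebra_simps)
  qed
  then show ?thesis using pK by blast
 qed
 moreover have "0 < 2 * \<kappa>" using \<kappa> by simp
 ultimately show ?thesis by blast
qed

section \<open>Propagation of the Hessian bound over the superlevel set\<close>

lemma dom_sol_lipschitz:
 assumes d: "dom K \<mu> u xs L" and P: "sol \<mu> (interior K) P"
  and B: "\<And>z. z \<in> K \<Longrightarrow> 1/8 \<le> u z \<Longrightarrow> \<bar>P z\<bar> \<le> B" and p: "p \<in> K" "1/2 \<le> u p" and z: "dist p z \<le> 1 / 172800"
 shows "\<bar>P z - P p\<bar> \<le> 5529600 * B * dist p z"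
proof (cases "z = p")
 case False
 note D = dom_D[OF d]
 obtain \<xi> where x: "norm \<xi> = 1" "z = p + dist p z *\<^sub>R \<xi>" using False by (rule unit_line)
 define T where "T = dist p z"
 have T: "0 < T" using False by (simp add: T_def)
 have h: "0 < (1/2 :: real)" "(1/2 :: real) \<le> 1" and q: "0 < (1/4 :: real)" "(1/4 :: real) \<le> 1" by auto
 have seg: "p + t *\<^sub>R \<xi> \<in> interior K" "1/4 \<le> u (p + t *\<^sub>R \<xi>)" if "0 \<le> t" "t \<le> T" for t
 proof -
  have "dist p (p + t *\<^sub>R \<xi>) \<le> (1/2)^2 / 43200"
   using that z line_dist[OF x(1), of p t] by (simp add: T_def power2_eq_square)
  from dom_nbhd[OF d h p this] show "1/4 \<le> u (p + t *\<^sub>R \<xi>)" "p + t *\<^sub>R \<xi> \<in> interior K"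
   by (auto intro!: ground_interiorI[OF D(1)])
 qed
 have "\<exists>t>0. t < T \<and> P (p + T *\<^sub>R \<xi>) - P (p + 0 *\<^sub>R \<xi>) = (T - 0) * dd \<xi> P (p + t *\<^sub>R \<xi>)"
 proof (rule MVT2[OF T])
  fix t assume t: "0 \<le> t" "t \<le> T"
  have "P differentiable at (p + t *\<^sub>R \<xi>)" using P seg(1)[OF t] unfolding sol_def by (blast intro: C2f_D(1))
  then show "((\<lambda>t. P (p + t *\<^sub>R \<xi>)) has_real_derivative dd \<xi> P (p + t *\<^sub>R \<xi>)) (at t)" by (rule has_real_derivative_dd)
 qed
 then obtain t where t: "0 < t" "t < T" "P z - P p = T * dd \<xi> P (p + t *\<^sub>R \<xi>)" using x(2) by (auto simp: T_def)
 have t': "0 \<le> t" "t \<le> T" using t by auto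
 have "\<bar>dd \<xi> P (p + t *\<^sub>R \<xi>)\<bar> \<le> 345600 / (1/4)^2 * B"
 proof (rule dom_sol_grad[OF q d P _ _ seg(2)[OF t'] x(1)])
  show "p + t *\<^sub>R \<xi> \<in> K" using seg(1)[OF t'] interior_subset by blast
  show "\<And>z. z \<in> K \<Longrightarrow> 1/4/2 \<le> u z \<Longrightarrow> \<bar>P z\<bar> \<le> B" using B by simp
 qed
 then have "T * \<bar>dd \<xi> P (p + t *\<^sub>R \<xi>)\<bar> \<le> T * (5529600 * B)" using T by (intro mult_left_mono) (auto simp: power2_eq_square)
 then show ?thesis unfolding t(3) using T by (simp add: abs_mult T_def mult_ac)
qed simp

lemma lipschitz_quotient:
 fixes P P' v v' B M e :: real
 assumes "\<bar>P' - P\<bar> \<le> M * B * e" "\<bar>v' - v\<bar> \<le> M * e" "\<bar>P\<bar> \<le> B" "1/2 \<le> v" "1/4 \<le> v'" "0 \<le> M * e"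
 shows "\<bar>P' / v' - P / v\<bar> \<le> 12 * M * B * e"
proof -
 have B: "0 \<le> B" using assms(3) by linarith
 have "P' / v' - P / v = (P' - P) / v' + P * (v - v') / (v * v')" using assms by (simp add: field_simps)
 moreover have "\<bar>(P' - P) / v'\<bar> \<le> 4 * (M * B * e)"
 proof -
  have "\<bar>P' - P\<bar> \<le> 4 * (M * B * e) * (1/4)" using assms(1) by simp
  also have "\<dots> \<le> 4 * (M * B * e) * v'" using assms(1,5) by (intro mult_left_mono) auto
  finally show ?thesis using assms(5) by (simp add: pos_divide_le_eq)
 qed
 moreover have "\<bar>P * (v - v') / (v * v')\<bar> \<le> 8 * (M * B * e)"
 proof -
  have vv: "1/8 \<le> v * v'" using mult_mono[of "1/2" v "1/4" v'] assms by simp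
  have "\<bar>P * (v - v')\<bar> \<le> B * (M * e)" unfolding abs_mult using assms B by (intro mult_mono) (auto simp: abs_minus_commute)
  also have "\<dots> = 8 * (M * B * e) * (1/8)" by simp
  also have "\<dots> \<le> 8 * (M * B * e) * (v * v')" using vv mult_nonneg_nonneg[OF assms(6) B] by (intro mult_left_mono) (auto simp: mult_ac)
  finally show ?thesis using vv by (simp add: pos_divide_le_eq abs_mult[of _ "inverse _"] divide_inverse[symmetric])
 qed
 ultimately show ?thesis by linarith
qed

text \<open>The entries keep their weights \<open>1 / L^2\<close>, \<open>1 / L\<close> and 1 also
  in the modulus of continuity, because every derivative of \<open>u\<close> in their formula is a
  solution of the right size, to which the interior gradient estimate applies.\<close>

lemma dom_hessq_lipschitz:
 "\<exists>M>0. \<forall>K \<mu> u xs L p z. dom K \<mu> u xs L \<longrightarrow> p \<in> K \<longrightarrow> 1/2 \<le> u p \<longrightarrow> dist p z \<le> 1 / 172800 \<longrightarrow>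
   \<bar>hessq u ex ex z - hessq u ex ex p\<bar> \<le> M * dist p z / L^2
   \<and> \<bar>hessq u ex ey z - hessq u ex ey p\<bar> \<le> M * dist p z / L
   \<and> \<bar>hessq u ey ey z - hessq u ey ey p\<bar> \<le> M * dist p z"
proof -
 have q: "0 < (1/8 :: real)" "(1/8 :: real) \<le> 1" by auto
 obtain C where C: "1 \<le> C" and der: "\<And>K \<mu> u xs L p. dom K \<mu> u xs L \<Longrightarrow> p \<in> K \<Longrightarrow> 1/8 \<le> u p \<Longrightarrow> deriv_bounds u L C p"
  using dom_derivs[OF q] by metis
 define N where "N = (5529600 :: real)"
 define M where "M = 108 * N * C^2"
 have M: "0 < M" using C by (simp add: M_def N_def)
 have "\<bar>hessq u ex ex z - hessq u ex ex p\<bar> \<le> M * dist p z / L^2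
   \<and> \<bar>hessq u ex ey z - hessq u ex ey p\<bar> \<le> M * dist p z / L
   \<and> \<bar>hessq u ey ey z - hessq u ey ey p\<bar> \<le> M * dist p z"
  if d: "dom K \<mu> u xs L" and p: "p \<in> K" "1/2 \<le> u p" and z: "dist p z \<le> 1 / 172800" for K \<mu> u xs L p z
 proof -
  note D = dom_D[OF d]
  note G = ground_D[OF D(1)]
  have Lp: "0 < L" using D(6) by simp
  have h: "0 < (1/2 :: real)" "(1/2 :: real) \<le> 1" by auto
  have z2: "dist p z \<le> (1/2)^2 / 43200" using z by (simp add: power2_eq_square)
  have uz: "z \<in> K" "1/4 \<le> u z" using dom_nbhd[OF d h p z2] by auto
  have pi: "p \<in> interior K" using p by (intro ground_interiorI[OF D(1)]) auto
  have zi: "z \<in> interior K" using uz by (intro ground_interiorI[OF D(1)]) auto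
  define e where "e = dist p z"
  have e: "0 \<le> N * e" by (simp add: N_def e_def)
  have ud: "\<bar>u z - u p\<bar> \<le> N * e"
   using dom_sol_lipschitz[OF d G(5) _ p z, of 1] ground_nonneg[OF D(1)] G(7) by (simp add: N_def e_def)
  have quo: "\<bar>P z / u z - P p / u p\<bar> \<le> 12 * N * B * e" "\<bar>P z / u z\<bar> \<le> 4 * B" "\<bar>P p / u p\<bar> \<le> 4 * B"
   if P: "sol \<mu> (interior K) P" and B: "\<And>z. z \<in> K \<Longrightarrow> 1/8 \<le> u z \<Longrightarrow> \<bar>P z\<bar> \<le> B" for P B
  proof -
   have Pp: "\<bar>P p\<bar> \<le> B" "\<bar>P z\<bar> \<le> B" using B[OF p(1)] B[OF uz(1)] p uz by auto
   show "\<bar>P z / u z - P p / u p\<bar> \<le> 12 * N * B * e"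
    using dom_sol_lipschitz[OF d P B p z] by (intro lipschitz_quotient ud Pp p uz e) (simp add: N_def e_def)
   have "\<bar>P y / u y\<bar> \<le> 4 * B" if "\<bar>P y\<bar> \<le> B" "1/4 \<le> u y" for y
   proof -
    have "\<bar>P y\<bar> \<le> 4 * B * (1/4)" using that by simp
    also have "\<dots> \<le> 4 * B * u y" using that by (intro mult_left_mono) auto
    finally show ?thesis using that by (simp add: pos_divide_le_eq)
   qed
   then show "\<bar>P z / u z\<bar> \<le> 4 * B" "\<bar>P p / u p\<bar> \<le> 4 * B" using Pp p uz by auto
  qed
  have hq: "\<bar>hessq u i j z - hessq u i j p\<bar> \<le> 108 * N * S * e"
   if i: "norm i = 1" and j: "norm j = 1"
    and B: "\<And>z. z \<in> K \<Longrightarrow> 1/8 \<le> u z \<Longrightarrow> \<bar>dd i u z\<bar> \<le> B"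
    and B': "\<And>z. z \<in> K \<Longrightarrow> 1/8 \<le> u z \<Longrightarrow> \<bar>dd j u z\<bar> \<le> B'"
    and S: "\<And>z. z \<in> K \<Longrightarrow> 1/8 \<le> u z \<Longrightarrow> \<bar>dd i (dd j u) z\<bar> \<le> S" and BB: "B * B' \<le> S" for i j B B' S
  proof -
   note si = sol_dd[OF G(5,1) i] and sj = sol_dd[OF G(5,1) j]
   note a = quo[OF si B] and b = quo[OF sj B'] and c = quo[OF sol_dd[OF sj G(1) i] S]
   define x y x' y' where "x = dd i u z / u z" "y = dd j u z / u z" "x' = dd i u p / u p" "y' = dd j u p / u p"
   have "\<bar>x * y - x' * y'\<bar> \<le> \<bar>x - x'\<bar> * \<bar>y\<bar> + \<bar>x'\<bar> * \<bar>y - y'\<bar>"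
    unfolding abs_mult[symmetric] using abs_triangle_ineq[of "(x - x') * y" "x' * (y - y')"] by (simp add: algebra_simps)
   also have "\<dots> \<le> 12 * N * B * e * (4 * B') + 4 * B * (12 * N * B' * e)"
    unfolding x_y_x'_y'_def
    by (intro add_mono mult_mono a b abs_ge_zero order_trans[OF abs_ge_zero a(1)] order_trans[OF abs_ge_zero a(2)])
   also have "\<dots> = 96 * (N * e) * (B * B')" by simp
   also have "\<dots> \<le> 96 * (N * e) * S" using BB e by (intro mult_left_mono) auto
   finally have f: "\<bar>x * y - x' * y'\<bar> \<le> 96 * (N * e) * S" .
   have "12 * N * S * e = 12 * ((N * e) * S)" "108 * N * S * e = 108 * ((N * e) * S)" by simp_all
   then show ?thesis using c(1) f unfolding hessq_def x_y_x'_y'_def[symmetric] mult.assoc[of 96 "N * e" S] by linarith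
  qed
  have scal: "S \<le> C^2 * w \<Longrightarrow> 108 * N * S * e \<le> M * e * w" for S w
  proof -
   assume "S \<le> C^2 * w"
   then have "108 * (N * e) * S \<le> 108 * (N * e) * (C^2 * w)" using e by (intro mult_left_mono) auto
   then show ?thesis by (simp add: M_def mult_ac)
  qed
  have C2: "C \<le> C^2" "1 \<le> C^2" using C by (auto simp: self_le_power)
  have xx: "\<bar>hessq u ex ex z - hessq u ex ex p\<bar> \<le> 108 * N * (C^2 / L^2) * e"
  proof (rule hq[of ex ex "C / L" "C / L"])
   fix y assume "y \<in> K" "1/8 \<le> u y"
   from der[OF d this, unfolded deriv_bounds_def] show "\<bar>dd ex u y\<bar> \<le> C / L" "\<bar>dd ex u y\<bar> \<le> C / L" "\<bar>dd ex (dd ex u) y\<bar> \<le> C^2 / L^2"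
    using divide_right_mono[OF C2(1), of "L^2"] by auto
  qed (auto simp: power2_eq_square)
  have xy: "\<bar>hessq u ex ey z - hessq u ex ey p\<bar> \<le> 108 * N * (C^2 / L) * e"
  proof (rule hq[of ex ey "C / L" C])
   fix y assume y: "y \<in> K" "1/8 \<le> u y"
   have "y \<in> interior K" using y by (intro ground_interiorI[OF D(1)]) auto
   note dd_hess(3)[OF G(5,1) this norm_basis(1)]
   with der[OF d y, unfolded deriv_bounds_def] show "\<bar>dd ex u y\<bar> \<le> C / L" "\<bar>dd ey u y\<bar> \<le> C" "\<bar>dd ex (dd ey u) y\<bar> \<le> C^2 / L"
    using divide_right_mono[OF C2(1), of L] Lp by auto
  qed (auto simp: power2_eq_square)
  have yy: "\<bar>hessq u ey ey z - hessq u ey ey p\<bar> \<le> 108 * N * C^2 * e"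
  proof (rule hq[of ey ey C C])
   fix y assume y: "y \<in> K" "1/8 \<le> u y"
   from der[OF d y, unfolded deriv_bounds_def] show "\<bar>dd ey u y\<bar> \<le> C" "\<bar>dd ey u y\<bar> \<le> C" "\<bar>dd ey (dd ey u) y\<bar> \<le> C^2"
    using C2 by auto
  qed (auto simp: power2_eq_square)
  show ?thesis using xx xy yy unfolding M_def e_def by (simp add: mult_ac)
 qed
 then show ?thesis using M by blast
qed

text \<open>Over the ball the form changes by at most \<open>2 * M * c\<close> times the anisotropic
  square norm, the mixed entry being split by the arithmetic-geometric mean inequality. So an
  absolute radius, independent of \<open>L\<close>, preserves half of the bound at the starting
  point.\<close>

lemma dom_start_ball:
 "\<exists>\<kappa>>0. \<kappa> \<le> 1/2 \<and> (\<exists>c>0. c \<le> 1 \<and> (\<forall>K \<mu> u xs L. dom K \<mu> u xs L \<longrightarrow> (\<exists>p\<in>K. 1/2 \<le> u p \<and>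
   (\<forall>z \<xi>. dist z p \<le> c \<longrightarrow> z \<in> interior K \<longrightarrow> norm \<xi> = 1 \<longrightarrow> \<kappa> * ((fst \<xi>)^2 / L^2 + (snd \<xi>)^2) \<le> whess u \<xi> z))))"
proof -
 obtain \<kappa> where \<kappa>: "0 < \<kappa>" and start: "\<And>K \<mu> u xs L. dom K \<mu> u xs L \<Longrightarrow> (\<exists>p\<in>K. 1/2 \<le> u p \<and>
   (\<forall>\<xi>. norm \<xi> = 1 \<longrightarrow> \<kappa> * ((fst \<xi>)^2 / L^2 + (snd \<xi>)^2) \<le> whess u \<xi> p))"
  using dom_start_point by blast
 obtain M where M: "0 < M" and lip: "\<And>K \<mu> u xs L p z. dom K \<mu> u xs L \<Longrightarrow> p \<in> K \<Longrightarrow> 1/2 \<le> u p \<Longrightarrow> dist p z \<le> 1 / 172800 \<Longrightarrow>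
   \<bar>hessq u ex ex z - hessq u ex ex p\<bar> \<le> M * dist p z / L^2
   \<and> \<bar>hessq u ex ey z - hessq u ex ey p\<bar> \<le> M * dist p z / L
   \<and> \<bar>hessq u ey ey z - hessq u ey ey p\<bar> \<le> M * dist p z"
  using dom_hessq_lipschitz by metis
 define \<kappa>' where "\<kappa>' = min (\<kappa> / 2) (1/2)"
 define c where "c = min (1 / 172800) (\<kappa> / (4 * M))"
 have \<kappa>': "0 < \<kappa>'" "\<kappa>' \<le> 1/2" "\<kappa>' \<le> \<kappa> / 2" using \<kappa> by (auto simp: \<kappa>'_def)
 have c: "0 < c" "c \<le> 1 / 172800" "c \<le> \<kappa> / (4 * M)" using \<kappa> M by (auto simp: c_def)
 have cM: "2 * (M * c) \<le> \<kappa> / 2" using c(3) M by (simp add: pos_le_divide_eq mult_ac)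
 have "\<exists>p\<in>K. 1/2 \<le> u p \<and>
   (\<forall>z \<xi>. dist z p \<le> c \<longrightarrow> z \<in> interior K \<longrightarrow> norm \<xi> = 1 \<longrightarrow> \<kappa>' * ((fst \<xi>)^2 / L^2 + (snd \<xi>)^2) \<le> whess u \<xi> z)"
  if d: "dom K \<mu> u xs L" for K \<mu> u xs L
 proof -
  note D = dom_D[OF d]
  note G = ground_D[OF D(1)]
  have Lp: "0 < L" using D(6) by simp
  obtain p where p: "p \<in> K" "1/2 \<le> u p" "\<And>\<xi>. norm \<xi> = 1 \<Longrightarrow> \<kappa> * ((fst \<xi>)^2 / L^2 + (snd \<xi>)^2) \<le> whess u \<xi> p"
   using start[OF d] by metis
  have pi: "p \<in> interior K" using p by (intro ground_interiorI[OF D(1)]) auto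
  have "\<kappa>' * ((fst \<xi>)^2 / L^2 + (snd \<xi>)^2) \<le> whess u \<xi> z"
   if z: "dist z p \<le> c" "z \<in> interior K" and x: "norm \<xi> = 1" for z \<xi>
  proof -
   have dz: "dist p z \<le> 1 / 172800" using z(1) c(2) by (simp add: dist_commute)
   have mz: "M * dist p z \<le> M * c" using z(1) M by (simp add: dist_commute)
   define X Y Z where "X = hessq u ex ex z - hessq u ex ex p" "Y = hessq u ex ey z - hessq u ex ey p" "Z = hessq u ey ey z - hessq u ey ey p"
   have XYZ: "\<bar>X\<bar> \<le> M * c / L^2" "\<bar>Y\<bar> \<le> M * c / L" "\<bar>Z\<bar> \<le> M * c"
    using lip[OF d p(1,2) dz] divide_right_mono[OF mz, of "L^2"] divide_right_mono[OF mz, of L] mz Lp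
    unfolding X_Y_Z_def by (auto intro: order_trans)
   define a b where "a = fst \<xi>" "b = snd \<xi>"
   have up: "u z \<noteq> 0" "u p \<noteq> 0" using G(6)[OF z(2)] G(6)[OF pi] by auto
   have "whess u \<xi> z - whess u \<xi> p = a^2 * X + 2 * (a * b) * Y + b^2 * Z"
    unfolding whess_quadratic[OF G(5,1) z(2) x up(1)] whess_quadratic[OF G(5,1) pi x up(2)] X_Y_Z_def a_b_def
    by (simp add: algebra_simps)
   moreover have "a^2 * (- X) \<le> a^2 * (M * c / L^2)" "b^2 * (- Z) \<le> b^2 * (M * c)" 
    by (intro mult_left_mono; use XYZ in simp)+
   moreover have "- (2 * (a * b) * Y) \<le> M * c * (a^2 / L^2 + b^2)"
   proof -
    have "- (2 * (a * b) * Y) \<le> 2 * \<bar>a * b\<bar> * \<bar>Y\<bar>" using abs_ge_minus_self[of "2 * (a * b) * Y"] by (simp add: abs_mult)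
    also have "\<dots> \<le> 2 * \<bar>a * b\<bar> * (M * c / L)" using XYZ by (intro mult_left_mono) auto
    also have "\<dots> = M * c * (2 * (\<bar>a\<bar> / L) * \<bar>b\<bar>)" by (simp add: abs_mult)
    also have "\<dots> \<le> M * c * ((\<bar>a\<bar> / L)^2 + \<bar>b\<bar>^2)" using M c by (intro mult_left_mono sum_squares_bound) auto
    finally show ?thesis by (simp add: power_divide)
   qed
   moreover have "M * c * (a^2 / L^2 + b^2) = a^2 * (M * c / L^2) + b^2 * (M * c)" by (simp add: distrib_left mult_ac)
   moreover have "2 * (M * c) * t = M * c * t + M * c * t" for t by simp
   ultimately have "whess u \<xi> p - 2 * (M * c) * (a^2 / L^2 + b^2) \<le> whess u \<xi> z" by simp
   moreover have "\<kappa> * (a^2 / L^2 + b^2) \<le> whess u \<xi> p" using p(3)[OF x] by (simp add: a_b_def)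
   moreover have "(2 * (M * c) + \<kappa>') * (a^2 / L^2 + b^2) \<le> \<kappa> * (a^2 / L^2 + b^2)"
    using cM \<kappa>' by (intro mult_right_mono) auto
   ultimately show ?thesis unfolding a_b_def[symmetric] distrib_right by linarith
  qed
  then show ?thesis using p by blast
 qed
 then show ?thesis using \<kappa>' c by (intro exI[of _ \<kappa>'] conjI exI[of _ c]) auto
qed

text \<open>A convex combination with weight \<open>\<theta>\<close> on the second estimate, so
  small that its negative part is at most \<open>c1 / 4\<close> while the first one still
  contributes \<open>c1 / 2\<close>.\<close>

lemma anisotropic_combine:
 fixes a b L c1 B w :: real
 assumes 1: "c1 * (a^2 / L^2) \<le> w" and 2: "b^2 / 4 - 4 * B^2 * (a^2 / L^2) \<le> w" and c1: "0 < c1"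
 defines "\<theta> \<equiv> c1 / (16 * B^2 + 2 * c1)"
 shows "0 < \<theta>" "min (c1 / 4) (\<theta> / 4) * (a^2 / L^2 + b^2) \<le> w"
proof -
 have q: "0 < 16 * B^2 + 2 * c1" using c1 by (simp add: add_nonneg_pos)
 show t: "0 < \<theta>" unfolding \<theta>_def by (rule divide_pos_pos[OF c1 q])
 have e: "\<theta> * (16 * B^2 + 2 * c1) = c1" using q by (simp add: \<theta>_def)
 have t2: "\<theta> \<le> 1/2" using q c1 by (simp add: \<theta>_def pos_divide_le_eq)
 define s where "s = a^2 / L^2"
 have s: "0 \<le> s" by (simp add: s_def)
 have "(1 - \<theta>) * (c1 * s) \<le> (1 - \<theta>) * w" using 1 t2 by (intro mult_left_mono) (auto simp: s_def)
 moreover have "\<theta> * (b^2 / 4 - 4 * B^2 * s) \<le> \<theta> * w" using 2 t by (intro mult_left_mono) (auto simp: s_def)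
 ultimately have "(1 - \<theta>) * (c1 * s) + \<theta> * (b^2 / 4 - 4 * B^2 * s) \<le> w" by (simp add: algebra_simps)
 moreover have "1/2 * (c1 * s) \<le> (1 - \<theta>) * (c1 * s)" using t2 c1 s by (intro mult_right_mono) auto
 moreover have "\<theta> * (4 * B^2 * s) \<le> c1 / 4 * s"
 proof -
  have "\<theta> * (4 * B^2) \<le> c1 / 4" using e mult_pos_pos[OF t c1] by (simp add: algebra_simps)
  from mult_right_mono[OF this s] show ?thesis by (simp add: mult.assoc)
 qed
 ultimately have "c1 / 4 * s + \<theta> / 4 * b^2 \<le> w" by (simp add: algebra_simps)
 moreover have "min (c1 / 4) (\<theta> / 4) * s \<le> c1 / 4 * s" "min (c1 / 4) (\<theta> / 4) * b^2 \<le> \<theta> / 4 * b^2"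
  using s by (intro mult_right_mono; simp)+
 ultimately show "min (c1 / 4) (\<theta> / 4) * (a^2 / L^2 + b^2) \<le> w" unfolding s_def[symmetric] distrib_left by linarith
qed

lemma exp_weight:
 fixes k v X Y \<kappa> :: real
 assumes "0 \<le> k" "k \<le> 1" "- 1 \<le> v" "v \<le> 0" "X \<le> Y" "0 \<le> \<kappa>"
 shows "\<kappa> * exp (- Y - 1) \<le> \<kappa> * exp (- X + k * v)"
proof -
 have "1 * v \<le> k * v" using assms by (intro mult_right_mono_neg) auto
 then show ?thesis using assms by (intro mult_left_mono) auto
qed

text \<open>For bounded \<open>L\<close> a Gaussian barrier in the tested direction suffices. For
  large \<open>L\<close> it would lose a factor exponential in \<open>L^2\<close>; it is then used
  only to reach the vertical line through \<open>p\<close>, at distance at most 1, in the direction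
  \<open>ex\<close>, and the side barrier goes on horizontally. The \<open>y\<close>-entry is
  bounded below through the equation, and \<open>anisotropic_combine\<close> joins both.\<close>

lemma dom_whess_lower:
 "\<exists>c>0. \<forall>K \<mu> u xs L p \<xi>. dom K \<mu> u xs L \<longrightarrow> p \<in> K \<longrightarrow> 1/2 \<le> u p \<longrightarrow> norm \<xi> = 1 \<longrightarrow>
   c * ((fst \<xi>)^2 / L^2 + (snd \<xi>)^2) \<le> whess u \<xi> p"
proof -
 obtain \<kappa> c where \<kappa>: "0 < \<kappa>" "\<kappa> \<le> 1/2" and c: "0 < c" "c \<le> 1" and start: "\<And>K \<mu> u xs L. dom K \<mu> u xs L \<Longrightarrow> (\<exists>p\<in>K. 1/2 \<le> u p \<and>
   (\<forall>z \<xi>. dist z p \<le> c \<longrightarrow> z \<in> interior K \<longrightarrow> norm \<xi> = 1 \<longrightarrow> \<kappa> * ((fst \<xi>)^2 / L^2 + (snd \<xi>)^2) \<le> whess u \<xi> z))"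
  using dom_start_ball by metis
 have half_1: "0 < (1/2 :: real)" "(1/2 :: real) \<le> 1" by auto
 obtain D0 where D0: "1 \<le> D0" and der: "\<And>K \<mu> u xs L p. dom K \<mu> u xs L \<Longrightarrow> p \<in> K \<Longrightarrow> 1/2 \<le> u p \<Longrightarrow> deriv_bounds u L D0 p"
  using dom_derivs[OF half_1] by metis
 define E where "E = 2 * (5376 + ln (1800 / (1/2) :: real))"
 define C where "C = 2 * 10^6 * (ln (14400::real) + 1)"
 define A where "A = 60 / c^2"
 define L0 where "L0 = 3 * C + 2 * D0"
 define B where "B = 6 * D0^2"
 define c1 where "c1 = \<kappa> * exp (- A) * exp (- (300 * C * E) - 1)"
 define \<theta> where "\<theta> = c1 / (16 * B^2 + 2 * c1)"
 define c2 where "c2 = \<kappa> / L0^2 * exp (- (A * ((E * L0)^2 + 1)) - 1)"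
 define m where "m = min c2 (min (c1 / 4) (\<theta> / 4))"
 have E: "0 < E" unfolding E_def by (simp add: add_pos_nonneg)
 have C: "1 \<le> C" "2 * 10^6 \<le> C" using ln_ge_zero[of "14400::real"] by (auto simp: C_def)
 have A: "0 < A" using c by (simp add: A_def)
 have L0: "1 \<le> L0" "2 * 10^6 \<le> L0" "3 * C \<le> L0" "2 * D0 \<le> L0" using C D0 by (auto simp: L0_def)
 have c1: "0 < c1" using \<kappa> by (simp add: c1_def)
 have c2: "0 < c2" using \<kappa> L0 by (simp add: c2_def)
 have "0 < \<theta>" unfolding \<theta>_def using c1 by (intro divide_pos_pos add_nonneg_pos) auto
 then have m: "0 < m" using c1 c2 by (simp add: m_def)
 have "m * ((fst \<xi>)^2 / L^2 + (snd \<xi>)^2) \<le> whess u \<xi> z"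
  if d: "dom K \<mu> u xs L" and z: "z \<in> K" "1/2 \<le> u z" and x: "norm \<xi> = 1" for K \<mu> u xs L z \<xi>
 proof -
  note D = dom_D[OF d]
  note G = ground_D[OF D(1)]
  have Lp: "0 < L" using D(6) by simp
  define a b where "a = fst \<xi>" "b = snd \<xi>"
  have ab: "a^2 + b^2 = 1" using x by (simp add: a_b_def norm_pair_eq_1)
  have ab0: "0 \<le> a^2 / L^2 + b^2" by simp
  have "1 \<le> L^2" using D(6) by simp
  then have "a^2 * 1 \<le> a^2 * L^2" by (intro mult_left_mono) auto
  then have aL: "a^2 / L^2 \<le> a^2" using Lp by (simp add: pos_divide_le_eq)
  obtain p where p: "p \<in> K" "1/2 \<le> u p" and
   st: "\<And>z \<xi>. dist z p \<le> c \<Longrightarrow> z \<in> interior K \<Longrightarrow> norm \<xi> = 1 \<Longrightarrow> \<kappa> * ((fst \<xi>)^2 / L^2 + (snd \<xi>)^2) \<le> whess u \<xi> z"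
   using start[OF d] by metis
  have pi: "p \<in> interior K" using p by (intro ground_interiorI[OF D(1)]) auto
  have zi: "z \<in> interior K" using z by (intro ground_interiorI[OF D(1)]) auto
  have mu: "\<mu> < 2690" by (rule dom_mu_le(2)[OF d])
  have h: "0 < (1/2 :: real)" by simp
  have zx: "\<bar>fst z - fst p\<bar> \<le> E * L"
   using dom_extent[OF d h z] dom_extent[OF d h p] by (simp add: E_def algebra_simps)
  have y1: "\<bar>snd w - snd p\<bar> \<le> 1" if "w \<in> K" for w using D(2,3)[OF that] D(2,3)[OF p(1)] by linarith
  have vz: "- 1 \<le> ln (u z)" "ln (u z) \<le> 0"
  proof -
   have "ln (1/2) \<le> ln (u z)" using z by (intro ln_mono) auto
   moreover have "ln (1/2 :: real) = - ln 2" by (simp add: ln_div)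
   ultimately show "- 1 \<le> ln (u z)" using ln2_le_25_over_36 by linarith
  qed (rule ln_u_nonpos[OF D(1) zi])
  show ?thesis
  proof (cases "L \<le> L0")
   case True
   have \<kappa>': "0 < \<kappa> / L0^2" "\<kappa> / L0^2 \<le> 1/2"
   proof -
    show "0 < \<kappa> / L0^2" using \<kappa> L0 by simp
    have "1 \<le> L0^2" using L0 by simp
    then have "\<kappa> / L0^2 \<le> \<kappa> / 1" using \<kappa> by (intro divide_left_mono) auto
    then show "\<kappa> / L0^2 \<le> 1/2" using \<kappa>(2) unfolding div_by_1 by (rule order_trans)
   qed
   have "\<kappa> / L0^2 * exp (- (60 / c^2) * (dist z p)^2 + 1 * ln (u z)) * (\<xi> \<bullet> \<xi>)^2 \<le> whess u \<xi> z"
   proof (rule whess_radial[OF D(1) mu pi p(2) x c \<kappa>' _ _ _ zi x])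
    fix y \<zeta> :: "point" assume y: "dist y p \<le> c" "y \<in> interior K" and n: "norm \<zeta> = 1"
    have "(\<zeta> \<bullet> \<xi>)^2 \<le> 1^2"
     using Cauchy_Schwarz_ineq2[of \<zeta> \<xi>] n x by (intro power2_le_iff_abs_le[THEN iffD2]) auto
    then have "\<kappa> / L0^2 * (\<zeta> \<bullet> \<xi>)^2 \<le> \<kappa> / L0^2 * 1" using \<kappa>' by (intro mult_left_mono) auto
    also have "\<dots> = \<kappa> * (1 / L0^2)" by simp
    also have "\<dots> \<le> \<kappa> * ((fst \<zeta>)^2 / L^2 + (snd \<zeta>)^2)"
    proof (intro mult_left_mono)
     have "1 / L0^2 = (fst \<zeta>)^2 / L0^2 + (snd \<zeta>)^2 / L0^2" using n by (simp add: norm_pair_eq_1 flip: add_divide_distrib)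
     also have "(fst \<zeta>)^2 / L0^2 \<le> (fst \<zeta>)^2 / L^2" using True Lp by (intro divide_left_mono power_mono) auto
     also have "(snd \<zeta>)^2 / L0^2 \<le> (snd \<zeta>)^2 / 1" using L0 by (intro divide_left_mono) auto
     finally show "1 / L0^2 \<le> (fst \<zeta>)^2 / L^2 + (snd \<zeta>)^2" by simp
    qed (use \<kappa> in simp)
    also have "\<dots> \<le> whess u \<zeta> y" by (rule st[OF y n])
    finally show "\<kappa> / L0^2 * (\<zeta> \<bullet> \<xi>)^2 \<le> whess u \<zeta> y" .
   qed auto
   moreover have "\<xi> \<bullet> \<xi> = 1" using x by (simp add: norm_eq_1)
   ultimately have 1: "\<kappa> / L0^2 * exp (- (A * (dist z p)^2) + 1 * ln (u z)) \<le> whess u \<xi> z" by (simp add: A_def)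
   have "A * (dist z p)^2 \<le> A * ((E * L0)^2 + 1)"
   proof (rule mult_left_mono)
    have "E * L \<le> E * L0" using True E by simp
    then have "\<bar>fst z - fst p\<bar> \<le> \<bar>E * L0\<bar>" using zx by linarith
    then have "(fst z - fst p)^2 \<le> (E * L0)^2" by (simp only: abs_le_square_iff)
    moreover have "\<bar>snd z - snd p\<bar> \<le> \<bar>1\<bar>" using y1[OF z(1)] by simp
    then have "(snd z - snd p)^2 \<le> 1^2" by (simp only: abs_le_square_iff)
    ultimately show "(dist z p)^2 \<le> (E * L0)^2 + 1" by (simp add: dist_prod_def dist_real_def)
   qed (use A in simp)
   from exp_weight[OF _ _ vz this less_imp_le[OF \<kappa>'(1)], of 1] have "c2 \<le> whess u \<xi> z" using 1 by (simp add: c2_def)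
   moreover have "m * (a^2 / L^2 + b^2) \<le> c2 * 1" using aL ab m ab0 by (intro mult_mono) (auto simp: m_def)
   ultimately show ?thesis by (simp add: a_b_def)
  next
   case False
   then have L: "L0 \<le> L" by simp
   have LL: "2 * 10^6 \<le> L" "3 * C \<le> L" "2 * D0 \<le> L" using L L0 by auto
   define k where "k = 8 * C^2 / L^2"
   have k: "0 < k" "k \<le> 1"
   proof -
    show "0 < k" using C Lp by (simp add: k_def)
    have "(3 * C)^2 \<le> L^2" using LL C by (intro power_mono) auto
    then have "9 * C^2 \<le> L^2" by (simp add: power_mult_distrib)
    then have "8 * C^2 \<le> 1 * L^2" using zero_le_power2[of C] by linarith
    then show "k \<le> 1" using Lp by (simp add: k_def pos_divide_le_eq)
   qed
   have fe: "\<zeta> \<bullet> ex = fst \<zeta>" for \<zeta> :: "point" by (cases \<zeta>) simp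
   have \<kappa>': "0 < \<kappa> / L^2" "\<kappa> / L^2 \<le> 1/2"
   proof -
    show "0 < \<kappa> / L^2" using \<kappa> Lp by simp
    have "1 \<le> L^2" using D(6) by simp
    then have "\<kappa> / L^2 \<le> \<kappa> / 1" using \<kappa> by (intro divide_left_mono) auto
    then show "\<kappa> / L^2 \<le> 1/2" using \<kappa>(2) unfolding div_by_1 by (rule order_trans)
   qed
   have rad: "\<kappa> / L^2 * exp (- (60 / c^2) * (dist y p)^2 + k * ln (u y)) * (\<zeta> \<bullet> ex)^2 \<le> whess u \<zeta> y"
    if y: "y \<in> interior K" and n: "norm \<zeta> = 1" for y \<zeta>
   proof (rule whess_radial[OF D(1) mu pi p(2) norm_basis(1) c \<kappa>' k _ y n])
    fix w \<zeta> :: "point" assume w: "dist w p \<le> c" "w \<in> interior K" and n: "norm \<zeta> = 1"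
    have "\<kappa> / L^2 * (\<zeta> \<bullet> ex)^2 \<le> \<kappa> * ((fst \<zeta>)^2 / L^2 + (snd \<zeta>)^2)"
     unfolding fe distrib_left using \<kappa> by simp
    then show "\<kappa> / L^2 * (\<zeta> \<bullet> ex)^2 \<le> whess u \<zeta> w" using st[OF w n] by linarith
   qed
   define \<kappa>1 where "\<kappa>1 = \<kappa> * exp (- A)"
   have \<kappa>1: "0 < \<kappa>1" "\<kappa>1 \<le> 1/2"
   proof -
    have "\<kappa> * exp (- A) \<le> \<kappa> * 1" using A \<kappa> by (intro mult_left_mono) auto
    then show "\<kappa>1 \<le> 1/2" using \<kappa>(2) unfolding \<kappa>1_def by linarith
   qed (use \<kappa> in \<open>simp add: \<kappa>1_def\<close>)
   define s where "s = (if fst p \<le> fst z then 1 else - 1 :: real)"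
   have s: "s \<in> {-1, 1}" "s * (fst z - fst p) = \<bar>fst z - fst p\<bar>" by (auto simp: s_def)
   have "\<kappa>1 / L^2 * exp (- (300 * C / L) * (s * (fst z - fst p)) + 8 * C^2 / L^2 * ln (u z)) * (fst \<xi>)^2 \<le> whess u \<xi> z"
   proof (rule whess_side[OF D(1) mu s(1) C(1) LL(2) \<kappa>1 _ _ _ zi x])
    fix w assume w: "w \<in> interior K" "0 \<le> s * (fst w - fst p)"
    show "s * (dd ex u w / u w) \<le> C / L * (1 + \<bar>dd ey u w / u w\<bar>)"
     unfolding C_def by (rule dom_side_vx[OF d LL(1) p s(1) w])
   next
    fix w \<zeta> :: "point" assume w: "fst w = fst p" "w \<in> interior K" and n: "norm \<zeta> = 1"
    have wK: "w \<in> K" using w(2) interior_subset by blast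
    have "\<bar>snd w - snd p\<bar> \<le> \<bar>1\<bar>" using y1[OF wK] by simp
    then have "(snd w - snd p)^2 \<le> 1^2" by (simp only: abs_le_square_iff)
    then have "(dist w p)^2 \<le> 1" using w(1) by (simp add: dist_prod_def dist_real_def)
    then have "A * (dist w p)^2 \<le> A * 1" using A by (intro mult_left_mono) auto
    then have "exp (- A + k * ln (u w)) \<le> exp (- (60 / c^2) * (dist w p)^2 + k * ln (u w))" by (simp add: A_def)
    then have "\<kappa> / L^2 * exp (- A + k * ln (u w)) * (\<zeta> \<bullet> ex)^2
      \<le> \<kappa> / L^2 * exp (- (60 / c^2) * (dist w p)^2 + k * ln (u w)) * (\<zeta> \<bullet> ex)^2"
     using \<kappa>' by (intro mult_right_mono mult_left_mono) auto
    also have "\<dots> \<le> whess u \<zeta> w" by (rule rad[OF w(2) n])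
    finally show "\<kappa>1 / L^2 * exp (8 * C^2 / L^2 * ln (u w)) * (fst \<zeta>)^2 \<le> whess u \<zeta> w"
     unfolding fe exp_add k_def[symmetric] \<kappa>1_def by (simp add: mult_ac)
   qed (use s in simp)
   then have 1: "\<kappa>1 / L^2 * exp (- (300 * C / L * \<bar>fst z - fst p\<bar>) + k * ln (u z)) * a^2 \<le> whess u \<xi> z"
    unfolding s(2) k_def[symmetric] a_b_def by simp
   have "300 * C / L * \<bar>fst z - fst p\<bar> \<le> 300 * C / L * (E * L)" using zx C Lp by (intro mult_left_mono) auto
   also have "\<dots> = 300 * C * E" using Lp by simp
   finally have e: "300 * C / L * \<bar>fst z - fst p\<bar> \<le> 300 * C * E" .
   have "0 \<le> \<kappa>1 / L^2" using \<kappa>1 by simp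
   from exp_weight[OF less_imp_le[OF k(1)] k(2) vz e this]
   have "\<kappa>1 / L^2 * exp (- (300 * C * E) - 1) * a^2 \<le> whess u \<xi> z"
    using 1 mult_right_mono[OF _ zero_le_power2[of a]] order_trans by blast
   then have w1: "c1 * (a^2 / L^2) \<le> whess u \<xi> z" by (simp add: c1_def \<kappa>1_def)
   have up: "0 < u z" using z by simp
   have w2: "b^2 / 4 - 4 * B^2 * (a^2 / L^2) \<le> whess u \<xi> z"
   proof -
    note dz = der[OF d z, unfolded deriv_bounds_def]
    define X Y Z where "X = hessq u ex ex z" "Y = hessq u ex ey z" "Z = hessq u ey ey z"
    have X: "0 \<le> X" using whess_nonneg[OF D(1) zi norm_basis(1)] unfolding whess_def hessq_def X_Y_Z_def by (simp add: power2_eq_square)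
    have inv: "\<bar>t / u z\<bar> \<le> 2 * S" if "\<bar>t\<bar> \<le> S" for t S
    proof -
     have "\<bar>t\<bar> \<le> 2 * S * (1/2)" using that by simp
     also have "\<dots> \<le> 2 * S * u z" using that z by (intro mult_left_mono) auto
     finally show ?thesis using up by (simp add: pos_divide_le_eq)
    qed
    have Y: "\<bar>Y\<bar> \<le> B / L"
    proof -
     have tri: "\<bar>x - y\<bar> \<le> R" if "\<bar>x\<bar> \<le> P" "\<bar>y\<bar> \<le> Q" "P + Q \<le> R" for x y P Q R :: real
      using that by linarith
     have 1: "\<bar>dd ex u z / u z * (dd ey u z / u z)\<bar> \<le> (2 * (D0 / L)) * (2 * D0)"
      unfolding abs_mult using dz by (intro mult_mono inv) auto
     have 2: "\<bar>dd ex (dd ey u) z / u z\<bar> \<le> 2 * (D0 / L)"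
      using dz unfolding dd_hess(3)[OF G(5,1) zi norm_basis(1)] by (intro inv) auto
     have "D0 / L \<le> D0^2 / L" using D0 Lp by (intro divide_right_mono) (auto simp: self_le_power)
     moreover have "(2 * (D0 / L)) * (2 * D0) = 4 * (D0^2 / L)" "B / L = 6 * (D0^2 / L)" by (auto simp: B_def power2_eq_square)
     ultimately have "(2 * (D0 / L)) * (2 * D0) + 2 * (D0 / L) \<le> B / L" by linarith
     then show ?thesis unfolding X_Y_Z_def hessq_def by (rule tri[OF 1 2])
    qed
    have Z: "1/2 \<le> Z"
    proof -
     have "dd ey (dd ey u) z = - \<mu> * u z - dd ex (dd ex u) z" using G(5) zi by (simp add: sol_def algebra_simps)
     then have "- (dd ey (dd ey u) z / u z) = \<mu> + dd ex (dd ex u) z / u z" using up by (simp add: field_simps)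
     moreover have "\<bar>dd ex (dd ex u) z / u z\<bar> \<le> 2 * (D0 / L^2)" using dz by (intro inv) auto
     moreover have "(2 * D0) * (2 * 1) \<le> L * L" using LL D0 by (intro mult_mono) auto
     then have "2 * (D0 / L^2) \<le> 1/2" using Lp by (simp add: pos_divide_le_eq power2_eq_square)
     moreover have "0 \<le> dd ey u z / u z * (dd ey u z / u z)" by simp
     moreover have "1/2 \<le> w - y" if "- y = \<mu> + x" "\<bar>x\<bar> \<le> P" "P \<le> 1/2" "0 \<le> w" for w x y P :: real
      using that dom_mu_gt[OF d] by linarith
     ultimately show ?thesis unfolding X_Y_Z_def hessq_def by blast
    qed
    have "whess u \<xi> z = a^2 * X + 2 * a * b * Y + b^2 * Z"
     using whess_quadratic[OF G(5,1) zi x] up by (simp add: X_Y_Z_def a_b_def)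
    moreover have "0 \<le> a^2 * X" using X by simp
    moreover have "b^2 * (1/2) \<le> b^2 * Z" using Z by (intro mult_left_mono) auto
    moreover have "- (2 * a * b * Y) \<le> 4 * B^2 * (a^2 / L^2) + b^2 / 4"
    proof -
     have "- (2 * a * b * Y) \<le> 2 * \<bar>a\<bar> * \<bar>b\<bar> * \<bar>Y\<bar>" using abs_ge_minus_self[of "2 * a * b * Y"] by (simp add: abs_mult)
     also have "\<dots> \<le> 2 * \<bar>a\<bar> * \<bar>b\<bar> * (B / L)" using Y by (intro mult_left_mono) auto
     also have "\<dots> = 2 * (2 * (B * (\<bar>a\<bar> / L))) * (\<bar>b\<bar> / 2)" by simp
     also have "\<dots> \<le> (2 * (B * (\<bar>a\<bar> / L)))^2 + (\<bar>b\<bar> / 2)^2" by (rule sum_squares_bound)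
     also have "\<dots> = 4 * B^2 * (a^2 / L^2) + b^2 / 4" by (simp add: power_divide power_mult_distrib)
     finally show ?thesis .
    qed
    ultimately show ?thesis by linarith
   qed
   have "m * (a^2 / L^2 + b^2) \<le> min (c1 / 4) (\<theta> / 4) * (a^2 / L^2 + b^2)"
    using ab0 by (intro mult_right_mono) (auto simp: m_def)
   also have "\<dots> \<le> whess u \<xi> z" unfolding \<theta>_def by (rule anisotropic_combine(2)[OF w1 w2 c1])
   finally show ?thesis by (simp add: a_b_def)
  qed
 qed
 then show ?thesis using m by blast
qed

section \<open>Second derivatives near the maximum\<close>

text \<open>\<open>u \<le> 1\<close> at both ends of the segment and
  \<open>u p \<ge> 1 - \<epsilon>\<close>: the slope at \<open>p\<close> can exceed
  \<open>\<epsilon> / T\<close> only by what the curvature produces over the length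
  \<open>T\<close>.\<close>

lemma taylor_bound:
 assumes g: "ground \<mu> K u" and x: "norm e = 1" and T: "0 < T"
  and seg: "\<And>t. \<bar>t\<bar> \<le> T \<Longrightarrow> p + t *\<^sub>R e \<in> interior K \<and> \<bar>dd e (dd e u) (p + t *\<^sub>R e)\<bar> \<le> M"
  and \<epsilon>: "1 - \<epsilon> \<le> u p"
 shows "\<bar>dd e u p\<bar> \<le> \<epsilon> / T + M * T"
proof -
 have one: "s * dd e u p * T \<le> \<epsilon> + M * T^2" if s: "s \<in> {-1, 1}" for s :: real
 proof -
  have abs_s: "\<bar>s * t\<bar> = \<bar>t\<bar>" for t using s by auto
  have d1: "((\<lambda>t. u (p + (s * t) *\<^sub>R e)) has_real_derivative dd e u (p + (s * t) *\<^sub>R e) * s) (at t)" if "\<bar>t\<bar> \<le> T" for t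
   using DERIV_chain2[OF DERIV_ln_line(3)[OF g x] DERIV_cmult_Id, of p s t UNIV] seg[of "s * t"] that abs_s by simp
  have d2: "((\<lambda>t. dd e u (p + (s * t) *\<^sub>R e)) has_real_derivative dd e (dd e u) (p + (s * t) *\<^sub>R e) * s) (at t)" if "\<bar>t\<bar> \<le> T" for t
   using DERIV_chain2[OF DERIV_ln_line(4)[OF g x] DERIV_cmult_Id, of p s t UNIV] seg[of "s * t"] that abs_s by simp
  obtain t where t: "0 < t" "t < T" "u (p + (s * T) *\<^sub>R e) - u (p + (s * 0) *\<^sub>R e) = (T - 0) * (dd e u (p + (s * t) *\<^sub>R e) * s)"
   using MVT2[OF T d1] by auto
  obtain r where r: "0 < r" "r < t" "dd e u (p + (s * t) *\<^sub>R e) - dd e u (p + (s * 0) *\<^sub>R e) = (t - 0) * (dd e (dd e u) (p + (s * r) *\<^sub>R e) * s)"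
   using MVT2[OF t(1) d2] t by auto
  have "\<bar>dd e (dd e u) (p + (s * r) *\<^sub>R e)\<bar> \<le> M" using seg[of "s * r"] r t abs_s by simp
  then have "t * \<bar>dd e (dd e u) (p + (s * r) *\<^sub>R e)\<bar> \<le> T * M" using t by (intro mult_mono) auto
  moreover have "\<bar>s * (dd e u (p + (s * t) *\<^sub>R e) - dd e u p)\<bar> = t * \<bar>dd e (dd e u) (p + (s * r) *\<^sub>R e)\<bar>"
   using r(3) t s by (auto simp: abs_mult)
  ultimately have "s * dd e u p \<le> s * dd e u (p + (s * t) *\<^sub>R e) + T * M" by (simp add: algebra_simps abs_le_iff)
  then have "s * dd e u p * T \<le> (s * dd e u (p + (s * t) *\<^sub>R e) + T * M) * T" using T by (intro mult_right_mono) auto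
  also have "\<dots> = u (p + (s * T) *\<^sub>R e) - u p + M * T^2" using t(3) by (simp add: power2_eq_square algebra_simps)
  also have "u (p + (s * T) *\<^sub>R e) \<le> 1"
   using ground_D(7)[OF g, of "p + (s * T) *\<^sub>R e"] seg[of "s * T"] T abs_s interior_subset[of K] by (auto simp del: split_paired_All)
  finally show ?thesis using \<epsilon> by linarith
 qed
 have "\<bar>dd e u p\<bar> * T \<le> \<epsilon> + M * T^2" using one[of 1] one[of "- 1"] by (cases "0 \<le> dd e u p") auto
 then have "\<bar>dd e u p\<bar> \<le> (\<epsilon> + M * T^2) / T" using T by (simp add: pos_le_divide_eq)
 also have "\<dots> = \<epsilon> / T + M * T" using T by (simp add: add_divide_distrib power2_eq_square)
 finally show ?thesis .
qed

text \<open>For large \<open>L\<close> the far point \<open>q\<close> may lie at another height than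
  \<open>p\<close>. A small vertical shift \<open>\<tau>\<close> of \<open>p\<close> compensates for
  this, so that the convex combination with \<open>q\<close> ends up exactly at the height of
  \<open>p\<close>.\<close>

lemma dom_horizontal_segment:
 assumes d: "dom K \<mu> u xs L" and p: "p \<in> K" "1/2 \<le> u p" and t: "\<bar>t\<bar> \<le> L / (172800 * 4 * 10^6)"
 shows "p + t *\<^sub>R ex \<in> K \<and> 1 / 14400 \<le> u (p + t *\<^sub>R ex)"
proof -
 note D = dom_D[OF d]
 note G = ground_D[OF D(1)]
 have Lp: "0 < L" using D(6) by simp
 have h: "0 < (1/2 :: real)" "(1/2 :: real) \<le> 1" by auto
 have near: "w \<in> K \<and> 1/4 \<le> u w" if "dist p w \<le> 1 / 172800" for w
  using dom_nbhd[OF d h p, of w] that by (simp add: power2_eq_square)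
 show ?thesis
 proof (cases "2 * 10^6 \<le> L")
  case False
  have "dist p (p + t *\<^sub>R ex) \<le> 1 / 172800" using line_dist[OF norm_basis(1), of p t] t False by simp
  from near[OF this] show ?thesis by simp
 next
  case True
  define s where "s = (if 0 \<le> t then 1 else - 1 :: real)"
  have s: "s \<in> {-1, 1}" "s * \<bar>t\<bar> = t" by (auto simp: s_def)
  have h3: "10^6 / (1/2) \<le> L" using True by simp
  obtain q where q: "q \<in> K" "fst q = fst p + s * (1/2 / 10^6 * L)" "1/2 / 7200 \<le> u q"
   using dom_side[OF d h h3 p s(1)] by blast
  define \<theta> where "\<theta> = \<bar>t\<bar> / (L / (2 * 10^6))"
  have \<theta>: "0 \<le> \<theta>" "\<theta> \<le> 1 / (2 * 172800)" "s * (L / (2 * 10^6)) * \<theta> = t"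
   using t Lp s by (auto simp: \<theta>_def pos_divide_le_eq mult_ac)
  define \<tau> where "\<tau> = - (\<theta> * (snd q - snd p)) / (1 - \<theta>)"
  have "\<bar>snd q - snd p\<bar> \<le> 1" using D(2,3)[OF q(1)] D(2,3)[OF p(1)] by linarith
  then have "\<theta> * \<bar>snd q - snd p\<bar> \<le> \<theta> * 1" using \<theta> by (intro mult_left_mono) auto
  moreover have "\<theta> \<le> 1 / 172800 * (1 - \<theta>)" using \<theta> by simp
  ultimately have "\<bar>\<tau>\<bar> \<le> 1 / 172800" using \<theta> by (simp add: \<tau>_def abs_mult pos_divide_le_eq)
  then have w: "p + \<tau> *\<^sub>R ey \<in> K \<and> 1/4 \<le> u (p + \<tau> *\<^sub>R ey)"
   using line_dist[OF norm_basis(2), of p \<tau>] by (intro near) simp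
  have "(1 - \<theta>) *\<^sub>R (p + \<tau> *\<^sub>R ey) + \<theta> *\<^sub>R q \<in> {z \<in> K. 1 / 14400 \<le> u z}"
   using w q \<theta> by (intro convexD[OF convex_superlevel[OF D(1)]]) auto
  moreover have "(1 - \<theta>) *\<^sub>R (p + \<tau> *\<^sub>R ey) + \<theta> *\<^sub>R q = p + t *\<^sub>R ex"
  proof (rule prod_eqI)
   show "fst ((1 - \<theta>) *\<^sub>R (p + \<tau> *\<^sub>R ey) + \<theta> *\<^sub>R q) = fst (p + t *\<^sub>R ex)"
    using \<theta>(3) by (simp add: q(2) algebra_simps)
   have "(1 - \<theta>) * \<tau> = - (\<theta> * (snd q - snd p))" using \<theta> by (simp add: \<tau>_def)
   then show "snd ((1 - \<theta>) *\<^sub>R (p + \<tau> *\<^sub>R ey) + \<theta> *\<^sub>R q) = snd (p + t *\<^sub>R ex)"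
    by (simp add: algebra_simps)
  qed
  ultimately show ?thesis by simp
 qed
qed

text \<open>The Taylor bound with \<open>T = r\<close> vertically and \<open>T = r * L\<close>
  horizontally, where the second derivatives are at most \<open>C\<close> and
  \<open>C / L^2\<close>. The choice \<open>\<epsilon> = r^2\<close> makes both terms proportional
  to \<open>r\<close>.\<close>

lemma dom_small_gradient:
 assumes \<delta>: "0 < (\<delta>::real)"
 shows "\<exists>\<epsilon>>0. \<epsilon> \<le> 1/2 \<and> (\<forall>K \<mu> u xs L p. dom K \<mu> u xs L \<longrightarrow> p \<in> K \<longrightarrow> 1 - \<epsilon> \<le> u p \<longrightarrow>
   \<bar>dd ex u p\<bar> \<le> \<delta> / L \<and> \<bar>dd ey u p\<bar> \<le> \<delta>)"
proof -
 have q: "0 < (1/14400 :: real)" "(1/14400 :: real) \<le> 1" by auto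
 obtain C where C: "1 \<le> C" and der: "\<And>K \<mu> u xs L p. dom K \<mu> u xs L \<Longrightarrow> p \<in> K \<Longrightarrow> 1/14400 \<le> u p \<Longrightarrow> deriv_bounds u L C p"
  using dom_derivs[OF q] by metis
 define r where "r = min (1 / (172800 * 4 * 10^6)) (\<delta> / (1 + C))"
 have r: "0 < r" "r \<le> 1 / (172800 * 4 * 10^6)" "r * (1 + C) \<le> \<delta>"
 proof -
  show "0 < r" using \<delta> C by (simp add: r_def)
  have "r \<le> \<delta> / (1 + C)" by (simp add: r_def)
  then show "r * (1 + C) \<le> \<delta>" using C by (simp add: pos_le_divide_eq)
 qed (unfold r_def, rule min.cobounded1)
 have "r * r \<le> 1/2 * 1" using r by (intro mult_mono) auto
 then have r2: "r^2 \<le> 1/2" by (simp add: power2_eq_square)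
 have "\<bar>dd ex u p\<bar> \<le> \<delta> / L \<and> \<bar>dd ey u p\<bar> \<le> \<delta>"
  if d: "dom K \<mu> u xs L" and p: "p \<in> K" "1 - r^2 \<le> u p" for K \<mu> u xs L p
 proof -
  note D = dom_D[OF d]
  note G = ground_D[OF D(1)]
  have Lp: "0 < L" using D(6) by simp
  have h: "0 < (1/2 :: real)" "(1/2 :: real) \<le> 1" by auto
  have p2: "1/2 \<le> u p" using p(2) r2 by linarith
  have "\<bar>dd ey u p\<bar> \<le> r^2 / r + C * r"
  proof (rule taylor_bound[OF D(1) norm_basis(2) r(1) _ p(2)])
   fix t assume t: "\<bar>t\<bar> \<le> r"
   have "dist p (p + t *\<^sub>R ey) \<le> (1/2)^2 / 43200"
    using line_dist[OF norm_basis(2), of p t] t r(2) by (simp add: power2_eq_square)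
   from dom_nbhd[OF d h p(1) p2 this] have w: "p + t *\<^sub>R ey \<in> K" "1/14400 \<le> u (p + t *\<^sub>R ey)" by auto
   moreover from w have "p + t *\<^sub>R ey \<in> interior K" by (intro ground_interiorI[OF D(1)]) auto
   ultimately show "p + t *\<^sub>R ey \<in> interior K \<and> \<bar>dd ey (dd ey u) (p + t *\<^sub>R ey)\<bar> \<le> C" using der[OF d w, unfolded deriv_bounds_def] by blast
  qed
  also have "\<dots> = r * (1 + C)" using r by (simp add: power2_eq_square algebra_simps)
  finally have y: "\<bar>dd ey u p\<bar> \<le> \<delta>" using r(3) by linarith
  have rL: "0 < r * L" using r Lp by simp
  have "\<bar>dd ex u p\<bar> \<le> r^2 / (r * L) + C / L^2 * (r * L)"
  proof (rule taylor_bound[OF D(1) norm_basis(1) rL _ p(2)])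
   fix t assume t: "\<bar>t\<bar> \<le> r * L"
   have "r * L \<le> 1 / (172800 * 4 * 10^6) * L" using r Lp by (intro mult_right_mono) auto
   then have "\<bar>t\<bar> \<le> L / (172800 * 4 * 10^6)" using t by simp
   from dom_horizontal_segment[OF d p(1) p2 this] have w: "p + t *\<^sub>R ex \<in> K" "1/14400 \<le> u (p + t *\<^sub>R ex)" by auto
   moreover from w have "p + t *\<^sub>R ex \<in> interior K" by (intro ground_interiorI[OF D(1)]) auto
   ultimately show "p + t *\<^sub>R ex \<in> interior K \<and> \<bar>dd ex (dd ex u) (p + t *\<^sub>R ex)\<bar> \<le> C / L^2" using der[OF d w, unfolded deriv_bounds_def] by blast
  qed
  also have "\<dots> = r * (1 + C) / L" using r Lp by (simp add: power2_eq_square field_simps)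
  also have "\<dots> \<le> \<delta> / L" using r(3) Lp by (intro divide_right_mono) auto
  finally show ?thesis using y by simp
 qed
 moreover have "0 < r^2" using r by simp
 ultimately show ?thesis using r2 by blast
qed

text \<open>The factor of the theorem is the maximum of \<open>1 / L^2\<close> and
  \<open>b^2\<close>, comparable to their sum; as \<open>a^2 + b^2 = 1\<close> and
  \<open>L \<ge> 1\<close>, the first of them may be replaced by \<open>a^2 / L^2\<close>.\<close>

lemma direction_scale:
 fixes a b L :: real
 assumes "a^2 + b^2 = 1" "1 \<le> L"
 shows "1 / L^2 * (max 1 (\<bar>b\<bar> * L))^2 \<le> 2 * (a^2 / L^2 + b^2)" "a^2 / L^2 + b^2 \<le> 2 * (1 / L^2 * (max 1 (\<bar>b\<bar> * L))^2)"
proof -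
 have Lp: "0 < L" "0 < L^2" "1 \<le> L^2" using assms by auto
 have gen: "max x y \<le> 2 * (p + y)" if "x = p + q" "q \<le> y" "0 \<le> p" "0 \<le> y" for x y p q :: real
  using that by auto
 have m: "1 / L^2 * (max 1 (\<bar>b\<bar> * L))^2 = max (1 / L^2) (b^2)"
 proof (cases "1 \<le> \<bar>b\<bar> * L")
  case True
  then have "1^2 \<le> (\<bar>b\<bar> * L)^2" by (intro power_mono) auto
  then have "1 / L^2 \<le> b^2" using Lp by (simp add: pos_divide_le_eq power_mult_distrib)
  then show ?thesis using True Lp by (simp add: max_def power_mult_distrib)
 next
  case False
  then have "(\<bar>b\<bar> * L)^2 \<le> 1^2" using Lp by (intro power_mono) auto
  then have "b^2 \<le> 1 / L^2" using Lp by (simp add: pos_le_divide_eq power_mult_distrib)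
  then show ?thesis using False by (simp add: max_def)
 qed
 have "1 / L^2 = a^2 / L^2 + b^2 / L^2" using assms(1) by (simp flip: add_divide_distrib)
 moreover have "b^2 / L^2 \<le> b^2 / 1" using Lp by (intro divide_left_mono) auto
 moreover have "0 \<le> a^2 / L^2" by simp
 ultimately show "1 / L^2 * (max 1 (\<bar>b\<bar> * L))^2 \<le> 2 * (a^2 / L^2 + b^2)"
  unfolding m div_by_1 using zero_le_power2[of b] by (intro gen)
 have "a^2 \<le> 1" using assms(1) zero_le_power2[of b] by linarith
 then have "a^2 / L^2 \<le> 1 / L^2" using Lp by (intro divide_right_mono) auto
 then show "a^2 / L^2 + b^2 \<le> 2 * (1 / L^2 * (max 1 (\<bar>b\<bar> * L))^2)"
  unfolding m using max.cobounded1[of "1 / L^2" "b^2"] max.cobounded2[of "b^2" "1 / L^2"] by linarith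
qed

theorem dom_second_derivative:
 "\<exists>\<epsilon>>0. \<exists>C>0. \<forall>K \<mu> u xs L p \<nu>. dom K \<mu> u xs L \<longrightarrow> p \<in> K \<longrightarrow> 1 - \<epsilon> \<le> u p \<longrightarrow> norm \<nu> = 1 \<longrightarrow>
   1 / C * (1 / L^2) * (max 1 (\<bar>snd \<nu>\<bar> * L))^2 \<le> - dd \<nu> (dd \<nu> u) p
   \<and> - dd \<nu> (dd \<nu> u) p \<le> C * (1 / L^2) * (max 1 (\<bar>snd \<nu>\<bar> * L))^2"
proof -
 have half: "0 < (1/2 :: real)" "(1/2 :: real) \<le> 1" by auto
 obtain D0 where D0: "1 \<le> D0" and der: "\<And>K \<mu> u xs L p. dom K \<mu> u xs L \<Longrightarrow> p \<in> K \<Longrightarrow> 1/2 \<le> u p \<Longrightarrow> deriv_bounds u L D0 p"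
  using dom_derivs[OF half] by metis
 obtain c where c: "0 < c" and low: "\<And>K \<mu> u xs L p \<xi>. dom K \<mu> u xs L \<Longrightarrow> p \<in> K \<Longrightarrow> 1/2 \<le> u p \<Longrightarrow> norm \<xi> = 1 \<Longrightarrow>
   c * ((fst \<xi>)^2 / L^2 + (snd \<xi>)^2) \<le> whess u \<xi> p"
  using dom_whess_lower by metis
 \<comment> \<open>Then the squared slope is at most \<open>2 * \<delta>^2 * S = c / 8 * S\<close>;
   divided by \<open>u \<ge> 1/2\<close> it costs \<open>c / 4 * S\<close>, half of the
   \<open>c / 2 * S\<close> supplied by the Hessian form.\<close>
 define \<delta> where "\<delta> = sqrt (c / 16)"
 have \<delta>: "0 < \<delta>" "\<delta>^2 = c / 16" using c by (auto simp: \<delta>_def)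
 obtain \<epsilon> where \<epsilon>: "0 < \<epsilon>" "\<epsilon> \<le> 1/2" and small: "\<And>K \<mu> u xs L p. dom K \<mu> u xs L \<Longrightarrow> p \<in> K \<Longrightarrow> 1 - \<epsilon> \<le> u p \<Longrightarrow>
   \<bar>dd ex u p\<bar> \<le> \<delta> / L \<and> \<bar>dd ey u p\<bar> \<le> \<delta>"
  using dom_small_gradient[OF \<delta>(1)] by metis
 define C where "C = max (8 / c) (4 * D0)"
 have C: "8 / c \<le> C" "4 * D0 \<le> C" "0 < C" using D0 by (auto simp: C_def less_max_iff_disj)
 have C1: "1 / C \<le> c / 8" using C c by (simp add: pos_divide_le_eq mult.commute)
 have "1 / C * (1 / L^2) * (max 1 (\<bar>snd \<nu>\<bar> * L))^2 \<le> - dd \<nu> (dd \<nu> u) p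
   \<and> - dd \<nu> (dd \<nu> u) p \<le> C * (1 / L^2) * (max 1 (\<bar>snd \<nu>\<bar> * L))^2"
  if d: "dom K \<mu> u xs L" and p: "p \<in> K" "1 - \<epsilon> \<le> u p" and nu: "norm \<nu> = 1" for K \<mu> u xs L p \<nu>
 proof -
  note D = dom_D[OF d]
  note G = ground_D[OF D(1)]
  have Lp: "0 < L" using D(6) by simp
  have p2: "1/2 \<le> u p" using p(2) \<epsilon> by linarith
  have up: "0 < u p" using p2 by simp
  have pi: "p \<in> interior K" using p up by (intro ground_interiorI[OF D(1)]) auto
  define a b where "a = fst \<nu>" "b = snd \<nu>"
  have ab: "a^2 + b^2 = 1" using nu by (simp add: a_b_def norm_pair_eq_1)
  define S where "S = a^2 / L^2 + b^2"
  define m where "m = 1 / L^2 * (max 1 (\<bar>b\<bar> * L))^2"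
  have m: "m \<le> 2 * S" "S \<le> 2 * m" "0 \<le> m" using direction_scale[OF ab D(6)] by (auto simp: m_def S_def)
  have cross: "2 * (\<bar>a\<bar> / L) * \<bar>b\<bar> \<le> S"
   using sum_squares_bound[of "\<bar>a\<bar> / L" "\<bar>b\<bar>"] by (simp add: S_def power_divide)
  have upper: "- dd \<nu> (dd \<nu> u) p \<le> 2 * D0 * S"
  proof -
   note dz = der[OF d p(1) p2, unfolded deriv_bounds_def]
   have gen: "- x \<le> 2 * t" if "x = u1 + u2 + u3" "- u1 \<le> s1" "- u3 \<le> s3" "- u2 \<le> t" "s1 + s3 = t"
    for x u1 u2 u3 s1 s3 t :: real using that by linarith
   have "dd \<nu> (dd \<nu> u) p = a^2 * dd ex (dd ex u) p + 2 * (a * b) * dd ex (dd ey u) p + b^2 * dd ey (dd ey u) p"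
    unfolding dd_components[OF sol_dd[OF G(5,1) nu] G(1) pi, of \<nu>] dd_hess[OF G(5,1) pi nu] a_b_def[symmetric]
    by (simp add: power2_eq_square algebra_simps)
   moreover have "- (a^2 * dd ex (dd ex u) p) \<le> a^2 * (D0 / L^2)"
    using dz mult_left_mono[of "- dd ex (dd ex u) p" "D0 / L^2" "a^2"] by (simp add: abs_le_iff)
   moreover have "- (b^2 * dd ey (dd ey u) p) \<le> b^2 * D0"
    using dz mult_left_mono[of "- dd ey (dd ey u) p" D0 "b^2"] by (simp add: abs_le_iff)
   moreover have "- (2 * (a * b) * dd ex (dd ey u) p) \<le> D0 * S"
   proof -
    have "- (2 * (a * b) * dd ex (dd ey u) p) \<le> 2 * \<bar>a * b\<bar> * \<bar>dd ex (dd ey u) p\<bar>"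
     using abs_ge_minus_self[of "2 * (a * b) * dd ex (dd ey u) p"] by (simp add: abs_mult)
    also have "\<dots> \<le> 2 * \<bar>a * b\<bar> * (D0 / L)" using dz dd_hess(3)[OF G(5,1) pi nu] by (intro mult_left_mono) auto
    also have "\<dots> = D0 * (2 * (\<bar>a\<bar> / L) * \<bar>b\<bar>)" by (simp add: abs_mult)
    also have "\<dots> \<le> D0 * S" using cross D0 by (intro mult_left_mono) auto
    finally show ?thesis .
   qed
   moreover have "a^2 * (D0 / L^2) + b^2 * D0 = D0 * S" by (simp add: S_def algebra_simps)
   ultimately show ?thesis unfolding mult.assoc[of 2 D0 S] by (rule gen)
  qed
  have lower: "c / 4 * S \<le> - dd \<nu> (dd \<nu> u) p"
  proof -
   define g where "g = dd \<nu> u p"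
   have gs: "g^2 \<le> c / 8 * S"
   proof -
    have g: "g = a * dd ex u p + b * dd ey u p" unfolding g_def a_b_def by (rule dd_components[OF G(5,1) pi])
    have "0 \<le> (a * dd ex u p - b * dd ey u p)^2" by simp
    then have "g^2 \<le> 2 * (a^2 * (dd ex u p)^2 + b^2 * (dd ey u p)^2)"
     unfolding g by (simp add: power2_eq_square algebra_simps)
    also have "\<dots> \<le> 2 * (a^2 * (\<delta> / L)^2 + b^2 * \<delta>^2)"
     using small[OF d p] \<delta>(1) Lp by (intro mult_left_mono add_mono abs_le_square_iff[THEN iffD1]) auto
    also have "\<dots> = 2 * \<delta>^2 * S" by (simp add: S_def power_divide algebra_simps)
    finally show ?thesis using \<delta>(2) by simp
   qed
   have gen: "c / 4 * S \<le> - x" if "w = h - x" "1/2 * (c * S) \<le> w" "h \<le> 2 * k" "k \<le> c / 8 * S" for w x h k :: real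
   proof -
    have "c / 4 * S = 1/2 * (c * S) - 2 * (c / 8 * S)" by simp
    then show ?thesis using that by linarith
   qed
   have "u p * whess u \<nu> p = g^2 / u p - dd \<nu> (dd \<nu> u) p"
    using up by (simp add: whess_def g_def power_divide power2_eq_square right_diff_distrib)
   moreover have "1/2 * (c * S) \<le> u p * whess u \<nu> p"
    using low[OF d p(1) p2 nu] p2 c m by (intro mult_mono) (auto simp: S_def a_b_def)
   moreover have "g^2 / u p \<le> g^2 / (1/2)" using p2 by (intro divide_left_mono) auto
   then have "g^2 / u p \<le> 2 * g^2" by simp
   ultimately show ?thesis using gs by (rule gen)
  qed
  have "1 / C * m \<le> c / 8 * m" using C1 m by (intro mult_right_mono) auto
  moreover have "c / 8 * m \<le> c / 8 * (2 * S)" using m c by (intro mult_left_mono) auto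
  moreover have "2 * D0 * S \<le> 2 * D0 * (2 * m)" using m D0 by (intro mult_left_mono) auto
  moreover have "4 * D0 * m \<le> C * m" using C m by (intro mult_right_mono) auto
  ultimately have "1 / C * m \<le> - dd \<nu> (dd \<nu> u) p" "- dd \<nu> (dd \<nu> u) p \<le> C * m" using lower upper by linarith+
  then show ?thesis by (simp add: m_def a_b_def mult.assoc)
 qed
 then show ?thesis using \<epsilon> C by blast
qed

section \<open>Normalised convex domains\<close>

text \<open>Along a line that starts in \<open>V\<close>, the inner \<open>deriv\<close> agrees near
  0 with the directional derivative at the moved point, so the iterated \<open>deriv\<close> is an
  iterated \<open>dd\<close>.\<close>

lemma C2_on_dd:
 assumes V: "open V" and C: "C2_on V u"
 shows "C2f V u" "p \<in> V \<Longrightarrow> second_directional_deriv \<nu> u p = dd \<nu> (dd \<nu> u) p"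
proof -
 obtain D H where D: "\<And>p. p \<in> V \<Longrightarrow> (u has_derivative blinfun_apply (D p)) (at p)"
  and H: "\<And>p. p \<in> V \<Longrightarrow> (D has_derivative blinfun_apply (H p)) (at p)" and Hc: "continuous_on V H"
  using C unfolding C2_on_def by blast
 have d1: "dd \<nu> u p = D p \<nu>" if "p \<in> V" for \<nu> p by (rule dd_has_derivative[OF D[OF that]])
 have hd: "(dd \<nu> u has_derivative (\<lambda>h. H p h \<nu>)) (at p)" if "p \<in> V" for \<nu> p
 proof -
  have "((\<lambda>q. D q \<nu>) has_derivative (\<lambda>h. H p h \<nu>)) (at p)"
   using H[OF that] by (auto intro!: derivative_eq_intros)
  then show ?thesis by (rule has_derivative_transform_within_open[OF _ V that]) (simp add: d1)
 qed
 have d2: "dd i (dd j u) p = H p i j" if "p \<in> V" for i j p by (rule dd_has_derivative[OF hd[OF that]])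
 have Hij: "continuous_on V (dd i (dd j u))" for i j
 proof -
  have "continuous_on V (\<lambda>p. H p i j)" using Hc by (intro continuous_intros)
  then show ?thesis using d2 by (simp cong: continuous_on_cong)
 qed
 show "C2f V u" unfolding C2f_def
  using V D hd Hij unfolding differentiable_def by blast
 show "second_directional_deriv \<nu> u p = dd \<nu> (dd \<nu> u) p" if p: "p \<in> V"
 proof -
  have "\<forall>\<^sub>F z in nhds p. z \<in> V" using V p by (rule eventually_nhds_in_open)
  from eventually_line[OF this, of \<nu>] have ev: "\<forall>\<^sub>F t in nhds 0. deriv (\<lambda>t. u (p + t *\<^sub>R \<nu>)) t = dd \<nu> u (p + t *\<^sub>R \<nu>)"
  proof (rule eventually_mono)
   fix t :: real assume t: "p + t *\<^sub>R \<nu> \<in> V"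
   from has_derivative_line[OF D[OF t]] show "deriv (\<lambda>t. u (p + t *\<^sub>R \<nu>)) t = dd \<nu> u (p + t *\<^sub>R \<nu>)"
    unfolding d1[OF t] by (rule DERIV_imp_deriv)
  qed
  then show ?thesis unfolding second_directional_deriv_def dd_def[of \<nu> "dd \<nu> u"] by (rule deriv_cong_ev) simp
 qed
qed

lemma laplacian_dd:
 assumes V: "open V" and C: "C2_on V u" and p: "p \<in> V"
 shows "laplacian u p = dd ex (dd ex u) p + dd ey (dd ey u) p"
 unfolding laplacian_def Basis_prod_def using C2_on_dd(2)[OF V C p]
 by (subst sum.union_disjoint) (auto simp: zero_prod_def)

lemma projection_length_le:
 assumes "\<And>p. p \<in> S \<Longrightarrow> l \<le> p \<bullet> e \<and> p \<bullet> e \<le> r" "l \<le> r"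
 shows "projection_length S e \<le> r - l"
proof (cases "(\<lambda>p. p \<bullet> e) ` S \<in> sets lborel")
 case True
 have "measure lborel ((\<lambda>p. p \<bullet> e) ` S) \<le> measure lborel {l..r}"
  using assms True by (intro measure_mono_fmeasurable) (auto simp: fmeasurable_def)
 then show ?thesis using assms(2) by (simp add: projection_length_def)
next
 \<comment> \<open>\<open>measure\<close> returns 0 for a set that is not measurable, so the bound
   holds by default.\<close>
 case False
 then show ?thesis using assms(2) by (simp add: projection_length_def measure_notin_sets)
qed

text \<open>If all contact points with \<open>y = 1\<close> lay strictly on one side of those with \<open>y = 0\<close>, tilting the
 direction slightly would shorten the projection.\<close>

lemma contact_points:
 fixes K :: "point set" and s :: real
 assumes K: "compact K" and y: "\<And>z. z \<in> K \<Longrightarrow> 0 \<le> snd z \<and> snd z \<le> 1"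
  and w: "\<And>\<sigma>. 0 < \<sigma> \<Longrightarrow> \<exists>z\<in>K. \<exists>z'\<in>K. 1 \<le> (z - z') \<bullet> (- (s * \<sigma>), 1)"
 shows "\<exists>p q. (p, 1) \<in> K \<and> (q, 0) \<in> K \<and> s * (p - q) \<le> 0"
proof -
 have "\<forall>n. \<exists>zz\<in>K \<times> K. 1 \<le> (fst zz - snd zz) \<bullet> (- (s * (1 / real (Suc n))), 1)"
 proof
  fix n
  obtain z z' where "z \<in> K" "z' \<in> K" "1 \<le> (z - z') \<bullet> (- (s * (1 / real (Suc n))), 1)"
   using w[of "1 / real (Suc n)"] by auto
  then show "\<exists>zz\<in>K \<times> K. 1 \<le> (fst zz - snd zz) \<bullet> (- (s * (1 / real (Suc n))), 1)"
   by (intro bexI[of _ "(z, z')"]) auto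
 qed
 then obtain f where f: "\<And>n. f n \<in> K \<times> K" "\<And>n. 1 \<le> (fst (f n) - snd (f n)) \<bullet> (- (s * (1 / real (Suc n))), 1)" by metis
 have "compact (K \<times> K)" using K by (intro compact_Times)
 from this[unfolded compact_def, rule_format, of f] f(1)
 obtain l r where l: "l \<in> K \<times> K" "strict_mono (r :: nat \<Rightarrow> nat)" "(f \<circ> r) \<longlonglongrightarrow> l" by blast
 obtain z z' where zz: "l = (z, z')" by (cases l)
 define F where "F n = fst (fst (f (r n))) - fst (snd (f (r n)))" for n
 define G where "G n = snd (fst (f (r n))) - snd (snd (f (r n)))" for n
 have fr: "(\<lambda>n. f (r n)) \<longlonglongrightarrow> l" using l(3) by (simp add: o_def)
 have Fl: "F \<longlonglongrightarrow> fst z - fst z'" and Gl: "G \<longlonglongrightarrow> snd z - snd z'"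
  unfolding F_def G_def using fr zz by (auto intro!: tendsto_eq_intros)
 have FG: "1 \<le> G n - s * F n * (1 / real (Suc (r n)))" for n
  using f(2)[of "r n"] unfolding inner_prod_def F_def G_def by (simp add: algebra_simps)
 have G1: "G n \<le> 1" for n
 proof -
  have "fst (f (r n)) \<in> K" "snd (f (r n)) \<in> K" using f(1)[of "r n"] by (simp_all add: mem_Times_iff)
  then show ?thesis using y unfolding G_def by (smt (verit))
 qed
 \<comment> \<open>A positive \<open>s * F n\<close> would, together with
   \<open>G n \<le> 1\<close>, make the extent in the tilted direction less than 1.\<close>
 have "s * F n \<le> 0" for n
 proof (rule ccontr)
  assume "\<not> s * F n \<le> 0"
  then have "0 < s * F n * (1 / real (Suc (r n)))" by (intro mult_pos_pos[of "s * F n"]) auto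
  then show False using FG[of n] G1[of n] by linarith
 qed
 then have s: "s * (fst z - fst z') \<le> 0"
  using LIMSEQ_le_const2[OF tendsto_mult_left[OF Fl, of s], of 0] by blast
 have "(\<lambda>n. 1 / real (Suc n)) \<longlonglongrightarrow> 0" using LIMSEQ_inverse_real_of_nat by (simp add: inverse_eq_divide)
 then have "(\<lambda>n. 1 / real (Suc (r n))) \<longlonglongrightarrow> 0" using LIMSEQ_subseq_LIMSEQ[OF _ l(2)] by (force simp: o_def)
 from tendsto_diff[OF Gl tendsto_mult[OF tendsto_mult_left[OF Fl, of s] this]]
 have "1 \<le> (snd z - snd z') - s * (fst z - fst z') * 0"
  by (rule LIMSEQ_le_const) (use FG in blast)
 moreover have zK: "z \<in> K" "z' \<in> K" using l(1) zz by auto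
 ultimately have "snd z = 1" "snd z' = 0" using y[OF zK(1)] y[OF zK(2)] by auto
 then have "z = (fst z, 1)" "z' = (fst z', 0)" by (simp_all add: prod_eq_iff)
 then show ?thesis using zK s by metis
qed

text \<open>Two pairs of contact points with horizontal offsets of opposite sign: the convex
  combination in which the offsets cancel is a vertical chord.\<close>

lemma vertical_contact:
 assumes K: "convex (K :: point set)" and a: "(p, 1) \<in> K" "(q, 0) \<in> K" "p \<le> q" and b: "(p', 1) \<in> K" "(q', 0) \<in> K" "q' \<le> p'"
 shows "\<exists>x. (x, 0) \<in> K \<and> (x, 1) \<in> K"
proof (cases "p = q")
 case False
 define d where "d = (q - p) + (p' - q')"
 define t where "t = (q - p) / d"
 have d: "0 < d" using False a b by (simp add: d_def)
 have t: "0 \<le> t" "t \<le> 1" using a b d by (auto simp: t_def pos_divide_le_eq d_def)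
 have e: "t * d = q - p" using d by (simp add: t_def)
 then have eq: "(1 - t) * p + t * p' = (1 - t) * q + t * q'" by (simp add: d_def algebra_simps)
 have "(1 - t) *\<^sub>R (p, 1) + t *\<^sub>R (p', 1) \<in> K" "(1 - t) *\<^sub>R (q, 0) + t *\<^sub>R (q', 0) \<in> K"
  by (intro convexD[OF K]; use t a b in simp)+
 then show ?thesis using eq by (intro exI[of _ "(1 - t) * p + t * p'"]) simp
qed (use a in auto)

text \<open>The box lies in the triangle spanned by the unit chord and a point at horizontal
  distance 1/2. At relative distance \<open>\<theta> \<le> 1/4\<close> the triangle covers the
  heights from \<open>\<theta> * y0\<close> to \<open>\<theta> * y0 + 1 - \<theta>\<close>, hence
  those between 1/4 and 3/4.\<close>

lemma triangle_rectangle: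
 assumes K: "convex K" and x: "(x0, 0) \<in> K" "(x0, 1) \<in> K" and q: "(x0 + s / 2, y0) \<in> K" "0 \<le> y0" "y0 \<le> 1" and s: "s \<in> {-1, 1 :: real}"
 shows "cbox (x0 + s / 16 - 1/16, 1/2 - 1/4) (x0 + s / 16 + 1/16, 1/2 + 1/4) \<subseteq> (K :: point set)"
proof
 fix z :: "point" assume "z \<in> cbox (x0 + s / 16 - 1/16, 1/2 - 1/4) (x0 + s / 16 + 1/16, 1/2 + 1/4)"
 then have z: "x0 + s / 16 - 1/16 \<le> fst z" "fst z \<le> x0 + s / 16 + 1/16" "1/4 \<le> snd z" "snd z \<le> 3/4"
  by (simp_all add: mem_cbox_pair)
 define \<theta> where "\<theta> = 2 * s * (fst z - x0)"
 have \<theta>: "0 \<le> \<theta>" "\<theta> \<le> 1/4" "\<theta> * s = 2 * (fst z - x0)" using z(1,2) s by (auto simp: \<theta>_def)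
 define y' where "y' = (snd z - \<theta> * y0) / (1 - \<theta>)"
 have ty: "0 \<le> \<theta> * y0" "\<theta> * y0 \<le> \<theta> * 1" "\<theta> * (1 - y0) \<ge> 0"
  using \<theta> q mult_left_mono[OF q(3) \<theta>(1)] by auto
 have y': "0 \<le> y'" "y' \<le> 1" using ty z(3,4) \<theta> by (auto simp: y'_def pos_divide_le_eq algebra_simps)
 have ye: "(1 - \<theta>) * y' = snd z - \<theta> * y0" using \<theta> by (simp add: y'_def)
 have "(1 - y') *\<^sub>R (x0, 0) + y' *\<^sub>R (x0, 1) \<in> K" using y' x by (intro convexD[OF K]) auto
 then have "(x0, y') \<in> K" by (simp add: algebra_simps)
 then have "(1 - \<theta>) *\<^sub>R (x0, y') + \<theta> *\<^sub>R (x0 + s / 2, y0) \<in> K" using \<theta> q by (intro convexD[OF K]) auto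
 moreover have "(1 - \<theta>) *\<^sub>R (x0, y') + \<theta> *\<^sub>R (x0 + s / 2, y0) = z"
  using ye \<theta>(3) by (intro prod_eqI) (simp_all add: algebra_simps)
 ultimately show "z \<in> K" by simp
qed

text \<open>For \<open>\<mu> \<le> 0\<close> the function \<open>u\<close> would be subharmonic.
  Adding \<open>\<delta>\<close> times the squared norm makes this strict, and
  \<open>\<delta>\<close> is small enough that the boundary values, at most 1/2, stay below the
  value at \<open>p\<close>.\<close>

lemma eigenvalue_pos:
 assumes K: "compact K" and c: "continuous_on K u" and b: "\<And>z. z \<in> K \<Longrightarrow> z \<notin> interior K \<Longrightarrow> u z = 0"
  and pos: "\<And>z. z \<in> interior K \<Longrightarrow> 0 < u z" and P: "sol \<mu> (interior K) u" and p: "p \<in> K" "u p = 1"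
 shows "0 < \<mu>"
proof (rule ccontr)
 assume "\<not> 0 < \<mu>"
 then have mu: "\<mu> \<le> 0" by simp
 obtain R where R: "\<And>z. z \<in> K \<Longrightarrow> norm z \<le> R" using compact_imp_bounded[OF K] unfolding bounded_iff by blast
 define \<delta> where "\<delta> = 1 / (2 * (R^2 + 1))"
 have q: "0 < R^2 + 1" by (simp add: add_nonneg_pos)
 have \<delta>: "0 < \<delta>" unfolding \<delta>_def using q by (intro divide_pos_pos) auto
 define w where "w z = 1 * u z + \<delta> * (dist z 0)^2" for z
 have wc: "continuous_on K w" unfolding w_def using c by (intro continuous_intros)
 obtain z where z: "z \<in> K" "\<And>y. y \<in> K \<Longrightarrow> w y \<le> w z" using continuous_attains_sup[OF K _ wc] p(1) by blast
 show False
 proof (cases "z \<in> interior K")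
  case True
  have "\<forall>\<^sub>F y in nhds z. y \<in> interior K" using True by (intro eventually_nhds_in_open) auto
  then have ev: "\<forall>\<^sub>F y in nhds z. w y \<le> w z"
   by (rule eventually_mono) (use z(2) interior_subset in blast)
  have "lap2 w z (1 * dd ex u z + \<delta> * (2 * (fst z - fst (0 :: point)))) (1 * dd ey u z + \<delta> * (2 * (snd z - snd (0 :: point)))) (1 * (- \<mu> * u z) + \<delta> * 4)"
   unfolding w_def by (rule lap2_lin[OF lap2_sol[OF P True] lap2_sqdist])
  from lap2_max(3)[OF this ev] have "\<delta> * 4 \<le> \<mu> * u z" by simp
  moreover have "\<mu> * u z \<le> 0" using mu pos[OF True] by (intro mult_nonpos_nonneg) auto
  ultimately show False using \<delta> by linarith
 next
  case False
  have "w p \<le> \<delta> * (norm z)^2" using z(2)[OF p(1)] b[OF z(1) False] by (simp add: w_def)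
  also have "\<dots> \<le> \<delta> * R^2" using \<delta> R[OF z(1)] by (intro mult_left_mono power_mono) auto
  also have "\<dots> \<le> \<delta> * (R^2 + 1)" using \<delta> by simp
  also have "\<dots> = 1/2" using q by (simp add: \<delta>_def)
  finally have "w p \<le> 1/2" .
  moreover have "0 \<le> \<delta> * (dist p 0)^2" using \<delta> by simp
  ultimately show False using p(2) unfolding w_def by linarith
 qed
qed

lemma interval_extent:
 fixes I :: "real set"
 assumes I: "is_interval I" "I \<subseteq> {a..b}" and L: "0 < L" "L \<le> measure lborel I"
 obtains l r where "l + L \<le> r" "{l<..<r} \<subseteq> I"
proof -
 have ne: "I \<noteq> {}" using L by auto
 have bd: "bdd_above I" "bdd_below I" using I(2) by (auto intro: bdd_above_mono bdd_below_mono)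
 have sub: "I \<subseteq> {Inf I..Sup I}" using bd by (auto intro: cInf_lower cSup_upper)
 have le: "Inf I \<le> Sup I" using ne bd by (rule cInf_le_cSup)
 have "measure lborel I \<le> Sup I - Inf I"
 proof (cases "I \<in> sets lborel")
  case True
  have "measure lborel I \<le> measure lborel {Inf I..Sup I}"
   using sub True le by (intro measure_mono_fmeasurable) (auto simp: fmeasurable_def)
  then show ?thesis using le by simp
 qed (use le in \<open>simp add: measure_notin_sets\<close>)
 then have "Inf I + L \<le> Sup I" using L by simp
 moreover have "{Inf I<..<Sup I} \<subseteq> I"
 proof
  fix x assume x: "x \<in> {Inf I<..<Sup I}"
  obtain i where "i \<in> I" "i < x" using cInf_lessD[OF ne, of x] x by auto
  moreover obtain j where "j \<in> I" "x < j" using less_cSupD[OF ne, of x] x by auto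
  ultimately show "x \<in> I" using mem_is_interval_1_I[OF I(1), of i j x] by simp
 qed
 ultimately show ?thesis by (rule that)
qed

text \<open>\<open>S\<close> may fail to be closed, since \<open>f1\<close> and \<open>f2\<close>
  can jump at \<open>a\<close> and \<open>b\<close>. Over the open interval both are continuous, so
  the closure has the same sections there.\<close>

lemma closure_graph_section:
 fixes a b :: real and f1 f2 :: "real \<Rightarrow> real"
 assumes c: "convex_on {a..b} f1" "concave_on {a..b} f2"
  and S: "S = {(x, y). x \<in> {a..b} \<and> f1 x \<le> y \<and> y \<le> f2 x}" and z: "(x, y) \<in> closure S" and x: "a < x" "x < b"
 shows "f1 x \<le> y" "y \<le> f2 x"
proof -
 have up: "y \<le> g x" if g: "convex_on {a..b} (\<lambda>x. - g x)" and S: "S \<subseteq> {z. snd z \<le> g (fst z)}" and z: "(x, y) \<in> closure S" for g S and y :: real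
 proof (rule ccontr)
  assume neg: "\<not> y \<le> g x"
  have "continuous_on {a<..<b} (\<lambda>x. - g x)"
   by (rule convex_on_continuous, simp, rule convex_on_subset[OF g]) auto
  from continuous_on_minus[OF this] have "continuous_on {a<..<b} g" by simp
  then have "continuous_on ({a<..<b} \<times> (UNIV :: real set)) (\<lambda>z. g (fst z))"
   by (rule continuous_on_compose2[OF _ continuous_on_fst[OF continuous_on_id]]) simp
  then have "continuous_on ({a<..<b} \<times> UNIV) (\<lambda>z. snd z - g (fst z))"
   by (intro continuous_on_diff continuous_on_snd continuous_on_id)
  then have "open (({a<..<b} \<times> UNIV) \<inter> (\<lambda>z. snd z - g (fst z)) -` {0<..})"
   by (rule continuous_open_preimage) (auto intro: open_Times)
  moreover have "(x, y) \<in> ({a<..<b} \<times> UNIV) \<inter> (\<lambda>z. snd z - g (fst z)) -` {0<..}" using neg x by auto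
  ultimately obtain w where "w \<in> S" "w \<in> ({a<..<b} \<times> UNIV) \<inter> (\<lambda>z. snd z - g (fst z)) -` {0<..}"
   using z unfolding closure_iff_nhds_not_empty by blast
  then show False using S by auto
 qed
 show "y \<le> f2 x" by (rule up[OF _ _ z]) (use c S in \<open>auto simp: concave_on_def\<close>)
 let ?r = "\<lambda>z :: point. (fst z, - snd z)"
 have "(x, - y) \<in> closure (?r ` S)"
 proof -
  have "?r ` closure S \<subseteq> closure (?r ` S)"
   by (rule image_closure_subset) (intro continuous_intros, auto intro: closure_subset[THEN subsetD])
  moreover have "?r (x, y) \<in> ?r ` closure S" using z by (rule imageI)
  ultimately show ?thesis by auto
 qed
 then have "- y \<le> - f1 x" by (rule up[rotated 2]) (use c S in auto)
 then show "f1 x \<le> y" by simp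
qed

lemma normalised_dom:
 assumes N: "normalised_convex_domain a b f1 f2 S" and LS: "is_length_scale a b (\<lambda>x. f2 x - f1 x) L"
  and E: "normalised_first_eigenfunction S \<mu> u"
 shows "\<exists>xs. dom (closure S) \<mu> u xs L"
proof -
 let ?K = "closure S"
 have conv: "convex S" and bd: "bounded S" and ab: "a < b" and cf: "convex_on {a..b} f1" "concave_on {a..b} f2"
  and f12: "\<And>x. x \<in> {a..b} \<Longrightarrow> f1 x \<le> f2 x" and S: "S = {(x, y). x \<in> {a..b} \<and> f1 x \<le> y \<and> y \<le> f2 x}"
  and f1: "\<And>x. x \<in> {a..b} \<Longrightarrow> 0 \<le> f1 x" and f2: "\<And>x. x \<in> {a..b} \<Longrightarrow> f2 x \<le> 1"
  and f1e: "\<exists>x\<in>{a..b}. f1 x = 0" and f2e: "\<exists>x\<in>{a..b}. f2 x = 1"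
  and proj: "\<And>e. norm e = 1 \<Longrightarrow> projection_length S (0, 1) \<le> projection_length S e"
  using N unfolding normalised_convex_domain_def by blast+
 have mem: "(x, y) \<in> S \<longleftrightarrow> x \<in> {a..b} \<and> f1 x \<le> y \<and> y \<le> f2 x" for x y unfolding S by simp
 have int: "interior ?K = interior S" by (rule convex_interior_closure[OF conv])
 have fr: "frontier ?K = frontier S" unfolding frontier_def int by simp
 have Kc: "compact ?K" using bd by (simp add: compact_closure)
 have Kconv: "convex ?K" using conv by (rule convex_closure)
 have SK: "z \<in> S \<Longrightarrow> z \<in> ?K" for z using closure_subset by blast
 have box: "?K \<subseteq> cbox (a, 0) (b, 1)"
 proof (rule closure_minimal)
  show "S \<subseteq> cbox (a, 0) (b, 1)"
  proof
   fix z assume "z \<in> S"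
   then have "(fst z, snd z) \<in> S" by simp
   then show "z \<in> cbox (a, 0) (b, 1)" using f1[of "fst z"] f2[of "fst z"] unfolding mem mem_cbox_pair by auto
  qed
 qed (rule closed_cbox)
 have Kb: "a \<le> fst z" "fst z \<le> b" "0 \<le> snd z" "snd z \<le> 1" if "z \<in> ?K" for z
  using subsetD[OF box that] by (auto simp: mem_cbox_pair)
 obtain x0 where x0: "x0 \<in> {a..b}" "f1 x0 = 0" using f1e by blast
 obtain x1 where x1: "x1 \<in> {a..b}" "f2 x1 = 1" using f2e by blast
 have p0: "(x0, 0) \<in> S" "(x1, 1) \<in> S" using x0 x1 f12[OF x0(1)] f12[OF x1(1)] by (auto simp: mem)
 have proj1: "projection_length S (0, 1) = 1"
 proof -
  have "(\<lambda>p. p \<bullet> (0, 1)) ` S = {0..1 :: real}"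
  proof (intro equalityI subsetI)
   fix y assume "y \<in> (\<lambda>p. p \<bullet> (0, 1)) ` S"
   then obtain z where "z \<in> S" "y = snd z" by (auto simp: inner_prod_def)
   then show "y \<in> {0..1}" using Kb[OF SK] by simp
  next
   fix y :: real assume "y \<in> {0..1}"
   then have "(1 - y) *\<^sub>R (x0, 0) + y *\<^sub>R (x1, 1) \<in> S" using p0 by (intro convexD[OF conv]) auto
   then show "y \<in> (\<lambda>p. p \<bullet> (0, 1)) ` S" by (rule rev_image_eqI) simp
  qed
  then show ?thesis by (simp add: projection_length_def)
 qed
 \<comment> \<open>Minimality of the vertical projection in attained form: compactness of the
   closure yields two points that realise the extent in the direction \<open>e\<close>.\<close>
 have width: "\<exists>z\<in>?K. \<exists>z'\<in>?K. norm e \<le> (z - z') \<bullet> e" if e: "e \<noteq> 0" for e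
 proof -
  have ne: "?K \<noteq> {}" using p0 SK by blast
  have c: "continuous_on ?K (\<lambda>p. p \<bullet> e)" by (intro continuous_intros)
  obtain z where z: "z \<in> ?K" "\<And>w. w \<in> ?K \<Longrightarrow> w \<bullet> e \<le> z \<bullet> e" using continuous_attains_sup[OF Kc ne c] by blast
  obtain z' where z': "z' \<in> ?K" "\<And>w. w \<in> ?K \<Longrightarrow> z' \<bullet> e \<le> w \<bullet> e" using continuous_attains_inf[OF Kc ne c] by blast
  let ?e = "(1 / norm e) *\<^sub>R e"
  have "1 \<le> projection_length S ?e" using proj[of ?e] e proj1 by simp
  also have "\<dots> \<le> z \<bullet> ?e - z' \<bullet> ?e"
  proof (rule projection_length_le)
   show "z' \<bullet> ?e \<le> w \<bullet> ?e \<and> w \<bullet> ?e \<le> z \<bullet> ?e" if "w \<in> S" for w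
    using z(2)[OF SK[OF that]] z'(2)[OF SK[OF that]] by (simp add: divide_right_mono)
   show "z' \<bullet> ?e \<le> z \<bullet> ?e" using z(2)[OF z'(1)] by (simp add: divide_right_mono)
  qed
  also have "\<dots> = ((z - z') \<bullet> e) / norm e" by (simp add: inner_diff_left diff_divide_distrib)
  finally have "norm e \<le> (z - z') \<bullet> e" using e by (simp add: pos_le_divide_eq)
  then show ?thesis using z z' by blast
 qed
 have ba: "1 \<le> b - a"
 proof -
  have "ex \<noteq> 0" by (simp add: zero_prod_def)
  from width[OF this] obtain z z' where z: "z \<in> ?K" "z' \<in> ?K" "norm ex \<le> (z - z') \<bullet> ex" by blast
  then have "1 \<le> fst z - fst z'" by (simp add: inner_prod_def)
  then show ?thesis using Kb[OF z(1)] Kb[OF z(2)] by linarith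
 qed
 have contact: "\<exists>p q. (p, 1) \<in> ?K \<and> (q, 0) \<in> ?K \<and> s * (p - q) \<le> 0" for s :: real
 proof (rule contact_points[OF Kc])
  show "0 \<le> snd z \<and> snd z \<le> 1" if "z \<in> ?K" for z using Kb[OF that] by simp
  fix \<sigma> :: real
  have "(- (s * \<sigma>), 1) \<noteq> (0 :: point)" by (simp add: zero_prod_def)
  from width[OF this] obtain z z' where z: "z \<in> ?K" "z' \<in> ?K" "norm (- (s * \<sigma>), 1 :: real) \<le> (z - z') \<bullet> (- (s * \<sigma>), 1)" by blast
  moreover have "1 \<le> norm (- (s * \<sigma>), 1 :: real)" by (simp add: norm_Pair)
  ultimately show "\<exists>z\<in>?K. \<exists>z'\<in>?K. 1 \<le> (z - z') \<bullet> (- (s * \<sigma>), 1)" by (meson order_trans)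
 qed
 obtain xs where xs: "(xs, 0) \<in> ?K" "(xs, 1) \<in> ?K"
 proof -
  obtain p q where 1: "(p, 1) \<in> ?K" "(q, 0) \<in> ?K" "1 * (p - q) \<le> 0" using contact by blast
  obtain p' q' where 2: "(p', 1) \<in> ?K" "(q', 0) \<in> ?K" "- 1 * (p' - q') \<le> 0" using contact by blast
  have "p \<le> q" "q' \<le> p'" using 1(3) 2(3) by auto
  from vertical_contact[OF Kconv 1(1,2) this(1) 2(1,2) this(2)] show thesis using that by blast
 qed
 have xsab: "a \<le> xs" "xs \<le> b" using Kb[OF xs(1)] by auto
 have Lmem: "L \<in> length_scale_candidates a b (\<lambda>x. f2 x - f1 x)"
  and Lmax: "\<And>M. M \<in> length_scale_candidates a b (\<lambda>x. f2 x - f1 x) \<Longrightarrow> M \<le> L"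
  using LS unfolding is_length_scale_def by auto
 \<comment> \<open>For the candidate 1 the height condition reads \<open>h \<ge> 0\<close>, and
   \<open>{a..b}\<close> has length at least 1 by minimality of the vertical projection.\<close>
 have L1: "1 \<le> L"
 proof (rule Lmax)
  have "is_interval {a..b}" "measure lborel {a..b} = b - a" using ab by (auto simp: is_interval_1)
  then show "1 \<in> length_scale_candidates a b (\<lambda>x. f2 x - f1 x)"
   unfolding length_scale_candidates_def using ba f12 by (auto intro!: exI[of _ "{a..b}"])
 qed
 have rect: "\<exists>\<alpha>. cbox (\<alpha> - L/2, 1/2 - (1/2 - 1/L^2)) (\<alpha> + L/2, 1/2 + (1/2 - 1/L^2)) \<subseteq> ?K" if L2: "2 \<le> L"
 proof -
  obtain I where I: "is_interval I" "I \<subseteq> {a..b}" "L \<le> measure lborel I" "\<And>x. x \<in> I \<Longrightarrow> 1 - 1 / L^2 \<le> f2 x - f1 x"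
   using Lmem unfolding length_scale_candidates_def by blast
  have Lp: "0 < L" using L1 by simp
  obtain l r where lr: "l + L \<le> r" "{l<..<r} \<subseteq> I" using interval_extent[OF I(1,2) Lp I(3)] by blast
  have "2^2 \<le> L^2" using L2 by (intro power_mono) auto
  then have iL: "1 / L^2 \<le> 1/4" using Lp by (simp add: pos_divide_le_eq)
  have "box (l, 1 / L^2) (r, 1 - 1 / L^2) \<subseteq> S"
  proof
   fix z assume "z \<in> box (l, 1 / L^2) (r, 1 - 1 / L^2)"
   then have z: "l < fst z" "fst z < r" "1 / L^2 < snd z" "snd z < 1 - 1 / L^2" by (simp_all add: mem_box_pair)
   then have i: "fst z \<in> I" using lr(2) by auto
   then have "fst z \<in> {a..b}" using I(2) by blast
   then have "(fst z, snd z) \<in> S" unfolding mem using I(4)[OF i] f1[of "fst z"] f2[of "fst z"] z by auto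
   then show "z \<in> S" by simp
  qed
  then have "closure (box (l, 1 / L^2) (r, 1 - 1 / L^2)) \<subseteq> ?K" by (rule closure_mono)
  moreover have "((l + r) / 2, 1/2) \<in> box (l, 1 / L^2) (r, 1 - 1 / L^2)" using lr Lp iL by (simp add: mem_box_pair)
  then have "box (l, 1 / L^2) (r, 1 - 1 / L^2) \<noteq> {}" by blast
  ultimately have "cbox (l, 1 / L^2) (r, 1 - 1 / L^2) \<subseteq> ?K" by simp
  moreover have "cbox ((l + r) / 2 - L/2, 1/2 - (1/2 - 1/L^2)) ((l + r) / 2 + L/2, 1/2 + (1/2 - 1/L^2)) \<subseteq> cbox (l, 1 / L^2) (r, 1 - 1 / L^2)"
  proof
   fix z assume "z \<in> cbox ((l + r) / 2 - L/2, 1/2 - (1/2 - 1/L^2)) ((l + r) / 2 + L/2, 1/2 + (1/2 - 1/L^2))"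
   then have zb: "(l + r) / 2 - L/2 \<le> fst z" "fst z \<le> (l + r) / 2 + L/2" "1/L^2 \<le> snd z" "snd z \<le> 1 - 1/L^2"
    unfolding mem_cbox_pair by auto
   show "z \<in> cbox (l, 1 / L^2) (r, 1 - 1 / L^2)" unfolding mem_cbox_pair
   proof (intro conjI zb(3,4))
    show "l \<le> fst z" "fst z \<le> r" using zb(1,2) lr(1) by (simp_all add: field_simps)
   qed
  qed
  ultimately show ?thesis by blast
 qed
 have rect0: "\<exists>\<alpha>. cbox (\<alpha> - 1/16, 1/2 - 1/4) (\<alpha> + 1/16, 1/2 + 1/4) \<subseteq> ?K"
 proof -
  obtain s where s: "s \<in> {-1, 1 :: real}" "xs + s / 2 \<in> {a..b}"
  proof (cases "xs + 1/2 \<le> b")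
   case True
   then show ?thesis using that[of 1] xsab by simp
  next
   case False
   then show ?thesis using that[of "- 1"] xsab ba by simp
  qed
  have "(xs + s / 2, f1 (xs + s / 2)) \<in> S" unfolding mem using s(2) f12 by blast
  from SK[OF this] have q: "(xs + s / 2, f1 (xs + s / 2)) \<in> ?K" .
  have "0 \<le> f1 (xs + s / 2)" "f1 (xs + s / 2) \<le> 1" using Kb[OF q] by auto
  from triangle_rectangle[OF Kconv xs q this s(1)] show ?thesis by blast
 qed
 \<comment> \<open>A taller far section, joined by convexity to the unit chord, would make every
   column within \<open>2 * L\<close> of \<open>xs\<close> on that side at least
   \<open>1 - 1 / (2 * L)^2\<close> tall, as \<open>2 * L / (8 * L^3) = 1 / (2 * L)^2\<close>. Then
   \<open>2 * L\<close> would be a candidate, against maximality of \<open>L\<close>.\<close>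
 have sect: "y' - y \<le> 1 - \<bar>x - xs\<bar> / (8 * L^3)"
  if z: "(x, y) \<in> ?K" "(x, y') \<in> ?K" and far: "2 * L \<le> \<bar>x - xs\<bar>" for x y y'
 proof (rule ccontr)
  assume neg: "\<not> ?thesis"
  define d where "d = \<bar>x - xs\<bar>"
  have Lp: "0 < L" using L1 by simp
  have d: "2 * L \<le> d" "0 < d" using far Lp by (auto simp: d_def)
  have xab: "a \<le> x" "x \<le> b" using Kb[OF z(1)] by auto
  define s where "s = sgn (x - xs)"
  have s: "s \<in> {-1, 1}" "x = xs + s * d" using d(2) by (auto simp: s_def d_def sgn_if)
  have tall: "1 - 1 / (2 * L)^2 \<le> f2 (xs + s * t) - f1 (xs + s * t) \<and> xs + s * t \<in> {a<..<b}" if t: "0 < t" "t < 2 * L" for t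
  proof -
   define \<theta> where "\<theta> = t / d"
   have \<theta>: "0 < \<theta>" "\<theta> < 1" "\<theta> * d = t" using t d by (auto simp: \<theta>_def)
   have "(1 - \<theta>) * xs + \<theta> * x = xs + s * (\<theta> * d)" unfolding s(2) by (simp add: algebra_simps)
   then have st: "(1 - \<theta>) * xs + \<theta> * x = xs + s * t" by (simp only: \<theta>(3))
   have "(1 - \<theta>) *\<^sub>R (xs, 0) + \<theta> *\<^sub>R (x, y) \<in> ?K" "(1 - \<theta>) *\<^sub>R (xs, 1) + \<theta> *\<^sub>R (x, y') \<in> ?K"
    by (rule convexD[OF Kconv]; use \<theta> xs z in simp)+
   then have m: "(xs + s * t, \<theta> * y) \<in> ?K" "(xs + s * t, (1 - \<theta>) + \<theta> * y') \<in> ?K" using st by simp_all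
   have "x \<noteq> xs" using d by (auto simp: d_def)
   have xin: "a < xs + s * t" "xs + s * t < b"
   proof -
    have "0 < (1 - \<theta>) * (xs - a) + \<theta> * (x - a)" "0 < (1 - \<theta>) * (b - xs) + \<theta> * (b - x)"
    proof -
     have "0 < xs - a \<or> 0 < x - a" "0 < b - xs \<or> 0 < b - x" using \<open>x \<noteq> xs\<close> xsab xab by auto
     moreover have "0 \<le> (1 - \<theta>) * (xs - a)" "0 \<le> \<theta> * (x - a)" "0 \<le> (1 - \<theta>) * (b - xs)" "0 \<le> \<theta> * (b - x)"
      using \<theta> xsab xab by auto
     moreover have "0 < xs - a \<Longrightarrow> 0 < (1 - \<theta>) * (xs - a)" "0 < x - a \<Longrightarrow> 0 < \<theta> * (x - a)"
      "0 < b - xs \<Longrightarrow> 0 < (1 - \<theta>) * (b - xs)" "0 < b - x \<Longrightarrow> 0 < \<theta> * (b - x)" using \<theta> by auto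
     ultimately show "0 < (1 - \<theta>) * (xs - a) + \<theta> * (x - a)" "0 < (1 - \<theta>) * (b - xs) + \<theta> * (b - x)"
      by (meson add_pos_nonneg add_nonneg_pos)+
    qed
    then show "a < xs + s * t" "xs + s * t < b" unfolding st[symmetric] by (simp_all add: algebra_simps)
   qed
   have "f1 (xs + s * t) \<le> \<theta> * y" by (rule closure_graph_section(1)[OF cf S m(1) xin])
   moreover have "(1 - \<theta>) + \<theta> * y' \<le> f2 (xs + s * t)" by (rule closure_graph_section(2)[OF cf S m(2) xin])
   ultimately have "1 - \<theta> * (1 - (y' - y)) \<le> f2 (xs + s * t) - f1 (xs + s * t)" by (simp add: algebra_simps)
   moreover have "\<theta> * (1 - (y' - y)) \<le> 1 / (2 * L)^2"
   proof -
    have "1 - (y' - y) \<le> d / (8 * L^3)" using neg by (simp add: d_def)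
    then have "\<theta> * (1 - (y' - y)) \<le> \<theta> * (d / (8 * L^3))" using \<theta> by (intro mult_left_mono) auto
    also have "\<dots> = t / (8 * L^3)" using \<theta>(3) by simp
    also have "\<dots> \<le> 2 * L / (8 * L^3)" using t Lp by (intro divide_right_mono) auto
    also have "\<dots> = 1 / (2 * L)^2" using Lp by (simp add: power2_eq_square power3_eq_cube)
    finally show ?thesis .
   qed
   ultimately show ?thesis using xin by simp
  qed
  define I where "I = (if s = 1 then {xs<..<xs + 2 * L} else {xs - 2 * L<..<xs})"
  have It: "\<exists>t. 0 < t \<and> t < 2 * L \<and> x = xs + s * t" if "x \<in> I" for x
   using that s(1) by (intro exI[of _ "s * (x - xs)"]) (auto simp: I_def split: if_splits)
  have Iall: "1 - 1 / (2 * L)^2 \<le> f2 x - f1 x \<and> x \<in> {a<..<b}" if "x \<in> I" for x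
   using It[OF that] tall by blast
  have "is_interval I" "measure lborel I = 2 * L" using Lp by (auto simp: I_def is_interval_1)
  moreover have "I \<subseteq> {a..b}" using Iall by fastforce
  ultimately have "2 * L \<in> length_scale_candidates a b (\<lambda>x. f2 x - f1 x)"
   unfolding length_scale_candidates_def using Lp Iall by (intro CollectI conjI exI[of _ I]) auto
  from Lmax[OF this] show False using Lp by simp
 qed
 have ground: "ground \<mu> ?K u"
 proof -
  have D: "dirichlet_eigenfunction S \<mu> u" and pos: "\<And>p. p \<in> interior S \<Longrightarrow> 0 < u p"
   and le: "\<And>p. p \<in> S \<Longrightarrow> u p \<le> 1" and one: "\<exists>p\<in>S. u p = 1"
   using E unfolding normalised_first_eigenfunction_def by blast+
  have uc: "continuous_on ?K u" and C2: "C2_on (interior S) u" and lap: "\<And>p. p \<in> interior S \<Longrightarrow> laplacian u p = - \<mu> * u p"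
   and u0: "\<And>p. p \<in> frontier S \<Longrightarrow> u p = 0"
   using D unfolding dirichlet_eigenfunction_def by blast+
  have sl: "sol \<mu> (interior S) u"
   unfolding sol_def using C2_on_dd(1)[OF open_interior C2] laplacian_dd[OF open_interior C2] lap by simp
  obtain p where p: "p \<in> S" "u p = 1" using one by blast
  have u0': "u z = 0" if "z \<in> ?K" "z \<notin> interior ?K" for z
   using u0[of z] that unfolding int by (simp add: frontier_def)
  have mu: "0 < \<mu>" by (rule eigenvalue_pos[OF Kc uc u0' _ _ SK[OF p(1)] p(2)]) (use pos sl int in auto)
  have le1: "u z \<le> 1" if "z \<in> ?K" for z
  proof (cases "z \<in> interior S")
   case True
   then show ?thesis using le interior_subset by blast
  next
   case False
   then show ?thesis using u0'[OF that] int by simp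
  qed
  show ?thesis unfolding ground_def fr int
   using mu Kc Kconv uc u0 pos sl le1 p SK by blast
 qed
 have "dom ?K \<mu> u xs L" unfolding dom_def
 proof (intro conjI ballI impI allI)
  fix x y y' assume z: "(x, y) \<in> ?K" "(x, y') \<in> ?K" "2 * L \<le> \<bar>x - xs\<bar>"
  show "\<bar>y - y'\<bar> \<le> 1 - \<bar>x - xs\<bar> / (8 * L^3)"
   using sect[OF z(1,2,3)] sect[OF z(2,1,3)] by (simp add: abs_le_iff)
 qed (use ground Kb xs L1 rect rect0 in auto)
 then show ?thesis by blast
qed

theorem proposition3p4:
  "\<exists>\<epsilon> > (0::real). \<exists>C > (0::real).
     \<forall>(a::real) (b::real) (f1::real \<Rightarrow> real) (f2::real \<Rightarrow> real) (\<Omega>::(real \<times> real) set)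
       (L::real) (\<mu>::real) (u::real \<times> real \<Rightarrow> real).
       normalised_convex_domain a b f1 f2 \<Omega> \<longrightarrow>
       is_length_scale a b (\<lambda>x. f2 x - f1 x) L \<longrightarrow>
       normalised_first_eigenfunction \<Omega> \<mu> u \<longrightarrow>
       (\<forall>(\<nu>1::real) (\<nu>2::real). norm (\<nu>1, \<nu>2) = 1 \<longrightarrow>
         (\<forall>(x, y) \<in> superlevel \<Omega> u (1 - \<epsilon>).
            1 / C * (1 / L\<^sup>2) * (max 1 (\<bar>\<nu>2\<bar> * L))\<^sup>2
              \<le> - second_directional_deriv (\<nu>1, \<nu>2) u (x, y) \<and>
            - second_directional_deriv (\<nu>1, \<nu>2) u (x, y)
              \<le> C * (1 / L\<^sup>2) * (max 1 (\<bar>\<nu>2\<bar> * L))\<^sup>2))"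
proof -
 obtain \<epsilon> C where \<epsilon>: "0 < \<epsilon>" and C: "0 < C" and main: "\<And>K \<mu> u xs L p \<nu>. dom K \<mu> u xs L \<Longrightarrow> p \<in> K \<Longrightarrow> 1 - \<epsilon> \<le> u p \<Longrightarrow> norm \<nu> = 1 \<Longrightarrow>
   1 / C * (1 / L^2) * (max 1 (\<bar>snd \<nu>\<bar> * L))^2 \<le> - dd \<nu> (dd \<nu> u) p
   \<and> - dd \<nu> (dd \<nu> u) p \<le> C * (1 / L^2) * (max 1 (\<bar>snd \<nu>\<bar> * L))^2"
  using dom_second_derivative by metis
 \<comment> \<open>Capped at 1/2 so that the level is positive and the superlevel set stays in the
   interior, where the derivatives of the statement are the genuine ones.\<close>
 define \<delta> where "\<delta> = min \<epsilon> (1/2)"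
 have \<delta>: "0 < \<delta>" "\<delta> \<le> \<epsilon>" "\<delta> \<le> 1/2" using \<epsilon> by (auto simp: \<delta>_def)
 have "1 / C * (1 / L^2) * (max 1 (\<bar>\<nu>2\<bar> * L))^2 \<le> - second_directional_deriv (\<nu>1, \<nu>2) u (x, y)
   \<and> - second_directional_deriv (\<nu>1, \<nu>2) u (x, y) \<le> C * (1 / L^2) * (max 1 (\<bar>\<nu>2\<bar> * L))^2"
  if N: "normalised_convex_domain a b f1 f2 S" "is_length_scale a b (\<lambda>x. f2 x - f1 x) L" "normalised_first_eigenfunction S \<mu> u"
   and nu: "norm (\<nu>1, \<nu>2) = 1" and z: "(x, y) \<in> superlevel S u (1 - \<delta>)"
  for a b f1 f2 S L \<mu> u \<nu>1 \<nu>2 x y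
 proof -
  obtain xs where d: "dom (closure S) \<mu> u xs L" using normalised_dom[OF N] by blast
  have zS: "(x, y) \<in> S" "1 - \<delta> \<le> u (x, y)" using z by (auto simp: superlevel_def)
  have zK: "(x, y) \<in> closure S" using zS(1) closure_subset by blast
  have "(x, y) \<in> interior (closure S)"
   using ground_interiorI[OF dom_D(1)[OF d] zK] zS(2) \<delta>(3) by simp
  moreover have "convex S" using N(1) unfolding normalised_convex_domain_def by blast
  ultimately have zi: "(x, y) \<in> interior S" by (simp only: convex_interior_closure)
  have "C2_on (interior S) u" using N(3) by (simp add: normalised_first_eigenfunction_def dirichlet_eigenfunction_def)
  note e = C2_on_dd(2)[OF open_interior this zi, of "(\<nu>1, \<nu>2)"]
  have "1 - \<epsilon> \<le> u (x, y)" using zS(2) \<delta>(2) by linarith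
  from main[OF d zK this nu] show ?thesis unfolding e by simp
 qed
 then have "\<forall>(x, y) \<in> superlevel S u (1 - \<delta>).
   1 / C * (1 / L^2) * (max 1 (\<bar>\<nu>2\<bar> * L))^2 \<le> - second_directional_deriv (\<nu>1, \<nu>2) u (x, y)
   \<and> - second_directional_deriv (\<nu>1, \<nu>2) u (x, y) \<le> C * (1 / L^2) * (max 1 (\<bar>\<nu>2\<bar> * L))^2"
  if "normalised_convex_domain a b f1 f2 S" "is_length_scale a b (\<lambda>x. f2 x - f1 x) L" "normalised_first_eigenfunction S \<mu> u"
   "norm (\<nu>1, \<nu>2) = 1" for a b f1 f2 S L \<mu> u \<nu>1 \<nu>2
  using that by (intro ballI) (simp only: split_paired_all prod.case)
 then show ?thesis
  by (intro exI[of _ \<delta>] conjI \<delta>(1) exI[of _ C] C allI impI)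
qed

end
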